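(* Let $\alpha,\beta,M\in\mathbb{R}$. Suppose there exist twice continuously differentiable functions $v\colon \mathbb{R}^n\to \mathbb{R}$ and $u\colon \mathbb{R}^n\to \mathbb{R}$, with $\sup_{x\in\overline{\mathcal{X}}}|u(x)|\leq M$, satisfying $$\begin{cases}\mathcal{L}v(x)\geq \alpha v(x)+\beta, & \forall x\in \mathcal{X}\setminus \mathcal{X}_s,\\ 0\geq \alpha v(x)+\beta, & \forall x\in \partial \mathcal{X}\cup \partial \mathcal{X}_s,\\ v(x)\leq 1, & \forall x\in \partial \mathcal{X}_s,\\ v(x)\leq \mathcal{L}u(x), & \forall x\in \mathcal{X}\setminus \mathcal{X}_s,\\ v(x)\leq 0, & \forall x\in \partial \mathcal{X}.\end{cases}$$ Then, for every $x_0\in \mathcal{X}\setminus \mathcal{X}_s$, $$\mathbb{P}_{x_0}^{[0,T]}\geq \begin{cases}\dfrac{\left(\frac{1}{\alpha}v(x_0)+\frac{\beta}{\alpha^2}\right)(e^{\alpha T}-1)-\frac{\beta}{\alpha}T}{T}-\dfrac{2M}{T}, & \text{if } \alpha\neq 0,\\[2mm] v(x_0)+\frac12\beta T-\dfrac{2M}{T}, & \text{if } \alpha=0.\end{cases}$$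
   Context: Let $b\colon\mathbb{R}^n\to\mathbb{R}^n$ and $\sigma\colon\mathbb{R}^n\to\mathbb{R}^{n\times k}$ be locally Lipschitz continuous, and let $W$ be a standard $k$-dimensional Wiener process on a probability space $(\Omega,\mathbb{P})$. For $x_0\in\mathbb{R}^n$, the SDE $dX=b(X)\,dt+\sigma(X)\,dW$ with initial state $x_0$ has a unique maximal local strong solution $X_{x_0}^{w}(t)$, $t\in[0,T^{x_0}(w))$, with continuous sample paths, where $T^{x_0}(w)\in(0,\infty]$ and $w\in\Omega$ is the sample point. Let $\mathcal{X}\subseteq\mathbb{R}^n$ be open and bounded, $\mathcal{X}_s\subseteq\mathcal{X}$ a closed set, and $0<T<\infty$. An overline denotes closure and $\partial$ denotes topological boundary. For $x_0\in\mathcal{X}\setminus\mathcal{X}_s$ define $$\mathbb{P}_{x_0}^{[0,T]}:=\mathbb{P}\big(\{w\in\Omega \mid \exists t\in[0,T].\ X_{x_0}^{w}(t)\in\mathcal{X}_s\ \wedge\ \forall\tau\in[0,t).\ X_{x_0}^{w}(\tau)\in\mathcal{X}\}\big),$$ where the path is required to be defined at the times involved. For a twice continuously differentiable $v\colon\mathbb{R}^n\to\mathbb{R}$, $$\mathcal{L}v(x)=\frac{\partial v(x)}{\partial x}b(x)+\frac12\mathrm{tr}\Big(\sigma(x)^{\top}\frac{\partial^2 v(x)}{\partial x^2}\sigma(x)\Big).$$ *)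

theory Defs
  imports "HOL-Probability.Probability"
begin

section \<open>Wiener processes and their filtration\<close>

definition wiener_process :: "'w measure \<Rightarrow> (real \<Rightarrow> 'w \<Rightarrow> real ^ 'k) \<Rightarrow> bool" where
  "wiener_process P W \<longleftrightarrow>
     (\<forall>t\<ge>0. W t \<in> borel_measurable P) \<and>
     (AE w in P. W 0 w = 0) \<and>
     (AE w in P. continuous_on {0..} (\<lambda>t. W t w)) \<and>
     (\<forall>s t. 0 \<le> s \<and> s < t \<longrightarrow>
        distributed P lborel (\<lambda>w. W t w - W s w)
          (\<lambda>x. ennreal (\<Prod>i\<in>UNIV. normal_density 0 (sqrt (t - s)) (x $ i)))) \<and>
     (\<forall>(r :: nat \<Rightarrow> real) m. 0 \<le> r 0 \<and> mono r \<longrightarrow>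
        prob_space.indep_vars P (\<lambda>_. borel) (\<lambda>i w. W (r (Suc i)) w - W (r i) w) {..<m})"

text \<open>The natural filtration of \<open>W\<close>, augmented by the null sets. For \<open>t < 0\<close> it consists of
  the null sets and their complements only; times below zero play no role.\<close>

definition wiener_filtration ::
  "'w measure \<Rightarrow> (real \<Rightarrow> 'w \<Rightarrow> real ^ 'k) \<Rightarrow> real \<Rightarrow> 'w measure" where
  "wiener_filtration P W t =
     sigma (space P)
       ({W s -` A \<inter> space P | s A. 0 \<le> s \<and> s \<le> t \<and> A \<in> sets borel} \<union> null_sets P)"


section \<open>The Ito integral\<close>

definition prog_measurable ::
  "(real \<Rightarrow> 'w measure) \<Rightarrow> (real \<Rightarrow> 'w \<Rightarrow> 'b :: topological_space) \<Rightarrow> bool" where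
  "prog_measurable F H \<longleftrightarrow>
     (\<forall>t\<ge>0. (\<lambda>(s, w). H s w) \<in> borel_measurable (restrict_space borel {0..t} \<Otimes>\<^sub>M F t))"

text \<open>A simple integrand is the process
  \<open>\<Phi>\<^sub>s = (\<Sum>j<m. \<phi>\<^sub>j \<one>(r\<^sub>j < s \<le> r\<^sub>j\<^sub>+\<^sub>1))\<close> with each \<open>\<phi>\<^sub>j\<close> bounded and known at time \<open>r\<^sub>j\<close>. It is
  represented by the data \<open>m\<close>, \<open>r\<close>, \<open>\<phi>\<close>; its values are matrices with \<open>n\<close> rows and \<open>k\<close> columns.\<close>

definition simple_integrand ::
  "(real \<Rightarrow> 'w measure) \<Rightarrow> nat \<Rightarrow> (nat \<Rightarrow> real) \<Rightarrow> (nat \<Rightarrow> 'w \<Rightarrow> real ^ 'k ^ 'n) \<Rightarrow> bool" where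
  "simple_integrand F m r \<phi> \<longleftrightarrow>
     0 \<le> r 0 \<and> mono r \<and>
     (\<forall>j<m. \<phi> j \<in> borel_measurable (F (r j)) \<and> (\<exists>C. \<forall>w\<in>space (F (r j)). norm (\<phi> j w) \<le> C))"

definition simple_value ::
  "nat \<Rightarrow> (nat \<Rightarrow> real) \<Rightarrow> (nat \<Rightarrow> 'w \<Rightarrow> real ^ 'k ^ 'n) \<Rightarrow> real \<Rightarrow> 'w \<Rightarrow> real ^ 'k ^ 'n" where
  "simple_value m r \<phi> s w = (\<Sum>j<m. indicator {r j<..r (Suc j)} s *\<^sub>R \<phi> j w)"

definition simple_ito_integral ::
  "(real \<Rightarrow> 'w \<Rightarrow> real ^ 'k) \<Rightarrow> nat \<Rightarrow> (nat \<Rightarrow> real) \<Rightarrow> (nat \<Rightarrow> 'w \<Rightarrow> real ^ 'k ^ 'n)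
    \<Rightarrow> real \<Rightarrow> 'w \<Rightarrow> real ^ 'n" where
  "simple_ito_integral W m r \<phi> t w =
     (\<Sum>j<m. \<phi> j w *v (W (min t (r (Suc j))) w - W (min t (r j)) w))"

text \<open>\<open>J\<close> is (a version of) \<open>\<integral>\<^sub>0\<^sup>t H dW\<close>. This is the integral for integrands that are square
  integrable along almost every path: simple integrands converge to \<open>H\<close> in
  \<open>L\<^sup>2([0,t])\<close> in probability, and their integrals converge to \<open>J\<close> in probability.
  The norm on matrices is the Frobenius norm.\<close>

definition has_ito_integral ::
  "'w measure \<Rightarrow> (real \<Rightarrow> 'w measure) \<Rightarrow> (real \<Rightarrow> 'w \<Rightarrow> real ^ 'k)
    \<Rightarrow> (real \<Rightarrow> 'w \<Rightarrow> real ^ 'k ^ 'n) \<Rightarrow> real \<Rightarrow> ('w \<Rightarrow> real ^ 'n) \<Rightarrow> bool" where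
  "has_ito_integral P F W H t J \<longleftrightarrow>
     prog_measurable F H \<and> J \<in> borel_measurable P \<and>
     (\<exists>m r \<phi>.
        (\<forall>i. simple_integrand F (m i) (r i) (\<phi> i)) \<and>
        (\<forall>\<epsilon>>0. (\<lambda>i. measure P {w \<in> space P.
            (\<integral>\<^sup>+ s\<in>{0..t}. ennreal ((norm (H s w - simple_value (m i) (r i) (\<phi> i) s w))\<^sup>2) \<partial>lborel)
              > ennreal \<epsilon>}) \<longlonglongrightarrow> 0) \<and>
        (\<forall>\<epsilon>>0. (\<lambda>i. measure P {w \<in> space P.
            dist (simple_ito_integral W (m i) (r i) (\<phi> i) t w) (J w) > \<epsilon>}) \<longlonglongrightarrow> 0))"


section \<open>Maximal local strong solutions\<close>

text \<open>\<open>(X, \<zeta>)\<close> solves \<open>dX = b(X) dt + \<sigma>(X) dW\<close>, \<open>X\<^sub>0 = x\<^sub>0\<close>, up to the lifetime \<open>\<zeta>\<close>. The values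
  \<open>X t w\<close> for \<open>t \<ge> \<zeta> w\<close> are arbitrary. The solution is strong: it is adapted to the augmented
  filtration of the given Wiener process. The times \<open>\<tau>\<^sub>m\<close> announce \<open>\<zeta>\<close> and may be taken
  finite (replace \<open>\<tau>\<^sub>m\<close> by \<open>min \<tau>\<^sub>m m\<close>), so that \<open>X\<close> is always defined at time \<open>min t \<tau>\<^sub>m\<close>.\<close>

definition local_strong_solution ::
  "'w measure \<Rightarrow> (real \<Rightarrow> 'w \<Rightarrow> real ^ 'k) \<Rightarrow> (real ^ 'n \<Rightarrow> real ^ 'n) \<Rightarrow> (real ^ 'n \<Rightarrow> real ^ 'k ^ 'n)
    \<Rightarrow> real ^ 'n \<Rightarrow> (real \<Rightarrow> 'w \<Rightarrow> real ^ 'n) \<Rightarrow> ('w \<Rightarrow> ereal) \<Rightarrow> bool" where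
  "local_strong_solution P W b \<sigma> x0 X \<zeta> \<longleftrightarrow>
     (let F = wiener_filtration P W in
       (\<forall>w\<in>space P. 0 < \<zeta> w) \<and>
       (\<forall>t. Measurable.pred (F t) (\<lambda>w. \<zeta> w \<le> ereal t)) \<and>
       (\<forall>w\<in>space P. continuous_on {t. 0 \<le> t \<and> ereal t < \<zeta> w} (\<lambda>t. X t w)) \<and>
       (\<forall>t\<ge>0. X t \<in> borel_measurable (restrict_space (F t) {w. ereal t < \<zeta> w})) \<and>
       (AE w in P. X 0 w = x0) \<and>
       (\<exists>\<tau> :: nat \<Rightarrow> 'w \<Rightarrow> real.
          (\<forall>m. stopping_time F (\<tau> m)) \<and>
          (\<forall>m. \<forall>w\<in>space P. 0 \<le> \<tau> m w \<and> ereal (\<tau> m w) < \<zeta> w) \<and>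
          (AE w in P. mono (\<lambda>m. \<tau> m w) \<and> (\<lambda>m. ereal (\<tau> m w)) \<longlonglongrightarrow> \<zeta> w) \<and>
          (\<forall>m. \<forall>t\<ge>0. \<exists>J.
             has_ito_integral P F W (\<lambda>s w. if s < \<tau> m w then \<sigma> (X s w) else 0) t J \<and>
             (AE w in P. X (min t (\<tau> m w)) w =
                x0 + integral {0..min t (\<tau> m w)} (\<lambda>s. b (X s w)) + J w))))"

text \<open>A local solution is maximal if \<open>\<zeta>\<close> is its explosion time.\<close>

definition maximal_local_strong_solution ::
  "'w measure \<Rightarrow> (real \<Rightarrow> 'w \<Rightarrow> real ^ 'k) \<Rightarrow> (real ^ 'n \<Rightarrow> real ^ 'n) \<Rightarrow> (real ^ 'n \<Rightarrow> real ^ 'k ^ 'n)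
    \<Rightarrow> real ^ 'n \<Rightarrow> (real \<Rightarrow> 'w \<Rightarrow> real ^ 'n) \<Rightarrow> ('w \<Rightarrow> ereal) \<Rightarrow> bool" where
  "maximal_local_strong_solution P W b \<sigma> x0 X \<zeta> \<longleftrightarrow>
     local_strong_solution P W b \<sigma> x0 X \<zeta> \<and>
     (AE w in P. \<zeta> w < \<infinity> \<longrightarrow>
        Limsup (at_left (real_of_ereal (\<zeta> w))) (\<lambda>t. ereal (norm (X t w))) = \<infinity>)"


section \<open>Reach-avoid probability\<close>

definition reach_avoid_prob ::
  "'w measure \<Rightarrow> (real \<Rightarrow> 'w \<Rightarrow> real ^ 'n) \<Rightarrow> ('w \<Rightarrow> ereal) \<Rightarrow> (real ^ 'n) set \<Rightarrow> (real ^ 'n) set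
    \<Rightarrow> real \<Rightarrow> real" where
  "reach_avoid_prob P X \<zeta> S G T =
     measure P {w \<in> space P. \<exists>t\<in>{0..T}. ereal t < \<zeta> w \<and> X t w \<in> G \<and> (\<forall>s\<in>{0..<t}. X s w \<in> S)}"


section \<open>The infinitesimal generator\<close>

definition partial_deriv :: "'n \<Rightarrow> (real ^ 'n \<Rightarrow> real) \<Rightarrow> real ^ 'n \<Rightarrow> real" where
  "partial_deriv i f x = frechet_derivative f (at x) (axis i 1)"

definition C1_fun :: "(real ^ 'n \<Rightarrow> real) \<Rightarrow> bool" where
  "C1_fun f \<longleftrightarrow> (\<forall>x. f differentiable at x) \<and> (\<forall>i. continuous_on UNIV (partial_deriv i f))"

definition C2_fun :: "(real ^ 'n \<Rightarrow> real) \<Rightarrow> bool" where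
  "C2_fun f \<longleftrightarrow> C1_fun f \<and> (\<forall>i. C1_fun (partial_deriv i f))"

definition gradient :: "(real ^ 'n \<Rightarrow> real) \<Rightarrow> real ^ 'n \<Rightarrow> real ^ 'n" where
  "gradient f x = (\<chi> i. partial_deriv i f x)"

definition hessian :: "(real ^ 'n \<Rightarrow> real) \<Rightarrow> real ^ 'n \<Rightarrow> real ^ 'n ^ 'n" where
  "hessian f x = (\<chi> i j. partial_deriv i (partial_deriv j f) x)"

definition generator ::
  "(real ^ 'n \<Rightarrow> real ^ 'n) \<Rightarrow> (real ^ 'n \<Rightarrow> real ^ 'k ^ 'n) \<Rightarrow> (real ^ 'n \<Rightarrow> real) \<Rightarrow> real ^ 'n \<Rightarrow> real"
  where
  "generator b \<sigma> v x =
     gradient v x \<bullet> b x + 1 / 2 * trace (transpose (\<sigma> x) ** hessian v x ** \<sigma> x)"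

end

theory Submission
  imports Defs
begin

text \<open>
  Stop the solution at the first exit from \<open>S - S\<^sub>s\<close> and write \<open>Y\<close> for the stopped process. Dynkin's
  formula \<open>E f(Y\<^sub>t) = f(x\<^sub>0) + E \<integral>\<^sub>0\<^sup>t \<one>(s < exit) L f(X\<^sub>s) ds\<close> turns the first two hypotheses on \<open>v\<close> into
  \<open>E v(Y\<^sub>t) \<ge> v(x\<^sub>0) + \<alpha> \<integral>\<^sub>0\<^sup>t E v(Y\<^sub>s) ds + \<beta> t\<close>: after the exit, \<open>Y\<close> rests at a boundary point, where
  \<open>\<alpha> v + \<beta> \<le> 0\<close>. A Gronwall argument for \<open>\<integral>\<^sub>0\<^sup>t E v(Y\<^sub>s) ds\<close> bounds \<open>\<integral>\<^sub>0\<^sup>T E v(Y\<^sub>s) ds\<close> from below. From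
  above, the part of this integral before the exit is at most \<open>E \<integral>\<^sub>0\<^sup>T \<one>(s < exit) L u(X\<^sub>s) ds \<le> 2 M\<close> by
  Dynkin's formula for \<open>u\<close>, and the part after the exit is at most \<open>T\<close> times the reach-avoid
  probability, since there \<open>v \<le> 1\<close> if the exit is into \<open>S\<^sub>s\<close> and \<open>v \<le> 0\<close> otherwise.

  Dynkin's formula is obtained without Ito's formula. Consider the Euler scheme whose coefficients are
  evaluated along the true solution. Its noise term is the integral of a simple integrand that is
  close to the integrand of the solution up to the exit. A maximal inequality for simple
  integrands, in which the integrand is switched off once its energy or its integral gets too large,
  shows that the scheme is uniformly close to the solution with high probability. For the scheme
  itself the formula is a Taylor expansion, by the independence of the increments of \<open>W\<close>.
\<close>

section \<open>Gaussian vectors\<close>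

text \<open>The stochastic integral is given at each deterministic time separately, each time with
  its own approximating simple integrands and only up to a null set. There is no continuous version
  of it that could be evaluated at the exit time. Two approximations are therefore compared on a
  common grid, with one exceptional set for all grid times, and the integrands are compared only at
  times before the exit.

  The solution obeys its equation only up to times \<open>\<tau> m\<close> that announce its
  lifetime, so paths are stopped at the exit or at \<open>\<tau> m\<close>, whichever is first. If
  \<open>\<tau> m\<close> interrupts a path before its exit and not later than T, the boundary
  conditions say nothing about the stopping position; the estimates then lose a constant times the
  probability of this event. A path that explodes must leave the bounded domain strictly before it
  explodes, so this probability tends to 0 with m.

  The main term of the bound is y(T) / T, where y solves y' = v x0 + \<alpha> y + \<beta> t with
  y(0) = 0: the time integral of the mean of v is a supersolution of this linear equation.\<close>

lemma lborel_vec_prod: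
  fixes g :: "'k::finite \<Rightarrow> real \<Rightarrow> real"
  assumes g: "\<And>i. integrable lborel (g i)"
  shows "integrable lborel (\<lambda>x::real^'k. \<Prod>i\<in>UNIV. g i (x $ i))"
    and "integral\<^sup>L lborel (\<lambda>x::real^'k. \<Prod>i\<in>UNIV. g i (x $ i)) = (\<Prod>i\<in>UNIV. \<integral>y. g i y \<partial>lborel)"
proof -
  interpret product_sigma_finite "\<lambda>_::real^'k. lborel::real measure"
    by standard
  \<comment> \<open>Lebesgue measure on vectors is a product measure indexed by the basis vectors,
    while the density is a product over the coordinates; \<open>idx\<close> translates the first
    index into the second.\<close>
  define idx :: "real^'k \<Rightarrow> 'k" where "idx = inv_into UNIV (\<lambda>i. axis i 1)"
  have inj: "inj (\<lambda>i::'k. axis i (1::real))"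
    by (auto simp: inj_def axis_eq_axis)
  have idx: "idx (axis i 1) = i" for i
    unfolding idx_def using inv_into_f_f[OF inj, of i] by simp
  have B: "(Basis :: (real^'k) set) = (\<lambda>i. axis i 1) ` UNIV"
    by (auto simp: Basis_vec_def)
  define T :: "(real^'k \<Rightarrow> real) \<Rightarrow> real^'k" where "T f = (\<Sum>b\<in>Basis. f b *\<^sub>R b)" for f
  have T: "T f $ i = f (axis i 1)" for f i
  proof -
    have "T f $ i = T f \<bullet> axis i 1"
      by (simp add: cart_eq_inner_axis)
    also have "\<dots> = f (axis i 1)"
      unfolding T_def by (rule inner_sum_left_Basis) (simp add: B)
    finally show ?thesis .
  qed
  have Tm: "T \<in> measurable (Pi\<^sub>M Basis (\<lambda>_. lborel)) borel"
    unfolding T_def by measurable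
  have lb: "(lborel :: (real^'k) measure) = distr (Pi\<^sub>M Basis (\<lambda>_. lborel)) borel T"
    unfolding T_def by (rule lborel_eq)
  have [measurable]: "g i \<in> borel_measurable borel" for i
    using borel_measurable_integrable[OF g[of i]] by simp
  have m: "(\<lambda>x::real^'k. \<Prod>i\<in>UNIV. g i (x $ i)) \<in> borel_measurable borel"
    by measurable
  have re: "(\<Prod>i\<in>UNIV. g i (T f $ i)) = (\<Prod>b\<in>Basis. g (idx b) (f b))" for f
    unfolding B by (subst prod.reindex[OF inj]) (simp add: T idx)
  have "integrable (Pi\<^sub>M Basis (\<lambda>_. lborel)) (\<lambda>f. \<Prod>b\<in>Basis. g (idx b) (f b))"
    by (rule product_integrable_prod) (auto intro: g)
  then show "integrable lborel (\<lambda>x::real^'k. \<Prod>i\<in>UNIV. g i (x $ i))"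
    unfolding lb by (subst integrable_distr_eq[OF Tm m]) (simp add: re)
  have "integral\<^sup>L lborel (\<lambda>x::real^'k. \<Prod>i\<in>UNIV. g i (x $ i))
      = (\<integral>f. (\<Prod>b\<in>Basis. g (idx b) (f b)) \<partial>(Pi\<^sub>M Basis (\<lambda>_. lborel)))"
    by (subst lb, subst integral_distr[OF Tm m]) (simp add: re)
  also have "\<dots> = (\<Prod>b\<in>Basis. \<integral>y. g (idx b) y \<partial>lborel)"
    by (rule product_integral_prod) (auto intro: g)
  also have "\<dots> = (\<Prod>i\<in>UNIV. \<integral>y. g i y \<partial>lborel)"
    unfolding B by (subst prod.reindex[OF inj]) (simp add: idx)
  finally show "integral\<^sup>L lborel (\<lambda>x::real^'k. \<Prod>i\<in>UNIV. g i (x $ i)) = (\<Prod>i\<in>UNIV. \<integral>y. g i y \<partial>lborel)" .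
qed

lemma norm_vec_pow4_le:
  fixes x :: "real ^ 'k"
  shows "norm x ^ 4 \<le> real CARD('k) * (\<Sum>i\<in>UNIV. (x $ i) ^ 4)"
proof -
  have "norm x ^ 4 = ((norm x)\<^sup>2)\<^sup>2"
    by simp
  also have "(norm x)\<^sup>2 = (\<Sum>i\<in>UNIV. (x $ i)\<^sup>2)"
    by (simp add: norm_vec_def L2_set_def sum_nonneg)
  also have "(\<Sum>i\<in>UNIV. (x $ i)\<^sup>2)\<^sup>2 \<le> real CARD('k) * (\<Sum>i\<in>UNIV. ((x $ i)\<^sup>2)\<^sup>2)"
    using sum_squared_le_sum_of_squares[of "\<lambda>i. (x $ i)\<^sup>2" UNIV] by (simp add: mult.commute)
  finally show ?thesis
    by simp
qed

text \<open>The density is a product, so the expectation of a monomial in the coordinates is the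
  product of one-dimensional moments. A mixed second moment contains a first moment as a factor and
  vanishes. The fourth moment of the norm is reduced to the coordinates by Cauchy-Schwarz, at the
  cost of a factor \<open>CARD('k)\<close>.\<close>

lemma (in prob_space) gaussian_moments:
  fixes Z :: "'a \<Rightarrow> real ^ 'k"
  assumes Z: "distributed M lborel Z (\<lambda>x. ennreal (\<Prod>i\<in>UNIV. normal_density 0 \<sigma> (x $ i)))"
    and \<sigma>: "0 < \<sigma>"
  shows "integrable M (\<lambda>w. Z w $ p)" "expectation (\<lambda>w. Z w $ p) = 0"
    and "integrable M (\<lambda>w. Z w $ p * Z w $ q)"
      "expectation (\<lambda>w. Z w $ p * Z w $ q) = (if p = q then \<sigma>\<^sup>2 else 0)"
    and "integrable M (\<lambda>w. norm (Z w) ^ 4)"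
      "expectation (\<lambda>w. norm (Z w) ^ 4) \<le> 3 * (real CARD('k))\<^sup>2 * \<sigma> ^ 4"
proof -
  define \<mu> where "\<mu> k = (\<integral>x. normal_density 0 \<sigma> x * x ^ k \<partial>lborel)" for k
  have int: "integrable lborel (\<lambda>x. normal_density 0 \<sigma> x * x ^ k)" for k
    using integrable_normal_moment[OF \<sigma>, of 0 k] by simp
  have \<mu>0: "\<mu> 0 = 1"
    using integral_normal_moment_even[OF \<sigma>, of 0 0] by (simp add: \<mu>_def)
  have \<mu>1: "\<mu> 1 = 0"
    using integral_normal_moment_odd[OF \<sigma>, of 0 0] by (simp add: \<mu>_def)
  have \<mu>2: "\<mu> 2 = \<sigma>\<^sup>2"
    using integral_normal_moment_even[OF \<sigma>, of 0 1] by (simp add: \<mu>_def)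
  have "\<mu> 4 = fact 4 / ((2 / \<sigma>\<^sup>2)\<^sup>2 * fact 2)"
    using integral_normal_moment_even[OF \<sigma>, of 0 2] by (simp add: \<mu>_def)
  also have "\<dots> = 3 * \<sigma> ^ 4"
    using \<sigma> by (simp add: fact_numeral field_simps power2_eq_square power4_eq_xxxx)
  finally have \<mu>4: "\<mu> 4 = 3 * \<sigma> ^ 4" .
  have nn: "0 \<le> (\<Prod>i\<in>UNIV. normal_density 0 \<sigma> (x $ i))" for x :: "real^'k"
    by (intro prod_nonneg) auto
  have mono: "integrable M (\<lambda>w. \<Prod>i\<in>UNIV. (Z w $ i) ^ k i)
    \<and> expectation (\<lambda>w. \<Prod>i\<in>UNIV. (Z w $ i) ^ k i) = (\<Prod>i\<in>UNIV. \<mu> (k i))" for k :: "'k \<Rightarrow> nat"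
  proof -
    have m: "(\<lambda>x::real^'k. \<Prod>i\<in>UNIV. (x $ i) ^ k i) \<in> borel_measurable lborel"
      by measurable
    have e: "(\<Prod>i\<in>UNIV. normal_density 0 \<sigma> (x $ i)) * (\<Prod>i\<in>UNIV. (x $ i) ^ k i)
        = (\<Prod>i\<in>UNIV. normal_density 0 \<sigma> (x $ i) * (x $ i) ^ k i)" for x :: "real^'k"
      by (simp add: prod.distrib)
    have "integrable lborel (\<lambda>x::real^'k. (\<Prod>i\<in>UNIV. normal_density 0 \<sigma> (x $ i)) * (\<Prod>i\<in>UNIV. (x $ i) ^ k i))"
      unfolding e using lborel_vec_prod(1)[of "\<lambda>i x. normal_density 0 \<sigma> x * x ^ k i"] int by blast
    then have 1: "integrable M (\<lambda>w. \<Prod>i\<in>UNIV. (Z w $ i) ^ k i)"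
      using distributed_integrable[OF Z m nn] by simp
    have "expectation (\<lambda>w. \<Prod>i\<in>UNIV. (Z w $ i) ^ k i)
       = integral\<^sup>L lborel (\<lambda>x::real^'k. (\<Prod>i\<in>UNIV. normal_density 0 \<sigma> (x $ i)) * (\<Prod>i\<in>UNIV. (x $ i) ^ k i))"
      using distributed_integral[OF Z m nn] by simp
    also have "\<dots> = (\<Prod>i\<in>UNIV. \<mu> (k i))"
      unfolding e \<mu>_def using lborel_vec_prod(2)[of "\<lambda>i x. normal_density 0 \<sigma> x * x ^ k i"] int by blast
    finally show ?thesis
      using 1 by simp
  qed
  \<comment> \<open>Powers of one coordinate are monomials whose other exponents are 0; exponent 0
    contributes the factor 1 to the monomial and, since \<open>\<mu> 0 = 1\<close>, also to the
    moment.\<close>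
  have d: "(\<Prod>i\<in>UNIV. h i (if i = p then a else 0)) = h p a" if "\<And>i. h i 0 = 1"
    for h :: "'k \<Rightarrow> nat \<Rightarrow> real" and a p
  proof -
    have "(\<Prod>i\<in>UNIV. h i (if i = p then a else 0)) = (\<Prod>i\<in>UNIV. if i = p then h i a else 1)"
      by (intro prod.cong) (auto simp: that)
    then show ?thesis by simp
  qed
  have one: "integrable M (\<lambda>w. (Z w $ p) ^ a) \<and> expectation (\<lambda>w. (Z w $ p) ^ a) = \<mu> a" for p a
    using mono[of "\<lambda>i. if i = p then a else 0"] d[of "\<lambda>i. \<mu>" p a]
      d[of "\<lambda>i a. (Z w $ i) ^ a" p a for w] by (simp add: \<mu>0)
  show "integrable M (\<lambda>w. Z w $ p)" "expectation (\<lambda>w. Z w $ p) = 0"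
    using one[of p 1] \<mu>1 by auto
  have "integrable M (\<lambda>w. Z w $ p * Z w $ q) \<and>
      expectation (\<lambda>w. Z w $ p * Z w $ q) = (if p = q then \<sigma>\<^sup>2 else 0)"
  proof (cases "p = q")
    case True
    then show ?thesis using one[of p 2] \<mu>2 by (simp add: power2_eq_square)
  next
    case False
    let ?k = "\<lambda>i. (if i = p then 1 else 0) + (if i = q then 1 else 0::nat)"
    have "(\<Prod>i\<in>UNIV. (Z w $ i) ^ ?k i) = Z w $ p * Z w $ q" for w
      using d[of "\<lambda>i a. (Z w $ i) ^ a" p 1] d[of "\<lambda>i a. (Z w $ i) ^ a" q 1]
      by (simp add: power_add prod.distrib)
    moreover have "(\<Prod>i\<in>UNIV. \<mu> (?k i)) = 0"
      using False \<mu>1 by (intro prod_zero) (auto intro!: bexI[of _ p])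
    ultimately show ?thesis
      using mono[of ?k] False by simp
  qed
  then show "integrable M (\<lambda>w. Z w $ p * Z w $ q)"
    "expectation (\<lambda>w. Z w $ p * Z w $ q) = (if p = q then \<sigma>\<^sup>2 else 0)" by auto
  have i4: "integrable M (\<lambda>w. real CARD('k) * (\<Sum>i\<in>UNIV. (Z w $ i) ^ 4))"
    using one[of _ 4] by auto
  have [measurable]: "Z \<in> borel_measurable M"
    using Z by (auto simp: distributed_def)
  show i: "integrable M (\<lambda>w. norm (Z w) ^ 4)"
  proof (rule Bochner_Integration.integrable_bound[OF i4])
    show "AE w in M. norm (norm (Z w) ^ 4) \<le> norm (real CARD('k) * (\<Sum>i\<in>UNIV. (Z w $ i) ^ 4))"
      using norm_vec_pow4_le[of "Z w" for w] by (auto intro: order_trans[OF _ abs_ge_self])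
  qed measurable
  have "expectation (\<lambda>w. norm (Z w) ^ 4) \<le> expectation (\<lambda>w. real CARD('k) * (\<Sum>i\<in>UNIV. (Z w $ i) ^ 4))"
    by (rule integral_mono[OF i i4]) (rule norm_vec_pow4_le)
  also have "\<dots> = real CARD('k) * (\<Sum>i\<in>(UNIV::'k set). \<mu> 4)"
    using one[of _ 4] by simp
  finally show "expectation (\<lambda>w. norm (Z w) ^ 4) \<le> 3 * (real CARD('k))\<^sup>2 * \<sigma> ^ 4"
    by (simp add: \<mu>4 power2_eq_square)
qed

section \<open>Increments of a Wiener process\<close>

lemma borel_measurable_vec_component:
  "f \<in> borel_measurable M \<Longrightarrow> (\<lambda>w. f w $ p) \<in> borel_measurable M"
  by (rule borel_measurable_continuous_on[of "\<lambda>x. x $ p"]) (auto intro: continuous_intros)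

locale wiener_space = prob_space P for P :: "'w measure" +
  fixes W :: "real \<Rightarrow> 'w \<Rightarrow> real ^ 'k"
  assumes wiener: "wiener_process P W"
begin

abbreviation F :: "real \<Rightarrow> 'w measure" where
  "F \<equiv> wiener_filtration P W"

lemma W_measurable_P: "0 \<le> t \<Longrightarrow> W t \<in> borel_measurable P"
  using wiener by (simp add: wiener_process_def)

lemma W_0: "AE w in P. W 0 w = 0"
  using wiener by (simp add: wiener_process_def)

lemma W_cont: "AE w in P. continuous_on {0..} (\<lambda>t. W t w)"
  using wiener by (simp add: wiener_process_def)

lemma W_gauss: "0 \<le> s \<Longrightarrow> s < t \<Longrightarrow> distributed P lborel (\<lambda>w. W t w - W s w)
          (\<lambda>x. ennreal (\<Prod>i\<in>UNIV. normal_density 0 (sqrt (t - s)) (x $ i)))"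
  using wiener by (simp add: wiener_process_def)

lemma W_indep: "0 \<le> r 0 \<Longrightarrow> mono r \<Longrightarrow>
   indep_vars (\<lambda>_. borel) (\<lambda>i w. W (r (Suc i)) w - W (r i) w) {..<m::nat}"
  using wiener by (simp add: wiener_process_def)

definition filtration_gen :: "real \<Rightarrow> 'w set set" where
  "filtration_gen t = {W s -` A \<inter> space P | s A. 0 \<le> s \<and> s \<le> t \<and> A \<in> sets borel} \<union> null_sets P"

lemma filtration_gen_sets: "filtration_gen t \<subseteq> sets P"
  using W_measurable_P by (auto simp: filtration_gen_def measurable_sets)

lemma space_F [simp]: "space (F t) = space P"
  unfolding wiener_filtration_def filtration_gen_def[symmetric] using filtration_gen_sets[of t]
  by (subst space_measure_of) (auto dest: sets.sets_into_space)

lemma sets_F: "sets (F t) = sigma_sets (space P) (filtration_gen t)"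
  unfolding wiener_filtration_def filtration_gen_def[symmetric] using filtration_gen_sets[of t]
  by (subst sets_measure_of) (auto dest: sets.sets_into_space)

lemma sets_F_subset: "sets (F t) \<subseteq> sets P"
  unfolding sets_F by (rule sets.sigma_sets_subset) (rule filtration_gen_sets)

lemma sets_F_mono: "s \<le> t \<Longrightarrow> sets (F s) \<subseteq> sets (F t)"
  unfolding sets_F by (rule sigma_sets_mono') (auto simp: filtration_gen_def intro: order_trans)

lemma measurable_F_mono: "f \<in> measurable (F s) N \<Longrightarrow> s \<le> t \<Longrightarrow> f \<in> measurable (F t) N"
  using measurable_mono[of N N "F s" "F t"] sets_F_mono[of s t] by auto

lemma measurable_F_P: "f \<in> measurable (F s) N \<Longrightarrow> f \<in> measurable P N"
  using measurable_mono[of N N "F s" P] sets_F_subset[of s] by auto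

lemma W_measurable: "0 \<le> s \<Longrightarrow> s \<le> t \<Longrightarrow> W s \<in> borel_measurable (F t)"
  by (rule measurableI) (auto simp: sets_F filtration_gen_def intro!: sigma_sets.Basic)

section \<open>Independence of the increments from the augmented past\<close>

definition W_cylinders :: "real \<Rightarrow> 'w set set" where
  "W_cylinders s = {{w \<in> space P. \<forall>u\<in>U. W u w \<in> A u} | U A.
      finite U \<and> U \<subseteq> {0..s} \<and> (\<forall>u. A u \<in> sets borel)}"

text \<open>Independence is given along monotone sequences of times. The times of the cylinder,
  together with 0 and s, are sorted and followed by t. The cylinder then becomes a condition on
  partial sums of the increments up to s, and the next increment is the one from s to t. As
  \<open>W 0\<close> vanishes only almost surely, the rewriting holds up to a null set.\<close>

lemma W_cylinders_indep:
  assumes st: "0 \<le> s" "s < t" and A: "A \<in> W_cylinders s" and B: "B \<in> sets borel"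
  shows "prob (A \<inter> ((\<lambda>w. W t w - W s w) -` B \<inter> space P))
    = prob A * prob ((\<lambda>w. W t w - W s w) -` B \<inter> space P)"
proof -
  obtain U C where U: "finite U" "U \<subseteq> {0..s}" and C: "\<And>u. C u \<in> sets borel"
    and A: "A = {w \<in> space P. \<forall>u\<in>U. W u w \<in> C u}"
    using A unfolding W_cylinders_def by blast
  define V where "V = insert 0 (insert s U)"
  define xs where "xs = sorted_list_of_set V"
  have finV: "finite V" and V: "V \<subseteq> {0..s}" "0 \<in> V" "s \<in> V"
    using U st by (auto simp: V_def)
  have xs: "set xs = V" "sorted xs" "xs \<noteq> []"
    using finV V by (auto simp: xs_def)
  define n where "n = length xs - 1"
  have n: "length xs = Suc n"
    using xs by (cases xs) (auto simp: n_def)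
  have nth: "xs ! i \<in> V" if "i \<le> n" for i
    using that n xs(1) nth_mem[of i xs] by auto
  have hd: "xs ! 0 = 0"
  proof -
    obtain i where i: "i \<le> n" "xs ! i = 0"
      using V(2) xs(1) n by (metis in_set_conv_nth less_Suc_eq_le)
    then have "xs ! 0 \<le> 0"
      using xs(2) n sorted_nth_mono[of xs 0 i] by auto
    then show ?thesis using nth[of 0] V by auto
  qed
  have lst: "xs ! n = s"
  proof -
    obtain i where i: "i \<le> n" "xs ! i = s"
      using V(3) xs(1) n by (metis in_set_conv_nth less_Suc_eq_le)
    then have "s \<le> xs ! n"
      using xs(2) n sorted_nth_mono[of xs i n] by auto
    then show ?thesis using nth[of n] V by auto
  qed
  \<comment> \<open>Constant \<open>t\<close> from index \<open>Suc n\<close> on, so that the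
    sequence is monotone on all of nat; increment number n, from \<open>xs ! n = s\<close> to t, is
    the one of interest.\<close>
  define r where "r i = (if i \<le> n then xs ! i else t)" for i
  have mono: "mono r"
  proof (rule monoI)
    fix i j :: nat assume ij: "i \<le> j"
    show "r i \<le> r j"
      using ij xs(2) n sorted_nth_mono[of xs i j] nth[of i] V(1) st by (auto simp: r_def)
  qed
  have r0: "r 0 = 0" using hd by (simp add: r_def)
  define X where "X i w = W (r (Suc i)) w - W (r i) w" for i w
  have ind: "indep_vars (\<lambda>_. borel) X {..<Suc n}"
    using W_indep[of r "Suc n"] r0 mono by (simp add: X_def[abs_def])
  have Xn: "X n w = W t w - W s w" for w
    using lst by (simp add: X_def r_def)
  have iv: "indep_var (Pi\<^sub>M {..<n} (\<lambda>_. borel)) (\<lambda>\<omega>. restrict (\<lambda>i. X i \<omega>) {..<n})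
     (Pi\<^sub>M {n} (\<lambda>_. borel)) (\<lambda>\<omega>. restrict (\<lambda>i. X i \<omega>) {n})"
    by (rule indep_var_restrict[OF ind]) auto
  define Q where "Q = {f \<in> space (Pi\<^sub>M {..<n} (\<lambda>_. borel)). \<forall>i\<in>{..n}. xs ! i \<in> U \<longrightarrow> (\<Sum>j<i. f j) \<in> C (xs ! i)}"
  have Q: "Q \<in> sets (Pi\<^sub>M {..<n} (\<lambda>_. borel :: (real^'k) measure))"
  proof -
    have "(\<lambda>f. \<Sum>j<i. f j) \<in> measurable (Pi\<^sub>M {..<n} (\<lambda>_. borel)) (borel :: (real^'k) measure)" if "i \<le> n" for i
      using that by (intro borel_measurable_sum measurable_component_singleton) auto
    then have "{f \<in> space (Pi\<^sub>M {..<n} (\<lambda>_. borel)). xs ! i \<in> U \<longrightarrow> (\<Sum>j<i. f j) \<in> C (xs ! i)}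
        \<in> sets (Pi\<^sub>M {..<n} (\<lambda>_. borel :: (real^'k) measure))" if "i \<le> n" for i
      using that C by (cases "xs ! i \<in> U") (auto simp: measurable_sets_borel intro: measurable_sets_Collect)
    then show ?thesis
      unfolding Q_def by (intro sets.sets_Collect_finite_All) auto
  qed
  define D where "D = {f \<in> space (Pi\<^sub>M {n} (\<lambda>_. borel)). f n \<in> B}"
  have D: "D \<in> sets (Pi\<^sub>M {n} (\<lambda>_. borel :: (real^'k) measure))"
    unfolding D_def using B by measurable
  let ?E = "(\<lambda>\<omega>. restrict (\<lambda>i. X i \<omega>) {..<n}) -` Q \<inter> space P"
  let ?G = "(\<lambda>\<omega>. restrict (\<lambda>i. X i \<omega>) {n}) -` D \<inter> space P"
  have rv: "random_variable (Pi\<^sub>M {..<n} (\<lambda>_. borel)) (\<lambda>\<omega>. restrict (\<lambda>i. X i \<omega>) {..<n})"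
       "random_variable (Pi\<^sub>M {n} (\<lambda>_. borel)) (\<lambda>\<omega>. restrict (\<lambda>i. X i \<omega>) {n})"
    using iv unfolding indep_var_eq by auto
  have G: "?G = (\<lambda>w. W t w - W s w) -` B \<inter> space P"
    by (auto simp: D_def space_PiM Xn)
  have sumX: "(\<Sum>j<i. X j w) = W (xs ! i) w" if "i \<le> n" "W 0 w = 0" for i w
  proof -
    have "(\<Sum>j<i. X j w) = W (r i) w - W (r 0) w"
      unfolding X_def by (rule sum_lessThan_telescope)
    then show ?thesis using that r0 by (simp add: r_def)
  qed
  have key: "w \<in> ?E \<longleftrightarrow> w \<in> A" if w: "w \<in> space P" "W 0 w = 0" for w
  proof -
    have "w \<in> ?E \<longleftrightarrow> (\<forall>i\<in>{..n}. xs ! i \<in> U \<longrightarrow> W (xs ! i) w \<in> C (xs ! i))"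
      using w sumX[OF _ w(2)] by (auto simp: Q_def space_PiM)
    also have "\<dots> \<longleftrightarrow> (\<forall>u\<in>U. W u w \<in> C u)"
    proof safe
      fix u assume *: "\<forall>i\<in>{..n}. xs ! i \<in> U \<longrightarrow> W (xs ! i) w \<in> C (xs ! i)" and u: "u \<in> U"
      then have "u \<in> set xs" by (simp add: xs V_def)
      then obtain i where "i \<le> n" "xs ! i = u"
        using n by (metis in_set_conv_nth less_Suc_eq_le)
      then show "W u w \<in> C u" using * u by auto
    qed auto
    finally show ?thesis using w A by auto
  qed
  have Am: "A \<in> events"
  proof -
    have "{w \<in> space P. W u w \<in> C u} \<in> events" if "u \<in> U" for u
      using measurable_sets[OF W_measurable_P C] that U by (auto simp: vimage_def Int_def conj_commute)
    then show ?thesis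
      unfolding A using U by (intro sets.sets_Collect_finite_All) auto
  qed
  have Em: "?E \<in> events" and Gm: "?G \<in> events"
    using measurable_sets[OF rv(1) Q] measurable_sets[OF rv(2) D] by auto
  have "AE w in P. w \<in> ?E \<longleftrightarrow> w \<in> A"
    using W_0 AE_space by eventually_elim (rule key)
  then have EA: "prob ?E = prob A" "prob (?E \<inter> ?G) = prob (A \<inter> ?G)"
    using Em Gm Am by (auto intro!: measure_eq_AE)
  have "indep_set (sigma_sets (space P) {(\<lambda>\<omega>. restrict (\<lambda>i. X i \<omega>) {..<n}) -` A \<inter> space P |A. A \<in> sets (Pi\<^sub>M {..<n} (\<lambda>_. borel))})
     (sigma_sets (space P) {(\<lambda>\<omega>. restrict (\<lambda>i. X i \<omega>) {n}) -` A \<inter> space P |A. A \<in> sets (Pi\<^sub>M {n} (\<lambda>_. borel))})"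
    using iv unfolding indep_var_eq by auto
  then have "prob (?E \<inter> ?G) = prob ?E * prob ?G"
    by (rule indep_setD) (use Q D in \<open>auto intro!: sigma_sets.Basic\<close>)
  moreover have "prob (A \<inter> ?G) = prob (?E \<inter> ?G)"
    using EA by simp
  ultimately show ?thesis
    unfolding G EA(1) by simp
qed

text \<open>The filtration contains all null sets, so the cylinders alone do not generate it. The
  intersection-stable class used here consists of the events that agree almost surely with a
  cylinder. Independence passes to such events, and a null set agrees with the empty
  cylinder.\<close>

lemma F_indep_increment:
  assumes st: "0 \<le> s" "s < t"
  shows "indep_set (sets (F s)) (sets (vimage_algebra (space P) (\<lambda>w. W t w - W s w) borel))"
proof -
  let ?V = "sets (vimage_algebra (space P) (\<lambda>w. W t w - W s w) (borel :: (real^'k) measure))"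
  have V: "?V = {(\<lambda>w. W t w - W s w) -` B \<inter> space P | B. B \<in> sets borel}"
    by (subst sets_vimage_algebra2) auto
  have [measurable]: "W t \<in> borel_measurable P" "W s \<in> borel_measurable P"
    using W_measurable_P st by auto
  have Vs: "?V \<subseteq> events"
    unfolding V using measurable_sets[of "\<lambda>w. W t w - W s w" P borel] by auto
  define E where "E = {A \<in> events. \<exists>A'\<in>W_cylinders s. AE w in P. w \<in> A \<longleftrightarrow> w \<in> A'}"
  have cyl_events: "A \<in> events" if A: "A \<in> W_cylinders s" for A
  proof -
    obtain U C where U: "finite U" "U \<subseteq> {0..s}" and C: "\<And>u. C u \<in> sets borel"
      and A: "A = {w \<in> space P. \<forall>u\<in>U. W u w \<in> C u}"
      using A unfolding W_cylinders_def by blast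
    have "{w \<in> space P. W u w \<in> C u} \<in> events" if "u \<in> U" for u
      using measurable_sets[OF W_measurable_P C] that U by (auto simp: vimage_def Int_def conj_commute)
    then show ?thesis
      unfolding A using U by (intro sets.sets_Collect_finite_All) auto
  qed
  have "indep_set E ?V"
  proof (rule indep_setI)
    fix a b assume a: "a \<in> E" and b: "b \<in> ?V"
    obtain A' where A': "A' \<in> W_cylinders s" "AE w in P. w \<in> a \<longleftrightarrow> w \<in> A'"
      using a by (auto simp: E_def)
    have "prob a = prob A'" "prob (a \<inter> b) = prob (A' \<inter> b)"
      using A' a b cyl_events[OF A'(1)] Vs by (auto intro!: measure_eq_AE simp: E_def)
    moreover have "prob (A' \<inter> b) = prob A' * prob b"
      using b W_cylinders_indep[OF st A'(1)] unfolding V by auto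
    ultimately show "prob (a \<inter> b) = prob a * prob b" by simp
  qed (use Vs in \<open>auto simp: E_def\<close>)
  moreover have "Int_stable E"
  proof (rule Int_stableI)
    fix a b assume a: "a \<in> E" and b: "b \<in> E"
    obtain A' where A': "A' \<in> W_cylinders s" "AE w in P. w \<in> a \<longleftrightarrow> w \<in> A'"
      using a by (auto simp: E_def)
    obtain B' where B': "B' \<in> W_cylinders s" "AE w in P. w \<in> b \<longleftrightarrow> w \<in> B'"
      using b by (auto simp: E_def)
    obtain U C where U: "finite U" "U \<subseteq> {0..s}" "\<And>u. C u \<in> sets borel"
      "A' = {w \<in> space P. \<forall>u\<in>U. W u w \<in> C u}"
      using A'(1) unfolding W_cylinders_def by blast
    obtain U' C' where U': "finite U'" "U' \<subseteq> {0..s}" "\<And>u. C' u \<in> sets borel"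
      "B' = {w \<in> space P. \<forall>u\<in>U'. W u w \<in> C' u}"
      using B'(1) unfolding W_cylinders_def by blast
    \<comment> \<open>The two cylinders restrict different finite sets of times; at a time
      restricted by only one of them the other imposes no condition.\<close>
    define C2 where "C2 u = {x. (u \<in> U \<longrightarrow> x \<in> C u) \<and> (u \<in> U' \<longrightarrow> x \<in> C' u)}" for u
    have "C2 u = (if u \<in> U then C u else UNIV) \<inter> (if u \<in> U' then C' u else UNIV)" for u
      by (auto simp: C2_def)
    then have "C2 u \<in> sets borel" for u
      using U(3) U'(3) by simp
    moreover have "A' \<inter> B' = {w \<in> space P. \<forall>u\<in>U \<union> U'. W u w \<in> C2 u}"
      unfolding U(4) U'(4) C2_def by auto
    ultimately have "A' \<inter> B' \<in> W_cylinders s"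
      unfolding W_cylinders_def using U(1,2) U'(1,2) by blast
    moreover have "AE w in P. w \<in> a \<inter> b \<longleftrightarrow> w \<in> A' \<inter> B'"
      using A'(2) B'(2) by eventually_elim auto
    ultimately have "\<exists>C\<in>W_cylinders s. AE w in P. w \<in> a \<inter> b \<longleftrightarrow> w \<in> C"
      by (rule bexI[rotated])
    then show "a \<inter> b \<in> E"
      using a b by (simp add: E_def sets.Int)
  qed
  moreover have "Int_stable ?V"
    by (rule sets.Int_stable)
  ultimately have I: "indep_set (sigma_sets (space P) E) (sigma_sets (space P) ?V)"
    by (rule indep_set_sigma_sets)
  have sub: "sets (F s) \<subseteq> sigma_sets (space P) E"
    unfolding sets_F
  proof (rule sigma_sets_mono')
    show "filtration_gen s \<subseteq> E"
    proof
      fix a assume a: "a \<in> filtration_gen s"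
      then have ae: "a \<in> events" using filtration_gen_sets by auto
      have "\<exists>A'\<in>W_cylinders s. AE w in P. w \<in> a \<longleftrightarrow> w \<in> A'"
      proof (cases "a \<in> null_sets P")
        case True
        have "{} \<in> W_cylinders s"
          unfolding W_cylinders_def using st by (auto intro!: exI[of _ "{0}"] exI[of _ "\<lambda>_. {}"])
        moreover have "AE w in P. w \<in> a \<longleftrightarrow> w \<in> {}"
          using AE_not_in[OF True] by eventually_elim auto
        ultimately show ?thesis by blast
      next
        case False
        then obtain u A where u: "0 \<le> u" "u \<le> s" "A \<in> sets borel" "a = W u -` A \<inter> space P"
          using a by (auto simp: filtration_gen_def)
        have "a = {w \<in> space P. \<forall>v\<in>{u}. W v w \<in> A}"
          using u by auto
        then have "a \<in> W_cylinders s"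
          unfolding W_cylinders_def using u by (intro CollectI exI[of _ "{u}"] exI[of _ "\<lambda>_. A"]) auto
        then show ?thesis by (intro bexI[of _ a]) auto
      qed
      then show "a \<in> E" using ae by (simp add: E_def)
    qed
  qed
  show ?thesis
  proof (rule indep_setI[OF sets_F_subset Vs])
    fix a b assume "a \<in> sets (F s)" "b \<in> ?V"
    then show "prob (a \<inter> b) = prob a * prob b"
      using sub by (intro indep_setD[OF I]) (simp_all add: subset_iff del: sets_vimage_algebra)
  qed
qed

section \<open>Moments of increments weighted by quantities known in the past\<close>

lemma increment_product:
  fixes g :: "'w \<Rightarrow> real" and \<phi> :: "real ^ 'k \<Rightarrow> real"
  assumes st: "0 \<le> s" "s < t" and g: "g \<in> borel_measurable (F s)" "integrable P g"
    and \<phi>: "\<phi> \<in> borel_measurable borel" "integrable P (\<lambda>w. \<phi> (W t w - W s w))"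
  shows "integrable P (\<lambda>w. g w * \<phi> (W t w - W s w))"
    and "expectation (\<lambda>w. g w * \<phi> (W t w - W s w)) = expectation g * expectation (\<lambda>w. \<phi> (W t w - W s w))"
proof -
  let ?V = "vimage_algebra (space P) (\<lambda>w. W t w - W s w) (borel :: (real^'k) measure)"
  have m2: "(\<lambda>w. \<phi> (W t w - W s w)) \<in> borel_measurable ?V"
  proof -
    have "(\<lambda>w. W t w - W s w) \<in> measurable ?V borel"
      by (rule measurable_vimage_algebra1) auto
    then show ?thesis
      using \<phi>(1) by (rule measurable_compose)
  qed
  have "{g -` A \<inter> space P |A. A \<in> sets borel} \<subseteq> sets (F s)"
    using measurable_sets[OF g(1)] by auto
  then have 1: "sigma_sets (space P) {g -` A \<inter> space P |A. A \<in> sets borel} \<subseteq> sets (F s)"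
    using sets.sigma_sets_subset[where M = "F s"] by simp
  have "{(\<lambda>w. \<phi> (W t w - W s w)) -` A \<inter> space P |A. A \<in> sets borel} \<subseteq> sets ?V"
    using measurable_sets[OF m2] by auto
  then have 2: "sigma_sets (space P) {(\<lambda>w. \<phi> (W t w - W s w)) -` A \<inter> space P |A. A \<in> sets borel} \<subseteq> sets ?V"
    using sets.sigma_sets_subset[where M = ?V] by simp
  have "indep_var borel g borel (\<lambda>w. \<phi> (W t w - W s w))"
    unfolding indep_var_eq
  proof (intro conjI)
    show "indep_set (sigma_sets (space P) {g -` A \<inter> space P |A. A \<in> sets borel})
      (sigma_sets (space P) {(\<lambda>w. \<phi> (W t w - W s w)) -` A \<inter> space P |A. A \<in> sets borel})"
    proof (rule indep_setI)
      fix a b assume "a \<in> sigma_sets (space P) {g -` A \<inter> space P |A. A \<in> sets borel}"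
        and "b \<in> sigma_sets (space P) {(\<lambda>w. \<phi> (W t w - W s w)) -` A \<inter> space P |A. A \<in> sets borel}"
      then have "a \<in> sets (F s)" "b \<in> sets ?V"
        using 1 2 by blast+
      then show "prob (a \<inter> b) = prob a * prob b"
        by (rule indep_setD[OF F_indep_increment[OF st]])
    next
      show "sigma_sets (space P) {g -` A \<inter> space P |A. A \<in> sets borel} \<subseteq> events"
        using 1 sets_F_subset by (rule order_trans)
      have "sets ?V \<subseteq> events"
        using F_indep_increment[OF st] unfolding indep_sets2_eq by (elim conjE)
      with 2 show "sigma_sets (space P) {(\<lambda>w. \<phi> (W t w - W s w)) -` A \<inter> space P |A. A \<in> sets borel} \<subseteq> events"
        by (rule order_trans)
    qed
  qed (use g \<phi> measurable_F_P in auto)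
  then show "integrable P (\<lambda>w. g w * \<phi> (W t w - W s w))"
    "expectation (\<lambda>w. g w * \<phi> (W t w - W s w)) = expectation g * expectation (\<lambda>w. \<phi> (W t w - W s w))"
    by (rule indep_var_integrable[OF _ g(2) \<phi>(2)], rule indep_var_lebesgue_integral[OF _ g(2) \<phi>(2)])
qed

lemma increment_linear:
  fixes G :: "'w \<Rightarrow> real ^ 'k"
  assumes st: "0 \<le> s" "s \<le> t" and G: "G \<in> borel_measurable (F s)" "integrable P G"
  shows "integrable P (\<lambda>w. G w \<bullet> (W t w - W s w))" "expectation (\<lambda>w. G w \<bullet> (W t w - W s w)) = 0"
proof -
  have "integrable P (\<lambda>w. G w \<bullet> (W t w - W s w)) \<and> expectation (\<lambda>w. G w \<bullet> (W t w - W s w)) = 0"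
  proof (cases "s = t")
    case False
    then have st': "0 \<le> s" "s < t" using st by auto
    have sq: "0 < sqrt (t - s)" using st' by simp
    note gm = gaussian_moments[OF W_gauss[OF st'] sq]
    have e: "G w \<bullet> (W t w - W s w) = (\<Sum>p\<in>UNIV. (G w $ p) * (W t w - W s w) $ p)" for w
      by (simp add: inner_vec_def)
    have Gp: "(\<lambda>w. G w $ p) \<in> borel_measurable (F s)" "integrable P (\<lambda>w. G w $ p)" for p
      using G by (auto simp: cart_eq_inner_axis)
    have i: "integrable P (\<lambda>w. (G w $ p) * (W t w - W s w) $ p)"
      "expectation (\<lambda>w. (G w $ p) * (W t w - W s w) $ p) = 0" for p
      using increment_product[OF st' Gp[of p], of "\<lambda>x. x $ p"] gm(1,2)[of p] st' by (auto simp del: vector_minus_component)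
    show ?thesis
      unfolding e using i by simp
  qed simp
  then show "integrable P (\<lambda>w. G w \<bullet> (W t w - W s w))" "expectation (\<lambda>w. G w \<bullet> (W t w - W s w)) = 0"
    by auto
qed

text \<open>The covariance matrix of the increment is \<open>t - s\<close> times the identity, so
  only the diagonal of \<open>Q\<close> survives. The second-order term of the generator has its
  origin here.\<close>

lemma increment_quadratic:
  fixes Q :: "'w \<Rightarrow> real ^ 'k ^ 'k"
  assumes st: "0 \<le> s" "s \<le> t" and Q: "Q \<in> borel_measurable (F s)" "integrable P Q"
  shows "integrable P (\<lambda>w. (W t w - W s w) \<bullet> (Q w *v (W t w - W s w)))"
    and "expectation (\<lambda>w. (W t w - W s w) \<bullet> (Q w *v (W t w - W s w))) = (t - s) * expectation (\<lambda>w. trace (Q w))"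
proof -
  have "integrable P (\<lambda>w. (W t w - W s w) \<bullet> (Q w *v (W t w - W s w))) \<and>
    expectation (\<lambda>w. (W t w - W s w) \<bullet> (Q w *v (W t w - W s w))) = (t - s) * expectation (\<lambda>w. trace (Q w))"
  proof (cases "s = t")
    case False
    then have st': "0 \<le> s" "s < t" using st by auto
    have sq: "0 < sqrt (t - s)" using st' by simp
    note gm = gaussian_moments[OF W_gauss[OF st'] sq]
    have e: "(W t w - W s w) \<bullet> (Q w *v (W t w - W s w)) =
       (\<Sum>p\<in>UNIV. \<Sum>q\<in>UNIV. (Q w $ p $ q) * ((W t w - W s w) $ p * (W t w - W s w) $ q))" for w
      by (simp add: inner_vec_def matrix_vector_mult_def sum_distrib_left ac_simps)
    have Gp: "(\<lambda>w. Q w $ p $ q) \<in> borel_measurable (F s)" "integrable P (\<lambda>w. Q w $ p $ q)" for p q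
      using integrable_bounded_linear[OF bounded_linear_compose[OF bounded_linear_vec_nth bounded_linear_vec_nth] Q(2)]
        borel_measurable_vec_component[OF borel_measurable_vec_component[OF Q(1)]]
      by auto
    have i: "integrable P (\<lambda>w. (Q w $ p $ q) * ((W t w - W s w) $ p * (W t w - W s w) $ q))"
      "expectation (\<lambda>w. (Q w $ p $ q) * ((W t w - W s w) $ p * (W t w - W s w) $ q))
        = (if q = p then (t - s) * expectation (\<lambda>w. Q w $ p $ q) else 0)" for p q
    proof -
      have "(\<lambda>x::real^'k. x $ p * x $ q) \<in> borel_measurable borel"
        by measurable
      note ip = increment_product[OF st' Gp[of p q] this gm(3)[of p q]]
      show "integrable P (\<lambda>w. (Q w $ p $ q) * ((W t w - W s w) $ p * (W t w - W s w) $ q))"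
        by (rule ip(1))
      show "expectation (\<lambda>w. (Q w $ p $ q) * ((W t w - W s w) $ p * (W t w - W s w) $ q))
        = (if q = p then (t - s) * expectation (\<lambda>w. Q w $ p $ q) else 0)"
        unfolding ip(2) gm(4) using st' by simp
    qed
    have "expectation (\<lambda>w. trace (Q w)) = (\<Sum>p\<in>UNIV. expectation (\<lambda>w. Q w $ p $ p))"
      unfolding trace_def using Gp(2) by simp
    then show ?thesis
      unfolding e using i by (simp add: sum_distrib_left)
  qed simp
  then show "integrable P (\<lambda>w. (W t w - W s w) \<bullet> (Q w *v (W t w - W s w)))"
    "expectation (\<lambda>w. (W t w - W s w) \<bullet> (Q w *v (W t w - W s w))) = (t - s) * expectation (\<lambda>w. trace (Q w))"
    by auto
qed

text \<open>This moment is of second order in the length of the step, so a Taylor error measured by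
  it vanishes in total when the grid is refined.\<close>

lemma increment_pow4:
  assumes st: "0 \<le> s" "s \<le> t"
  shows "integrable P (\<lambda>w. norm (W t w - W s w) ^ 4)"
    and "expectation (\<lambda>w. norm (W t w - W s w) ^ 4) \<le> 3 * (real CARD('k))\<^sup>2 * (t - s)\<^sup>2"
proof -
  have "integrable P (\<lambda>w. norm (W t w - W s w) ^ 4) \<and>
    expectation (\<lambda>w. norm (W t w - W s w) ^ 4) \<le> 3 * (real CARD('k))\<^sup>2 * (t - s)\<^sup>2"
  proof (cases "s = t")
    case False
    then have st': "0 \<le> s" "s < t" using st by auto
    have sq: "0 < sqrt (t - s)" using st' by simp
    note gm = gaussian_moments[OF W_gauss[OF st'] sq]
    have "sqrt (t - s) ^ 4 = ((sqrt (t - s))\<^sup>2)\<^sup>2"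
      by (simp only: power_mult[symmetric]) simp
    also have "\<dots> = (t - s)\<^sup>2"
      using st' by simp
    finally show ?thesis
      using gm(5,6) st' by simp
  qed simp
  then show "integrable P (\<lambda>w. norm (W t w - W s w) ^ 4)"
    "expectation (\<lambda>w. norm (W t w - W s w) ^ 4) \<le> 3 * (real CARD('k))\<^sup>2 * (t - s)\<^sup>2"
    by auto
qed

end

section \<open>Matrices with the Frobenius norm\<close>

lemma norm_vec_le_mult:
  fixes x :: "'a::real_normed_vector ^ 'm" and y :: "'b::real_normed_vector ^ 'm"
  assumes "\<And>i. norm (x $ i) \<le> c * norm (y $ i)" "0 \<le> c"
  shows "norm x \<le> c * norm y"
  unfolding norm_vec_def using assms
  by (subst L2_set_right_distrib) (auto intro!: L2_set_mono)

lemma norm_matrix_vector_mult_le: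
  fixes A :: "real ^ 'k ^ 'n" and x :: "real ^ 'k"
  shows "norm (A *v x) \<le> norm A * norm x"
proof -
  have "norm ((A *v x) $ i) \<le> norm x * norm (A $ i)" for i
  proof -
    have "(A *v x) $ i = A $ i \<bullet> x"
      by (simp add: matrix_vector_mult_def inner_vec_def)
    then show ?thesis
      using Cauchy_Schwarz_ineq2[of "A $ i" x] by (simp add: mult.commute)
  qed
  then have "norm (A *v x) \<le> norm x * norm A"
    by (rule norm_vec_le_mult) simp
  then show ?thesis by (simp add: mult.commute)
qed

lemma bounded_bilinear_matrix_vector_mult:
  "bounded_bilinear (\<lambda>(A :: real ^ 'k ^ 'n) x. A *v x)"
  by unfold_locales
    (auto simp: matrix_vector_mult_add_rdistrib matrix_vector_right_distrib scaleR_matrix_vector_assoc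
      matrix_vector_mult_scaleR intro!: exI[of _ 1] norm_matrix_vector_mult_le)

lemma norm_transpose [simp]: "norm (transpose A :: real ^ 'k ^ 'n) = norm A"
proof -
  have "norm (transpose A) = sqrt (\<Sum>i\<in>UNIV. \<Sum>j\<in>UNIV. (A $ j $ i)\<^sup>2)"
    by (simp add: norm_vec_def L2_set_def transpose_def sum_nonneg)
  also have "\<dots> = sqrt (\<Sum>j\<in>UNIV. \<Sum>i\<in>UNIV. (A $ j $ i)\<^sup>2)"
    by (subst sum.swap) simp
  finally show ?thesis
    by (simp add: norm_vec_def L2_set_def sum_nonneg)
qed

text \<open>A row of \<open>A ** B\<close> is \<open>transpose B\<close> applied to the same row of
  \<open>A\<close>, and transposition preserves the Frobenius norm; the bound follows row by row
  from the one for vectors.\<close>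

lemma norm_matrix_mult_le:
  fixes A :: "real ^ 'k ^ 'n" and B :: "real ^ 'm ^ 'k"
  shows "norm (A ** B) \<le> norm A * norm B"
proof -
  have "norm ((A ** B) $ i) \<le> norm B * norm (A $ i)" for i
  proof -
    have "(A ** B) $ i = transpose B *v (A $ i)"
      by (simp add: matrix_matrix_mult_def matrix_vector_mult_def transpose_def vec_eq_iff mult.commute)
    then show ?thesis
      using norm_matrix_vector_mult_le[of "transpose B" "A $ i"] by simp
  qed
  then have "norm (A ** B) \<le> norm B * norm A"
    by (rule norm_vec_le_mult) simp
  then show ?thesis by (simp add: mult.commute)
qed

lemma bounded_bilinear_matrix_mult:
  "bounded_bilinear (\<lambda>(A :: real ^ 'k ^ 'n) (B :: real ^ 'm ^ 'k). A ** B)"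
  by unfold_locales
    (auto simp: matrix_matrix_mult_def vec_eq_iff sum.distrib algebra_simps sum_distrib_left
      intro!: exI[of _ 1] norm_matrix_mult_le[unfolded matrix_matrix_mult_def])

lemma bounded_linear_transpose: "bounded_linear (transpose :: real ^ 'k ^ 'n \<Rightarrow> _)"
  by unfold_locales (auto simp: transpose_def vec_eq_iff norm_transpose[unfolded transpose_def] intro!: exI[of _ 1])

lemma bounded_linear_trace: "bounded_linear (trace :: real ^ 'n ^ 'n \<Rightarrow> real)"
  unfolding trace_def
  by (intro bounded_linear_sum bounded_linear_compose[OF bounded_linear_vec_nth bounded_linear_vec_nth])

lemmas continuous_on_matrix_vector_mult [continuous_intros] =
  bounded_bilinear.continuous_on[OF bounded_bilinear_matrix_vector_mult]
lemmas continuous_on_matrix_mult [continuous_intros] =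
  bounded_bilinear.continuous_on[OF bounded_bilinear_matrix_mult]
lemmas continuous_on_transpose [continuous_intros] =
  bounded_linear.continuous_on[OF bounded_linear_transpose]
lemmas continuous_on_trace [continuous_intros] =
  bounded_linear.continuous_on[OF bounded_linear_trace]

lemma borel_measurable_matrix_vector_mult [measurable (raw)]:
  fixes A :: "'a \<Rightarrow> real ^ 'k ^ 'n" and x :: "'a \<Rightarrow> real ^ 'k"
  assumes "A \<in> borel_measurable M" "x \<in> borel_measurable M"
  shows "(\<lambda>w. A w *v x w) \<in> borel_measurable M"
  using assms by (rule borel_measurable_continuous_Pair) (intro continuous_intros)

lemma borel_measurable_matrix_mult [measurable (raw)]:
  fixes A :: "'a \<Rightarrow> real ^ 'k ^ 'n" and B :: "'a \<Rightarrow> real ^ 'm ^ 'k"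
  assumes "A \<in> borel_measurable M" "B \<in> borel_measurable M"
  shows "(\<lambda>w. A w ** B w) \<in> borel_measurable M"
  using assms by (rule borel_measurable_continuous_Pair) (intro continuous_intros)

lemma borel_measurable_transpose [measurable (raw)]:
  fixes A :: "'a \<Rightarrow> real ^ 'k ^ 'n"
  assumes "A \<in> borel_measurable M"
  shows "(\<lambda>w. transpose (A w)) \<in> borel_measurable M"
  using assms by (intro borel_measurable_continuous_on[of transpose] continuous_intros)

text \<open>Adjointness of \<open>A\<close>. With \<open>A\<close> the diffusion matrix and x an
  increment, it exhibits the second-order Taylor term as a quadratic form in the increment whose
  matrix is the one under the trace in the generator.\<close>

lemma quadratic_form_pullback:
  fixes A :: "real ^ 'k ^ 'n" and H :: "real ^ 'n ^ 'n" and x :: "real ^ 'k"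
  shows "(A *v x) \<bullet> (H *v (A *v x)) = x \<bullet> ((transpose A ** H ** A) *v x)"
proof -
  have "(A *v x) \<bullet> (H *v (A *v x)) = (H *v (A *v x)) \<bullet> (A *v x)"
    by (rule inner_commute)
  also have "\<dots> = (transpose A *v (H *v (A *v x))) \<bullet> x"
    by (simp only: dot_lmul_matrix[symmetric] transpose_matrix_vector)
  also have "\<dots> = x \<bullet> (transpose A *v (H *v (A *v x)))"
    by (rule inner_commute)
  finally show ?thesis
    by (simp only: matrix_vector_mul_assoc matrix_mul_assoc)
qed

lemma norm_square_pullback:
  fixes A :: "real ^ 'k ^ 'n" and x :: "real ^ 'k"
  shows "(norm (A *v x))\<^sup>2 = x \<bullet> ((transpose A ** A) *v x)"
  using quadratic_form_pullback[of A x "mat 1"] by (simp add: power2_norm_eq_inner)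

lemma trace_gram:
  fixes A :: "real ^ 'k ^ 'n"
  shows "trace (transpose A ** A) = (norm A)\<^sup>2"
proof -
  have "(norm A)\<^sup>2 = (\<Sum>j\<in>UNIV. \<Sum>i\<in>UNIV. (A $ j $ i)\<^sup>2)"
    by (simp add: norm_vec_def L2_set_def sum_nonneg)
  also have "\<dots> = (\<Sum>i\<in>UNIV. \<Sum>j\<in>UNIV. (A $ j $ i)\<^sup>2)"
    by (rule sum.swap)
  finally show ?thesis
    by (simp add: trace_def transpose_def matrix_matrix_mult_def power2_eq_square)
qed

section \<open>A maximal inequality for discrete stochastic integrals\<close>

context wiener_space
begin

text \<open>The stochastic integral up to grid point number l. The weight of a cell multiplies the
  increment that follows its left end, so a weight known at that left end is independent of the
  increment.\<close>

definition isum :: "(nat \<Rightarrow> real) \<Rightarrow> (nat \<Rightarrow> 'w \<Rightarrow> real ^ 'k ^ 'n) \<Rightarrow> nat \<Rightarrow> 'w \<Rightarrow> real ^ 'n" where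
  "isum \<rho> \<psi> l w = (\<Sum>k<l. \<psi> k w *v (W (\<rho> (Suc k)) w - W (\<rho> k) w))"

lemma isum_0 [simp]: "isum \<rho> \<psi> 0 w = 0"
  by (simp add: isum_def)

lemma isum_Suc: "isum \<rho> \<psi> (Suc l) w = isum \<rho> \<psi> l w + \<psi> l w *v (W (\<rho> (Suc l)) w - W (\<rho> l) w)"
  by (simp add: isum_def)

lemma isum_measurable:
  assumes \<rho>: "0 \<le> \<rho> 0" "mono \<rho>" and \<psi>: "\<And>k. k < l \<Longrightarrow> \<psi> k \<in> borel_measurable (F (\<rho> k))"
  shows "isum \<rho> \<psi> l \<in> borel_measurable (F (\<rho> l))"
proof -
  note \<rho>m = monoD[OF \<rho>(2)]
  have nn: "0 \<le> \<rho> k" for k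
    using \<rho>(1) \<rho>m[of 0 k] by simp
  have "(\<lambda>w. \<psi> k w *v (W (\<rho> (Suc k)) w - W (\<rho> k) w)) \<in> borel_measurable (F (\<rho> l))" if k: "k < l" for k
  proof -
    have [measurable]: "\<psi> k \<in> borel_measurable (F (\<rho> l))"
      using \<rho>m[of k l] k by (intro measurable_F_mono[OF \<psi>[OF k]]) simp
    have [measurable]: "W (\<rho> (Suc k)) \<in> borel_measurable (F (\<rho> l))" "W (\<rho> k) \<in> borel_measurable (F (\<rho> l))"
      using \<rho>m[of "Suc k" l] \<rho>m[of k l] k nn by (auto intro!: W_measurable)
    show ?thesis by measurable
  qed
  then show ?thesis
    unfolding isum_def[abs_def] by (intro borel_measurable_sum) auto
qed

text \<open>The Ito isometry, by induction on l. The cross term is linear in the new increment with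
  a coefficient from the past and has mean 0. The square of the new summand is a quadratic form in
  the increment, and the trace of its matrix is the squared Frobenius norm of the weight.\<close>

lemma isum_isometry:
  fixes \<psi> :: "nat \<Rightarrow> 'w \<Rightarrow> real ^ 'k ^ 'n"
  assumes \<rho>: "0 \<le> \<rho> 0" "mono \<rho>" and \<psi>: "\<And>k. k < l \<Longrightarrow> \<psi> k \<in> borel_measurable (F (\<rho> k))"
    and C: "\<And>k w. k < l \<Longrightarrow> w \<in> space P \<Longrightarrow> norm (\<psi> k w) \<le> C"
  shows "integrable P (\<lambda>w. (norm (isum \<rho> \<psi> l w))\<^sup>2)"
    and "expectation (\<lambda>w. (norm (isum \<rho> \<psi> l w))\<^sup>2) =
      (\<Sum>k<l. (\<rho> (Suc k) - \<rho> k) * expectation (\<lambda>w. (norm (\<psi> k w))\<^sup>2))"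
proof -
  have "integrable P (\<lambda>w. (norm (isum \<rho> \<psi> l w))\<^sup>2) \<and>
    expectation (\<lambda>w. (norm (isum \<rho> \<psi> l w))\<^sup>2) =
      (\<Sum>k<l. (\<rho> (Suc k) - \<rho> k) * expectation (\<lambda>w. (norm (\<psi> k w))\<^sup>2))"
    using \<psi> C
  proof (induction l)
    case 0
    then show ?case by simp
  next
    case (Suc l)
    have IH: "integrable P (\<lambda>w. (norm (isum \<rho> \<psi> l w))\<^sup>2)"
      "expectation (\<lambda>w. (norm (isum \<rho> \<psi> l w))\<^sup>2) =
      (\<Sum>k<l. (\<rho> (Suc k) - \<rho> k) * expectation (\<lambda>w. (norm (\<psi> k w))\<^sup>2))"
      using Suc by auto
    let ?S = "isum \<rho> \<psi> l" and ?D = "\<lambda>w. W (\<rho> (Suc l)) w - W (\<rho> l) w"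
    have st: "0 \<le> \<rho> l" "\<rho> l \<le> \<rho> (Suc l)"
      using \<rho>(1) monoD[OF \<rho>(2), of 0 l] monoD[OF \<rho>(2), of l "Suc l"] by simp_all
    have [measurable]: "?S \<in> borel_measurable (F (\<rho> l))"
      using Suc.prems by (intro isum_measurable \<rho>) auto
    have [measurable]: "\<psi> l \<in> borel_measurable (F (\<rho> l))"
      using Suc.prems by auto
    have C: "norm (\<psi> l w) \<le> C" if "w \<in> space P" for w
      using Suc.prems that by auto
    have "0 \<le> C"
      using not_empty C by (meson ex_in_conv norm_ge_zero order_trans)
    have G: "(\<lambda>w. transpose (\<psi> l w) *v ?S w) \<in> borel_measurable (F (\<rho> l))"
      by measurable
    have Gi: "integrable P (\<lambda>w. transpose (\<psi> l w) *v ?S w)"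
    proof (rule Bochner_Integration.integrable_bound)
      show "integrable P (\<lambda>w. C * (1 + (norm (?S w))\<^sup>2))"
        using IH by auto
      show "(\<lambda>w. transpose (\<psi> l w) *v ?S w) \<in> borel_measurable P"
        using G by (rule measurable_F_P)
      have "norm (transpose (\<psi> l w) *v ?S w) \<le> norm (C * (1 + (norm (?S w))\<^sup>2))" if "w \<in> space P" for w
      proof -
        have "norm (transpose (\<psi> l w) *v ?S w) \<le> norm (\<psi> l w) * norm (?S w)"
          using norm_matrix_vector_mult_le[of "transpose (\<psi> l w)" "?S w"] by simp
        also have "\<dots> \<le> C * (1 + (norm (?S w))\<^sup>2)"
        proof (rule mult_mono)
          \<comment> \<open>Only the square of the sum is known to be integrable, so its first power
            is dominated by the square.\<close>
          show "norm (?S w) \<le> 1 + (norm (?S w))\<^sup>2"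
            using zero_le_power2[of "norm (?S w) - 1/2"] by (simp add: power2_eq_square algebra_simps)
        qed (use C \<open>0 \<le> C\<close> that in auto)
        finally show ?thesis by simp
      qed
      then show "AE w in P. norm (transpose (\<psi> l w) *v ?S w) \<le> norm (C * (1 + (norm (?S w))\<^sup>2))"
        by (rule AE_I2)
    qed
    have Q: "(\<lambda>w. transpose (\<psi> l w) ** \<psi> l w) \<in> borel_measurable (F (\<rho> l))"
      by measurable
    have Qi: "integrable P (\<lambda>w. transpose (\<psi> l w) ** \<psi> l w)"
    proof (rule integrable_const_bound)
      have "norm (transpose (\<psi> l w) ** \<psi> l w) \<le> C * C" if "w \<in> space P" for w
      proof -
        have "norm (transpose (\<psi> l w) ** \<psi> l w) \<le> norm (transpose (\<psi> l w)) * norm (\<psi> l w)"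
          by (rule norm_matrix_mult_le)
        also have "\<dots> \<le> C * C"
          using C[OF that] \<open>0 \<le> C\<close> by (intro mult_mono) auto
        finally show ?thesis .
      qed
      then show "AE w in P. norm (transpose (\<psi> l w) ** \<psi> l w) \<le> C * C"
        by (rule AE_I2)
      show "(\<lambda>w. transpose (\<psi> l w) ** \<psi> l w) \<in> borel_measurable P"
        using Q by (rule measurable_F_P)
    qed
    note L = increment_linear[OF st G Gi] and QQ = increment_quadratic[OF st Q Qi]
    have e: "(norm (isum \<rho> \<psi> (Suc l) w))\<^sup>2 = (norm (?S w))\<^sup>2 + 2 * ((transpose (\<psi> l w) *v ?S w) \<bullet> ?D w)
        + ?D w \<bullet> ((transpose (\<psi> l w) ** \<psi> l w) *v ?D w)" for w
    proof -
      have "(norm (isum \<rho> \<psi> (Suc l) w))\<^sup>2 = (norm (?S w))\<^sup>2 + 2 * (?S w \<bullet> (\<psi> l w *v ?D w)) + (norm (\<psi> l w *v ?D w))\<^sup>2"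
        unfolding isum_Suc power2_norm_eq_inner by (simp add: inner_simps inner_commute)
      moreover have "?S w \<bullet> (\<psi> l w *v ?D w) = (transpose (\<psi> l w) *v ?S w) \<bullet> ?D w"
        by (simp only: dot_lmul_matrix[symmetric] transpose_matrix_vector)
      ultimately show ?thesis
        by (simp only: norm_square_pullback)
    qed
    have i: "integrable P (\<lambda>w. (norm (?S w))\<^sup>2 + 2 * ((transpose (\<psi> l w) *v ?S w) \<bullet> ?D w))"
      using IH(1) L(1) by auto
    have "integrable P (\<lambda>w. (norm (isum \<rho> \<psi> (Suc l) w))\<^sup>2)"
      unfolding e using i QQ(1) by auto
    moreover have "expectation (\<lambda>w. (norm (isum \<rho> \<psi> (Suc l) w))\<^sup>2) =
      expectation (\<lambda>w. (norm (?S w))\<^sup>2) + (\<rho> (Suc l) - \<rho> l) * expectation (\<lambda>w. (norm (\<psi> l w))\<^sup>2)"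
      unfolding e using i IH(1) L QQ by (simp add: trace_gram)
    ultimately show ?case
      unfolding IH(2) by simp
  qed
  then show "integrable P (\<lambda>w. (norm (isum \<rho> \<psi> l w))\<^sup>2)"
    "expectation (\<lambda>w. (norm (isum \<rho> \<psi> l w))\<^sup>2) =
      (\<Sum>k<l. (\<rho> (Suc k) - \<rho> k) * expectation (\<lambda>w. (norm (\<psi> k w))\<^sup>2))" by auto
qed

text \<open>An inequality in the style of Lenglart: the energy is required to be small only up to
  the index at which the sum is large, and is unrestricted afterwards. The constant \<open>C\<close>
  secures integrability, and the estimate is uniform in it; hence it can be applied along sequences
  of simple integrands without a common bound.\<close>

lemma isum_maximal:
  fixes \<psi> :: "nat \<Rightarrow> 'w \<Rightarrow> real ^ 'k ^ 'n"
  assumes \<rho>: "0 \<le> \<rho> 0" "mono \<rho>" and \<psi>: "\<And>k. k < K \<Longrightarrow> \<psi> k \<in> borel_measurable (F (\<rho> k))"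
    and C: "\<And>k w. k < K \<Longrightarrow> w \<in> space P \<Longrightarrow> norm (\<psi> k w) \<le> C"
    and \<delta>: "0 \<le> \<delta>" and \<epsilon>: "0 < \<epsilon>"
  shows "{w \<in> space P. \<exists>l\<le>K. (\<Sum>k<l. (\<rho> (Suc k) - \<rho> k) * (norm (\<psi> k w))\<^sup>2) \<le> \<delta> \<and> norm (isum \<rho> \<psi> l w) > \<epsilon>} \<in> sets P"
      (is "?A \<in> _")
    and "prob {w \<in> space P. \<exists>l\<le>K. (\<Sum>k<l. (\<rho> (Suc k) - \<rho> k) * (norm (\<psi> k w))\<^sup>2) \<le> \<delta> \<and> norm (isum \<rho> \<psi> l w) > \<epsilon>}
      \<le> \<delta> / \<epsilon>\<^sup>2"
proof -
  note \<rho>m = monoD[OF \<rho>(2)]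
  define a where "a k w = (\<rho> (Suc k) - \<rho> k) * (norm (\<psi> k w))\<^sup>2" for k w
  have a0: "0 \<le> a k w" for k w
    using \<rho>m[of k "Suc k"] by (simp add: a_def)
  define E where "E l w = (\<Sum>k<l. a k w)" for l w
  have Emono: "E k w \<le> E l w" if "k \<le> l" for k l w
    unfolding E_def using that a0 by (intro sum_mono2) auto
  have Sm: "isum \<rho> \<psi> i \<in> borel_measurable (F (\<rho> k))" if "i \<le> k" "i \<le> K" for i k
  proof (rule measurable_F_mono[OF isum_measurable[OF \<rho>]])
    show "\<rho> i \<le> \<rho> k" using \<rho>m[of i k] that by simp
  qed (use that \<psi> in auto)
  have Em: "E (Suc i) \<in> borel_measurable (F (\<rho> k))" if "i \<le> k" "i < K" for i k
  proof -
    have "\<psi> j \<in> borel_measurable (F (\<rho> k))" if "j < Suc i" for j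
      using \<rho>m[of j k] that \<open>i \<le> k\<close> \<open>i < K\<close> by (intro measurable_F_mono[OF \<psi>[of j]]) simp_all
    then show ?thesis
      unfolding E_def[abs_def] a_def by (intro borel_measurable_sum borel_measurable_times borel_measurable_power borel_measurable_norm) auto
  qed
  \<comment> \<open>The test at index k involves the energy including the coming cell and the sums
    up to k. All of this is known at \<open>\<rho> k\<close> because \<open>\<psi> k\<close> is, so
    the switched weights are adapted again.\<close>
  define c where "c k w \<longleftrightarrow> E (Suc k) w \<le> \<delta> \<and> (\<forall>i\<le>k. norm (isum \<rho> \<psi> i w) \<le> \<epsilon>)" for k w
  have cm: "{w \<in> space (F (\<rho> k)). c k w} \<in> sets (F (\<rho> k))" if "k < K" for k
  proof -
    have [measurable]: "E (Suc k) \<in> borel_measurable (F (\<rho> k))"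
      using Em that by auto
    have [measurable]: "isum \<rho> \<psi> i \<in> borel_measurable (F (\<rho> k))" if "i \<in> {..k}" for i
      using Sm[of i k] that \<open>k < K\<close> by auto
    have "{w \<in> space (F (\<rho> k)). E (Suc k) w \<le> \<delta> \<and> (\<forall>i\<in>{..k}. norm (isum \<rho> \<psi> i w) \<le> \<epsilon>)} \<in> sets (F (\<rho> k))"
      by measurable
    moreover have "{w \<in> space (F (\<rho> k)). c k w} =
        {w \<in> space (F (\<rho> k)). E (Suc k) w \<le> \<delta> \<and> (\<forall>i\<in>{..k}. norm (isum \<rho> \<psi> i w) \<le> \<epsilon>)}"
      unfolding c_def by blast
    ultimately show ?thesis
      by (simp only:)
  qed
  \<comment> \<open>Switching the weights off as soon as the energy or the sum is too large does not affect the first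
    large value of the sum, which therefore persists up to \<open>K\<close>; Chebyshev's inequality applies there.\<close>
  define \<psi>' where "\<psi>' k w = (if c k w then \<psi> k w else 0)" for k w
  have \<psi>'m: "\<psi>' k \<in> borel_measurable (F (\<rho> k))" if "k < K" for k
    unfolding \<psi>'_def by (rule measurable_If[OF \<psi>[OF that] measurable_const cm[OF that]]) simp
  have C0: "0 \<le> max C 0" by simp
  have \<psi>'C: "norm (\<psi>' k w) \<le> max C 0" if "k < K" "w \<in> space P" for k w
    using C[OF that] by (auto simp: \<psi>'_def)
  note iso = isum_isometry[OF \<rho>, of K \<psi>' "max C 0", OF \<psi>'m \<psi>'C]
  \<comment> \<open>If the last cell is switched on, its test bounds the full energy up to and
    including it; if it is switched off, it adds nothing.\<close>
  have energy: "(\<Sum>k<l. (\<rho> (Suc k) - \<rho> k) * (norm (\<psi>' k w))\<^sup>2) \<le> \<delta>" for l w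
  proof (induction l)
    case (Suc l)
    show ?case
    proof (cases "c l w")
      case True
      have "(\<Sum>k<Suc l. (\<rho> (Suc k) - \<rho> k) * (norm (\<psi>' k w))\<^sup>2) \<le> E (Suc l) w"
        unfolding E_def a_def \<psi>'_def by (intro sum_mono mult_left_mono) (simp_all add: \<rho>m)
      also have "\<dots> \<le> \<delta>" using True by (simp add: c_def)
      finally show ?thesis .
    next
      case False
      then show ?thesis using Suc by (simp add: \<psi>'_def)
    qed
  qed (use \<delta> in simp)
  have stop: "norm (isum \<rho> \<psi>' K w) > \<epsilon>" if w: "\<exists>l\<le>K. E l w \<le> \<delta> \<and> norm (isum \<rho> \<psi> l w) > \<epsilon>" for w
  proof -
    define l where "l = (LEAST l. l \<le> K \<and> E l w \<le> \<delta> \<and> norm (isum \<rho> \<psi> l w) > \<epsilon>)"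
    have l: "l \<le> K" "E l w \<le> \<delta>" "norm (isum \<rho> \<psi> l w) > \<epsilon>"
      using LeastI_ex[OF w] by (auto simp: l_def)
    have least: "norm (isum \<rho> \<psi> i w) \<le> \<epsilon>" if "i < l" for i
    proof (rule ccontr)
      assume "\<not> norm (isum \<rho> \<psi> i w) \<le> \<epsilon>"
      then have "l \<le> i"
        unfolding l_def using that l Emono[of i l w] by (intro Least_le) auto
      then show False using that by simp
    qed
    have c1: "c k w" if "k < l" for k
      using that l(2) Emono[of "Suc k" l w] least by (auto simp: c_def)
    have c2: "\<not> c k w" if "l \<le> k" for k
      using that l(3) by (auto simp: c_def not_le)
    have "isum \<rho> \<psi>' l w = isum \<rho> \<psi> l w"
      unfolding isum_def by (intro sum.cong) (auto simp: \<psi>'_def c1)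
    moreover have "isum \<rho> \<psi>' (l + i) w = isum \<rho> \<psi>' l w" for i
      by (induction i) (auto simp: isum_Suc \<psi>'_def c2)
    ultimately show ?thesis
      using l by (metis le_Suc_ex)
  qed
  have SmP: "isum \<rho> \<psi> l \<in> borel_measurable P" if "l \<le> K" for l
    using Sm[of l l] that measurable_F_P by auto
  have EmP: "E l \<in> borel_measurable P" if "l \<le> K" for l
  proof (cases l)
    case 0
    then show ?thesis by (simp add: E_def[abs_def])
  next
    case (Suc i)
    then show ?thesis using Em[of i i] that measurable_F_P by auto
  qed
  have A: "?A = {w \<in> space P. \<exists>l\<in>{..K}. E l w \<le> \<delta> \<and> norm (isum \<rho> \<psi> l w) > \<epsilon>}"
    by (auto simp: E_def a_def)
  show "?A \<in> sets P"
    unfolding A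
  proof (intro sets.sets_Collect_finite_Ex)
    fix l assume "l \<in> {..K}"
    then have [measurable]: "E l \<in> borel_measurable P" "isum \<rho> \<psi> l \<in> borel_measurable P"
      using SmP EmP by auto
    show "{w \<in> space P. E l w \<le> \<delta> \<and> norm (isum \<rho> \<psi> l w) > \<epsilon>} \<in> sets P"
      by measurable
  qed simp
  have "prob ?A \<le> prob {w \<in> space P. (norm (isum \<rho> \<psi>' K w))\<^sup>2 \<ge> \<epsilon>\<^sup>2}"
  proof (rule finite_measure_mono)
    show "?A \<subseteq> {w \<in> space P. (norm (isum \<rho> \<psi>' K w))\<^sup>2 \<ge> \<epsilon>\<^sup>2}"
    proof
      fix w assume "w \<in> ?A"
      then have "w \<in> space P" "norm (isum \<rho> \<psi>' K w) > \<epsilon>"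
        using stop[of w] unfolding A by auto
      then show "w \<in> {w \<in> space P. (norm (isum \<rho> \<psi>' K w))\<^sup>2 \<ge> \<epsilon>\<^sup>2}"
        using \<epsilon> by (auto intro!: power_mono)
    qed
    show "{w \<in> space P. (norm (isum \<rho> \<psi>' K w))\<^sup>2 \<ge> \<epsilon>\<^sup>2} \<in> sets P"
      using borel_measurable_integrable[OF iso(1)] by measurable
  qed
  also have "\<dots> \<le> expectation (\<lambda>w. (norm (isum \<rho> \<psi>' K w))\<^sup>2) / \<epsilon>\<^sup>2"
    using iso(1) \<epsilon> by (intro integral_Markov_inequality_measure[where A = "{}"]) auto
  also have "\<dots> \<le> \<delta> / \<epsilon>\<^sup>2"
  proof (rule divide_right_mono)
    have int: "integrable P (\<lambda>w. (\<rho> (Suc k) - \<rho> k) * (norm (\<psi>' k w))\<^sup>2)" if "k < K" for k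
    proof (rule integrable_const_bound)
      show "AE w in P. norm ((\<rho> (Suc k) - \<rho> k) * (norm (\<psi>' k w))\<^sup>2) \<le> (\<rho> (Suc k) - \<rho> k) * (max C 0)\<^sup>2"
        using \<psi>'C[OF that] \<rho>m[of k "Suc k"] by (intro AE_I2) (auto simp: abs_mult intro!: mult_left_mono power_mono)
      show "(\<lambda>w. (\<rho> (Suc k) - \<rho> k) * (norm (\<psi>' k w))\<^sup>2) \<in> borel_measurable P"
        using measurable_F_P[OF \<psi>'m[OF that]] by measurable
    qed
    have "expectation (\<lambda>w. (norm (isum \<rho> \<psi>' K w))\<^sup>2) = (\<Sum>k<K. expectation (\<lambda>w. (\<rho> (Suc k) - \<rho> k) * (norm (\<psi>' k w))\<^sup>2))"
      by (subst iso(2)) simp_all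
    also have "\<dots> = expectation (\<lambda>w. \<Sum>k<K. (\<rho> (Suc k) - \<rho> k) * (norm (\<psi>' k w))\<^sup>2)"
      using int by (intro Bochner_Integration.integral_sum[symmetric]) auto
    also have "\<dots> \<le> expectation (\<lambda>w. \<delta>)"
      using int energy by (intro integral_mono) auto
    finally show "expectation (\<lambda>w. (norm (isum \<rho> \<psi>' K w))\<^sup>2) \<le> \<delta>"
      by (simp add: prob_space)
  qed simp
  finally show "prob ?A \<le> \<delta> / \<epsilon>\<^sup>2" .
qed

end

section \<open>Simple integrands on a common grid\<close>

lemma finite_set_strict_enumeration:
  fixes Q :: "real set"
  assumes "finite Q" "Q \<noteq> {}"
  obtains \<rho> :: "nat \<Rightarrow> real" and K where "strict_mono \<rho>" "\<rho> ` {..K} = Q"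
proof -
  define xs where "xs = sorted_list_of_set Q"
  have xs: "set xs = Q" "sorted_wrt (<) xs" "xs \<noteq> []"
    using assms by (auto simp: xs_def)
  define K where "K = length xs - 1"
  have K: "length xs = Suc K"
    using xs(3) by (cases xs) (auto simp: K_def)
  \<comment> \<open>Beyond the finite set the enumeration continues with unit steps, which makes it
    strictly increasing on all of nat.\<close>
  define \<rho> where "\<rho> i = (if i \<le> K then xs ! i else xs ! K + real (i - K))" for i
  have "\<rho> n < \<rho> (Suc n)" for n
  proof -
    consider "n < K" | "n = K" | "n > K" by linarith
    then show ?thesis
    proof cases
      case 1
      then show ?thesis
        using sorted_wrt_nth_less[OF xs(2), of n "Suc n"] K by (simp add: \<rho>_def)
    qed (auto simp: \<rho>_def)
  qed
  then have "strict_mono \<rho>"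
    by (simp add: strict_mono_Suc_iff)
  moreover have "\<rho> ` {..K} = Q"
  proof -
    have "\<rho> ` {..K} = (\<lambda>i. xs ! i) ` {..<length xs}"
      unfolding K by (auto simp: \<rho>_def lessThan_Suc_atMost)
    then show ?thesis
      unfolding xs(1)[symmetric] by (auto simp: in_set_conv_nth)
  qed
  ultimately show ?thesis by (rule that)
qed

text \<open>The window from a to b stands for the cells of a fine grid within one interval of a
  coarser partition; the cut at l corresponds to integrating only up to the l-th grid point.\<close>

lemma sum_telescope_window:
  fixes f :: "nat \<Rightarrow> 'a::ab_group_add"
  assumes "a \<le> b"
  shows "(\<Sum>k<l. if a \<le> k \<and> k < b then f (Suc k) - f k else 0) = f (min l b) - f (min l a)"
  using assms by (induction l) (auto simp: min_def not_le le_Suc_eq)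

lemma simple_value_measurable [measurable]:
  "(\<lambda>s. simple_value m r \<phi> s w) \<in> borel_measurable borel"
  unfolding simple_value_def by measurable

text \<open>Identifies the energy integral of a step function with the sum that occurs in the
  maximal inequality. The cells are open on the left, so the right end represents the cell, and the
  time 0, which lies in no cell, is negligible.\<close>

lemma nn_integral_step_function:
  fixes g :: "real \<Rightarrow> 'a::{real_normed_vector, second_countable_topology}"
  assumes \<rho>: "strict_mono \<rho>" "\<rho> 0 = 0"
    and g [measurable]: "g \<in> borel_measurable borel"
    and step: "\<And>k s. s \<in> {\<rho> k<..\<rho> (Suc k)} \<Longrightarrow> g s = g (\<rho> (Suc k))"
  shows "(\<integral>\<^sup>+ s\<in>{0..\<rho> l}. ennreal ((norm (g s))\<^sup>2) \<partial>lborel) =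
    ennreal (\<Sum>k<l. (\<rho> (Suc k) - \<rho> k) * (norm (g (\<rho> (Suc k))))\<^sup>2)"
proof (induction l)
  case 0
  have "AE s in lborel. s \<noteq> (0::real)"
    by (rule AE_lborel_singleton)
  then have "AE s in lborel. ennreal ((norm (g s))\<^sup>2) * indicator {0..\<rho> 0} s = 0"
    unfolding \<rho>(2) by eventually_elim (auto split: split_indicator)
  then have "(\<integral>\<^sup>+ s\<in>{0..\<rho> 0}. ennreal ((norm (g s))\<^sup>2) \<partial>lborel) = (\<integral>\<^sup>+ (s::real). 0 \<partial>lborel)"
    by (rule nn_integral_cong_AE)
  then show ?case by simp
next
  case (Suc l)
  have le: "\<rho> l < \<rho> (Suc l)" "0 \<le> \<rho> l"
    using \<rho> strict_monoD[OF \<rho>(1), of l "Suc l"] strict_mono_less_eq[OF \<rho>(1), of 0 l] by auto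
  have "(\<integral>\<^sup>+ s\<in>{0..\<rho> (Suc l)}. ennreal ((norm (g s))\<^sup>2) \<partial>lborel) =
    (\<integral>\<^sup>+ s. ennreal ((norm (g s))\<^sup>2) * indicator {0..\<rho> l} s
      + ennreal ((norm (g s))\<^sup>2) * indicator {\<rho> l<..\<rho> (Suc l)} s \<partial>lborel)"
    using le by (intro nn_integral_cong) (auto split: split_indicator)
  also have "\<dots> = (\<integral>\<^sup>+ s\<in>{0..\<rho> l}. ennreal ((norm (g s))\<^sup>2) \<partial>lborel) +
     (\<integral>\<^sup>+ s\<in>{\<rho> l<..\<rho> (Suc l)}. ennreal ((norm (g s))\<^sup>2) \<partial>lborel)"
    by (intro nn_integral_add) auto
  also have "(\<integral>\<^sup>+ s\<in>{\<rho> l<..\<rho> (Suc l)}. ennreal ((norm (g s))\<^sup>2) \<partial>lborel) =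
     (\<integral>\<^sup>+ s. ennreal ((norm (g (\<rho> (Suc l))))\<^sup>2) * indicator {\<rho> l<..\<rho> (Suc l)} s \<partial>lborel)"
    by (intro nn_integral_cong) (auto split: split_indicator simp: step)
  also have "\<dots> = ennreal ((norm (g (\<rho> (Suc l))))\<^sup>2) * ennreal (\<rho> (Suc l) - \<rho> l)"
    using le by (subst nn_integral_cmult_indicator) auto
  also have "\<dots> = ennreal ((\<rho> (Suc l) - \<rho> l) * (norm (g (\<rho> (Suc l))))\<^sup>2)"
    using le by (subst ennreal_mult[symmetric]) (auto simp: mult.commute)
  also have "(\<integral>\<^sup>+ s\<in>{0..\<rho> l}. ennreal ((norm (g s))\<^sup>2) \<partial>lborel) +
      ennreal ((\<rho> (Suc l) - \<rho> l) * (norm (g (\<rho> (Suc l))))\<^sup>2) =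
      ennreal (\<Sum>k<Suc l. (\<rho> (Suc k) - \<rho> k) * (norm (g (\<rho> (Suc k))))\<^sup>2)"
  proof -
    have "0 \<le> \<rho> (Suc k) - \<rho> k" for k
      using strict_monoD[OF \<rho>(1), of k "Suc k"] by simp
    then show ?thesis
      unfolding Suc by (subst ennreal_plus[symmetric]) (auto intro!: sum_nonneg mult_nonneg_nonneg)
  qed
  finally show ?case .
qed

lemma nn_integral_norm_diff_le:
  fixes f g h :: "real \<Rightarrow> 'a::{real_normed_vector, second_countable_topology}"
  assumes [measurable]: "(\<lambda>s. norm (f s - h s)) \<in> borel_measurable (restrict_space lborel A)"
      "(\<lambda>s. norm (g s - h s)) \<in> borel_measurable (restrict_space lborel A)" "A \<in> sets borel"
  shows "(\<integral>\<^sup>+ s\<in>A. ennreal ((norm (f s - g s))\<^sup>2) \<partial>lborel) \<le>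
    2 * (\<integral>\<^sup>+ s\<in>A. ennreal ((norm (f s - h s))\<^sup>2) \<partial>lborel) + 2 * (\<integral>\<^sup>+ s\<in>A. ennreal ((norm (g s - h s))\<^sup>2) \<partial>lborel)"
proof -
  let ?M = "restrict_space lborel A"
  have e: "(\<integral>\<^sup>+ s\<in>A. u s \<partial>lborel) = (\<integral>\<^sup>+ s. u s \<partial>?M)" for u
    by (subst nn_integral_restrict_space) auto
  have "(\<integral>\<^sup>+ s. ennreal ((norm (f s - g s))\<^sup>2) \<partial>?M) \<le>
     (\<integral>\<^sup>+ s. 2 * ennreal ((norm (f s - h s))\<^sup>2) + 2 * ennreal ((norm (g s - h s))\<^sup>2) \<partial>?M)"
  proof (rule nn_integral_mono)
    fix s
    have "norm (f s - g s) \<le> norm (f s - h s) + norm (g s - h s)"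
      by (metis dist_norm dist_triangle2)
    then have "(norm (f s - g s))\<^sup>2 \<le> (norm (f s - h s) + norm (g s - h s))\<^sup>2"
      by (intro power_mono) auto
    also have "\<dots> \<le> 2 * (norm (f s - h s))\<^sup>2 + 2 * (norm (g s - h s))\<^sup>2"
      using zero_le_power2[of "norm (f s - h s) - norm (g s - h s)"] by (simp add: power2_eq_square algebra_simps)
    finally have "ennreal ((norm (f s - g s))\<^sup>2) \<le> ennreal (2 * (norm (f s - h s))\<^sup>2 + 2 * (norm (g s - h s))\<^sup>2)"
      by (rule ennreal_leI)
    also have "\<dots> = 2 * ennreal ((norm (f s - h s))\<^sup>2) + 2 * ennreal ((norm (g s - h s))\<^sup>2)"
      by (simp add: ennreal_plus ennreal_mult)
    finally show "ennreal ((norm (f s - g s))\<^sup>2) \<le> 2 * ennreal ((norm (f s - h s))\<^sup>2) + 2 * ennreal ((norm (g s - h s))\<^sup>2)" .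
  qed
  also have "\<dots> = 2 * (\<integral>\<^sup>+ s. ennreal ((norm (f s - h s))\<^sup>2) \<partial>?M) + 2 * (\<integral>\<^sup>+ s. ennreal ((norm (g s - h s))\<^sup>2) \<partial>?M)"
    by (subst nn_integral_add) (auto simp: nn_integral_cmult)
  finally show ?thesis unfolding e .
qed

context wiener_space
begin

lemma simple_value_bounded:
  assumes "simple_integrand F m r \<phi>"
  obtains C where "0 \<le> C" "\<And>s w. w \<in> space P \<Longrightarrow> norm (simple_value m r \<phi> s w) \<le> C"
proof -
  have "\<forall>j. \<exists>C\<ge>0. j < m \<longrightarrow> (\<forall>w\<in>space P. norm (\<phi> j w) \<le> C)"
  proof
    fix j
    show "\<exists>C\<ge>0. j < m \<longrightarrow> (\<forall>w\<in>space P. norm (\<phi> j w) \<le> C)"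
    proof (cases "j < m")
      case True
      then obtain C where "\<forall>w\<in>space P. norm (\<phi> j w) \<le> C"
        using assms by (auto simp: simple_integrand_def)
      then show ?thesis
        by (intro exI[of _ "max C 0"]) (auto simp: le_max_iff_disj)
    qed auto
  qed
  then obtain C where C: "\<And>j. 0 \<le> C j" "\<And>j w. j < m \<Longrightarrow> w \<in> space P \<Longrightarrow> norm (\<phi> j w) \<le> C j"
    by metis
  show ?thesis
  proof (rule that[of "\<Sum>j<m. C j"])
    fix s w assume w: "w \<in> space P"
    show "norm (simple_value m r \<phi> s w) \<le> (\<Sum>j<m. C j)"
      unfolding simple_value_def
      by (rule sum_norm_le) (use C w in \<open>auto split: split_indicator\<close>)
  qed (auto intro: sum_nonneg C)
qed

text \<open>On a common grid \<open>\<rho>\<close> the value on a cell \<open>(\<rho>\<^sub>k, \<rho>\<^sub>k\<^sub>+\<^sub>1]\<close> is read off at its right end, because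
  simple integrands are left-continuous step functions; that value is known at time \<open>\<rho>\<^sub>k\<close>.\<close>

lemma simple_refine:
  assumes si: "simple_integrand F m r \<phi>" and sm: "strict_mono \<rho>" and sub: "r ` {..m} \<subseteq> range \<rho>"
  shows "s \<in> {\<rho> k<..\<rho> (Suc k)} \<Longrightarrow> simple_value m r \<phi> s w = simple_value m r \<phi> (\<rho> (Suc k)) w"
    and "simple_value m r \<phi> (\<rho> (Suc k)) \<in> borel_measurable (F (\<rho> k))"
    and "simple_ito_integral W m r \<phi> (\<rho> l) w = isum \<rho> (\<lambda>k. simple_value m r \<phi> (\<rho> (Suc k))) l w"
proof -
  have "\<forall>j. \<exists>a. j \<le> m \<longrightarrow> r j = \<rho> a"
    using sub by auto
  \<comment> \<open>\<open>a j\<close> is the position of the partition point \<open>r j\<close> in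
    the fine grid, so interval number j consists of the cells k with \<open>a j \<le> k\<close> and
    \<open>k < a (Suc j)\<close>.\<close>
  then obtain a where a: "\<And>j. j \<le> m \<Longrightarrow> r j = \<rho> (a j)"
    by metis
  have mono: "mono r" using si by (simp add: simple_integrand_def)
  have aa: "a j \<le> a (Suc j)" if "j < m" for j
  proof -
    have "\<rho> (a j) \<le> \<rho> (a (Suc j))"
      using monoD[OF mono, of j "Suc j"] a[of j] a[of "Suc j"] that by simp
    then show ?thesis by (simp add: strict_mono_less_eq[OF sm])
  qed
  have mem: "s \<in> {r j<..r (Suc j)} \<longleftrightarrow> a j \<le> k \<and> k < a (Suc j)"
    if "s \<in> {\<rho> k<..\<rho> (Suc k)}" "j < m" for s k j
  proof -
    have "\<rho> (a j) < s \<longleftrightarrow> a j \<le> k"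
    proof
      assume "\<rho> (a j) < s"
      then have "\<rho> (a j) < \<rho> (Suc k)" using that by auto
      then show "a j \<le> k" by (simp add: strict_mono_less[OF sm])
    next
      assume "a j \<le> k"
      then have "\<rho> (a j) \<le> \<rho> k" by (simp add: strict_mono_less_eq[OF sm])
      then show "\<rho> (a j) < s" using that by auto
    qed
    moreover have "s \<le> \<rho> (a (Suc j)) \<longleftrightarrow> k < a (Suc j)"
    proof
      assume "s \<le> \<rho> (a (Suc j))"
      then have "\<rho> k < \<rho> (a (Suc j))" using that by auto
      then show "k < a (Suc j)" by (simp add: strict_mono_less[OF sm])
    next
      assume "k < a (Suc j)"
      then have "\<rho> (Suc k) \<le> \<rho> (a (Suc j))" by (simp add: strict_mono_less_eq[OF sm])
      then show "s \<le> \<rho> (a (Suc j))" using that by auto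
    qed
    ultimately show ?thesis using a that(2) by simp
  qed
  have top: "\<rho> (Suc k) \<in> {\<rho> k<..\<rho> (Suc k)}" for k
    using strict_monoD[OF sm, of k "Suc k"] by simp
  have val: "simple_value m r \<phi> s w = (\<Sum>j<m. if a j \<le> k \<and> k < a (Suc j) then \<phi> j w else 0)"
    if "s \<in> {\<rho> k<..\<rho> (Suc k)}" for s k w
    unfolding simple_value_def
  proof (rule sum.cong[OF refl])
    fix j assume "j \<in> {..<m}"
    then show "indicator {r j<..r (Suc j)} s *\<^sub>R \<phi> j w = (if a j \<le> k \<and> k < a (Suc j) then \<phi> j w else 0)"
      using mem[OF that, of j] by (simp add: indicator_def del: greaterThanAtMost_iff)
  qed
  show "simple_value m r \<phi> s w = simple_value m r \<phi> (\<rho> (Suc k)) w" if "s \<in> {\<rho> k<..\<rho> (Suc k)}"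
    using val[OF that] val[OF top] by simp
  show "simple_value m r \<phi> (\<rho> (Suc k)) \<in> borel_measurable (F (\<rho> k))"
  proof -
    have "(\<lambda>w. if a j \<le> k \<and> k < a (Suc j) then \<phi> j w else 0) \<in> borel_measurable (F (\<rho> k))" if "j < m" for j
    proof (cases "a j \<le> k")
      case True
      have "\<phi> j \<in> borel_measurable (F (r j))"
        using si that by (simp add: simple_integrand_def)
      moreover have "r j \<le> \<rho> k"
        using a[of j] that True by (simp add: strict_mono_less_eq[OF sm])
      ultimately have "\<phi> j \<in> borel_measurable (F (\<rho> k))"
        by (rule measurable_F_mono)
      then show ?thesis by simp
    qed simp
    then show ?thesis
      unfolding val[OF top, abs_def] by (intro borel_measurable_sum) auto
  qed
  let ?D = "\<lambda>k. W (\<rho> (Suc k)) w - W (\<rho> k) w"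
  have "isum \<rho> (\<lambda>k. simple_value m r \<phi> (\<rho> (Suc k))) l w
      = (\<Sum>k<l. \<Sum>j<m. (if a j \<le> k \<and> k < a (Suc j) then \<phi> j w else 0) *v ?D k)"
    unfolding isum_def val[OF top]
    by (intro sum.cong refl bounded_bilinear.sum_left[OF bounded_bilinear_matrix_vector_mult])
  also have "\<dots> = (\<Sum>j<m. \<Sum>k<l. \<phi> j w *v (if a j \<le> k \<and> k < a (Suc j) then ?D k else 0))"
    by (subst sum.swap) (intro sum.cong refl, simp)
  also have "\<dots> = (\<Sum>j<m. \<phi> j w *v (\<Sum>k<l. if a j \<le> k \<and> k < a (Suc j) then ?D k else 0))"
    by (intro sum.cong refl bounded_bilinear.sum_right[OF bounded_bilinear_matrix_vector_mult, symmetric])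
  also have "\<dots> = (\<Sum>j<m. \<phi> j w *v (W (\<rho> (min l (a (Suc j)))) w - W (\<rho> (min l (a j))) w))"
  proof (intro sum.cong refl)
    fix j assume "j \<in> {..<m}"
    then show "\<phi> j w *v (\<Sum>k<l. if a j \<le> k \<and> k < a (Suc j) then ?D k else 0) =
      \<phi> j w *v (W (\<rho> (min l (a (Suc j)))) w - W (\<rho> (min l (a j))) w)"
      using sum_telescope_window[OF aa[of j], of "\<lambda>k. W (\<rho> k) w" l] by simp
  qed
  also have "\<dots> = simple_ito_integral W m r \<phi> (\<rho> l) w"
  proof -
    have "\<rho> (min l i) = min (\<rho> l) (\<rho> i)" for i
      by (simp add: min_def strict_mono_less_eq[OF sm])
    then show ?thesis
      unfolding simple_ito_integral_def using a by (intro sum.cong) auto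
  qed
  finally show "simple_ito_integral W m r \<phi> (\<rho> l) w = isum \<rho> (\<lambda>k. simple_value m r \<phi> (\<rho> (Suc k))) l w" ..
qed

text \<open>On a grid that contains both partitions and \<open>Q\<close>, the difference of the two
  integrals is a single discrete stochastic integral. The set \<open>A\<close> is obtained before
  the time t is chosen, so it serves all times in \<open>Q\<close> at once; the uniform closeness of
  the Euler scheme rests on this order.\<close>

lemma simple_maximal:
  fixes \<phi> \<phi>' :: "nat \<Rightarrow> 'w \<Rightarrow> real ^ 'k ^ 'n"
  assumes si: "simple_integrand F m r \<phi>" and si': "simple_integrand F m' r' \<phi>'"
    and Q: "finite Q" "Q \<subseteq> {0..}" and \<delta>: "0 \<le> \<delta>" and \<epsilon>: "0 < \<epsilon>"
  obtains A where "A \<in> sets P" "prob A \<le> \<delta> / \<epsilon>\<^sup>2"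
    "\<And>w t. w \<in> space P \<Longrightarrow> t \<in> Q \<Longrightarrow>
       (\<integral>\<^sup>+ s\<in>{0..t}. ennreal ((norm (simple_value m r \<phi> s w - simple_value m' r' \<phi>' s w))\<^sup>2) \<partial>lborel) \<le> ennreal \<delta> \<Longrightarrow>
       norm (simple_ito_integral W m r \<phi> t w - simple_ito_integral W m' r' \<phi>' t w) > \<epsilon> \<Longrightarrow> w \<in> A"
proof -
  \<comment> \<open>The point 0 is added so that the grid starts at 0 and the discrete energy is the
    integral over all of \<open>{0..t}\<close>.\<close>
  define R where "R = {0} \<union> Q \<union> r ` {..m} \<union> r' ` {..m'}"
  have rnn: "0 \<le> r j" "0 \<le> r' j" for j
    using si si' monoD[of r 0 j] monoD[of r' 0 j] by (auto simp: simple_integrand_def)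
  have R: "finite R" "R \<noteq> {}" "R \<subseteq> {0..}"
    using Q rnn by (auto simp: R_def)
  obtain \<rho> :: "nat \<Rightarrow> real" and K where sm: "strict_mono \<rho>" and \<rho>R: "\<rho> ` {..K} = R"
    by (rule finite_set_strict_enumeration[OF R(1,2)]) blast
  have \<rho>0: "\<rho> 0 = 0"
  proof -
    have "0 \<in> \<rho> ` {..K}" by (simp add: \<rho>R R_def)
    then obtain i where "\<rho> i = 0" by auto
    then have "\<rho> 0 \<le> 0" using strict_mono_less_eq[OF sm, of 0 i] by simp
    moreover have "\<rho> 0 \<in> R" using \<rho>R by auto
    ultimately show ?thesis using R(3) by auto
  qed
  have sub: "r ` {..m} \<subseteq> range \<rho>" "r' ` {..m'} \<subseteq> range \<rho>"
  proof -
    have "R \<subseteq> range \<rho>" using \<rho>R by auto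
    then show "r ` {..m} \<subseteq> range \<rho>" "r' ` {..m'} \<subseteq> range \<rho>"
      unfolding R_def by blast+
  qed
  note rf = simple_refine[OF si sm sub(1)] and rf' = simple_refine[OF si' sm sub(2)]
  let ?v = "\<lambda>s w. simple_value m r \<phi> s w - simple_value m' r' \<phi>' s w"
  define \<psi> where "\<psi> k w = ?v (\<rho> (Suc k)) w" for k w
  have \<psi>m: "\<psi> k \<in> borel_measurable (F (\<rho> k))" for k
    unfolding \<psi>_def[abs_def] using rf(2)[of k] rf'(2)[of k] by (rule borel_measurable_diff)
  obtain C where C: "0 \<le> C" "\<And>s w. w \<in> space P \<Longrightarrow> norm (simple_value m r \<phi> s w) \<le> C"
    using simple_value_bounded[OF si] by blast
  obtain C' where C': "0 \<le> C'" "\<And>s w. w \<in> space P \<Longrightarrow> norm (simple_value m' r' \<phi>' s w) \<le> C'"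
    using simple_value_bounded[OF si'] by blast
  have \<psi>C: "norm (\<psi> k w) \<le> C + C'" if "w \<in> space P" for k w
    unfolding \<psi>_def using C(2)[OF that] C'(2)[OF that] by (meson add_mono norm_triangle_ineq4 order_trans)
  have \<rho>: "0 \<le> \<rho> 0" "mono \<rho>"
    using \<rho>0 sm by (auto simp: strict_mono_mono)
  note mx = isum_maximal[OF \<rho>, of K \<psi> "C + C'" \<delta> \<epsilon>, OF \<psi>m \<psi>C \<delta> \<epsilon>]
  show ?thesis
  proof (rule that)
    show "{w \<in> space P. \<exists>l\<le>K. (\<Sum>k<l. (\<rho> (Suc k) - \<rho> k) * (norm (\<psi> k w))\<^sup>2) \<le> \<delta> \<and> norm (isum \<rho> \<psi> l w) > \<epsilon>} \<in> sets P"
      (is "?A \<in> _") by (rule mx(1))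
    show "prob ?A \<le> \<delta> / \<epsilon>\<^sup>2" by (rule mx(2))
    fix w t assume w: "w \<in> space P" and t: "t \<in> Q"
      and e: "(\<integral>\<^sup>+ s\<in>{0..t}. ennreal ((norm (?v s w))\<^sup>2) \<partial>lborel) \<le> ennreal \<delta>"
      and big: "norm (simple_ito_integral W m r \<phi> t w - simple_ito_integral W m' r' \<phi>' t w) > \<epsilon>"
    have "t \<in> \<rho> ` {..K}" using t by (simp add: \<rho>R R_def)
    then obtain l where l: "l \<le> K" "t = \<rho> l" by auto
    have "(\<integral>\<^sup>+ s\<in>{0..\<rho> l}. ennreal ((norm (?v s w))\<^sup>2) \<partial>lborel) =
      ennreal (\<Sum>k<l. (\<rho> (Suc k) - \<rho> k) * (norm (?v (\<rho> (Suc k)) w))\<^sup>2)"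
    proof (rule nn_integral_step_function[OF sm \<rho>0])
      show "(\<lambda>s. ?v s w) \<in> borel_measurable borel"
        by measurable
      show "?v s w = ?v (\<rho> (Suc k)) w" if "s \<in> {\<rho> k<..\<rho> (Suc k)}" for k s
        using rf(1)[OF that] rf'(1)[OF that] by simp
    qed
    then have "(\<Sum>k<l. (\<rho> (Suc k) - \<rho> k) * (norm (\<psi> k w))\<^sup>2) \<le> \<delta>"
      using e l \<delta> by (simp add: \<psi>_def)
    moreover have "norm (isum \<rho> \<psi> l w) > \<epsilon>"
    proof -
      have "isum \<rho> \<psi> l w = simple_ito_integral W m r \<phi> t w - simple_ito_integral W m' r' \<phi>' t w"
        unfolding l(2) rf(3) rf'(3) isum_def \<psi>_def
        by (simp add: sum_subtractf matrix_vector_mult_diff_rdistrib)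
      then show ?thesis using big by simp
    qed
    ultimately show "w \<in> ?A" using w l(1) by auto
  qed
qed

end

section \<open>Ito integrals and simple integrands\<close>

text \<open>The interval is made the whole space instead of being put into an indicator: the measure
  is finite, and processes have to be jointly measurable only over the times that matter.\<close>

definition clock :: "real \<Rightarrow> real measure" where
  "clock T = restrict_space lborel {0..T}"

lemma space_clock [simp]: "space (clock T) = {0..T}"
  by (simp add: clock_def space_restrict_space)

lemma finite_measure_clock: "finite_measure (clock T)"
  by (rule finite_measureI) (simp add: clock_def emeasure_restrict_space space_restrict_space emeasure_lborel_Icc_eq)

lemma sets_clock [measurable_cong]: "sets (clock T) = sets (restrict_space borel {0..T})"
  unfolding clock_def by (rule sets_restrict_space_cong) simp

lemma nn_integral_clock: "(\<integral>\<^sup>+ s. f s \<partial>clock T) = (\<integral>\<^sup>+ s\<in>{0..T}. f s \<partial>lborel)"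
  unfolding clock_def by (subst nn_integral_restrict_space) auto

text \<open>Extended-valued, because an integrand with an Ito integral is approximated only in
  probability, and its square need not be integrable in time along every single path.\<close>

definition energy ::
  "real \<Rightarrow> (real \<Rightarrow> 'w \<Rightarrow> 'a::real_normed_vector) \<Rightarrow> (real \<Rightarrow> 'w \<Rightarrow> 'a) \<Rightarrow> 'w \<Rightarrow> ennreal" where
  "energy t G H w = (\<integral>\<^sup>+ s\<in>{0..t}. ennreal ((norm (G s w - H s w))\<^sup>2) \<partial>lborel)"

lemma energy_commute: "energy t G H w = energy t H G w"
  unfolding energy_def by (simp add: norm_minus_commute)

lemma energy_mono: "s \<le> t \<Longrightarrow> energy s G H w \<le> energy t G H w"
  unfolding energy_def by (intro nn_integral_mono) (auto split: split_indicator)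

lemma energy_measurable:
  fixes G H :: "real \<Rightarrow> 'w \<Rightarrow> 'a::{real_normed_vector, second_countable_topology}"
  assumes [measurable]: "(\<lambda>x. G (fst x) (snd x)) \<in> borel_measurable (clock t \<Otimes>\<^sub>M P)"
    "(\<lambda>x. H (fst x) (snd x)) \<in> borel_measurable (clock t \<Otimes>\<^sub>M P)"
  shows "energy t G H \<in> borel_measurable P"
proof -
  interpret c: finite_measure "clock t" by (rule finite_measure_clock)
  have "(\<lambda>x. ennreal ((norm (G (fst x) (snd x) - H (fst x) (snd x)))\<^sup>2)) \<in> borel_measurable (clock t \<Otimes>\<^sub>M P)"
    by measurable
  from measurable_pair_swap[OF this]
  have "(\<lambda>(w, s). ennreal ((norm (G s w - H s w))\<^sup>2)) \<in> borel_measurable (P \<Otimes>\<^sub>M clock t)"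
    by (simp add: split_def)
  then show ?thesis
    unfolding energy_def[abs_def] nn_integral_clock[symmetric] by (rule c.borel_measurable_nn_integral)
qed

lemma energy_triangle:
  fixes G H K :: "real \<Rightarrow> 'w \<Rightarrow> 'a::{real_normed_vector, second_countable_topology}"
  assumes G: "(\<lambda>x. G (fst x) (snd x)) \<in> borel_measurable (clock t \<Otimes>\<^sub>M P)"
    and H: "(\<lambda>x. H (fst x) (snd x)) \<in> borel_measurable (clock t \<Otimes>\<^sub>M P)"
    and K: "(\<lambda>x. K (fst x) (snd x)) \<in> borel_measurable (clock t \<Otimes>\<^sub>M P)"
    and w: "w \<in> space P"
  shows "energy t G H w \<le> 2 * energy t G K w + 2 * energy t H K w"
proof -
  have sec: "(\<lambda>s. L s w) \<in> borel_measurable (restrict_space lborel {0..t})"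
    if "(\<lambda>x. L (fst x) (snd x)) \<in> borel_measurable (clock t \<Otimes>\<^sub>M P)" for L :: "real \<Rightarrow> 'w \<Rightarrow> 'a"
    using measurable_compose[OF measurable_Pair2'[OF w] that] by (simp add: clock_def)
  have [measurable]: "(\<lambda>s. G s w) \<in> borel_measurable (restrict_space lborel {0..t})"
    "(\<lambda>s. H s w) \<in> borel_measurable (restrict_space lborel {0..t})"
    "(\<lambda>s. K s w) \<in> borel_measurable (restrict_space lborel {0..t})"
    using sec G H K by auto
  show ?thesis
    unfolding energy_def by (rule nn_integral_norm_diff_le) measurable
qed

context wiener_space
begin

lemma prog_measurable_clock:
  fixes H :: "real \<Rightarrow> 'w \<Rightarrow> 'a::topological_space"
  assumes "prog_measurable F H" "0 \<le> T"
  shows "(\<lambda>x. H (fst x) (snd x)) \<in> borel_measurable (clock T \<Otimes>\<^sub>M P)"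
proof -
  have H: "(\<lambda>(s, w). H s w) \<in> borel_measurable (restrict_space borel {0..T} \<Otimes>\<^sub>M F T)"
    using assms by (simp add: prog_measurable_def)
  have id: "(\<lambda>w. w) \<in> measurable P (F T)"
    using sets_F_subset[of T] sets.sets_into_space[of _ "F T"] by (intro measurableI) (auto simp: Int_absorb1 subset_iff)
  have f: "fst \<in> measurable (clock T \<Otimes>\<^sub>M P) (restrict_space borel {0..T})"
    using measurable_fst[of "clock T" P] measurable_cong_sets[OF refl sets_clock, of "clock T \<Otimes>\<^sub>M P" T] by simp
  have "(\<lambda>x. (fst x, snd x)) \<in> measurable (clock T \<Otimes>\<^sub>M P) (restrict_space borel {0..T} \<Otimes>\<^sub>M F T)"
    by (rule measurable_Pair[OF f measurable_compose[OF measurable_snd id]])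
  from measurable_compose[OF this H] show ?thesis
    by (simp add: split_def)
qed

lemma simple_value_clock:
  assumes "simple_integrand F m r \<phi>"
  shows "(\<lambda>x. simple_value m r \<phi> (fst x) (snd x)) \<in> borel_measurable (clock T \<Otimes>\<^sub>M P)"
proof -
  have f: "fst \<in> borel_measurable (clock T \<Otimes>\<^sub>M P)"
    using measurable_compose[OF measurable_fst[of "clock T" P], of "\<lambda>x. x" borel]
    by (simp add: clock_def measurable_restrict_space1)
  have "(\<lambda>x. indicator {r j<..r (Suc j)} (fst x) *\<^sub>R \<phi> j (snd x)) \<in> borel_measurable (clock T \<Otimes>\<^sub>M P)" if "j < m" for j
  proof -
    have "\<phi> j \<in> borel_measurable P"
      using assms that measurable_F_P by (auto simp: simple_integrand_def)
    then have 1: "(\<lambda>x. \<phi> j (snd x)) \<in> borel_measurable (clock T \<Otimes>\<^sub>M P)"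
      by (rule measurable_compose[OF measurable_snd])
    have 2: "(\<lambda>x. indicator {r j<..r (Suc j)} (fst x) :: real) \<in> borel_measurable (clock T \<Otimes>\<^sub>M P)"
      by (rule measurable_compose[OF f]) measurable
    show ?thesis
      by (rule borel_measurable_scaleR[OF 2 1])
  qed
  then show ?thesis
    unfolding simple_value_def by (intro borel_measurable_sum) auto
qed

lemma simple_ito_integral_measurable:
  assumes si: "simple_integrand F m r \<phi>" and t: "0 \<le> t"
  shows "simple_ito_integral W m r \<phi> t \<in> borel_measurable P"
proof -
  have r: "0 \<le> r j" for j
    using si monoD[of r 0 j] by (auto simp: simple_integrand_def)
  have "(\<lambda>w. \<phi> j w *v (W (min t (r (Suc j))) w - W (min t (r j)) w)) \<in> borel_measurable P" if "j < m" for j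
  proof -
    have [measurable]: "\<phi> j \<in> borel_measurable P"
      using si that measurable_F_P by (auto simp: simple_integrand_def)
    have [measurable]: "W (min t (r i)) \<in> borel_measurable P" for i
      using r t by (intro W_measurable_P) simp
    show ?thesis by measurable
  qed
  then show ?thesis
    unfolding simple_ito_integral_def[abs_def] by (intro borel_measurable_sum) auto
qed

lemma ito_integral_approx:
  fixes H :: "real \<Rightarrow> 'w \<Rightarrow> real ^ 'k ^ 'n"
  assumes "has_ito_integral P F W H t J"
  obtains m r and \<phi> :: "nat \<Rightarrow> nat \<Rightarrow> 'w \<Rightarrow> real ^ 'k ^ 'n" where
    "\<And>i. simple_integrand F (m i) (r i) (\<phi> i)"
    "\<And>\<epsilon>. 0 < \<epsilon> \<Longrightarrow> (\<lambda>i. prob {w \<in> space P. energy t H (simple_value (m i) (r i) (\<phi> i)) w > ennreal \<epsilon>}) \<longlonglongrightarrow> 0"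
    "\<And>\<epsilon>. 0 < \<epsilon> \<Longrightarrow> (\<lambda>i. prob {w \<in> space P. norm (simple_ito_integral W (m i) (r i) (\<phi> i) t w - J w) > \<epsilon>}) \<longlonglongrightarrow> 0"
  using assms unfolding has_ito_integral_def energy_def dist_norm by blast

text \<open>The integral at t comes with its own approximating sequence. The sequence belonging to
  \<open>T\<close> is compared with it on \<open>{0..t}\<close>: both are close to \<open>H\<close>
  there in energy, so their integrals at t are close by the maximal inequality. Hence the sequence
  for \<open>T\<close> also approximates \<open>J t\<close>.\<close>

lemma ito_integral_simultaneous_approx:
  fixes H :: "real \<Rightarrow> 'w \<Rightarrow> real ^ 'k ^ 'n"
  assumes T: "0 \<le> T" and HT: "has_ito_integral P F W H T JT"
    and Q: "finite Q" "Q \<subseteq> {0..T}" and J: "\<And>t. t \<in> Q \<Longrightarrow> has_ito_integral P F W H t (J t)"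
    and pos: "0 < \<epsilon>" "0 < \<delta>" "0 < \<eta>"
  obtains m r \<phi> B where "simple_integrand F m r (\<phi> :: nat \<Rightarrow> 'w \<Rightarrow> real ^ 'k ^ 'n)" "B \<in> sets P" "prob B \<le> \<eta>"
    "\<And>w. w \<in> space P - B \<Longrightarrow> energy T H (simple_value m r \<phi>) w \<le> ennreal \<delta>"
    "\<And>w t. w \<in> space P - B \<Longrightarrow> t \<in> Q \<Longrightarrow> norm (simple_ito_integral W m r \<phi> t w - J t w) \<le> \<epsilon>"
proof -
  obtain m r and \<phi> :: "nat \<Rightarrow> nat \<Rightarrow> 'w \<Rightarrow> real ^ 'k ^ 'n" where si: "\<And>i. simple_integrand F (m i) (r i) (\<phi> i)"
    and en: "\<And>\<epsilon>. 0 < \<epsilon> \<Longrightarrow> (\<lambda>i. prob {w \<in> space P. energy T H (simple_value (m i) (r i) (\<phi> i)) w > ennreal \<epsilon>}) \<longlonglongrightarrow> 0"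
    by (rule ito_integral_approx[OF HT]) blast
  have Hm: "(\<lambda>x. H (fst x) (snd x)) \<in> borel_measurable (clock t \<Otimes>\<^sub>M P)" if "0 \<le> t" for t
    using HT that by (intro prog_measurable_clock) (auto simp: has_ito_integral_def)
  have Em: "{w \<in> space P. energy t H (simple_value m r \<phi>) w > ennreal \<epsilon>} \<in> sets P"
    if "simple_integrand F m r \<phi>" "0 \<le> t" for t m r and \<phi> :: "nat \<Rightarrow> 'w \<Rightarrow> real ^ 'k ^ 'n" and \<epsilon>
    using energy_measurable[OF Hm simple_value_clock] that by measurable
  \<comment> \<open>One share of \<eta> for each time in \<open>Q\<close> and one for the
    energy.\<close>
  define \<eta>' where "\<eta>' = \<eta> / (real (card Q) + 1)"
  have \<eta>': "0 < \<eta>'" using pos by (simp add: \<eta>'_def)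
  have Jm: "J t \<in> borel_measurable P" if "t \<in> Q" for t
    using J[OF that] by (simp add: has_ito_integral_def)
  have Bm: "{w \<in> space P. norm (simple_ito_integral W m r \<phi> t w - J t w) > \<epsilon>} \<in> sets P"
    if "simple_integrand F m r \<phi>" "t \<in> Q" for t m r and \<phi> :: "nat \<Rightarrow> 'w \<Rightarrow> real ^ 'k ^ 'n" and \<epsilon>
  proof -
    have [measurable]: "simple_ito_integral W m r \<phi> t \<in> borel_measurable P"
      using that Q by (intro simple_ito_integral_measurable) auto
    have [measurable]: "J t \<in> borel_measurable P"
      using Jm that by auto
    show ?thesis by measurable
  qed
  have "eventually (\<lambda>i. prob {w \<in> space P. norm (simple_ito_integral W (m i) (r i) (\<phi> i) t w - J t w) > \<epsilon>} \<le> \<eta>') sequentially"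
    if t: "t \<in> Q" for t
  proof -
    have t0: "0 \<le> t" "t \<le> T" using Q t by auto
    obtain m' r' and \<phi>' :: "nat \<Rightarrow> nat \<Rightarrow> 'w \<Rightarrow> real ^ 'k ^ 'n" where si': "\<And>i. simple_integrand F (m' i) (r' i) (\<phi>' i)"
      and en': "\<And>\<epsilon>. 0 < \<epsilon> \<Longrightarrow> (\<lambda>i. prob {w \<in> space P. energy t H (simple_value (m' i) (r' i) (\<phi>' i)) w > ennreal \<epsilon>}) \<longlonglongrightarrow> 0"
      and it': "\<And>\<epsilon>. 0 < \<epsilon> \<Longrightarrow> (\<lambda>i. prob {w \<in> space P. norm (simple_ito_integral W (m' i) (r' i) (\<phi>' i) t w - J t w) > \<epsilon>}) \<longlonglongrightarrow> 0"
      by (rule ito_integral_approx[OF J[OF t]]) blast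
    \<comment> \<open>Two energies of at most \<open>\<delta>'\<close> combine to at most
      \<open>4 * \<delta>'\<close>; the maximal inequality with threshold
      \<open>\<epsilon> / 2\<close> then costs \<open>16 * \<delta>' / \<epsilon>\<^sup>2\<close>,
      that is \<open>\<eta>' / 4\<close>.\<close>
    define \<delta>' where "\<delta>' = \<eta>' * \<epsilon>\<^sup>2 / 64"
    have \<delta>': "0 < \<delta>'" using \<eta>' pos by (simp add: \<delta>'_def)
    let ?a = "\<lambda>i. {w \<in> space P. energy T H (simple_value (m i) (r i) (\<phi> i)) w > ennreal \<delta>'}"
    let ?b = "\<lambda>i. {w \<in> space P. energy t H (simple_value (m' i) (r' i) (\<phi>' i)) w > ennreal \<delta>'}"
    let ?c = "\<lambda>i. {w \<in> space P. norm (simple_ito_integral W (m' i) (r' i) (\<phi>' i) t w - J t w) > \<epsilon> / 2}"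
    have \<eta>4: "0 < \<eta>' / 4" and e2: "0 < \<epsilon> / 2" using \<eta>' pos by auto
    have "eventually (\<lambda>i. prob (?a i) < \<eta>' / 4 \<and> prob (?b i) < \<eta>' / 4 \<and> prob (?c i) < \<eta>' / 4) sequentially"
      using order_tendstoD(2)[OF en[OF \<delta>'] \<eta>4] order_tendstoD(2)[OF en'[OF \<delta>'] \<eta>4] order_tendstoD(2)[OF it'[OF e2] \<eta>4]
      by eventually_elim auto
    then show ?thesis
    proof eventually_elim
      case (elim i)
      have "0 \<le> 4 * \<delta>'" using \<delta>' by simp
      obtain A where A: "A \<in> sets P" "prob A \<le> 4 * \<delta>' / (\<epsilon> / 2)\<^sup>2"
        "\<And>w u. w \<in> space P \<Longrightarrow> u \<in> {t} \<Longrightarrow>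
          (\<integral>\<^sup>+ s\<in>{0..u}. ennreal ((norm (simple_value (m i) (r i) (\<phi> i) s w - simple_value (m' i) (r' i) (\<phi>' i) s w))\<^sup>2) \<partial>lborel) \<le> ennreal (4 * \<delta>') \<Longrightarrow>
          norm (simple_ito_integral W (m i) (r i) (\<phi> i) u w - simple_ito_integral W (m' i) (r' i) (\<phi>' i) u w) > \<epsilon> / 2 \<Longrightarrow> w \<in> A"
        by (rule simple_maximal[OF si[of i] si'[of i], of "{t}" "4 * \<delta>'" "\<epsilon> / 2"]) (use t0 \<delta>' pos in auto)
      have sub: "{w \<in> space P. norm (simple_ito_integral W (m i) (r i) (\<phi> i) t w - J t w) > \<epsilon>} \<subseteq> (?a i \<union> ?b i) \<union> (?c i \<union> A)"
      proof
        fix w assume "w \<in> {w \<in> space P. norm (simple_ito_integral W (m i) (r i) (\<phi> i) t w - J t w) > \<epsilon>}"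
        then have w: "w \<in> space P" and big: "norm (simple_ito_integral W (m i) (r i) (\<phi> i) t w - J t w) > \<epsilon>"
          by auto
        show "w \<in> (?a i \<union> ?b i) \<union> (?c i \<union> A)"
        proof (rule ccontr)
          assume n: "w \<notin> (?a i \<union> ?b i) \<union> (?c i \<union> A)"
          have 1: "energy T H (simple_value (m i) (r i) (\<phi> i)) w \<le> ennreal \<delta>'"
            and 2: "energy t H (simple_value (m' i) (r' i) (\<phi>' i)) w \<le> ennreal \<delta>'"
            and 3: "norm (simple_ito_integral W (m' i) (r' i) (\<phi>' i) t w - J t w) \<le> \<epsilon> / 2"
            using n w by auto
          have "energy t (simple_value (m i) (r i) (\<phi> i)) (simple_value (m' i) (r' i) (\<phi>' i)) w \<le>
            2 * energy t (simple_value (m i) (r i) (\<phi> i)) H w + 2 * energy t (simple_value (m' i) (r' i) (\<phi>' i)) H w"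
            by (rule energy_triangle[OF simple_value_clock[OF si] simple_value_clock[OF si'] Hm[OF t0(1)] w])
          also have "\<dots> \<le> 2 * ennreal \<delta>' + 2 * ennreal \<delta>'"
            using 1 2 energy_mono[OF t0(2), of H "simple_value (m i) (r i) (\<phi> i)" w]
            by (intro add_mono mult_left_mono) (auto simp: energy_commute[of t _ H])
          also have "\<dots> = ennreal (4 * \<delta>')"
            using \<delta>' by (simp add: ennreal_plus[symmetric] flip: ennreal_numeral ennreal_mult')
          finally have en: "energy t (simple_value (m i) (r i) (\<phi> i)) (simple_value (m' i) (r' i) (\<phi>' i)) w \<le> ennreal (4 * \<delta>')" .
          have "w \<notin> A" using n by blast
          then have "norm (simple_ito_integral W (m i) (r i) (\<phi> i) t w - simple_ito_integral W (m' i) (r' i) (\<phi>' i) t w) \<le> \<epsilon> / 2"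
            using A(3)[OF w singletonI en[unfolded energy_def]] by (meson not_le)
          with 3 have "norm (simple_ito_integral W (m i) (r i) (\<phi> i) t w - J t w) \<le> \<epsilon> / 2 + \<epsilon> / 2"
            by (intro norm_diff_triangle_le)
          then show False using big by simp
        qed
      qed
      have meas: "?a i \<in> sets P" "?b i \<in> sets P" "?c i \<in> sets P"
        by (rule Em[OF si[of i] T], rule Em[OF si'[of i] t0(1)], rule Bm[OF si'[of i] t])
      have "prob {w \<in> space P. norm (simple_ito_integral W (m i) (r i) (\<phi> i) t w - J t w) > \<epsilon>} \<le> prob ((?a i \<union> ?b i) \<union> (?c i \<union> A))"
        by (rule finite_measure_mono[OF sub]) (intro sets.Un meas A(1))
      also have "\<dots> \<le> prob (?a i \<union> ?b i) + prob (?c i \<union> A)"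
        by (intro measure_Un_le sets.Un meas A(1))
      also have "\<dots> \<le> (prob (?a i) + prob (?b i)) + (prob (?c i) + prob A)"
        by (intro add_mono measure_Un_le meas A(1))
      also have "prob A \<le> \<eta>' / 4"
        using A(2) pos by (simp add: \<delta>'_def power2_eq_square field_simps)
      finally show ?case
        using elim by simp
    qed
  qed
  then have "eventually (\<lambda>i. \<forall>t\<in>Q. prob {w \<in> space P. norm (simple_ito_integral W (m i) (r i) (\<phi> i) t w - J t w) > \<epsilon>} \<le> \<eta>') sequentially"
    using Q(1) by (intro eventually_ball_finite) auto
  moreover have "eventually (\<lambda>i. prob {w \<in> space P. energy T H (simple_value (m i) (r i) (\<phi> i)) w > ennreal \<delta>} < \<eta>') sequentially"
    using order_tendstoD(2)[OF en[OF pos(2)] \<eta>'] .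
  ultimately have "eventually (\<lambda>i. (\<forall>t\<in>Q. prob {w \<in> space P. norm (simple_ito_integral W (m i) (r i) (\<phi> i) t w - J t w) > \<epsilon>} \<le> \<eta>') \<and>
      prob {w \<in> space P. energy T H (simple_value (m i) (r i) (\<phi> i)) w > ennreal \<delta>} < \<eta>') sequentially"
    by (rule eventually_conj)
  from eventually_happens'[OF sequentially_bot this]
  obtain i where i: "\<And>t. t \<in> Q \<Longrightarrow> prob {w \<in> space P. norm (simple_ito_integral W (m i) (r i) (\<phi> i) t w - J t w) > \<epsilon>} \<le> \<eta>'"
    and ie: "prob {w \<in> space P. energy T H (simple_value (m i) (r i) (\<phi> i)) w > ennreal \<delta>} < \<eta>'"
    by blast
  let ?E = "{w \<in> space P. energy T H (simple_value (m i) (r i) (\<phi> i)) w > ennreal \<delta>}"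
  let ?B = "\<lambda>t. {w \<in> space P. norm (simple_ito_integral W (m i) (r i) (\<phi> i) t w - J t w) > \<epsilon>}"
  have ms: "?E \<in> sets P" "\<And>t. t \<in> Q \<Longrightarrow> ?B t \<in> sets P"
    using Em[OF si[of i] T] Bm[OF si[of i]] by auto
  have mU: "(\<Union>t\<in>Q. ?B t) \<in> sets P"
    using Q(1) ms(2) by (intro sets.finite_UN) auto
  have "prob (?E \<union> (\<Union>t\<in>Q. ?B t)) \<le> prob ?E + prob (\<Union>t\<in>Q. ?B t)"
    by (intro measure_Un_le ms mU)
  also have "prob (\<Union>t\<in>Q. ?B t) \<le> (\<Sum>t\<in>Q. prob (?B t))"
    using Q(1) ms(2) by (intro measure_UNION_le) auto
  also have "(\<Sum>t\<in>Q. prob (?B t)) \<le> (\<Sum>t\<in>Q. \<eta>')"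
    by (intro sum_mono i)
  also have "prob ?E + (\<Sum>t\<in>Q. \<eta>') \<le> \<eta>' + real (card Q) * \<eta>'"
    using ie by simp
  also have "\<eta>' + real (card Q) * \<eta>' = \<eta>' * (real (card Q) + 1)"
    by (simp add: algebra_simps)
  also have "\<dots> = \<eta>"
    unfolding \<eta>'_def using of_nat_0_le_iff[of "card Q", where 'a = real] by simp
  finally have pB: "prob (?E \<union> (\<Union>t\<in>Q. ?B t)) \<le> \<eta>" by simp
  show ?thesis
    by (rule that[OF si[of i] sets.Un[OF ms(1) mU] pB]) auto
qed

text \<open>The given simple integrand resembles \<open>H\<close> only while \<open>R\<close> holds,
  which will mean that the path has not been stopped. The bound \<open>E\<close> depends on the path
  but not on t, so one exceptional set suffices for all times. The summand \<delta> pays for an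
  auxiliary simple integrand close to \<open>H\<close>, and the last summand is the maximal
  inequality at energy \<open>4 * \<delta>\<close> and threshold
  \<open>\<epsilon> / 2\<close>.\<close>

lemma simple_vs_ito_integral:
  fixes H :: "real \<Rightarrow> 'w \<Rightarrow> real ^ 'k ^ 'n"
  assumes T: "0 \<le> T" and HT: "has_ito_integral P F W H T JT"
    and Q: "finite Q" "Q \<subseteq> {0..T}" and J: "\<And>t. t \<in> Q \<Longrightarrow> has_ito_integral P F W H t (J t)"
    and si: "simple_integrand F m r \<phi>"
    and E: "E \<in> borel_measurable P"
      "\<And>w t. w \<in> space P \<Longrightarrow> t \<in> Q \<Longrightarrow> R t w \<Longrightarrow> energy t (simple_value m r \<phi>) H w \<le> E w"
    and pos: "0 < \<epsilon>" "0 < \<delta>"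
  obtains A where "A \<in> sets P" "prob A \<le> prob {w \<in> space P. E w > ennreal \<delta>} + \<delta> + 16 * \<delta> / \<epsilon>\<^sup>2"
    "\<And>w t. w \<in> space P \<Longrightarrow> t \<in> Q \<Longrightarrow> R t w \<Longrightarrow> norm (simple_ito_integral W m r \<phi> t w - J t w) > \<epsilon> \<Longrightarrow> w \<in> A"
proof -
  have e2: "0 < \<epsilon> / 2" using pos by simp
  obtain m' r' \<phi>' B where si': "simple_integrand F m' r' (\<phi>' :: nat \<Rightarrow> 'w \<Rightarrow> real ^ 'k ^ 'n)"
    and B: "B \<in> sets P" "prob B \<le> \<delta>"
    "\<And>w. w \<in> space P - B \<Longrightarrow> energy T H (simple_value m' r' \<phi>') w \<le> ennreal \<delta>"
    "\<And>w t. w \<in> space P - B \<Longrightarrow> t \<in> Q \<Longrightarrow> norm (simple_ito_integral W m' r' \<phi>' t w - J t w) \<le> \<epsilon> / 2"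
    by (rule ito_integral_simultaneous_approx[OF T HT Q J e2 pos(2) pos(2)]) blast+
  have Hm: "(\<lambda>x. H (fst x) (snd x)) \<in> borel_measurable (clock t \<Otimes>\<^sub>M P)" if "0 \<le> t" for t
    using HT that by (intro prog_measurable_clock) (auto simp: has_ito_integral_def)
  obtain A where A: "A \<in> sets P" "prob A \<le> 4 * \<delta> / (\<epsilon> / 2)\<^sup>2"
    "\<And>w u. w \<in> space P \<Longrightarrow> u \<in> Q \<Longrightarrow>
      (\<integral>\<^sup>+ s\<in>{0..u}. ennreal ((norm (simple_value m r \<phi> s w - simple_value m' r' \<phi>' s w))\<^sup>2) \<partial>lborel) \<le> ennreal (4 * \<delta>) \<Longrightarrow>
      norm (simple_ito_integral W m r \<phi> u w - simple_ito_integral W m' r' \<phi>' u w) > \<epsilon> / 2 \<Longrightarrow> w \<in> A"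
    by (rule simple_maximal[OF si si', of Q "4 * \<delta>" "\<epsilon> / 2"]) (use Q pos in auto)
  let ?E = "{w \<in> space P. E w > ennreal \<delta>}"
  have Em: "?E \<in> sets P" using E(1) by measurable
  show ?thesis
  proof (rule that)
    show "?E \<union> (B \<union> A) \<in> sets P" by (intro sets.Un Em B(1) A(1))
    have "prob (?E \<union> (B \<union> A)) \<le> prob ?E + prob (B \<union> A)"
      by (intro measure_Un_le Em sets.Un B(1) A(1))
    also have "prob (B \<union> A) \<le> prob B + prob A"
      by (intro measure_Un_le B(1) A(1))
    also have "prob A \<le> 16 * \<delta> / \<epsilon>\<^sup>2"
      using A(2) by (simp add: power2_eq_square)
    finally show "prob (?E \<union> (B \<union> A)) \<le> prob ?E + \<delta> + 16 * \<delta> / \<epsilon>\<^sup>2"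
      using B(2) by simp
    fix w t assume w: "w \<in> space P" and t: "t \<in> Q" and R: "R t w"
      and big: "norm (simple_ito_integral W m r \<phi> t w - J t w) > \<epsilon>"
    show "w \<in> ?E \<union> (B \<union> A)"
    proof (rule ccontr)
      assume n: "w \<notin> ?E \<union> (B \<union> A)"
      have t0: "0 \<le> t" "t \<le> T" using Q t by auto
      have "energy t (simple_value m r \<phi>) (simple_value m' r' \<phi>') w \<le>
        2 * energy t (simple_value m r \<phi>) H w + 2 * energy t (simple_value m' r' \<phi>') H w"
        by (rule energy_triangle[OF simple_value_clock[OF si] simple_value_clock[OF si'] Hm[OF t0(1)] w])
      also have "\<dots> \<le> 2 * ennreal \<delta> + 2 * ennreal \<delta>"
      proof (intro add_mono mult_left_mono)
        show "energy t (simple_value m r \<phi>) H w \<le> ennreal \<delta>"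
          using E(2)[OF w t R] n w by auto
        have "energy t H (simple_value m' r' \<phi>') w \<le> energy T H (simple_value m' r' \<phi>') w"
          by (rule energy_mono[OF t0(2)])
        also have "\<dots> \<le> ennreal \<delta>" using B(3) n w by auto
        finally show "energy t (simple_value m' r' \<phi>') H w \<le> ennreal \<delta>"
          by (simp add: energy_commute[of t _ H])
      qed auto
      also have "\<dots> = ennreal (4 * \<delta>)"
        using pos by (simp add: ennreal_plus[symmetric] flip: ennreal_numeral ennreal_mult')
      finally have en: "energy t (simple_value m r \<phi>) (simple_value m' r' \<phi>') w \<le> ennreal (4 * \<delta>)" .
      have "w \<notin> A" using n by blast
      then have "norm (simple_ito_integral W m r \<phi> t w - simple_ito_integral W m' r' \<phi>' t w) \<le> \<epsilon> / 2"
        using A(3)[OF w t en[unfolded energy_def]] by (meson not_le)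
      moreover have "norm (simple_ito_integral W m' r' \<phi>' t w - J t w) \<le> \<epsilon> / 2"
        using B(4)[OF _ t] n w by auto
      ultimately have "norm (simple_ito_integral W m r \<phi> t w - J t w) \<le> \<epsilon> / 2 + \<epsilon> / 2"
        by (rule norm_diff_triangle_le)
      then show False using big by simp
    qed
  qed
qed

end

section \<open>Measurability and convergence in probability\<close>

text \<open>Dominated convergence for indicators. It turns the pathwise limits below, which hold
  without any rate, into smallness in probability.\<close>

lemma (in prob_space) prob_tendsto_0:
  assumes A: "\<And>N::nat. A N \<in> events" and ev: "AE w in M. eventually (\<lambda>N. w \<notin> A N) sequentially"
  shows "(\<lambda>N. prob (A N)) \<longlonglongrightarrow> 0"
proof -
  have "(\<lambda>N. integral\<^sup>L M (indicator (A N) :: 'a \<Rightarrow> real)) \<longlonglongrightarrow> integral\<^sup>L M (\<lambda>_. 0::real)"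
  proof (rule integral_dominated_convergence[where w = "\<lambda>_. 1"])
    show "AE w in M. (\<lambda>N. indicator (A N) w :: real) \<longlonglongrightarrow> 0"
      using ev by eventually_elim (auto intro!: tendsto_eventually elim: eventually_mono)
  qed (use A in \<open>auto split: split_indicator\<close>)
  moreover have "integral\<^sup>L M (indicator (A N) :: 'a \<Rightarrow> real) = prob (A N)" for N
    using A[of N] sets.sets_into_space[OF A[of N]] by (simp add: Int_absorb2)
  ultimately show ?thesis by simp
qed

lemma fst_clock_measurable: "fst \<in> borel_measurable (clock T \<Otimes>\<^sub>M M)"
  using measurable_compose[OF measurable_fst[of "clock T" M], of "\<lambda>x. x" borel]
  by (simp add: clock_def measurable_restrict_space1)

text \<open>Sampling at the next point of a grid of mesh \<open>1 / Suc n\<close> involves only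
  countably many of the random variables and is therefore jointly measurable; right continuity
  identifies the limit.\<close>

lemma right_continuous_jointly_measurable:
  fixes Y :: "real \<Rightarrow> 'w \<Rightarrow> 'a::metric_space"
  assumes Ym: "\<And>t. 0 \<le> t \<Longrightarrow> Y t \<in> borel_measurable M"
    and rc: "\<And>w t. w \<in> space M \<Longrightarrow> 0 \<le> t \<Longrightarrow> ((\<lambda>s. Y s w) \<longlongrightarrow> Y t w) (at_right t)"
  shows "(\<lambda>x. Y (fst x) (snd x)) \<in> borel_measurable (clock T \<Otimes>\<^sub>M M)"
proof -
  \<comment> \<open>The added 1 places the sampling time strictly after s, as a limit along
    \<open>at_right\<close> requires.\<close>
  define q where "q n s = real (nat \<lfloor>s * real (Suc n)\<rfloor> + 1) / real (Suc n)" for n s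
  note [measurable] = fst_clock_measurable[of T M]
  show ?thesis
  proof (rule borel_measurable_LIMSEQ_metric)
    fix n
    show "(\<lambda>x. Y (q n (fst x)) (snd x)) \<in> borel_measurable (clock T \<Otimes>\<^sub>M M)"
      unfolding q_def
    proof (rule measurable_compose_countable[where g = "\<lambda>x. nat \<lfloor>fst x * real (Suc n)\<rfloor>"
          and f = "\<lambda>i x. Y (real (i + 1) / real (Suc n)) (snd x)"])
      show "(\<lambda>x. Y (real (i + 1) / real (Suc n)) (snd x)) \<in> borel_measurable (clock T \<Otimes>\<^sub>M M)" for i
        by (rule measurable_compose[OF measurable_snd Ym]) simp
      show "(\<lambda>x. nat \<lfloor>fst x * real (Suc n)\<rfloor>) \<in> measurable (clock T \<Otimes>\<^sub>M M) (count_space UNIV)"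
        by measurable
    qed
  next
    fix x assume "x \<in> space (clock T \<Otimes>\<^sub>M M)"
    then have s: "0 \<le> fst x" and w: "snd x \<in> space M"
      by (auto simp: space_pair_measure)
    let ?s = "fst x"
    have lo: "?s < q n ?s" and hi: "q n ?s \<le> ?s + 1 / real (Suc n)" for n
    proof -
      have "real (nat \<lfloor>?s * real (Suc n)\<rfloor>) = real_of_int \<lfloor>?s * real (Suc n)\<rfloor>"
        using s by simp
      then have "?s * real (Suc n) < real (nat \<lfloor>?s * real (Suc n)\<rfloor> + 1)"
        and "real (nat \<lfloor>?s * real (Suc n)\<rfloor> + 1) \<le> ?s * real (Suc n) + 1"
        by linarith+
      then show "?s < q n ?s" "q n ?s \<le> ?s + 1 / real (Suc n)"
        unfolding q_def by (auto simp: field_simps simp del: of_nat_Suc of_nat_add)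
    qed
    have "(\<lambda>n. q n ?s) \<longlonglongrightarrow> ?s"
    proof (rule real_tendsto_sandwich[of "\<lambda>_. ?s"])
      have "(\<lambda>n. ?s + 1 / real (Suc n)) \<longlonglongrightarrow> ?s + 0"
        by (intro tendsto_intros LIMSEQ_inverse_real_of_nat[unfolded inverse_eq_divide])
      then show "(\<lambda>n. ?s + 1 / real (Suc n)) \<longlonglongrightarrow> ?s" by simp
    qed (use lo hi in \<open>auto intro!: always_eventually less_imp_le\<close>)
    then have "filterlim (\<lambda>n. q n ?s) (at_right ?s) sequentially"
      unfolding filterlim_at using lo by (auto intro!: always_eventually simp: less_imp_neq[THEN not_sym])
    then show "(\<lambda>n. Y (q n ?s) (snd x)) \<longlonglongrightarrow> Y ?s (snd x)"
      by (rule filterlim_compose[OF rc[OF w s]])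
  qed
qed

section \<open>The uniform grid\<close>

definition grid :: "real \<Rightarrow> nat \<Rightarrow> nat \<Rightarrow> real" where
  "grid T N j = T * real j / real N"

lemma grid_0 [simp]: "grid T N 0 = 0"
  by (simp add: grid_def)

lemma grid_N: "0 < N \<Longrightarrow> grid T N N = T"
  by (simp add: grid_def)

lemma grid_nonneg: "0 \<le> T \<Longrightarrow> 0 \<le> grid T N j"
  by (simp add: grid_def)

lemma grid_mono: "0 \<le> T \<Longrightarrow> i \<le> j \<Longrightarrow> grid T N i \<le> grid T N j"
  unfolding grid_def by (intro divide_right_mono mult_left_mono) auto

lemma grid_Suc: "grid T N (Suc j) = grid T N j + T / real N"
  by (simp add: grid_def field_simps add_divide_distrib)

lemma grid_le: "0 \<le> T \<Longrightarrow> j \<le> N \<Longrightarrow> grid T N j \<le> T"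
  using grid_mono[of T j N N] grid_N[of N T] by (cases "N = 0") (auto simp: grid_def)

lemma grid_cell:
  assumes s: "0 < s" "s \<le> T" and N: "0 < N"
  obtains j where "j < N" "s \<in> {grid T N j<..grid T N (Suc j)}"
proof -
  have T: "0 < T" using s by simp
  \<comment> \<open>Cells are open on the left, so the cell of s is found by rounding up; the time 0
    lies in no cell.\<close>
  define c where "c = \<lceil>s * real N / T\<rceil>"
  have c: "real_of_int c - 1 < s * real N / T" "s * real N / T \<le> real_of_int c"
    unfolding c_def by linarith+
  have "0 < s * real N / T" using s N T by simp
  then have c1: "1 \<le> c" unfolding c_def by simp
  have "s * real N / T \<le> real N" using s N T by (simp add: field_simps)
  then have cN: "c \<le> int N" unfolding c_def by (simp add: ceiling_le_iff)
  define j where "j = nat (c - 1)"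
  have j: "real j = real_of_int c - 1"
    using c1 by (simp add: j_def)
  show ?thesis
  proof (rule that)
    show "j < N" using cN c1 by (simp add: j_def)
    show "s \<in> {grid T N j<..grid T N (Suc j)}"
    proof -
      have "real j < s * real N / T" "s * real N / T \<le> real j + 1"
        using c j by auto
      then show ?thesis using T N by (auto simp: grid_def field_simps)
    qed
  qed
qed

lemma indicator_grid:
  assumes T: "0 \<le> T" and s: "s \<in> {grid T N j<..grid T N (Suc j)}"
  shows "indicator {grid T N i<..grid T N (Suc i)} s = (if i = j then 1 else 0::real)"
proof -
  have "s \<notin> {grid T N i<..grid T N (Suc i)}" if "i \<noteq> j"
  proof (cases "i < j")
    case True
    then show ?thesis using grid_mono[OF T, of "Suc i" j N] s by auto
  next
    case False
    then show ?thesis using grid_mono[OF T, of "Suc j" i N] s that by auto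
  qed
  then show ?thesis using s by (auto simp: indicator_def)
qed

lemma simple_value_grid:
  assumes T: "0 \<le> T" and j: "j < N" and s: "s \<in> {grid T N j<..grid T N (Suc j)}"
  shows "simple_value N (grid T N) \<phi> s w = \<phi> j w"
proof -
  have "simple_value N (grid T N) \<phi> s w = (\<Sum>i<N. if i = j then \<phi> i w else 0)"
    unfolding simple_value_def indicator_grid[OF T s] by (intro sum.cong) auto
  then show ?thesis using j by simp
qed

section \<open>Stopped Ito processes and their Euler scheme\<close>

text \<open>The equation is required only at deterministic times before \<open>\<rho>\<close>; thus no stochastic integral up
  to a random time occurs.\<close>

locale stopped_ito = wiener_space P W for P :: "'w measure" and W :: "real \<Rightarrow> 'w \<Rightarrow> real ^ 'k" +
  fixes b :: "real ^ 'n \<Rightarrow> real ^ 'n" and \<sigma> :: "real ^ 'n \<Rightarrow> real ^ 'k ^ 'n"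
    and X :: "real \<Rightarrow> 'w \<Rightarrow> real ^ 'n" and \<rho> :: "'w \<Rightarrow> real"
    and H :: "real \<Rightarrow> 'w \<Rightarrow> real ^ 'k ^ 'n" and C :: "(real ^ 'n) set" and x0 :: "real ^ 'n"
  assumes b_cont: "continuous_on UNIV b" and \<sigma>_cont: "continuous_on UNIV \<sigma>"
    and C: "compact C" "x0 \<in> C"
    and \<rho>_nonneg: "\<And>w. w \<in> space P \<Longrightarrow> 0 \<le> \<rho> w"
    and \<rho>_stop: "\<And>t. 0 \<le> t \<Longrightarrow> {w \<in> space P. t < \<rho> w} \<in> sets (F t)"
    and X_adapted: "\<And>t. 0 \<le> t \<Longrightarrow> (\<lambda>w. if t < \<rho> w then X t w else 0) \<in> borel_measurable (F t)"
    and X_cont: "\<And>w. w \<in> space P \<Longrightarrow> continuous_on {0..\<rho> w} (\<lambda>t. X t w)"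
    and X_C: "\<And>w t. w \<in> space P \<Longrightarrow> 0 \<le> t \<Longrightarrow> t < \<rho> w \<Longrightarrow> X t w \<in> C"
    and X_0: "AE w in P. X 0 w = x0"
    and H_eq: "\<And>w t. w \<in> space P \<Longrightarrow> 0 \<le> t \<Longrightarrow> t < \<rho> w \<Longrightarrow> H t w = \<sigma> (X t w)"
    and X_ito: "\<And>t. 0 \<le> t \<Longrightarrow> \<exists>J. has_ito_integral P F W H t J \<and>
      (AE w in P. t < \<rho> w \<longrightarrow> X t w = x0 + integral {0..t} (\<lambda>s. b (X s w)) + J w)"
begin

text \<open>The value 0 from \<open>\<rho>\<close> on makes the process adapted and right-continuous
  although X is controlled only before \<open>\<rho>\<close>. For continuous g it is also bounded,
  because the path is in the compact set \<open>C\<close> until then.\<close>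

definition act :: "(real ^ 'n \<Rightarrow> 'b::real_normed_vector) \<Rightarrow> real \<Rightarrow> 'w \<Rightarrow> 'b" where
  "act g t w = (if t < \<rho> w then g (X t w) else 0)"

lemma act_measurable:
  assumes g: "continuous_on UNIV g" and t: "0 \<le> t"
  shows "act g t \<in> borel_measurable (F t)"
proof -
  have 1: "(\<lambda>w. g (if t < \<rho> w then X t w else 0)) \<in> borel_measurable (F t)"
    by (rule borel_measurable_continuous_on[OF g X_adapted[OF t]])
  have "(\<lambda>w. if t < \<rho> w then g (if t < \<rho> w then X t w else 0) else 0) \<in> borel_measurable (F t)"
    by (rule measurable_If[OF 1 measurable_const]) (use \<rho>_stop[OF t] in auto)
  moreover have "act g t = (\<lambda>w. if t < \<rho> w then g (if t < \<rho> w then X t w else 0) else 0)"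
    by (auto simp: act_def)
  ultimately show ?thesis by simp
qed

lemma act_tendsto:
  assumes g: "continuous_on UNIV g" and w: "w \<in> space P" and s: "0 \<le> s"
    and \<tau>: "(\<tau> \<longlongrightarrow> s) A" "eventually (\<lambda>n. 0 \<le> \<tau> n) A"
    and side: "s \<noteq> \<rho> w \<or> eventually (\<lambda>n. s \<le> \<tau> n) A"
  shows "((\<lambda>n. act g (\<tau> n) w) \<longlongrightarrow> act g s w) A"
proof (cases "s < \<rho> w")
  case True
  have ev: "eventually (\<lambda>n. \<tau> n < \<rho> w) A"
    using order_tendstoD(2)[OF \<tau>(1) True] .
  have "((\<lambda>n. X (\<tau> n) w) \<longlongrightarrow> X s w) A"
  proof (rule continuous_on_tendsto_compose[OF X_cont[OF w] \<tau>(1)])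
    show "eventually (\<lambda>n. \<tau> n \<in> {0..\<rho> w}) A"
      using ev \<tau>(2) by eventually_elim auto
  qed (use True s in auto)
  then have "((\<lambda>n. g (X (\<tau> n) w)) \<longlongrightarrow> g (X s w)) A"
    by (rule continuous_on_tendsto_compose[OF g]) auto
  moreover have "eventually (\<lambda>n. g (X (\<tau> n) w) = act g (\<tau> n) w) A"
    using ev by eventually_elim (simp add: act_def)
  ultimately show ?thesis
    using True by (simp add: act_def[of g s] Lim_transform_eventually)
next
  case False
  have "eventually (\<lambda>n. \<rho> w \<le> \<tau> n) A"
  proof (cases "s = \<rho> w")
    case True
    then show ?thesis using side by auto
  next
    case False
    with \<open>\<not> s < \<rho> w\<close> have "\<rho> w < s" by simp
    from order_tendstoD(1)[OF \<tau>(1) this] show ?thesis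
      by eventually_elim simp
  qed
  then have "eventually (\<lambda>n. act g (\<tau> n) w = 0) A"
    by eventually_elim (simp add: act_def)
  moreover have "act g s w = 0" using False by (simp add: act_def)
  ultimately show ?thesis by (simp add: tendsto_eventually)
qed

lemma act_jointly_measurable:
  fixes g :: "real ^ 'n \<Rightarrow> 'b::{real_normed_vector, second_countable_topology}"
  assumes g: "continuous_on UNIV g"
  shows "(\<lambda>x. act g (fst x) (snd x)) \<in> borel_measurable (clock T \<Otimes>\<^sub>M P)"
proof (rule right_continuous_jointly_measurable)
  show "act g t \<in> borel_measurable P" if "0 \<le> t" for t
    using act_measurable[OF g that] by (rule measurable_F_P)
  show "((\<lambda>s. act g s w) \<longlongrightarrow> act g t w) (at_right t)" if "w \<in> space P" "0 \<le> t" for w t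
  proof (rule act_tendsto[OF g that])
    show "((\<lambda>s. s) \<longlongrightarrow> t) (at_right t)" by (rule tendsto_ident_at)
    have "eventually (\<lambda>s. t < s) (at_right t)"
      by (simp add: eventually_at_filter)
    then show "eventually (\<lambda>s. 0 \<le> s) (at_right t)" "t \<noteq> \<rho> w \<or> eventually (\<lambda>s. t \<le> s) (at_right t)"
      using that by (auto elim!: eventually_mono)
  qed
qed

text \<open>A constant of the locale, so that the truncated scheme and all estimates refer to the
  same bound. Being at least 1, it is dominated by its own powers.\<close>

definition K :: real where
  "K = (SOME K. 1 \<le> K \<and> (\<forall>x\<in>C. norm x \<le> K \<and> norm (b x) \<le> K \<and> norm (\<sigma> x) \<le> K))"

lemma K: "1 \<le> K" "\<And>x. x \<in> C \<Longrightarrow> norm x \<le> K" "\<And>x. x \<in> C \<Longrightarrow> norm (b x) \<le> K" "\<And>x. x \<in> C \<Longrightarrow> norm (\<sigma> x) \<le> K"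
proof -
  have "bounded C" "bounded (b ` C)" "bounded (\<sigma> ` C)"
    using C(1) b_cont \<sigma>_cont by (auto intro!: compact_imp_bounded compact_continuous_image intro: continuous_on_subset)
  then obtain A1 A2 A3 where "\<forall>x\<in>C. norm x \<le> A1" "\<forall>x\<in>b ` C. norm x \<le> A2" "\<forall>x\<in>\<sigma> ` C. norm x \<le> A3"
    unfolding bounded_iff by (elim exE)
  then have "\<exists>K. 1 \<le> K \<and> (\<forall>x\<in>C. norm x \<le> K \<and> norm (b x) \<le> K \<and> norm (\<sigma> x) \<le> K)"
    by (intro exI[of _ "max (max 1 A1) (max A2 A3)"]) (auto simp: le_max_iff_disj)
  from someI_ex[OF this]
  show "1 \<le> K" "\<And>x. x \<in> C \<Longrightarrow> norm x \<le> K" "\<And>x. x \<in> C \<Longrightarrow> norm (b x) \<le> K" "\<And>x. x \<in> C \<Longrightarrow> norm (\<sigma> x) \<le> K"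
    by (auto simp: K_def)
qed

lemma act_bound:
  assumes "w \<in> space P" "0 \<le> t"
  shows "norm (act b t w) \<le> K" "norm (act \<sigma> t w) \<le> K"
  using X_C[OF assms] K by (auto simp: act_def intro: order_trans[OF _ K(1)])

section \<open>The Euler scheme driven by the true solution\<close>

definition drift_sum :: "real \<Rightarrow> nat \<Rightarrow> nat \<Rightarrow> 'w \<Rightarrow> real ^ 'n" where
  "drift_sum T N l w = (\<Sum>j<l. (T / real N) *\<^sub>R act b (grid T N j) w)"

definition euler :: "real \<Rightarrow> nat \<Rightarrow> nat \<Rightarrow> 'w \<Rightarrow> real ^ 'n" where
  "euler T N l w = x0 + drift_sum T N l w + isum (grid T N) (\<lambda>j. act \<sigma> (grid T N j)) l w"

lemma simple_integrand_grid:
  assumes T: "0 \<le> T"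
  shows "simple_integrand F N (grid T N) (\<lambda>j. act \<sigma> (grid T N j))"
  unfolding simple_integrand_def
proof (intro conjI allI impI)
  show "mono (grid T N)" by (rule monoI) (rule grid_mono[OF T])
  show "act \<sigma> (grid T N j) \<in> borel_measurable (F (grid T N j))" for j
    using T by (intro act_measurable[OF \<sigma>_cont] grid_nonneg)
  show "\<exists>C. \<forall>w\<in>space (F (grid T N j)). norm (act \<sigma> (grid T N j) w) \<le> C" for j
    using act_bound(2)[OF _ grid_nonneg[OF T]] by auto
qed simp

lemma simple_ito_integral_grid:
  assumes T: "0 \<le> T" and l: "l \<le> N"
  shows "simple_ito_integral W N (grid T N) \<phi> (grid T N l) w = isum (grid T N) \<phi> l w"
proof -
  have m: "min (grid T N l) (grid T N j) = grid T N (min l j)" for j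
    using grid_mono[OF T, of l j N] grid_mono[OF T, of j l N] by (auto simp: min_def)
  have "simple_ito_integral W N (grid T N) \<phi> (grid T N l) w =
    (\<Sum>j<N. \<phi> j w *v (W (grid T N (min l (Suc j))) w - W (grid T N (min l j)) w))"
    unfolding simple_ito_integral_def m ..
  also have "\<dots> = (\<Sum>j<l. \<phi> j w *v (W (grid T N (min l (Suc j))) w - W (grid T N (min l j)) w))"
    using l by (intro sum.mono_neutral_right) auto
  also have "\<dots> = isum (grid T N) \<phi> l w"
    unfolding isum_def by (intro sum.cong) (auto simp: min.absorb2)
  finally show ?thesis .
qed

text \<open>At time s the simple integrand shows \<open>act \<sigma>\<close> at a grid time at most
  \<open>T / N\<close> earlier. This converges to \<open>act \<sigma> s\<close> unless s is
  \<open>\<rho>\<close>, where the approach is from the wrong side, or 0, which lies in no cell. Two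
  instants are negligible, and \<open>(2 * K)\<^sup>2\<close> is a dominating constant.\<close>

lemma euler_energy_tendsto:
  assumes T: "0 < T" and w: "w \<in> space P"
  shows "(\<lambda>N. energy T (simple_value N (grid T N) (\<lambda>j. act \<sigma> (grid T N j))) (act \<sigma>) w) \<longlonglongrightarrow> 0"
proof -
  let ?V = "\<lambda>N. simple_value N (grid T N) (\<lambda>j. act \<sigma> (grid T N j))"
  let ?f = "\<lambda>N s. ennreal ((norm (?V N s w - act \<sigma> s w))\<^sup>2) * indicator {0..T} s"
  have T0: "0 \<le> T" using T by simp
  have val: "\<exists>\<tau>. 0 \<le> \<tau> \<and> s - T / real N \<le> \<tau> \<and> \<tau> \<le> s \<and> ?V N s w = act \<sigma> \<tau> w"
    if s: "0 < s" "s \<le> T" and N: "0 < N" for N s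
  proof -
    obtain j where j: "j < N" "s \<in> {grid T N j<..grid T N (Suc j)}"
      using grid_cell[OF s N] .
    show ?thesis
      using simple_value_grid[OF T0 j] j(2) grid_nonneg[OF T0, of N j]
      by (intro exI[of _ "grid T N j"]) (auto simp: grid_Suc)
  qed
  have sec: "(\<lambda>s. act \<sigma> s w) \<in> borel_measurable (clock T)"
    using measurable_compose[OF measurable_Pair2'[OF w] act_jointly_measurable[OF \<sigma>_cont, of T]] by simp
  have Vm: "(\<lambda>s. ?V N s w) \<in> borel_measurable (clock T)" for N
    unfolding clock_def by (intro measurable_restrict_space1) simp
  have "(\<lambda>N. \<integral>\<^sup>+ s. ennreal ((norm (?V N s w - act \<sigma> s w))\<^sup>2) \<partial>clock T) \<longlonglongrightarrow> (\<integral>\<^sup>+ s. 0 \<partial>clock T)"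
  proof (rule nn_integral_dominated_convergence[where w = "\<lambda>_. ennreal ((2 * K)\<^sup>2)"])
    show "(\<lambda>s. ennreal ((norm (?V N s w - act \<sigma> s w))\<^sup>2)) \<in> borel_measurable (clock T)" for N
      using sec Vm[of N] by measurable
    interpret c: finite_measure "clock T" by (rule finite_measure_clock)
    show "(\<integral>\<^sup>+ s. ennreal ((2 * K)\<^sup>2) \<partial>clock T) < \<infinity>"
      using c.emeasure_finite[of "{0..T}"] by (simp add: less_top[symmetric] ennreal_mult_eq_top_iff)
    have ae: "AE s in clock T. s \<noteq> 0 \<and> s \<noteq> \<rho> w"
    proof -
      have "AE s in lborel. s \<noteq> 0 \<and> s \<noteq> \<rho> w"
        using AE_lborel_singleton[of "0::real"] AE_lborel_singleton[of "\<rho> w"] by eventually_elim simp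
      then show ?thesis unfolding clock_def
        by (subst AE_restrict_space_iff) auto
    qed
    have bd: "ennreal ((norm (?V N s w - act \<sigma> s w))\<^sup>2) \<le> ennreal ((2 * K)\<^sup>2)" if s: "0 < s" "s \<le> T" for N s
    proof -
      have "norm (?V N s w) \<le> K"
      proof (cases "N = 0")
        case True
        then show ?thesis using K(1) by (simp add: simple_value_def)
      next
        case False
        then show ?thesis using val[OF s, of N] act_bound(2)[OF w] by auto
      qed
      moreover have "norm (act \<sigma> s w) \<le> K" using act_bound(2)[OF w] s by simp
      ultimately have "norm (?V N s w - act \<sigma> s w) \<le> 2 * K"
        using norm_triangle_ineq4[of "?V N s w" "act \<sigma> s w"] by linarith
      then show ?thesis by (intro ennreal_leI power_mono) auto
    qed
    show "AE s in clock T. ennreal ((norm (?V N s w - act \<sigma> s w))\<^sup>2) \<le> ennreal ((2 * K)\<^sup>2)" for N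
      using ae AE_space by eventually_elim (rule bd, auto)
    show "AE s in clock T. (\<lambda>N. ennreal ((norm (?V N s w - act \<sigma> s w))\<^sup>2)) \<longlonglongrightarrow> 0"
      using ae AE_space
    proof eventually_elim
      case (elim s)
      then have s: "0 < s" "s \<le> T" "s \<noteq> \<rho> w" by auto
      have "\<forall>N. \<exists>\<tau>. 0 < N \<longrightarrow> 0 \<le> \<tau> \<and> s - T / real N \<le> \<tau> \<and> \<tau> \<le> s \<and> ?V N s w = act \<sigma> \<tau> w"
        using val[OF s(1,2)] by blast
      then obtain \<tau> where \<tau>: "\<And>N. 0 < N \<Longrightarrow> 0 \<le> \<tau> N \<and> s - T / real N \<le> \<tau> N \<and> \<tau> N \<le> s \<and> ?V N s w = act \<sigma> (\<tau> N) w"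
        by metis
      have ev: "eventually (\<lambda>N::nat. 0 < N) sequentially" by (rule eventually_gt_at_top)
      have lim: "\<tau> \<longlonglongrightarrow> s"
      proof (rule real_tendsto_sandwich[where f = "\<lambda>N. s - T / real N" and h = "\<lambda>_. s"])
        show "(\<lambda>N. s - T / real N) \<longlonglongrightarrow> s"
          using tendsto_diff[OF tendsto_const[of s] lim_const_over_n[of T]] by simp
        show "eventually (\<lambda>N. s - T / real N \<le> \<tau> N) sequentially" "eventually (\<lambda>N. \<tau> N \<le> s) sequentially"
          using ev by (eventually_elim, use \<tau> in blast)+
      qed simp
      have ev0: "eventually (\<lambda>N. 0 \<le> \<tau> N) sequentially"
        using ev by (eventually_elim, use \<tau> in blast)
      have ev1: "eventually (\<lambda>N. act \<sigma> (\<tau> N) w = ?V N s w) sequentially"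
        using ev
      proof eventually_elim
        case (elim N)
        show ?case using \<tau>[OF elim] by simp
      qed
      have "(\<lambda>N. act \<sigma> (\<tau> N) w) \<longlonglongrightarrow> act \<sigma> s w"
        by (rule act_tendsto[OF \<sigma>_cont w _ lim ev0]) (use s in auto)
      then have "(\<lambda>N. ?V N s w) \<longlonglongrightarrow> act \<sigma> s w"
        using ev1 by (rule Lim_transform_eventually)
      then have "(\<lambda>N. ennreal ((norm (?V N s w - act \<sigma> s w))\<^sup>2)) \<longlonglongrightarrow> ennreal ((norm (act \<sigma> s w - act \<sigma> s w))\<^sup>2)"
        by (intro tendsto_intros)
      then show ?case by simp
    qed
  qed auto
  then show ?thesis
    unfolding energy_def nn_integral_clock by simp
qed

text \<open>Left Riemann sums of a continuous function. Uniform continuity on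
  \<open>{0..min T (\<rho> w)}\<close> allows an error of \<open>\<epsilon> / T\<close> per unit of
  time, so one threshold for N serves all grid points before \<open>\<rho>\<close>.\<close>

lemma drift_sum_tendsto:
  assumes T: "0 < T" and w: "w \<in> space P" and \<epsilon>: "0 < \<epsilon>"
  shows "eventually (\<lambda>N. \<forall>l\<le>N. grid T N l < \<rho> w \<longrightarrow>
    norm (drift_sum T N l w - integral {0..grid T N l} (\<lambda>s. b (X s w))) \<le> \<epsilon>) sequentially"
proof -
  define m where "m = min T (\<rho> w)"
  define f where "f s = b (X s w)" for s
  have T0: "0 \<le> T" using T by simp
  have "continuous_on {0..\<rho> w} f"
    unfolding f_def by (rule continuous_on_compose2[OF b_cont X_cont[OF w]]) auto
  then have fc: "continuous_on {0..m} f"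
    by (rule continuous_on_subset) (auto simp: m_def)
  then have "uniformly_continuous_on {0..m} f"
    by (intro compact_uniformly_continuous) auto
  then obtain d where d: "0 < d" "\<And>s s'. s \<in> {0..m} \<Longrightarrow> s' \<in> {0..m} \<Longrightarrow> dist s' s < d \<Longrightarrow> dist (f s') (f s) < \<epsilon> / T"
    unfolding uniformly_continuous_on_def using \<epsilon> T by (metis divide_pos_pos)
  have "(\<lambda>N. T / real N) \<longlonglongrightarrow> 0" by (rule lim_const_over_n)
  from order_tendstoD(2)[OF this d(1)] eventually_gt_at_top[of "0::nat"]
  show ?thesis
  proof eventually_elim
    case (elim N)
    have *: "norm (drift_sum T N l w - integral {0..grid T N l} f) \<le> \<epsilon> / T * grid T N l"
      if "l \<le> N" "grid T N l < \<rho> w" for l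
      using that
    proof (induction l)
      case 0
      then show ?case by (simp add: drift_sum_def)
    next
      case (Suc l)
      let ?a = "grid T N l" and ?c = "grid T N (Suc l)"
      have ac: "0 \<le> ?a" "?a \<le> ?c" "?c \<le> T" "?c - ?a = T / real N"
        using grid_nonneg[OF T0] grid_mono[OF T0, of l "Suc l" N] grid_le[OF T0 Suc.prems(1)] grid_Suc[of T N l] by auto
      have cm: "?c \<le> m" using ac Suc.prems by (simp add: m_def)
      have al: "?a < \<rho> w" using ac Suc.prems by simp
      have IH: "norm (drift_sum T N l w - integral {0..?a} f) \<le> \<epsilon> / T * ?a"
        using Suc.IH Suc.prems al by simp
      have fi: "f integrable_on {0..?c}"
        using fc cm by (intro integrable_continuous_interval) (auto intro: continuous_on_subset)
      have fi2: "f integrable_on {?a..?c}"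
        using fc cm ac by (intro integrable_continuous_interval) (auto intro: continuous_on_subset)
      have split: "integral {0..?c} f = integral {0..?a} f + integral {?a..?c} f"
        using Henstock_Kurzweil_Integration.integral_combine[OF ac(1,2) fi] by simp
      have cst: "(T / real N) *\<^sub>R act b ?a w = integral {?a..?c} (\<lambda>_. f ?a)"
        using ac al by (simp add: act_def f_def)
      have "norm ((T / real N) *\<^sub>R act b ?a w - integral {?a..?c} f) = norm (integral {?a..?c} (\<lambda>s. f ?a - f s))"
        unfolding cst by (subst Henstock_Kurzweil_Integration.integral_diff) (use fi2 in auto)
      also have "\<dots> \<le> \<epsilon> / T * (?c - ?a)"
      proof (rule integral_bound[OF ac(2)])
        show "continuous_on {?a..?c} (\<lambda>s. f ?a - f s)"
          using fc cm ac by (intro continuous_intros) (auto intro: continuous_on_subset)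
        fix s assume s: "s \<in> {?a..?c}"
        have "dist ?a s < d" using s ac elim by (auto simp: dist_real_def)
        then have "dist (f ?a) (f s) < \<epsilon> / T"
          using s ac cm by (intro d(2)) auto
        then show "norm (f ?a - f s) \<le> \<epsilon> / T" by (simp add: dist_norm)
      qed
      finally have st: "norm ((T / real N) *\<^sub>R act b ?a w - integral {?a..?c} f) \<le> \<epsilon> / T * (?c - ?a)" .
      have "norm (drift_sum T N (Suc l) w - integral {0..?c} f) =
        norm ((drift_sum T N l w - integral {0..?a} f) + ((T / real N) *\<^sub>R act b ?a w - integral {?a..?c} f))"
        unfolding split by (simp add: drift_sum_def algebra_simps)
      also have "\<dots> \<le> \<epsilon> / T * ?a + \<epsilon> / T * (?c - ?a)"
        using IH st by (rule norm_triangle_le[OF add_mono])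
      also have "\<dots> = \<epsilon> / T * ?c" by (simp add: algebra_simps)
      finally show ?case .
    qed
    show ?case
    proof (intro allI impI)
      fix l assume l: "l \<le> N" "grid T N l < \<rho> w"
      have "\<epsilon> / T * grid T N l \<le> \<epsilon> / T * T"
        using \<epsilon> T grid_le[OF T0 l(1)] by (intro mult_left_mono) auto
      with *[OF l] T show "norm (drift_sum T N l w - integral {0..grid T N l} (\<lambda>s. b (X s w))) \<le> \<epsilon>"
        by (simp add: f_def[abs_def])
    qed
  qed
qed

end

context stopped_ito
begin

lemma act_measurable_P: "continuous_on UNIV g \<Longrightarrow> 0 \<le> t \<Longrightarrow> act g t \<in> borel_measurable P"
  by (rule measurable_F_P[OF act_measurable])

lemma drift_sum_measurable:
  assumes T: "0 \<le> T"
  shows "drift_sum T N l \<in> borel_measurable P"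
proof -
  have "(\<lambda>w. (T / real N) *\<^sub>R act b (grid T N j) w) \<in> borel_measurable P" for j
    by (rule borel_measurable_scaleR[OF borel_measurable_const act_measurable_P[OF b_cont grid_nonneg[OF T]]])
  then show ?thesis
    unfolding drift_sum_def[abs_def] by (rule borel_measurable_sum)
qed

lemma euler_measurable:
  assumes T: "0 \<le> T"
  shows "euler T N l \<in> borel_measurable P"
proof -
  have "isum (grid T N) (\<lambda>j. act \<sigma> (grid T N j)) l \<in> borel_measurable (F (grid T N l))"
    using T by (intro isum_measurable act_measurable[OF \<sigma>_cont] grid_nonneg monoI grid_mono) simp_all
  then have "isum (grid T N) (\<lambda>j. act \<sigma> (grid T N j)) l \<in> borel_measurable P"
    by (rule measurable_F_P)
  then show ?thesis
    unfolding euler_def[abs_def] using drift_sum_measurable[OF T] by measurable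
qed

text \<open>\<open>X\<close> at a grid time is known to be measurable only where that time precedes
  \<open>\<rho>\<close>; on this event the variable set to 0 elsewhere can be substituted.\<close>

lemma grid_event_measurable:
  assumes T: "0 \<le> T" and f: "\<And>l. l \<le> N \<Longrightarrow> f l \<in> borel_measurable P"
  shows "{w \<in> space P. \<exists>l\<le>N. grid T N l < \<rho> w \<and> norm (f l w - X (grid T N l) w) > \<epsilon>} \<in> sets P"
proof -
  have "{w \<in> space P. grid T N l < \<rho> w \<and> norm (f l w - X (grid T N l) w) > \<epsilon>} \<in> sets P" if l: "l \<le> N" for l
  proof -
    have [measurable]: "{w \<in> space P. grid T N l < \<rho> w} \<in> sets P"
      using \<rho>_stop[OF grid_nonneg[OF T]] sets_F_subset by auto
    have [measurable]: "(\<lambda>w. if grid T N l < \<rho> w then X (grid T N l) w else 0) \<in> borel_measurable P"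
      using X_adapted[OF grid_nonneg[OF T]] by (rule measurable_F_P)
    have [measurable]: "f l \<in> borel_measurable P" using f l .
    have "{w \<in> space P. grid T N l < \<rho> w} \<inter>
        {w \<in> space P. norm (f l w - (if grid T N l < \<rho> w then X (grid T N l) w else 0)) > \<epsilon>} \<in> sets P"
      by (intro sets.Int) measurable
    also have "{w \<in> space P. grid T N l < \<rho> w} \<inter>
        {w \<in> space P. norm (f l w - (if grid T N l < \<rho> w then X (grid T N l) w else 0)) > \<epsilon>} =
        {w \<in> space P. grid T N l < \<rho> w \<and> norm (f l w - X (grid T N l) w) > \<epsilon>}"
      by auto
    finally show ?thesis .
  qed
  then have "{w \<in> space P. \<exists>l\<in>{..N}. grid T N l < \<rho> w \<and> norm (f l w - X (grid T N l) w) > \<epsilon>} \<in> sets P"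
    by (intro sets.sets_Collect_finite_Ex) auto
  then show ?thesis by (simp only: Bex_def atMost_iff)
qed

section \<open>Closeness of the scheme to the solution\<close>

definition bad_euler :: "real \<Rightarrow> real \<Rightarrow> nat \<Rightarrow> 'w set" where
  "bad_euler T \<epsilon> N = {w \<in> space P. \<exists>l\<le>N. grid T N l < \<rho> w \<and> norm (euler T N l w - X (grid T N l) w) > \<epsilon>}"

text \<open>The error splits into two parts. The drift error, in which the exact integral
  \<open>J\<close> replaces the noise sum, tends to 0 pathwise by the integral equation and gives
  the sets \<open>D N\<close>. The noise error compares the simple integrand of the scheme with
  \<open>H\<close>; before \<open>\<rho>\<close> their energy distance is at most
  \<open>E N\<close>, which tends to 0.\<close>

lemma bad_euler_tendsto:
  assumes T: "0 < T" and \<epsilon>: "0 < \<epsilon>"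
  shows "(\<lambda>N. prob (bad_euler T \<epsilon> N)) \<longlonglongrightarrow> 0"
proof -
  have T0: "0 \<le> T" using T by simp
  have e2: "0 < \<epsilon> / 2" using \<epsilon> by simp
  \<comment> \<open>One version of the integral is fixed for every time. Only the countably many
    grid times are used, so their equations hold together outside a single null set.\<close>
  define J where "J t = (SOME J. has_ito_integral P F W H t J \<and>
      (AE w in P. t < \<rho> w \<longrightarrow> X t w = x0 + integral {0..t} (\<lambda>s. b (X s w)) + J w))" for t
  have J: "has_ito_integral P F W H t (J t)"
    and JX: "AE w in P. t < \<rho> w \<longrightarrow> X t w = x0 + integral {0..t} (\<lambda>s. b (X s w)) + J t w" if "0 \<le> t" for t
    using someI_ex[OF X_ito[OF that]] unfolding J_def by blast+
  let ?V = "\<lambda>N. simple_value N (grid T N) (\<lambda>j. act \<sigma> (grid T N j))"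
  define E where "E N = energy T (?V N) (act \<sigma>)" for N
  have Em: "E N \<in> borel_measurable P" for N
    unfolding E_def by (rule energy_measurable[OF simple_value_clock[OF simple_integrand_grid[OF T0]] act_jointly_measurable[OF \<sigma>_cont]])
  have EH: "energy t (?V N) H w \<le> E N w" if w: "w \<in> space P" and t: "t \<in> grid T N ` {..N}" "t < \<rho> w" for N t w
  proof -
    have tT: "t \<le> T" using t grid_le[OF T0] by auto
    have "energy t (?V N) H w = energy t (?V N) (act \<sigma>) w"
      unfolding energy_def using H_eq[OF w] t(2)
      by (intro nn_integral_cong) (auto simp: act_def split: split_indicator)
    also have "\<dots> \<le> E N w" unfolding E_def by (rule energy_mono[OF tT])
    finally show ?thesis .
  qed
  define D where "D N = {w \<in> space P. \<exists>l\<le>N. grid T N l < \<rho> w \<and>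
      norm ((x0 + drift_sum T N l w + J (grid T N l) w) - X (grid T N l) w) > \<epsilon> / 2}" for N
  have Jm: "J (grid T N l) \<in> borel_measurable P" for N l
    using J[OF grid_nonneg[OF T0]] by (simp add: has_ito_integral_def)
  have Dm: "D N \<in> sets P" for N
    unfolding D_def
  proof (rule grid_event_measurable[OF T0])
    show "(\<lambda>w. x0 + drift_sum T N l w + J (grid T N l) w) \<in> borel_measurable P" for l
      using Jm[of N l] drift_sum_measurable[OF T0, of N l] by measurable
  qed
  have "AE w in P. \<forall>N l. grid T N l < \<rho> w \<longrightarrow>
      X (grid T N l) w = x0 + integral {0..grid T N l} (\<lambda>s. b (X s w)) + J (grid T N l) w"
    using JX[OF grid_nonneg[OF T0]] by (simp add: AE_all_countable)
  then have "AE w in P. eventually (\<lambda>N. w \<notin> D N) sequentially"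
    using AE_space
  proof eventually_elim
    case (elim w)
    note Xeq = elim(1)
    show ?case
      using drift_sum_tendsto[OF T elim(2) e2]
    proof eventually_elim
      case (elim N)
      show ?case
      proof
        assume "w \<in> D N"
        then obtain l where l: "l \<le> N" "grid T N l < \<rho> w"
          "norm ((x0 + drift_sum T N l w + J (grid T N l) w) - X (grid T N l) w) > \<epsilon> / 2"
          by (auto simp: D_def)
        have "(x0 + drift_sum T N l w + J (grid T N l) w) - X (grid T N l) w
          = drift_sum T N l w - integral {0..grid T N l} (\<lambda>s. b (X s w))"
          using Xeq l(2) by simp
        moreover have "norm (drift_sum T N l w - integral {0..grid T N l} (\<lambda>s. b (X s w))) \<le> \<epsilon> / 2"
          using elim l(1,2) by blast
        ultimately have "norm ((x0 + drift_sum T N l w + J (grid T N l) w) - X (grid T N l) w) \<le> \<epsilon> / 2"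
          by (simp only:)
        then show False using l(3) by linarith
      qed
    qed
  qed
  then have D0: "(\<lambda>N. prob (D N)) \<longlonglongrightarrow> 0"
    by (rule prob_tendsto_0[OF Dm])
  have E0: "(\<lambda>N. prob {w \<in> space P. E N w > ennreal \<delta>}) \<longlonglongrightarrow> 0" if \<delta>: "0 < \<delta>" for \<delta>
  proof (rule prob_tendsto_0)
    show "{w \<in> space P. E N w > ennreal \<delta>} \<in> sets P" for N
      using Em[of N] by measurable
    show "AE w in P. eventually (\<lambda>N. w \<notin> {w \<in> space P. E N w > ennreal \<delta>}) sequentially"
      using AE_space
    proof eventually_elim
      case (elim w)
      have "(\<lambda>N. E N w) \<longlonglongrightarrow> 0" unfolding E_def by (rule euler_energy_tendsto[OF T elim])
      from order_tendstoD(2)[OF this, of "ennreal \<delta>"] \<delta> show ?case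
        by (auto elim!: eventually_mono)
    qed
  qed
  show ?thesis
  proof (rule tendstoI)
    fix \<eta> :: real assume \<eta>: "0 < \<eta>"
    \<comment> \<open>The noise estimate costs \<open>\<delta> + 16 * \<delta> / (\<epsilon> /
      2)\<^sup>2 = \<delta> * q\<close>. The choice of \<delta> makes this
      \<open>\<eta> / 4\<close>; the drift set and the energy set contribute less than
      \<open>\<eta> / 4\<close> each.\<close>
    define q where "q = 1 + 64 / \<epsilon>\<^sup>2"
    have q: "0 < q" unfolding q_def using \<epsilon> by (intro add_pos_nonneg) auto
    define \<delta> where "\<delta> = \<eta> / (4 * q)"
    have \<delta>: "0 < \<delta>" "\<delta> + 16 * \<delta> / (\<epsilon> / 2)\<^sup>2 = \<eta> / 4"
    proof -
      show "0 < \<delta>" using \<eta> q by (simp add: \<delta>_def)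
      have "\<delta> + 16 * \<delta> / (\<epsilon> / 2)\<^sup>2 = \<delta> * q"
        by (simp add: q_def power2_eq_square algebra_simps)
      also have "\<dots> = \<eta> / 4" using q by (simp add: \<delta>_def)
      finally show "\<delta> + 16 * \<delta> / (\<epsilon> / 2)\<^sup>2 = \<eta> / 4" .
    qed
    have "0 < \<eta> / 4" using \<eta> by simp
    from order_tendstoD(2)[OF D0 this] order_tendstoD(2)[OF E0[OF \<delta>(1)] this]
    show "eventually (\<lambda>N. dist (prob (bad_euler T \<epsilon> N)) 0 < \<eta>) sequentially"
      using eventually_gt_at_top[of "0::nat"]
    proof eventually_elim
      case (elim N)
      obtain A where A: "A \<in> sets P" "prob A \<le> prob {w \<in> space P. E N w > ennreal \<delta>} + \<delta> + 16 * \<delta> / (\<epsilon> / 2)\<^sup>2"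
        "\<And>w t. w \<in> space P \<Longrightarrow> t \<in> grid T N ` {..N} \<Longrightarrow> t < \<rho> w \<Longrightarrow>
          norm (simple_ito_integral W N (grid T N) (\<lambda>j. act \<sigma> (grid T N j)) t w - J t w) > \<epsilon> / 2 \<Longrightarrow> w \<in> A"
      proof (rule simple_vs_ito_integral[OF T0 J[OF T0], of "grid T N ` {..N}" J N "grid T N"
            "\<lambda>j. act \<sigma> (grid T N j)" "E N" "\<lambda>t w. t < \<rho> w" "\<epsilon> / 2" \<delta>])
        show "finite (grid T N ` {..N})" by simp
        show "grid T N ` {..N} \<subseteq> {0..T}"
          using grid_nonneg[OF T0] grid_le[OF T0] by auto
        show "has_ito_integral P F W H t (J t)" if "t \<in> grid T N ` {..N}" for t
          using that grid_nonneg[OF T0] by (intro J) auto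
        show "simple_integrand F N (grid T N) (\<lambda>j. act \<sigma> (grid T N j))"
          by (rule simple_integrand_grid[OF T0])
        show "E N \<in> borel_measurable P" by (rule Em)
        show "energy t (?V N) H w \<le> E N w" if "w \<in> space P" "t \<in> grid T N ` {..N}" "t < \<rho> w" for w t
          using that by (rule EH)
        show "0 < \<epsilon> / 2" by (rule e2)
        show "0 < \<delta>" by (rule \<delta>(1))
      qed blast
      have "bad_euler T \<epsilon> N \<subseteq> A \<union> D N"
      proof
        fix w assume "w \<in> bad_euler T \<epsilon> N"
        then obtain l where w: "w \<in> space P" and l: "l \<le> N" "grid T N l < \<rho> w"
          "norm (euler T N l w - X (grid T N l) w) > \<epsilon>"
          by (auto simp: bad_euler_def)
        let ?t = "grid T N l"
        have e: "euler T N l w - X ?t w = ((x0 + drift_sum T N l w + J ?t w) - X ?t w) +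
          (simple_ito_integral W N (grid T N) (\<lambda>j. act \<sigma> (grid T N j)) ?t w - J ?t w)"
          unfolding simple_ito_integral_grid[OF T0 l(1)] by (simp add: euler_def)
        show "w \<in> A \<union> D N"
        proof (cases "norm ((x0 + drift_sum T N l w + J ?t w) - X ?t w) > \<epsilon> / 2")
          case True
          then show ?thesis using w l by (auto simp: D_def)
        next
          case False
          then have "norm (simple_ito_integral W N (grid T N) (\<lambda>j. act \<sigma> (grid T N j)) ?t w - J ?t w) > \<epsilon> / 2"
            using l(3) e norm_triangle_ineq[of "(x0 + drift_sum T N l w + J ?t w) - X ?t w"
              "simple_ito_integral W N (grid T N) (\<lambda>j. act \<sigma> (grid T N j)) ?t w - J ?t w"] by simp
          then show ?thesis using A(3)[OF w _ l(2)] l(1) by auto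
        qed
      qed
      then have "prob (bad_euler T \<epsilon> N) \<le> prob (A \<union> D N)"
        by (rule finite_measure_mono) (intro sets.Un A(1) Dm)
      also have "\<dots> \<le> prob A + prob (D N)"
        by (intro measure_Un_le A(1) Dm)
      finally show ?case
        using A(2) \<delta>(2) elim \<eta> by simp
    qed
  qed
qed

section \<open>Truncation of the scheme\<close>

definition bad_increment :: "real \<Rightarrow> real \<Rightarrow> nat \<Rightarrow> 'w set" where
  "bad_increment T \<epsilon> N = {w \<in> space P. \<exists>j<N. norm (W (grid T N (Suc j)) w - W (grid T N j) w) > \<epsilon>}"

lemma bad_increment_measurable:
  assumes T: "0 \<le> T"
  shows "bad_increment T \<epsilon> N \<in> sets P"
proof -
  have [measurable]: "W (grid T N j) \<in> borel_measurable P" for j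
    by (intro W_measurable_P grid_nonneg[OF T])
  have "{w \<in> space P. \<exists>j\<in>{..<N}. norm (W (grid T N (Suc j)) w - W (grid T N j) w) > \<epsilon>} \<in> sets P"
    by measurable
  then show ?thesis by (simp only: bad_increment_def Bex_def lessThan_iff)
qed

text \<open>Almost every path of \<open>W\<close> is uniformly continuous on \<open>{0..T}\<close>,
  so all its increments on a fine grid are small at once.\<close>

lemma bad_increment_tendsto:
  assumes T: "0 < T" and \<epsilon>: "0 < \<epsilon>"
  shows "(\<lambda>N. prob (bad_increment T \<epsilon> N)) \<longlonglongrightarrow> 0"
proof (rule prob_tendsto_0)
  have T0: "0 \<le> T" using T by simp
  show "bad_increment T \<epsilon> N \<in> sets P" for N by (rule bad_increment_measurable[OF T0])
  show "AE w in P. eventually (\<lambda>N. w \<notin> bad_increment T \<epsilon> N) sequentially"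
    using W_cont
  proof eventually_elim
    case (elim w)
    then have "continuous_on {0..T} (\<lambda>t. W t w)"
      by (rule continuous_on_subset) auto
    then have "uniformly_continuous_on {0..T} (\<lambda>t. W t w)"
      by (intro compact_uniformly_continuous) auto
    then obtain d where d: "0 < d" "\<And>s s'. s \<in> {0..T} \<Longrightarrow> s' \<in> {0..T} \<Longrightarrow> dist s' s < d \<Longrightarrow> dist (W s' w) (W s w) < \<epsilon>"
      unfolding uniformly_continuous_on_def using \<epsilon> by metis
    have "(\<lambda>N. T / real N) \<longlonglongrightarrow> 0" by (rule lim_const_over_n)
    from order_tendstoD(2)[OF this d(1)] show ?case
    proof eventually_elim
      case (elim N)
      have *: "norm (W (grid T N (Suc j)) w - W (grid T N j) w) \<le> \<epsilon>" if j: "j < N" for j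
      proof -
        have "dist (grid T N (Suc j)) (grid T N j) < d"
          using elim T by (simp add: dist_real_def grid_Suc)
        then have "dist (W (grid T N (Suc j)) w) (W (grid T N j) w) < \<epsilon>"
          using grid_nonneg[OF T0] grid_le[OF T0] j by (intro d(2)) auto
        then show ?thesis by (simp add: dist_norm)
      qed
      show ?case
      proof
        assume "w \<in> bad_increment T \<epsilon> N"
        then obtain j where "j < N" "norm (W (grid T N (Suc j)) w - W (grid T N j) w) > \<epsilon>"
          unfolding bad_increment_def by blast
        with *[of j] show False by simp
      qed
    qed
  qed
qed

text \<open>The scheme \<open>euler\<close> with its steps cut off. All its values are bounded, so that expectations exist,
  and it differs from \<open>euler\<close> only with small probability.\<close>

primrec teuler :: "real \<Rightarrow> nat \<Rightarrow> nat \<Rightarrow> 'w \<Rightarrow> real ^ 'n" where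
  "teuler T N 0 w = x0"
| "teuler T N (Suc j) w = teuler T N j w +
    (if grid T N j < \<rho> w \<and> norm (teuler T N j w) \<le> K + 1 \<and> norm (W (grid T N (Suc j)) w - W (grid T N j) w) \<le> 1
     then (T / real N) *\<^sub>R b (X (grid T N j) w) + \<sigma> (X (grid T N j) w) *v (W (grid T N (Suc j)) w - W (grid T N j) w)
     else 0)"

lemma teuler_measurable:
  assumes T: "0 \<le> T"
  shows "teuler T N j \<in> borel_measurable (F (grid T N j))"
proof (induction j)
  case 0
  show ?case by simp
next
  case (Suc j)
  let ?t = "grid T N j" and ?u = "grid T N (Suc j)"
  have tu: "0 \<le> ?t" "?t \<le> ?u" using grid_nonneg[OF T] grid_mono[OF T, of j "Suc j" N] by auto
  have [measurable]: "teuler T N j \<in> borel_measurable (F ?u)"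
    using Suc tu(2) by (rule measurable_F_mono)
  have [measurable]: "W ?t \<in> borel_measurable (F ?u)" "W ?u \<in> borel_measurable (F ?u)"
    using tu by (auto intro!: W_measurable)
  have [measurable]: "act b ?t \<in> borel_measurable (F ?u)" "act \<sigma> ?t \<in> borel_measurable (F ?u)"
    using measurable_F_mono[OF act_measurable[OF b_cont tu(1)] tu(2)]
      measurable_F_mono[OF act_measurable[OF \<sigma>_cont tu(1)] tu(2)] by auto
  have "{w \<in> space (F ?u). ?t < \<rho> w} \<in> sets (F ?u)"
    using \<rho>_stop[OF tu(1)] sets_F_mono[OF tu(2)] by auto
  then have [measurable]: "Measurable.pred (F ?u) (\<lambda>w. ?t < \<rho> w)"
    by (simp add: pred_def)
  have "(\<lambda>w. teuler T N j w + (if ?t < \<rho> w \<and> norm (teuler T N j w) \<le> K + 1 \<and> norm (W ?u w - W ?t w) \<le> 1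
     then (T / real N) *\<^sub>R act b ?t w + act \<sigma> ?t w *v (W ?u w - W ?t w) else 0)) \<in> borel_measurable (F ?u)"
    by measurable
  moreover have "teuler T N (Suc j) = (\<lambda>w. teuler T N j w + (if ?t < \<rho> w \<and> norm (teuler T N j w) \<le> K + 1 \<and> norm (W ?u w - W ?t w) \<le> 1
     then (T / real N) *\<^sub>R act b ?t w + act \<sigma> ?t w *v (W ?u w - W ?t w) else 0))"
    by (auto simp: act_def)
  ultimately show ?case by simp
qed

lemma step_bound:
  assumes w: "w \<in> space P" and t: "0 \<le> t" "t < \<rho> w" and h: "0 \<le> h"
  shows "norm (h *\<^sub>R b (X t w) + \<sigma> (X t w) *v d) \<le> K * h + K * norm d"
proof -
  have "norm (h *\<^sub>R b (X t w)) \<le> K * h"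
    using K(3)[OF X_C[OF w t]] h by (simp add: mult.commute mult_left_mono)
  moreover have "norm (\<sigma> (X t w) *v d) \<le> K * norm d"
    using norm_matrix_vector_mult_le[of "\<sigma> (X t w)" d] K(4)[OF X_C[OF w t]]
    by (meson mult_right_mono norm_ge_zero order_trans)
  ultimately show ?thesis by (rule norm_triangle_le[OF add_mono])
qed

text \<open>A step starts only from norm at most \<open>K + 1\<close>; since the step length and the
  increment of \<open>W\<close> are at most 1, its size is at most \<open>2 * K\<close>.\<close>

lemma teuler_bound:
  assumes T: "0 \<le> T" "T / real N \<le> 1" and w: "w \<in> space P"
  shows "norm (teuler T N j w) \<le> 3 * K + 1"
proof (induction j)
  case 0
  then show ?case using K(1) K(2)[OF C(2)] by simp
next
  case (Suc j)
  show ?case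
  proof (cases "grid T N j < \<rho> w \<and> norm (teuler T N j w) \<le> K + 1 \<and> norm (W (grid T N (Suc j)) w - W (grid T N j) w) \<le> 1")
    case True
    let ?d = "W (grid T N (Suc j)) w - W (grid T N j) w"
    let ?s = "(T / real N) *\<^sub>R b (X (grid T N j) w) + \<sigma> (X (grid T N j) w) *v ?d"
    have "norm ?s \<le> K * (T / real N) + K * norm ?d"
      using True T by (intro step_bound[OF w grid_nonneg]) auto
    also have "\<dots> \<le> K * 1 + K * 1"
      using True T K(1) by (intro add_mono mult_left_mono) auto
    finally have s: "norm ?s \<le> 2 * K" by simp
    have "norm (teuler T N j w) \<le> K + 1" using True by simp
    then have "norm (teuler T N j w + ?s) \<le> (K + 1) + 2 * K"
      using s by (rule norm_triangle_le[OF add_mono])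
    then show ?thesis using True by simp
  next
    case False
    then show ?thesis using Suc by auto
  qed
qed

text \<open>At index \<open>Suc j\<close> the grid times number 0 to j have been inspected. The
  construction is measurable without evaluating X at the random time \<open>\<rho>\<close> and forms
  the bridge from the scheme to the stopped process.\<close>

primrec last_active :: "real \<Rightarrow> nat \<Rightarrow> nat \<Rightarrow> 'w \<Rightarrow> real ^ 'n" where
  "last_active T N 0 w = x0"
| "last_active T N (Suc j) w = (if grid T N j < \<rho> w then X (grid T N j) w else last_active T N j w)"

lemma last_active_measurable:
  assumes T: "0 \<le> T"
  shows "last_active T N j \<in> borel_measurable P"
proof (induction j)
  case 0
  show ?case by simp
next
  case (Suc j)
  note [measurable] = Suc
  have [measurable]: "act (\<lambda>x. x) (grid T N j) \<in> borel_measurable P"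
    by (rule act_measurable_P[OF continuous_on_id grid_nonneg[OF T]])
  have "{w \<in> space P. grid T N j < \<rho> w} \<in> sets P"
    using \<rho>_stop[OF grid_nonneg[OF T]] sets_F_subset by auto
  then have [measurable]: "Measurable.pred P (\<lambda>w. grid T N j < \<rho> w)" by (simp add: pred_def)
  have "(\<lambda>w. if grid T N j < \<rho> w then act (\<lambda>x. x) (grid T N j) w else last_active T N j w) \<in> borel_measurable P"
    by measurable
  moreover have "last_active T N (Suc j) = (\<lambda>w. if grid T N j < \<rho> w then act (\<lambda>x. x) (grid T N j) w else last_active T N j w)"
    by (auto simp: act_def)
  ultimately show ?case by simp
qed

text \<open>Before \<open>\<rho>\<close> the scheme is within \<epsilon> \<le> 1 of a point of
  \<open>C\<close>, hence of norm at most \<open>K + 1\<close>, and the increments of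
  \<open>W\<close> are at most 1: no cutoff acts. The last step begins at the last grid time before
  \<open>\<rho>\<close>, and afterwards both schemes rest. That step has size at most
  \<open>K * (T / real N) + K * \<epsilon>\<close>, which is added to the distance \<epsilon> at its
  start.\<close>

lemma teuler_eq_euler:
  assumes T: "0 < T" and w: "w \<in> space P" and \<epsilon>: "0 < \<epsilon>" "\<epsilon> \<le> 1"
    and g1: "w \<notin> bad_euler T \<epsilon> N" and g2: "w \<notin> bad_increment T \<epsilon> N"
  shows "l \<le> N \<Longrightarrow> teuler T N l w = euler T N l w"
    and "l \<le> N \<Longrightarrow> norm (euler T N l w - last_active T N (Suc l) w) \<le> \<epsilon> + K * (T / real N) + K * \<epsilon>"
proof -
  have T0: "0 \<le> T" using T by simp
  have nn: "0 \<le> K * (T / real N)" "0 \<le> K * \<epsilon>" "0 \<le> \<epsilon>"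
    using K(1) T \<epsilon> by auto
  have cl: "norm (euler T N l w - X (grid T N l) w) \<le> \<epsilon>" if "l \<le> N" "grid T N l < \<rho> w" for l
    using g1 w that by (auto simp: bad_euler_def not_less)
  have inc: "norm (W (grid T N (Suc j)) w - W (grid T N j) w) \<le> \<epsilon>" if "j < N" for j
  proof -
    have "\<not> norm (W (grid T N (Suc j)) w - W (grid T N j) w) > \<epsilon>"
      using g2 w that unfolding bad_increment_def by blast
    then show ?thesis by simp
  qed
  have es: "euler T N (Suc l) w = euler T N l w + (if grid T N l < \<rho> w
     then (T / real N) *\<^sub>R b (X (grid T N l) w) + \<sigma> (X (grid T N l) w) *v (W (grid T N (Suc l)) w - W (grid T N l) w) else 0)" for l
    by (simp add: euler_def drift_sum_def isum_Suc act_def)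
  have e0: "euler T N 0 w = x0" by (simp add: euler_def drift_sum_def)
  show "teuler T N l w = euler T N l w" if "l \<le> N"
    using that
  proof (induction l)
    case 0
    then show ?case by (simp add: e0)
  next
    case (Suc l)
    then have IH: "teuler T N l w = euler T N l w" by simp
    show ?case
    proof (cases "grid T N l < \<rho> w")
      case True
      have "norm (euler T N l w) \<le> norm (euler T N l w - X (grid T N l) w) + norm (X (grid T N l) w)"
        using norm_triangle_ineq[of "euler T N l w - X (grid T N l) w" "X (grid T N l) w"] by simp
      also have "\<dots> \<le> 1 + K"
        using cl[OF _ True] Suc.prems \<epsilon> K(2)[OF X_C[OF w grid_nonneg[OF T0] True]] by (intro add_mono) auto
      finally have "norm (euler T N l w) \<le> K + 1" by simp
      moreover have "norm (W (grid T N (Suc l)) w - W (grid T N l) w) \<le> 1"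
        using inc[of l] Suc.prems \<epsilon> by simp
      ultimately show ?thesis using True IH by (simp add: es)
    qed (use IH in \<open>simp add: es\<close>)
  qed
  show "norm (euler T N l w - last_active T N (Suc l) w) \<le> \<epsilon> + K * (T / real N) + K * \<epsilon>" if "l \<le> N"
    using that
  proof (induction l)
    case 0
    show ?case
    proof (cases "grid T N 0 < \<rho> w")
      case True
      then show ?thesis using cl[of 0] nn by simp
    next
      case False
      then show ?thesis using nn by (simp add: e0)
    qed
  next
    case (Suc l)
    show ?case
    proof (cases "grid T N (Suc l) < \<rho> w")
      case True
      then show ?thesis using cl[OF Suc.prems True] nn by simp
    next
      case False
      then have la: "last_active T N (Suc (Suc l)) w = last_active T N (Suc l) w" by simp
      show ?thesis
      proof (cases "grid T N l < \<rho> w")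
        case True
        let ?s = "(T / real N) *\<^sub>R b (X (grid T N l) w) + \<sigma> (X (grid T N l) w) *v (W (grid T N (Suc l)) w - W (grid T N l) w)"
        have "norm ?s \<le> K * (T / real N) + K * norm (W (grid T N (Suc l)) w - W (grid T N l) w)"
          using T by (intro step_bound[OF w grid_nonneg[OF T0] True]) auto
        also have "\<dots> \<le> K * (T / real N) + K * \<epsilon>"
          using inc[of l] Suc.prems K(1) by (intro add_left_mono mult_left_mono) auto
        finally have s: "norm ?s \<le> K * (T / real N) + K * \<epsilon>" .
        have "euler T N (Suc l) w - last_active T N (Suc (Suc l)) w = (euler T N l w - X (grid T N l) w) + ?s"
          unfolding la using True by (simp add: es)
        moreover have "norm ((euler T N l w - X (grid T N l) w) + ?s) \<le> \<epsilon> + (K * (T / real N) + K * \<epsilon>)"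
          by (rule norm_triangle_le[OF add_mono[OF cl[OF _ True] s]]) (use Suc.prems in simp)
        ultimately show ?thesis by simp
      next
        case False
        then have "euler T N (Suc l) w = euler T N l w" by (simp add: es)
        then show ?thesis unfolding la using Suc by simp
      qed
    qed
  qed
qed

text \<open>The stopped process at time T. For \<open>\<rho> w = 0\<close> the value is set to
  \<open>x0\<close>, because the path is placed in \<open>C\<close> only before
  \<open>\<rho>\<close> and starts at \<open>x0\<close> only almost surely. In this form the stopped
  process lies in \<open>C\<close> for every w.\<close>

definition final_value :: "real \<Rightarrow> 'w \<Rightarrow> real ^ 'n" where
  "final_value T w = (if 0 < \<rho> w then X (min T (\<rho> w)) w else x0)"

text \<open>\<open>C\<close> is closed and the path is continuous up to \<open>\<rho>\<close>, so
  the position at \<open>\<rho>\<close> itself is a limit of positions in \<open>C\<close>.\<close>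

lemma X_mem_C:
  assumes w: "w \<in> space P" and t: "0 \<le> t" "t \<le> \<rho> w" "0 < \<rho> w"
  shows "X t w \<in> C"
proof (cases "t < \<rho> w")
  case True
  then show ?thesis using X_C[OF w t(1)] by simp
next
  case False
  then have t: "t = \<rho> w" using t by simp
  define s where "s n = \<rho> w * (1 - 1 / real (Suc n))" for n
  have s: "0 \<le> s n" "s n < \<rho> w" for n
  proof -
    have "1 / real (Suc n) \<le> 1" "0 < 1 / real (Suc n)" by (simp_all add: field_simps)
    then show "0 \<le> s n" using \<open>0 < \<rho> w\<close> by (simp add: s_def)
    have "\<rho> w * (1 - 1 / real (Suc n)) < \<rho> w * 1"
      using \<open>0 < \<rho> w\<close> \<open>0 < 1 / real (Suc n)\<close> by (intro mult_strict_left_mono) linarith+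
    then show "s n < \<rho> w" by (simp add: s_def)
  qed
  have "s \<longlonglongrightarrow> \<rho> w * (1 - 0)"
    unfolding s_def by (intro tendsto_intros LIMSEQ_inverse_real_of_nat[unfolded inverse_eq_divide])
  then have "s \<longlonglongrightarrow> \<rho> w" by simp
  then have "(\<lambda>n. X (s n) w) \<longlonglongrightarrow> X (\<rho> w) w"
    by (rule continuous_on_tendsto_compose[OF X_cont[OF w]])
       (use s \<open>0 < \<rho> w\<close> in \<open>auto intro!: always_eventually less_imp_le\<close>)
  then have "X (\<rho> w) w \<in> C"
    by (rule closed_sequentially[OF compact_imp_closed[OF C(1)] X_C[OF w s]])
  then show ?thesis by (simp add: t)
qed

lemma final_value_mem_C:
  assumes "w \<in> space P" "0 \<le> T"
  shows "final_value T w \<in> C"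
  using X_mem_C[OF assms(1), of "min T (\<rho> w)"] C(2) assms(2) by (auto simp: final_value_def)

text \<open>The last active grid time is within one mesh of \<open>min T (\<rho> w)\<close>: either
  it is T, or the next grid time is already at or past \<open>\<rho>\<close>.\<close>

lemma last_active_tendsto:
  assumes T: "0 < T" and w: "w \<in> space P"
  shows "(\<lambda>N. last_active T N (Suc N) w) \<longlonglongrightarrow> final_value T w"
proof (cases "0 < \<rho> w")
  case False
  have T0: "0 \<le> T" using T by simp
  have "last_active T N l w = x0" for N l
  proof (induction l)
    case (Suc l)
    have "\<not> grid T N l < \<rho> w" using False grid_nonneg[OF T0, of N l] by simp
    then show ?case using Suc by simp
  qed simp
  then show ?thesis using False by (simp add: final_value_def del: last_active.simps)
next
  case True
  have T0: "0 \<le> T" using T by simp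
  have ex: "\<exists>i\<le>l. last_active T N (Suc l) w = X (grid T N i) w \<and> grid T N i < \<rho> w \<and> (i = l \<or> \<rho> w \<le> grid T N (Suc i))" for N l
  proof (induction l)
    case 0
    then show ?case using True by simp
  next
    case (Suc l)
    then obtain i where i: "i \<le> l" "last_active T N (Suc l) w = X (grid T N i) w" "grid T N i < \<rho> w"
      "i = l \<or> \<rho> w \<le> grid T N (Suc i)" by blast
    show ?case
    proof (cases "grid T N (Suc l) < \<rho> w")
      case True
      then show ?thesis by (intro exI[of _ "Suc l"]) simp
    next
      case False
      then show ?thesis using i by (intro exI[of _ i]) auto
    qed
  qed
  have "\<forall>N. \<exists>\<tau>. 0 < N \<longrightarrow> last_active T N (Suc N) w = X \<tau> w \<and> 0 \<le> \<tau> \<and> \<tau> \<le> min T (\<rho> w) \<and> min T (\<rho> w) - T / real N \<le> \<tau>"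
  proof
    fix N
    obtain i where i: "i \<le> N" "last_active T N (Suc N) w = X (grid T N i) w" "grid T N i < \<rho> w"
      "i = N \<or> \<rho> w \<le> grid T N (Suc i)" using ex[of N N] by blast
    have "0 \<le> T / real N" using T by simp
    note hn = this
    have "0 < N \<longrightarrow> min T (\<rho> w) - T / real N \<le> grid T N i"
    proof
      assume N: "0 < N"
      from i(4) show "min T (\<rho> w) - T / real N \<le> grid T N i"
      proof
        assume iN: "i = N"
        show ?thesis
          unfolding iN grid_N[OF N] using hn min.cobounded1[of T "\<rho> w"] by linarith
      next
        assume "\<rho> w \<le> grid T N (Suc i)"
        then show ?thesis
          using min.cobounded2[of T "\<rho> w"] grid_Suc[of T N i] by linarith
      qed
    qed
    then show "\<exists>\<tau>. 0 < N \<longrightarrow> last_active T N (Suc N) w = X \<tau> w \<and> 0 \<le> \<tau> \<and> \<tau> \<le> min T (\<rho> w) \<and> min T (\<rho> w) - T / real N \<le> \<tau>"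
      using i(2,3) grid_le[OF T0 i(1)] grid_nonneg[OF T0] by (intro exI[of _ "grid T N i"]) auto
  qed
  then obtain \<tau> where \<tau>: "\<And>N. 0 < N \<Longrightarrow> last_active T N (Suc N) w = X (\<tau> N) w \<and> 0 \<le> \<tau> N \<and> \<tau> N \<le> min T (\<rho> w) \<and> min T (\<rho> w) - T / real N \<le> \<tau> N"
    by metis
  have ev: "eventually (\<lambda>N::nat. 0 < N) sequentially" by (rule eventually_gt_at_top)
  have lim: "\<tau> \<longlonglongrightarrow> min T (\<rho> w)"
  proof (rule real_tendsto_sandwich[where f = "\<lambda>N. min T (\<rho> w) - T / real N" and h = "\<lambda>_. min T (\<rho> w)"])
    show "(\<lambda>N. min T (\<rho> w) - T / real N) \<longlonglongrightarrow> min T (\<rho> w)"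
      using tendsto_diff[OF tendsto_const[of "min T (\<rho> w)"] lim_const_over_n[of T]] by simp
    show "eventually (\<lambda>N. min T (\<rho> w) - T / real N \<le> \<tau> N) sequentially" "eventually (\<lambda>N. \<tau> N \<le> min T (\<rho> w)) sequentially"
      using ev by (eventually_elim, use \<tau> in blast)+
  qed simp
  have "(\<lambda>N. X (\<tau> N) w) \<longlonglongrightarrow> X (min T (\<rho> w)) w"
  proof (rule continuous_on_tendsto_compose[OF X_cont[OF w] lim])
    show "eventually (\<lambda>N. \<tau> N \<in> {0..\<rho> w}) sequentially"
      using ev
    proof eventually_elim
      case (elim N)
      then show ?case using \<tau>[OF elim] by auto
    qed
  qed (use True T in auto)
  then have "(\<lambda>N. last_active T N (Suc N) w) \<longlonglongrightarrow> X (min T (\<rho> w)) w"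
  proof (rule Lim_transform_eventually)
    show "eventually (\<lambda>N. X (\<tau> N) w = last_active T N (Suc N) w) sequentially"
      using ev
    proof eventually_elim
      case (elim N)
      show ?case using \<tau>[OF elim] by (simp del: last_active.simps)
    qed
  qed
  then show ?thesis using True by (simp add: final_value_def del: last_active.simps)
qed

lemma final_value_measurable:
  assumes T: "0 < T"
  shows "final_value T \<in> borel_measurable P"
proof (rule borel_measurable_LIMSEQ_metric)
  show "last_active T N (Suc N) \<in> borel_measurable P" for N
    using T by (intro last_active_measurable) simp
qed (rule last_active_tendsto[OF T])

text \<open>Off this set, and for \<epsilon> at most 1, the truncation is invisible, the scheme
  follows the path before \<open>\<rho>\<close>, and it ends near the stopped position.\<close>

definition bad :: "real \<Rightarrow> real \<Rightarrow> nat \<Rightarrow> 'w set" where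
  "bad T \<epsilon> N = bad_euler T \<epsilon> N \<union> bad_increment T \<epsilon> N \<union>
    {w \<in> space P. norm (last_active T N (Suc N) w - final_value T w) > \<epsilon>}"

lemma bad_measurable:
  assumes T: "0 < T"
  shows "bad T \<epsilon> N \<in> sets P"
proof -
  have T0: "0 \<le> T" using T by simp
  have [measurable]: "last_active T N (Suc N) \<in> borel_measurable P" "final_value T \<in> borel_measurable P"
    by (rule last_active_measurable[OF T0], rule final_value_measurable[OF T])
  have "bad_euler T \<epsilon> N \<in> sets P"
    unfolding bad_euler_def by (rule grid_event_measurable[OF T0 euler_measurable[OF T0]])
  moreover have "bad_increment T \<epsilon> N \<in> sets P"
    by (rule bad_increment_measurable[OF T0])
  moreover have "{w \<in> space P. norm (last_active T N (Suc N) w - final_value T w) > \<epsilon>} \<in> sets P"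
    by measurable
  ultimately show ?thesis unfolding bad_def by (intro sets.Un)
qed

lemma bad_tendsto:
  assumes T: "0 < T" and \<epsilon>: "0 < \<epsilon>"
  shows "(\<lambda>N. prob (bad T \<epsilon> N)) \<longlonglongrightarrow> 0"
proof -
  have T0: "0 \<le> T" using T by simp
  let ?L = "\<lambda>N. {w \<in> space P. norm (last_active T N (Suc N) w - final_value T w) > \<epsilon>}"
  have ml: "last_active T N (Suc N) \<in> borel_measurable P" for N
    by (rule last_active_measurable[OF T0])
  have mL: "?L N \<in> sets P" for N
    using ml[of N] final_value_measurable[OF T] by measurable
  have mE: "bad_euler T \<epsilon> N \<in> sets P" for N
    unfolding bad_euler_def by (rule grid_event_measurable[OF T0 euler_measurable[OF T0]])
  have mI: "bad_increment T \<epsilon> N \<in> sets P" for N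
    by (rule bad_increment_measurable[OF T0])
  have L: "(\<lambda>N. prob (?L N)) \<longlonglongrightarrow> 0"
  proof (rule prob_tendsto_0[OF mL])
    show "AE w in P. eventually (\<lambda>N. w \<notin> ?L N) sequentially"
      using AE_space
    proof eventually_elim
      case (elim w)
      from tendstoD[OF last_active_tendsto[OF T elim] \<epsilon>] show ?case
        by eventually_elim (simp add: dist_norm del: last_active.simps)
    qed
  qed
  have "(\<lambda>N. prob (bad_euler T \<epsilon> N) + prob (bad_increment T \<epsilon> N) + prob (?L N)) \<longlonglongrightarrow> 0 + 0 + 0"
    by (intro tendsto_add bad_euler_tendsto[OF T \<epsilon>] bad_increment_tendsto[OF T \<epsilon>] L)
  then have lim: "(\<lambda>N. prob (bad_euler T \<epsilon> N) + prob (bad_increment T \<epsilon> N) + prob (?L N)) \<longlonglongrightarrow> 0"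
    by simp
  show ?thesis
  proof (rule real_tendsto_sandwich[OF _ _ tendsto_const lim])
    have "prob (bad T \<epsilon> N) \<le> prob (bad_euler T \<epsilon> N) + prob (bad_increment T \<epsilon> N) + prob (?L N)" for N
    proof -
      have "prob (bad T \<epsilon> N) \<le> prob (bad_euler T \<epsilon> N \<union> bad_increment T \<epsilon> N) + prob (?L N)"
        unfolding bad_def by (intro measure_Un_le sets.Un mE mI mL)
      also have "prob (bad_euler T \<epsilon> N \<union> bad_increment T \<epsilon> N) \<le> prob (bad_euler T \<epsilon> N) + prob (bad_increment T \<epsilon> N)"
        by (intro measure_Un_le mE mI)
      finally show ?thesis by simp
    qed
    then show "eventually (\<lambda>N. prob (bad T \<epsilon> N) \<le> prob (bad_euler T \<epsilon> N) + prob (bad_increment T \<epsilon> N) + prob (?L N)) sequentially"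
      by (rule always_eventually[OF allI])
  qed simp
qed

lemma teuler_good:
  assumes T: "0 < T" and w: "w \<in> space P - bad T \<epsilon> N" and \<epsilon>: "0 < \<epsilon>" "\<epsilon> \<le> 1"
  shows "l \<le> N \<Longrightarrow> grid T N l < \<rho> w \<Longrightarrow> norm (teuler T N l w - X (grid T N l) w) \<le> \<epsilon>"
    and "norm (teuler T N N w - final_value T w) \<le> 2 * \<epsilon> + K * (T / real N) + K * \<epsilon>"
proof -
  have w': "w \<in> space P" "w \<notin> bad_euler T \<epsilon> N" "w \<notin> bad_increment T \<epsilon> N"
    "norm (last_active T N (Suc N) w - final_value T w) \<le> \<epsilon>"
    using w by (auto simp: bad_def not_less)
  note te = teuler_eq_euler[OF T w'(1) \<epsilon> w'(2,3)]
  show "norm (teuler T N l w - X (grid T N l) w) \<le> \<epsilon>" if "l \<le> N" "grid T N l < \<rho> w"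
    using w'(1,2) te(1)[OF that(1)] that by (auto simp: bad_euler_def not_less)
  have "norm (teuler T N N w - final_value T w) \<le>
    norm (teuler T N N w - last_active T N (Suc N) w) + norm (last_active T N (Suc N) w - final_value T w)"
    by (metis dist_norm dist_triangle)
  also have "\<dots> \<le> (\<epsilon> + K * (T / real N) + K * \<epsilon>) + \<epsilon>"
    using te[of N] w'(4) by (intro add_mono) (simp_all del: last_active.simps)
  finally show "norm (teuler T N N w - final_value T w) \<le> 2 * \<epsilon> + K * (T / real N) + K * \<epsilon>"
    by simp
qed

end

section \<open>Taylor expansion of twice continuously differentiable functions\<close>

lemma C2_imp_C1: "C2_fun f \<Longrightarrow> C1_fun f"
  by (simp add: C2_fun_def)

lemma C1_has_derivative:
  assumes "C1_fun f"
  shows "(f has_derivative (\<lambda>d. gradient f x \<bullet> d)) (at x)"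
proof -
  have D: "(f has_derivative frechet_derivative f (at x)) (at x)"
    using assms by (simp add: C1_fun_def frechet_derivative_works)
  interpret bounded_linear "frechet_derivative f (at x)"
    using D by (rule has_derivative_bounded_linear)
  have "frechet_derivative f (at x) d = gradient f x \<bullet> d" for d
  proof -
    have "d = (\<Sum>i\<in>UNIV. d $ i *\<^sub>R axis i 1)"
      using basis_expansion[of d] by (simp add: scalar_mult_eq_scaleR)
    then have "frechet_derivative f (at x) d = frechet_derivative f (at x) (\<Sum>i\<in>UNIV. d $ i *\<^sub>R axis i 1)"
      by simp
    also have "\<dots> = (\<Sum>i\<in>UNIV. d $ i * partial_deriv i f x)"
      by (simp add: sum scaleR partial_deriv_def)
    also have "\<dots> = gradient f x \<bullet> d"
      by (simp add: gradient_def inner_vec_def mult.commute)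
    finally show ?thesis .
  qed
  then have "frechet_derivative f (at x) = (\<lambda>d. gradient f x \<bullet> d)" by (rule ext)
  with D show ?thesis by simp
qed

lemma C1_continuous: "C1_fun f \<Longrightarrow> continuous_on UNIV f"
  by (rule differentiable_imp_continuous_on) (auto simp: C1_fun_def differentiable_on_def intro: differentiable_at_withinI)

lemma gradient_continuous: "C1_fun f \<Longrightarrow> continuous_on UNIV (gradient f)"
  unfolding gradient_def[abs_def] by (intro continuous_on_vec_lambda) (simp add: C1_fun_def)

lemma hessian_continuous: "C2_fun f \<Longrightarrow> continuous_on UNIV (hessian f)"
  unfolding hessian_def[abs_def] by (intro continuous_on_vec_lambda) (simp add: C1_fun_def C2_fun_def)

lemma generator_continuous:
  assumes "C2_fun f" "continuous_on UNIV b" "continuous_on UNIV \<sigma>"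
  shows "continuous_on UNIV (generator b \<sigma> f)"
  unfolding generator_def[abs_def]
  by (intro continuous_intros gradient_continuous hessian_continuous C2_imp_C1 assms)

lemma has_real_derivative_along_line:
  assumes "C1_fun f"
  shows "((\<lambda>s. f (y + s *\<^sub>R d)) has_real_derivative gradient f (y + s *\<^sub>R d) \<bullet> d) (at s)"
proof -
  have "((\<lambda>s. y + s *\<^sub>R d) has_derivative (\<lambda>h. h *\<^sub>R d)) (at s)"
    by (auto intro!: derivative_eq_intros)
  from diff_chain_at[OF this C1_has_derivative[OF assms]]
  have "((\<lambda>s. f (y + s *\<^sub>R d)) has_derivative (\<lambda>h. gradient f (y + s *\<^sub>R d) \<bullet> (h *\<^sub>R d))) (at s)"
    by (simp add: o_def)
  then show ?thesis
    by (simp add: has_field_derivative_def mult_commute_abs)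
qed

lemma C2_taylor:
  assumes f: "C2_fun f"
  obtains t where "0 < t" "t < 1"
    "f (y + d) = f y + gradient f y \<bullet> d + 1 / 2 * (d \<bullet> (hessian f (y + t *\<^sub>R d) *v d))"
proof -
  \<comment> \<open>\<open>\<phi> m\<close> is the m-th derivative of f along the line through y
    with direction d, for m at most 2; the formula is Maclaurin's for this function on the unit
    interval.\<close>
  define \<phi> where "\<phi> m s = (if m = 0 then f (y + s *\<^sub>R d) else if m = 1 then gradient f (y + s *\<^sub>R d) \<bullet> d
     else d \<bullet> (hessian f (y + s *\<^sub>R d) *v d))" for m :: nat and s :: real
  have d0: "(\<phi> 0 has_real_derivative \<phi> 1 s) (at s)" for s
    unfolding \<phi>_def using has_real_derivative_along_line[OF C2_imp_C1[OF f]] by simp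
  have d1: "(\<phi> 1 has_real_derivative \<phi> 2 s) (at s)" for s
  proof -
    have "((\<lambda>s. \<Sum>j\<in>UNIV. partial_deriv j f (y + s *\<^sub>R d) * d $ j) has_real_derivative
        (\<Sum>j\<in>UNIV. (gradient (partial_deriv j f) (y + s *\<^sub>R d) \<bullet> d) * d $ j)) (at s)"
      using f by (intro DERIV_sum DERIV_cmult_right has_real_derivative_along_line) (simp add: C2_fun_def)
    moreover have "(\<Sum>j\<in>UNIV. (gradient (partial_deriv j f) x \<bullet> d) * d $ j) = d \<bullet> (hessian f x *v d)" for x
    proof -
      have "(\<Sum>j\<in>UNIV. (gradient (partial_deriv j f) x \<bullet> d) * d $ j)
        = (\<Sum>j\<in>UNIV. \<Sum>i\<in>UNIV. d $ i * (partial_deriv i (partial_deriv j f) x * d $ j))"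
        by (simp add: gradient_def inner_vec_def sum_distrib_left sum_distrib_right mult_ac)
      also have "\<dots> = (\<Sum>i\<in>UNIV. \<Sum>j\<in>UNIV. d $ i * (partial_deriv i (partial_deriv j f) x * d $ j))"
        by (rule sum.swap)
      finally show ?thesis
        by (simp add: hessian_def matrix_vector_mult_def inner_vec_def sum_distrib_left)
    qed
    ultimately show ?thesis
      unfolding \<phi>_def by (simp add: gradient_def inner_vec_def)
  qed
  have "\<exists>t>0. t < 1 \<and> \<phi> 0 1 = (\<Sum>m<2. \<phi> m 0 / fact m * 1 ^ m) + \<phi> 2 t / fact 2 * 1 ^ 2"
  proof (rule Maclaurin)
    show "\<forall>m t. m < 2 \<and> 0 \<le> t \<and> t \<le> 1 \<longrightarrow> (\<phi> m has_real_derivative \<phi> (Suc m) t) (at t)"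
    proof (intro allI impI)
      fix m :: nat and t :: real assume "m < 2 \<and> 0 \<le> t \<and> t \<le> 1"
      then have "m = 0 \<or> m = 1" by auto
      then show "(\<phi> m has_real_derivative \<phi> (Suc m) t) (at t)"
        using d0[of t] d1[of t] by (auto simp: numeral_2_eq_2)
    qed
  qed auto
  then obtain t where "0 < t" "t < 1" "\<phi> 0 1 = (\<Sum>m<2. \<phi> m 0 / fact m * 1 ^ m) + \<phi> 2 t / fact 2 * 1 ^ 2"
    by blast
  then show ?thesis
    by (intro that[of t]) (auto simp: \<phi>_def numeral_2_eq_2)
qed

lemma quadratic_form_bound:
  fixes H :: "real ^ 'n ^ 'n"
  shows "\<bar>x \<bullet> (H *v y)\<bar> \<le> norm H * (norm x * norm y)"
proof -
  have "\<bar>x \<bullet> (H *v y)\<bar> \<le> norm x * norm (H *v y)"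
    by (rule Cauchy_Schwarz_ineq2)
  also have "\<dots> \<le> norm x * (norm H * norm y)"
    by (intro mult_left_mono norm_matrix_vector_mult_le) auto
  finally show ?thesis by (simp add: mult_ac)
qed

text \<open>The remainder contains the Hessian at an intermediate point. Uniform continuity on the
  ball of radius \<open>B + 1\<close> replaces that point by y, and \<open>r \<le> 1\<close> keeps
  the segment inside this ball.\<close>

lemma C2_taylor_remainder:
  assumes f: "C2_fun (f :: real ^ 'n \<Rightarrow> real)" and \<epsilon>: "0 < \<epsilon>"
  obtains r where "0 < r" "r \<le> 1" "\<And>y d. norm y \<le> B \<Longrightarrow> norm d \<le> r \<Longrightarrow>
    \<bar>f (y + d) - f y - gradient f y \<bullet> d - 1 / 2 * (d \<bullet> (hessian f y *v d))\<bar> \<le> \<epsilon> * (norm d)\<^sup>2"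
proof -
  have "uniformly_continuous_on (cball 0 (B + 1)) (hessian f)"
    by (intro compact_uniformly_continuous continuous_on_subset[OF hessian_continuous[OF f]]) auto
  then obtain r0 where r0: "0 < r0" "\<And>x x'. x \<in> cball 0 (B + 1) \<Longrightarrow> x' \<in> cball 0 (B + 1) \<Longrightarrow>
      dist x' x < r0 \<Longrightarrow> dist (hessian f x') (hessian f x) < \<epsilon>"
    unfolding uniformly_continuous_on_def using \<epsilon> by metis
  define r where "r = min 1 (r0 / 2)"
  have r: "0 < r" "r \<le> 1" "r < r0" using r0(1) by (auto simp: r_def)
  show ?thesis
  proof (rule that[OF r(1,2)])
    fix y d :: "real ^ 'n" assume y: "norm y \<le> B" and d: "norm d \<le> r"
    obtain t where t: "0 < t" "t < 1"
      "f (y + d) = f y + gradient f y \<bullet> d + 1 / 2 * (d \<bullet> (hessian f (y + t *\<^sub>R d) *v d))"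
      by (rule C2_taylor[OF f])
    have td: "norm (t *\<^sub>R d) \<le> r"
    proof -
      have "t * norm d \<le> 1 * norm d" using t by (intro mult_right_mono) auto
      then show ?thesis using t d by simp
    qed
    have "norm (y + t *\<^sub>R d) \<le> B + 1"
      using y td r by (intro norm_triangle_le) linarith
    then have "dist (hessian f (y + t *\<^sub>R d)) (hessian f y) < \<epsilon>"
    proof (intro r0(2))
      show "dist (y + t *\<^sub>R d) y < r0" using td r by (simp add: dist_norm)
    qed (use y in auto)
    then have nh: "norm (hessian f (y + t *\<^sub>R d) - hessian f y) \<le> \<epsilon>"
      by (simp add: dist_norm)
    have "f (y + d) - f y - gradient f y \<bullet> d - 1 / 2 * (d \<bullet> (hessian f y *v d))
      = 1 / 2 * (d \<bullet> ((hessian f (y + t *\<^sub>R d) - hessian f y) *v d))"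
      unfolding t(3) by (simp add: matrix_vector_mult_diff_rdistrib inner_diff_right algebra_simps)
    also have "\<bar>\<dots>\<bar> \<le> 1 / 2 * (norm (hessian f (y + t *\<^sub>R d) - hessian f y) * (norm d * norm d))"
      using quadratic_form_bound[of d "hessian f (y + t *\<^sub>R d) - hessian f y" d] by (simp add: abs_mult)
    also have "\<dots> \<le> 1 * (\<epsilon> * (norm d * norm d))"
      using nh \<epsilon> by (intro mult_mono) auto
    finally show "\<bar>f (y + d) - f y - gradient f y \<bullet> d - 1 / 2 * (d \<bullet> (hessian f y *v d))\<bar> \<le> \<epsilon> * (norm d)\<^sup>2"
      by (simp add: power2_eq_square)
  qed
qed

lemma two_terms_pow4: "((a::real) + b) ^ 4 \<le> 8 * (a ^ 4 + b ^ 4)"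
proof -
  have sq: "(x + y)\<^sup>2 \<le> 2 * (x\<^sup>2 + y\<^sup>2)" for x y :: real
    using zero_le_power2[of "x - y"] by (simp add: power2_eq_square algebra_simps)
  have "(a + b) ^ 4 = ((a + b)\<^sup>2)\<^sup>2" by simp
  also have "\<dots> \<le> (2 * (a\<^sup>2 + b\<^sup>2))\<^sup>2" by (intro power_mono sq) auto
  also have "\<dots> = 4 * (a\<^sup>2 + b\<^sup>2)\<^sup>2" by (simp only: power_mult_distrib) simp
  also have "\<dots> \<le> 4 * (2 * ((a\<^sup>2)\<^sup>2 + (b\<^sup>2)\<^sup>2))" by (intro mult_left_mono sq) auto
  finally show ?thesis by simp
qed

text \<open>The two error terms have different fates. Summed over all steps, the first remains of
  order \<epsilon> in expectation; the second is quadratic in h and quartic in the increment and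
  vanishes with the mesh. Increments beyond 1 and steps longer than the Taylor radius are rare and
  go into the second term, whatever their constant.\<close>

lemma euler_step_taylor:
  fixes f :: "real ^ 'n \<Rightarrow> real"
  assumes f: "C2_fun f" and K: "1 \<le> K" and \<epsilon>: "0 < \<epsilon>"
  obtains A where "0 \<le> A" "\<And>y \<beta> (S :: real ^ 'k ^ 'n) h \<Delta>.
    norm y \<le> B \<Longrightarrow> norm \<beta> \<le> K \<Longrightarrow> norm S \<le> K \<Longrightarrow> 0 \<le> h \<Longrightarrow> h \<le> 1 \<Longrightarrow>
    \<bar>(if norm \<Delta> \<le> 1 then f (y + (h *\<^sub>R \<beta> + S *v \<Delta>)) - f y else 0) -
      (h * (gradient f y \<bullet> \<beta>) + gradient f y \<bullet> (S *v \<Delta>) + 1 / 2 * ((S *v \<Delta>) \<bullet> (hessian f y *v (S *v \<Delta>))))\<bar>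
    \<le> \<epsilon> * (h + (norm \<Delta>)\<^sup>2) + A * (h\<^sup>2 + norm \<Delta> ^ 4)"
proof -
  have "compact (f ` cball 0 (B + 2 * K))" "compact (gradient f ` cball 0 B)" "compact (hessian f ` cball 0 B)"
    by (intro compact_continuous_image continuous_on_subset[OF C1_continuous[OF C2_imp_C1[OF f]]]
        continuous_on_subset[OF gradient_continuous[OF C2_imp_C1[OF f]]]
        continuous_on_subset[OF hessian_continuous[OF f]]; simp)+
  then have "bounded (f ` cball 0 (B + 2 * K))" "bounded (gradient f ` cball 0 B)" "bounded (hessian f ` cball 0 B)"
    by (intro compact_imp_bounded; simp)+
  then obtain L1 L2 L3 where L123: "\<forall>x\<in>f ` cball 0 (B + 2 * K). norm x \<le> L1" "\<forall>x\<in>gradient f ` cball 0 B. norm x \<le> L2"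
    "\<forall>x\<in>hessian f ` cball 0 B. norm x \<le> L3"
    unfolding bounded_iff by (elim exE)
  define L where "L = max 1 (max L1 (max L2 L3))"
  have L1: "1 \<le> L" by (simp add: L_def)
  have Lf: "\<bar>f y\<bar> \<le> L" if "norm y \<le> B + 2 * K" for y
  proof -
    have "norm (f y) \<le> L1" using L123(1) that by simp
    then show ?thesis by (simp add: L_def)
  qed
  have Lg: "norm (gradient f y) \<le> L" if "norm y \<le> B" for y
  proof -
    have "norm (gradient f y) \<le> L2" using L123(2) that by simp
    then show ?thesis by (simp add: L_def)
  qed
  have LH: "norm (hessian f y) \<le> L" if "norm y \<le> B" for y
  proof -
    have "norm (hessian f y) \<le> L3" using L123(3) that by simp
    then show ?thesis by (simp add: L_def)
  qed
  \<comment> \<open>Since \<open>(norm d)\<^sup>2 \<le> 2 * K\<^sup>2 * (h + (norm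
    \<Delta>)\<^sup>2)\<close>, the Taylor remainder consumes half of \<epsilon> with this
    choice.\<close>
  define \<epsilon>1 where "\<epsilon>1 = \<epsilon> / (4 * K\<^sup>2)"
  have K2: "1 \<le> K\<^sup>2" using K by simp
  have \<epsilon>1: "0 < \<epsilon>1" "\<epsilon>1 * (2 * K\<^sup>2) = \<epsilon> / 2" using \<epsilon> K by (auto simp: \<epsilon>1_def field_simps)
  obtain r where r: "0 < r" "r \<le> 1" "\<And>y d. norm y \<le> B \<Longrightarrow> norm d \<le> r \<Longrightarrow>
    \<bar>f (y + d) - f y - gradient f y \<bullet> d - 1 / 2 * (d \<bullet> (hessian f y *v d))\<bar> \<le> \<epsilon>1 * (norm d)\<^sup>2"
    by (rule C2_taylor_remainder[OF f \<epsilon>1(1), of B]) blast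
  \<comment> \<open>The weight in Young's inequality for the cross terms
    \<open>h * norm \<Delta>\<close>: the squared increment then gets the other half of \<epsilon>,
    and the rest goes to \<open>h\<^sup>2\<close>.\<close>
  define \<kappa> where "\<kappa> = \<epsilon> / (L * K\<^sup>2)"
  have \<kappa>: "0 < \<kappa>" "L * K\<^sup>2 * \<kappa> = \<epsilon>"
  proof -
    have "0 < L * K\<^sup>2" using L1 K2 by (intro mult_pos_pos) auto
    then show "0 < \<kappa>" "L * K\<^sup>2 * \<kappa> = \<epsilon>" using \<epsilon> by (auto simp: \<kappa>_def)
  qed
  \<comment> \<open>\<open>2 * L\<close> bounds the change of f, and each of the three main terms is
    at most \<open>L * K\<^sup>2\<close> when h and the increment are at most 1. The summands of
    \<open>A\<close> below belong, in this order, to the cases of a large increment, a long step and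
    a short step.\<close>
  define C0 where "C0 = 2 * L + 3 * (L * K\<^sup>2)"
  define A where "A = C0 + C0 * (8 * K ^ 4 / r ^ 4) + (L * K\<^sup>2 + L * K\<^sup>2 / \<kappa>)"
  have LK: "0 \<le> L * K\<^sup>2" using L1 by simp
  have C0: "0 \<le> C0" using LK L1 by (simp add: C0_def)
  have parts: "0 \<le> C0 * (8 * K ^ 4 / r ^ 4)" "0 \<le> L * K\<^sup>2 + L * K\<^sup>2 / \<kappa>"
    using C0 r(1) K LK \<kappa>(1) by (auto intro!: mult_nonneg_nonneg divide_nonneg_nonneg add_nonneg_nonneg)
  show ?thesis
  proof (rule that[of A])
    show "0 \<le> A" using C0 parts by (simp add: A_def)
    fix y \<beta> :: "real ^ 'n" and S :: "real ^ 'k ^ 'n" and h :: real and \<Delta> :: "real ^ 'k"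
    assume y: "norm y \<le> B" and \<beta>: "norm \<beta> \<le> K" and S: "norm S \<le> K" and h: "0 \<le> h" "h \<le> 1"
    define d where "d = h *\<^sub>R \<beta> + S *v \<Delta>"
    let ?main = "h * (gradient f y \<bullet> \<beta>) + gradient f y \<bullet> (S *v \<Delta>) + 1 / 2 * ((S *v \<Delta>) \<bullet> (hessian f y *v (S *v \<Delta>)))"
    let ?E = "\<bar>(if norm \<Delta> \<le> 1 then f (y + d) - f y else 0) - ?main\<bar>"
    let ?n = "norm \<Delta>"
    have h2: "h\<^sup>2 \<le> h" using h by (simp add: power2_eq_square mult_left_le)
    have Sd: "norm (S *v \<Delta>) \<le> K * ?n"
      using norm_matrix_vector_mult_le[of S \<Delta>] S by (meson mult_right_mono norm_ge_zero order_trans)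
    have hb: "norm (h *\<^sub>R \<beta>) \<le> K * h"
      using mult_left_mono[OF \<beta> h(1)] h by (simp add: mult.commute)
    have nd: "norm d \<le> K * (h + ?n)"
      unfolding d_def using norm_triangle_le[OF add_mono[OF hb Sd]] by (simp add: algebra_simps)
    have KK: "K \<le> K\<^sup>2" using self_le_power[OF K, of 2] by simp
    have m1: "\<bar>h * (gradient f y \<bullet> \<beta>)\<bar> \<le> L * K\<^sup>2 * h"
    proof -
      have "\<bar>gradient f y \<bullet> \<beta>\<bar> \<le> norm (gradient f y) * norm \<beta>" by (rule Cauchy_Schwarz_ineq2)
      also have "\<dots> \<le> L * K" using Lg[OF y] \<beta> L1 by (intro mult_mono) auto
      also have "\<dots> \<le> L * K\<^sup>2" using KK L1 by (intro mult_left_mono) auto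
      finally have "\<bar>gradient f y \<bullet> \<beta>\<bar> \<le> L * K\<^sup>2" .
      from mult_left_mono[OF this h(1)] show ?thesis using h by (simp add: abs_mult mult_ac)
    qed
    have m2: "\<bar>gradient f y \<bullet> (S *v \<Delta>)\<bar> \<le> L * K\<^sup>2 * ?n"
    proof -
      have "\<bar>gradient f y \<bullet> (S *v \<Delta>)\<bar> \<le> norm (gradient f y) * norm (S *v \<Delta>)" by (rule Cauchy_Schwarz_ineq2)
      also have "\<dots> \<le> L * (K\<^sup>2 * ?n)"
      proof (rule mult_mono[OF Lg[OF y]])
        show "norm (S *v \<Delta>) \<le> K\<^sup>2 * ?n"
          using Sd mult_right_mono[OF KK norm_ge_zero[of \<Delta>]] by linarith
      qed (use L1 in auto)
      finally show ?thesis by simp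
    qed
    have m3: "\<bar>1 / 2 * ((S *v \<Delta>) \<bullet> (hessian f y *v (S *v \<Delta>)))\<bar> \<le> L * K\<^sup>2 * ?n\<^sup>2"
    proof -
      have "\<bar>(S *v \<Delta>) \<bullet> (hessian f y *v (S *v \<Delta>))\<bar> \<le> norm (hessian f y) * (norm (S *v \<Delta>) * norm (S *v \<Delta>))"
        by (rule quadratic_form_bound)
      also have "\<dots> \<le> L * ((K * ?n) * (K * ?n))"
        using LH[OF y] Sd L1 K by (intro mult_mono) auto
      also have "\<dots> = L * K\<^sup>2 * ?n\<^sup>2" by (simp add: power2_eq_square)
      finally show ?thesis using LK by (simp add: abs_mult)
    qed
    have eps0: "0 \<le> \<epsilon> * (h + ?n\<^sup>2)" using \<epsilon> h by simp
    have q0: "0 \<le> h\<^sup>2 + ?n ^ 4" by simp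
    have A3: "C0 \<le> A" "C0 * (8 * K ^ 4 / r ^ 4) \<le> A" "L * K\<^sup>2 + L * K\<^sup>2 / \<kappa> \<le> A"
      using C0 parts unfolding A_def by linarith+
    have AC: "C0 * (h\<^sup>2 + ?n ^ 4) \<le> A * (h\<^sup>2 + ?n ^ 4)"
      "C0 * (8 * K ^ 4 / r ^ 4) * (h\<^sup>2 + ?n ^ 4) \<le> A * (h\<^sup>2 + ?n ^ 4)"
      "(L * K\<^sup>2 + L * K\<^sup>2 / \<kappa>) * (h\<^sup>2 + ?n ^ 4) \<le> A * (h\<^sup>2 + ?n ^ 4)"
      by (rule mult_right_mono[OF A3(1) q0], rule mult_right_mono[OF A3(2) q0], rule mult_right_mono[OF A3(3) q0])
    have "?E \<le> \<epsilon> * (h + ?n\<^sup>2) + A * (h\<^sup>2 + ?n ^ 4)"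
    proof (cases "?n \<le> 1")
      case False
      then have n1: "1 < ?n" by simp
      have p: "1 \<le> ?n ^ 4" "?n \<le> ?n ^ 4" "?n\<^sup>2 \<le> ?n ^ 4"
        using n1 power_increasing[of 1 4 ?n] power_increasing[of 2 4 ?n] by (auto simp: one_le_power)
      have "?E \<le> L * K\<^sup>2 * h + L * K\<^sup>2 * ?n + L * K\<^sup>2 * ?n\<^sup>2"
        using False m1 m2 m3 by (simp only: if_False)
      also have "\<dots> \<le> L * K\<^sup>2 * ?n ^ 4 + L * K\<^sup>2 * ?n ^ 4 + L * K\<^sup>2 * ?n ^ 4"
        using p h LK by (intro add_mono mult_left_mono) auto
      also have "\<dots> = 3 * (L * K\<^sup>2) * ?n ^ 4" by simp
      also have "\<dots> \<le> C0 * (h\<^sup>2 + ?n ^ 4)"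
        using L1 C0 by (intro mult_mono) (auto simp: C0_def)
      finally show ?thesis using AC(1) eps0 by linarith
    next
      case True
      show ?thesis
      proof (cases "norm d \<le> r")
        case False
        have yd: "norm (y + d) \<le> B + 2 * K"
        proof (rule norm_triangle_le)
          have "K * (h + ?n) \<le> K * 2" using h True K by (intro mult_left_mono) auto
          then show "norm y + norm d \<le> B + 2 * K" using y nd by linarith
        qed
        have yB: "norm y \<le> B + 2 * K" using y K by linarith
        have p: "?n\<^sup>2 \<le> 1" using True by (simp add: power_le_one)
        have "?E \<le> 2 * L + (L * K\<^sup>2 * h + L * K\<^sup>2 * ?n + L * K\<^sup>2 * ?n\<^sup>2)"
          using True m1 m2 m3 Lf[OF yd] Lf[OF yB] by (simp only: if_True)
        also have "\<dots> \<le> 2 * L + (L * K\<^sup>2 * 1 + L * K\<^sup>2 * 1 + L * K\<^sup>2 * 1)"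
          using h True p LK by (intro add_mono mult_left_mono) auto
        also have "\<dots> = C0 * 1" by (simp add: C0_def)
        also have "\<dots> \<le> C0 * ((8 * K ^ 4 / r ^ 4) * (h\<^sup>2 + ?n ^ 4))"
        proof (rule mult_left_mono[OF _ C0])
          \<comment> \<open>A step longer than r forces h or the increment to be large, so
            \<open>h\<^sup>2 + norm \<Delta> ^ 4\<close> is bounded below by a positive constant and
            can absorb any bounded quantity.\<close>
          have "r ^ 4 \<le> norm d ^ 4" using False r(1) by (intro power_mono) auto
          also have "\<dots> \<le> (K * (h + ?n)) ^ 4" using nd by (intro power_mono) auto
          also have "\<dots> = K ^ 4 * (h + ?n) ^ 4" by (simp add: power_mult_distrib)
          also have "\<dots> \<le> K ^ 4 * (8 * (h ^ 4 + ?n ^ 4))"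
            using K by (intro mult_left_mono two_terms_pow4) auto
          also have "\<dots> \<le> K ^ 4 * (8 * (h\<^sup>2 + ?n ^ 4))"
            using K h power_decreasing[of 2 4 h] by (intro mult_left_mono add_right_mono) auto
          finally have "r ^ 4 \<le> K ^ 4 * (8 * (h\<^sup>2 + ?n ^ 4))" .
          then show "1 \<le> (8 * K ^ 4 / r ^ 4) * (h\<^sup>2 + ?n ^ 4)"
            using r(1) by (simp add: field_simps)
        qed
        also have "\<dots> = C0 * (8 * K ^ 4 / r ^ 4) * (h\<^sup>2 + ?n ^ 4)" by simp
        finally show ?thesis using AC(2) eps0 by linarith
      next
        case dr: True
        let ?H = "hessian f y" and ?s = "S *v \<Delta>"
        have quad: "d \<bullet> (?H *v d) = ?s \<bullet> (?H *v ?s) + (h\<^sup>2 * (\<beta> \<bullet> (?H *v \<beta>)) + h * (\<beta> \<bullet> (?H *v ?s)) + h * (?s \<bullet> (?H *v \<beta>)))"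
          by (simp add: d_def matrix_vector_right_distrib matrix_vector_mult_scaleR inner_add_left inner_add_right
              power2_eq_square algebra_simps)
        have b1: "\<bar>\<beta> \<bullet> (?H *v \<beta>)\<bar> \<le> L * K\<^sup>2"
        proof -
          have "\<bar>\<beta> \<bullet> (?H *v \<beta>)\<bar> \<le> norm ?H * (norm \<beta> * norm \<beta>)" by (rule quadratic_form_bound)
          also have "\<dots> \<le> L * (K * K)" using LH[OF y] \<beta> L1 K by (intro mult_mono) auto
          finally show ?thesis by (simp add: power2_eq_square)
        qed
        have b2: "\<bar>\<beta> \<bullet> (?H *v ?s)\<bar> \<le> L * K\<^sup>2 * ?n"
        proof -
          have "\<bar>\<beta> \<bullet> (?H *v ?s)\<bar> \<le> norm ?H * (norm \<beta> * norm ?s)" by (rule quadratic_form_bound)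
          also have "\<dots> \<le> L * (K * (K * ?n))" using LH[OF y] \<beta> Sd L1 K by (intro mult_mono) auto
          finally show ?thesis by (simp add: power2_eq_square)
        qed
        have b3: "\<bar>?s \<bullet> (?H *v \<beta>)\<bar> \<le> L * K\<^sup>2 * ?n"
        proof -
          have "\<bar>?s \<bullet> (?H *v \<beta>)\<bar> \<le> norm ?H * (norm ?s * norm \<beta>)" by (rule quadratic_form_bound)
          also have "\<dots> \<le> L * ((K * ?n) * K)" using LH[OF y] \<beta> Sd L1 K by (intro mult_mono) auto
          finally show ?thesis by (simp add: power2_eq_square mult_ac)
        qed
        have c1: "\<bar>h\<^sup>2 * (\<beta> \<bullet> (?H *v \<beta>))\<bar> \<le> L * K\<^sup>2 * h\<^sup>2"
          using mult_left_mono[OF b1, of "h\<^sup>2"] by (simp add: abs_mult mult_ac)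
        have c2: "\<bar>h * (\<beta> \<bullet> (?H *v ?s))\<bar> \<le> L * K\<^sup>2 * (h * ?n)"
          using mult_left_mono[OF b2 h(1)] h by (simp add: abs_mult mult_ac)
        have c3: "\<bar>h * (?s \<bullet> (?H *v \<beta>))\<bar> \<le> L * K\<^sup>2 * (h * ?n)"
          using mult_left_mono[OF b3 h(1)] h by (simp add: abs_mult mult_ac)
        have hn: "L * K\<^sup>2 * (h * ?n) \<le> L * K\<^sup>2 / \<kappa> * h\<^sup>2 + \<epsilon> / 2 * ?n\<^sup>2"
        proof -
          have "(h / \<kappa>) * ?n \<le> (h / \<kappa>)\<^sup>2 / 2 + ?n\<^sup>2 / 2"
            using sum_squares_bound[of "h / \<kappa>" ?n] by linarith
          also have "\<dots> \<le> (h / \<kappa>)\<^sup>2 + ?n\<^sup>2 / 2" by simp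
          finally have "\<kappa> * ((h / \<kappa>) * ?n) \<le> \<kappa> * ((h / \<kappa>)\<^sup>2 + ?n\<^sup>2 / 2)"
            using \<kappa>(1) by (intro mult_left_mono) auto
          moreover have "\<kappa> * ((h / \<kappa>) * ?n) = h * ?n" using \<kappa>(1) by simp
          moreover have "\<kappa> * ((h / \<kappa>)\<^sup>2 + ?n\<^sup>2 / 2) = h\<^sup>2 / \<kappa> + \<kappa> / 2 * ?n\<^sup>2"
            using \<kappa>(1) by (simp add: power2_eq_square distrib_left)
          ultimately have "h * ?n \<le> h\<^sup>2 / \<kappa> + \<kappa> / 2 * ?n\<^sup>2" by simp
          then have "L * K\<^sup>2 * (h * ?n) \<le> L * K\<^sup>2 * (h\<^sup>2 / \<kappa> + \<kappa> / 2 * ?n\<^sup>2)"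
            using LK by (rule mult_left_mono)
          also have "\<dots> = L * K\<^sup>2 / \<kappa> * h\<^sup>2 + (L * K\<^sup>2 * \<kappa>) / 2 * ?n\<^sup>2"
            by (simp add: distrib_left)
          finally show ?thesis unfolding \<kappa>(2) .
        qed
        have rem: "\<bar>f (y + d) - f y - gradient f y \<bullet> d - 1 / 2 * (d \<bullet> (?H *v d))\<bar> \<le> \<epsilon> / 2 * (h + ?n\<^sup>2)"
        proof -
          have "\<bar>f (y + d) - f y - gradient f y \<bullet> d - 1 / 2 * (d \<bullet> (?H *v d))\<bar> \<le> \<epsilon>1 * (norm d)\<^sup>2"
            by (rule r(3)[OF y dr])
          also have "\<dots> \<le> \<epsilon>1 * (2 * K\<^sup>2 * (h + ?n\<^sup>2))"
          proof (rule mult_left_mono)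
            have "(norm d)\<^sup>2 \<le> (K * (h + ?n))\<^sup>2" using nd by (intro power_mono) auto
            also have "\<dots> = K\<^sup>2 * (h + ?n)\<^sup>2" by (simp add: power_mult_distrib)
            also have "\<dots> \<le> K\<^sup>2 * (2 * (h\<^sup>2 + ?n\<^sup>2))"
              using zero_le_power2[of "h - ?n"] by (intro mult_left_mono) (auto simp: power2_eq_square algebra_simps)
            also have "\<dots> \<le> K\<^sup>2 * (2 * (h + ?n\<^sup>2))"
              using h2 by (intro mult_left_mono) auto
            finally show "(norm d)\<^sup>2 \<le> 2 * K\<^sup>2 * (h + ?n\<^sup>2)" by (simp only: mult_ac)
          qed (use \<epsilon>1 in simp)
          also have "\<dots> = (\<epsilon>1 * (2 * K\<^sup>2)) * (h + ?n\<^sup>2)" by simp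
          finally show ?thesis unfolding \<epsilon>1(2) .
        qed
        have gd: "gradient f y \<bullet> d = h * (gradient f y \<bullet> \<beta>) + gradient f y \<bullet> ?s"
          by (simp add: d_def inner_add_right)
        have "?E \<le> \<epsilon> / 2 * (h + ?n\<^sup>2) + (L * K\<^sup>2 * h\<^sup>2 / 2 + L * K\<^sup>2 * (h * ?n))"
        proof -
          have aux: "\<bar>z - (g + 1 / 2 * q)\<bar> \<le> e + (a / 2 + c)"
            if "\<bar>z - g - 1 / 2 * (q + (x1 + x2 + x3))\<bar> \<le> e" "\<bar>x1\<bar> \<le> a" "\<bar>x2\<bar> \<le> c" "\<bar>x3\<bar> \<le> c"
            for z g q x1 x2 x3 e a c :: real
            using that unfolding abs_le_iff by (elim conjE, intro conjI; argo)
          from aux[OF rem[unfolded gd quad] c1 c2 c3] show ?thesis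
            using True by simp
        qed
        also have "\<dots> \<le> \<epsilon> / 2 * (h + ?n\<^sup>2) + (L * K\<^sup>2 * h\<^sup>2 + (L * K\<^sup>2 / \<kappa> * h\<^sup>2 + \<epsilon> / 2 * ?n\<^sup>2))"
          using hn mult_nonneg_nonneg[OF LK zero_le_power2[of h]] by (intro add_left_mono add_mono) linarith+
        also have "\<dots> \<le> \<epsilon> * (h + ?n\<^sup>2) + (L * K\<^sup>2 + L * K\<^sup>2 / \<kappa>) * (h\<^sup>2 + ?n ^ 4)"
        proof -
          have "(L * K\<^sup>2 + L * K\<^sup>2 / \<kappa>) * h\<^sup>2 \<le> (L * K\<^sup>2 + L * K\<^sup>2 / \<kappa>) * (h\<^sup>2 + ?n ^ 4)"
            using parts(2) by (intro mult_left_mono) auto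
          moreover have "(L * K\<^sup>2 + L * K\<^sup>2 / \<kappa>) * h\<^sup>2 = L * K\<^sup>2 * h\<^sup>2 + L * K\<^sup>2 / \<kappa> * h\<^sup>2"
            by (rule distrib_right)
          moreover have "\<epsilon> / 2 * (h + ?n\<^sup>2) + \<epsilon> / 2 * ?n\<^sup>2 \<le> \<epsilon> * (h + ?n\<^sup>2)"
            using \<epsilon> h by (simp add: algebra_simps)
          ultimately show ?thesis by linarith
        qed
        finally show ?thesis using AC(3) by linarith
      qed
    qed
    then show "\<bar>(if norm \<Delta> \<le> 1 then f (y + (h *\<^sub>R \<beta> + S *v \<Delta>)) - f y else 0) - ?main\<bar>
      \<le> \<epsilon> * (h + ?n\<^sup>2) + A * (h\<^sup>2 + ?n ^ 4)"
      unfolding d_def .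
  qed
qed

section \<open>Dynkin's formula\<close>

text \<open>Off the exceptional set the difference is small, and on it at most twice the common
  bound. The sets may change with \<epsilon>, as the set \<open>bad\<close> does with its
  tolerance.\<close>

lemma (in prob_space) expectation_diff_tendsto_0:
  fixes Z Y :: "nat \<Rightarrow> 'a \<Rightarrow> real"
  assumes m: "eventually (\<lambda>N. Z N \<in> borel_measurable M \<and> Y N \<in> borel_measurable M) sequentially"
    and B: "eventually (\<lambda>N. \<forall>w\<in>space M. \<bar>Z N w\<bar> \<le> B \<and> \<bar>Y N w\<bar> \<le> B) sequentially"
    and close: "\<And>\<epsilon>. 0 < \<epsilon> \<Longrightarrow> \<exists>A. (\<forall>N. A N \<in> events) \<and> (\<lambda>N. prob (A N)) \<longlonglongrightarrow> 0 \<and>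
      eventually (\<lambda>N. \<forall>w\<in>space M - A N. \<bar>Z N w - Y N w\<bar> \<le> \<epsilon>) sequentially"
  shows "(\<lambda>N. expectation (Z N) - expectation (Y N)) \<longlonglongrightarrow> 0"
proof (rule tendstoI)
  fix e :: real assume e: "0 < e"
  have "0 < e / 2" using e by simp
  from close[OF this] obtain A where A: "\<And>N. A N \<in> events" "(\<lambda>N. prob (A N)) \<longlonglongrightarrow> 0"
    "eventually (\<lambda>N. \<forall>w\<in>space M - A N. \<bar>Z N w - Y N w\<bar> \<le> e / 2) sequentially"
    by blast
  define B1 where "B1 = max B 0"
  have B1: "0 \<le> B1" "B \<le> B1" by (auto simp: B1_def)
  have "0 < e / (4 * B1 + 4)" using e B1 by simp
  from order_tendstoD(2)[OF A(2) this] A(3) m B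
  show "eventually (\<lambda>N. dist (expectation (Z N) - expectation (Y N)) 0 < e) sequentially"
  proof eventually_elim
    case (elim N)
    have [measurable]: "Z N \<in> borel_measurable M" "Y N \<in> borel_measurable M" using elim(3) by auto
    have bZ: "\<bar>Z N w\<bar> \<le> B1" "\<bar>Y N w\<bar> \<le> B1" if "w \<in> space M" for w
      using elim(4) B1(2) that by (meson order_trans)+
    have iZ: "integrable M (Z N)" "integrable M (Y N)"
      using bZ by (auto intro!: integrable_const_bound[where B = B1])
    have iA: "integrable M (\<lambda>w. e / 2 + 2 * B1 * indicator (A N) w)"
      using A(1)[of N] by (intro Bochner_Integration.integrable_add integrable_mult_right integrable_real_indicator) (auto simp: emeasure_eq_measure)
    have "\<bar>expectation (Z N) - expectation (Y N)\<bar> = \<bar>expectation (\<lambda>w. Z N w - Y N w)\<bar>"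
      using iZ by simp
    also have "\<dots> \<le> expectation (\<lambda>w. \<bar>Z N w - Y N w\<bar>)"
      by (rule integral_abs_bound)
    also have "\<dots> \<le> expectation (\<lambda>w. e / 2 + 2 * B1 * indicator (A N) w)"
    proof (rule integral_mono)
      show "integrable M (\<lambda>w. \<bar>Z N w - Y N w\<bar>)" using iZ by simp
      fix w assume w: "w \<in> space M"
      show "\<bar>Z N w - Y N w\<bar> \<le> e / 2 + 2 * B1 * indicator (A N) w"
      proof (cases "w \<in> A N")
        case True
        then show ?thesis using bZ[OF w] e by simp
      next
        case False
        then show ?thesis using elim(2) w by simp
      qed
    qed (rule iA)
    also have "\<dots> = e / 2 + 2 * B1 * prob (A N)"
      using A(1)[of N] sets.sets_into_space[OF A(1)[of N]] by (simp add: prob_space Int_absorb2 emeasure_eq_measure)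
    also have "\<dots> < e"
    proof -
      have "2 * B1 * prob (A N) \<le> 2 * B1 * (e / (4 * B1 + 4))"
        using elim(1) B1 by (intro mult_left_mono) auto
      also have "\<dots> < e / 2"
        using e B1 by (simp add: field_simps)
      finally show ?thesis by simp
    qed
    finally show ?case by simp
  qed
qed

lemma telescoping_error_bound:
  fixes a c :: "nat \<Rightarrow> real"
  assumes "\<And>j. j < N \<Longrightarrow> \<bar>a (Suc j) - a j - c j\<bar> \<le> d"
  shows "\<bar>a N - a 0 - (\<Sum>j<N. c j)\<bar> \<le> real N * d"
  using assms
proof (induction N)
  case (Suc N)
  then have "\<bar>a N - a 0 - (\<Sum>j<N. c j)\<bar> \<le> real N * d" "\<bar>a (Suc N) - a N - c N\<bar> \<le> d"
    by simp_all
  then show ?case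
    by (simp add: distrib_right)
qed simp

lemma continuous_bounded_on_compact:
  fixes g :: "'a::topological_space \<Rightarrow> 'b::real_normed_vector"
  assumes "continuous_on UNIV g" "compact A"
  obtains B where "0 \<le> B" "\<And>x. x \<in> A \<Longrightarrow> norm (g x) \<le> B"
proof -
  have "bounded (g ` A)"
    using assms by (intro compact_imp_bounded compact_continuous_image) (auto intro: continuous_on_subset)
  then obtain B where B: "\<forall>x\<in>g ` A. norm x \<le> B" unfolding bounded_iff by (elim exE)
  have "norm (g x) \<le> max B 0" if "x \<in> A" for x
    using B that by (auto intro: order_trans[OF _ max.cobounded1])
  then show ?thesis by (intro that[of "max B 0"]) auto
qed

context wiener_space
begin

lemma increment_square:
  assumes st: "0 \<le> s" "s \<le> t"
  shows "integrable P (\<lambda>w. (norm (W t w - W s w))\<^sup>2)"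
    and "expectation (\<lambda>w. (norm (W t w - W s w))\<^sup>2) = (t - s) * real CARD('k)"
proof -
  have 1: "(\<lambda>_. mat 1 :: real ^ 'k ^ 'k) \<in> borel_measurable (F s)" by simp
  have 2: "integrable P (\<lambda>_. mat 1 :: real ^ 'k ^ 'k)" by simp
  note q = increment_quadratic[OF st 1 2]
  show "integrable P (\<lambda>w. (norm (W t w - W s w))\<^sup>2)"
    using q(1) by (simp only: matrix_vector_mul_lid power2_norm_eq_inner)
  have "expectation (\<lambda>_. trace (mat 1 :: real ^ 'k ^ 'k)) = real CARD('k)"
    by (simp add: trace_I prob_space)
  then show "expectation (\<lambda>w. (norm (W t w - W s w))\<^sup>2) = (t - s) * real CARD('k)"
    using q(2) by (simp only: matrix_vector_mul_lid power2_norm_eq_inner)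
qed

end

context stopped_ito
begin

text \<open>The cutoff in \<open>cnd\<close> is the part of the condition in \<open>teuler\<close> that is known at the beginning of the
  step; the cutoff of the increment is estimated by fourth moments.\<close>

definition cnd :: "real \<Rightarrow> nat \<Rightarrow> nat \<Rightarrow> (real ^ 'n \<Rightarrow> real ^ 'n \<Rightarrow> 'b::real_normed_vector) \<Rightarrow> 'w \<Rightarrow> 'b" where
  "cnd T N j g w = (if grid T N j < \<rho> w \<and> norm (teuler T N j w) \<le> K + 1
     then g (teuler T N j w) (X (grid T N j) w) else 0)"

lemma cnd_measurable:
  fixes g :: "real ^ 'n \<Rightarrow> real ^ 'n \<Rightarrow> 'b::{real_normed_vector, second_countable_topology}"
  assumes T: "0 \<le> T" and g: "continuous_on UNIV (\<lambda>p. g (fst p) (snd p))"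
  shows "cnd T N j g \<in> borel_measurable (F (grid T N j))"
proof -
  let ?t = "grid T N j"
  have t: "0 \<le> ?t" by (rule grid_nonneg[OF T])
  note [measurable] = teuler_measurable[OF T, of N j] act_measurable[OF continuous_on_id t]
  have "{w \<in> space (F ?t). ?t < \<rho> w} \<in> sets (F ?t)"
    using \<rho>_stop[OF t] by simp
  then have [measurable]: "Measurable.pred (F ?t) (\<lambda>w. ?t < \<rho> w)"
    by (simp add: pred_def)
  have [measurable]: "(\<lambda>w. g (teuler T N j w) (act (\<lambda>x. x) ?t w)) \<in> borel_measurable (F ?t)"
    by (rule borel_measurable_continuous_Pair[OF teuler_measurable[OF T] act_measurable[OF continuous_on_id t] g])
  have "(\<lambda>w. if ?t < \<rho> w \<and> norm (teuler T N j w) \<le> K + 1 then g (teuler T N j w) (act (\<lambda>x. x) ?t w) else 0)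
      \<in> borel_measurable (F ?t)"
    by measurable
  moreover have "cnd T N j g = (\<lambda>w. if ?t < \<rho> w \<and> norm (teuler T N j w) \<le> K + 1 then g (teuler T N j w) (act (\<lambda>x. x) ?t w) else 0)"
    by (auto simp: cnd_def act_def)
  ultimately show ?thesis by simp
qed

lemma cnd_bounded:
  fixes g :: "real ^ 'n \<Rightarrow> real ^ 'n \<Rightarrow> 'b::real_normed_vector"
  assumes g: "continuous_on UNIV (\<lambda>p. g (fst p) (snd p))"
  obtains B where "0 \<le> B" "\<And>T N j w. 0 \<le> T \<Longrightarrow> w \<in> space P \<Longrightarrow> norm (cnd T N j g w) \<le> B"
proof -
  obtain B where B: "0 \<le> B" "\<And>p. p \<in> cball 0 (K + 1) \<times> C \<Longrightarrow> norm (g (fst p) (snd p)) \<le> B"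
    by (rule continuous_bounded_on_compact[OF g compact_Times[OF compact_cball C(1)]]) blast
  show ?thesis
  proof (rule that[OF B(1)])
    fix T :: real and N j w assume T: "0 \<le> T" and w: "w \<in> space P"
    show "norm (cnd T N j g w) \<le> B"
    proof (cases "grid T N j < \<rho> w \<and> norm (teuler T N j w) \<le> K + 1")
      case True
      then have "(teuler T N j w, X (grid T N j) w) \<in> cball 0 (K + 1) \<times> C"
        using X_C[OF w grid_nonneg[OF T]] by auto
      from B(2)[OF this] show ?thesis using True by (simp add: cnd_def)
    next
      case False
      then have "cnd T N j g w = 0" unfolding cnd_def by (rule if_not_P)
      then show ?thesis using B(1) by simp
    qed
  qed
qed

lemma cnd_integrable:
  fixes g :: "real ^ 'n \<Rightarrow> real ^ 'n \<Rightarrow> 'b::{banach, second_countable_topology}"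
  assumes T: "0 \<le> T" and g: "continuous_on UNIV (\<lambda>p. g (fst p) (snd p))"
  shows "integrable P (cnd T N j g)"
proof -
  obtain B where "\<And>T N j w. 0 \<le> T \<Longrightarrow> w \<in> space P \<Longrightarrow> norm (cnd T N j g w) \<le> B"
    by (rule cnd_bounded[OF g]) blast
  then show ?thesis
    using measurable_F_P[OF cnd_measurable[OF T g]] T
    by (intro integrable_const_bound[where B = B]) auto
qed

text \<open>The Euler step starts at \<open>y\<close> but uses the coefficients at the true position \<open>x\<close>.\<close>

definition gen2 :: "(real ^ 'n \<Rightarrow> real) \<Rightarrow> real ^ 'n \<Rightarrow> real ^ 'n \<Rightarrow> real" where
  "gen2 f y x = gradient f y \<bullet> b x + 1 / 2 * trace (transpose (\<sigma> x) ** hessian f y ** \<sigma> x)"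

lemma gen2_same: "gen2 f x x = generator b \<sigma> f x"
  by (simp add: gen2_def generator_def)

lemma coefficient_continuity:
  assumes f: "C2_fun f"
  shows "continuous_on UNIV (\<lambda>p. gradient f (fst p) \<bullet> b (snd p))"
    and "continuous_on UNIV (\<lambda>p. transpose (\<sigma> (snd p)) *v gradient f (fst p))"
    and "continuous_on UNIV (\<lambda>p. transpose (\<sigma> (snd p)) ** hessian f (fst p) ** \<sigma> (snd p))"
    and "continuous_on UNIV (\<lambda>p. gen2 f (fst p) (snd p))"
proof -
  have 1: "continuous_on UNIV (\<lambda>p. b (snd p))" "continuous_on UNIV (\<lambda>p. \<sigma> (snd p))"
    "continuous_on UNIV (\<lambda>p. gradient f (fst p))" "continuous_on UNIV (\<lambda>p. hessian f (fst p))"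
    by (rule continuous_on_compose2[OF b_cont], simp_all add: continuous_on_snd continuous_on_id)
       (rule continuous_on_compose2[OF \<sigma>_cont] continuous_on_compose2[OF gradient_continuous[OF C2_imp_C1[OF f]]]
         continuous_on_compose2[OF hessian_continuous[OF f]]; simp add: continuous_on_snd continuous_on_fst continuous_on_id)+
  then show "continuous_on UNIV (\<lambda>p. gradient f (fst p) \<bullet> b (snd p))"
    "continuous_on UNIV (\<lambda>p. transpose (\<sigma> (snd p)) *v gradient f (fst p))"
    "continuous_on UNIV (\<lambda>p. transpose (\<sigma> (snd p)) ** hessian f (fst p) ** \<sigma> (snd p))"
    by (intro continuous_intros; simp)+
  from 1 show "continuous_on UNIV (\<lambda>p. gen2 f (fst p) (snd p))"
    unfolding gen2_def by (intro continuous_intros; simp)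
qed

lemma f_teuler_bounded:
  assumes f: "continuous_on UNIV (f :: real ^ 'n \<Rightarrow> real)"
  obtains B where "0 \<le> B" "\<And>x. norm x \<le> 3 * K + 1 \<Longrightarrow> \<bar>f x\<bar> \<le> B"
proof -
  obtain B where "0 \<le> B" "\<And>x. x \<in> cball 0 (3 * K + 1) \<Longrightarrow> norm (f x) \<le> B"
    by (rule continuous_bounded_on_compact[OF f compact_cball]) blast
  then show ?thesis by (intro that[of B]) auto
qed

lemma f_teuler_integrable:
  assumes T: "0 \<le> T" "T / real N \<le> 1" and f: "continuous_on UNIV (f :: real ^ 'n \<Rightarrow> real)"
  shows "integrable P (\<lambda>w. f (teuler T N j w))"
proof -
  obtain B where B: "\<And>x. norm x \<le> 3 * K + 1 \<Longrightarrow> \<bar>f x\<bar> \<le> B"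
    by (rule f_teuler_bounded[OF f]) blast
  have "(\<lambda>w. f (teuler T N j w)) \<in> borel_measurable P"
    by (rule borel_measurable_continuous_on[OF f measurable_F_P[OF teuler_measurable[OF T(1)]]])
  then show ?thesis
    using B[OF teuler_bound[OF T]] by (intro integrable_const_bound[where B = B]) auto
qed

text \<open>\<open>A\<close> stems from the Taylor estimate and is the same for all horizons, grids
  and steps; this is why it is quantified outside. In expectation the term linear in the increment
  vanishes and the quadratic one becomes a trace, which together with the drift term forms
  \<open>gen2\<close>.\<close>

lemma dynkin_step:
  assumes f: "C2_fun (f :: real ^ 'n \<Rightarrow> real)" and \<epsilon>: "0 < \<epsilon>"
  shows "\<exists>A\<ge>0. \<forall>T N j. 0 < T \<longrightarrow> T / real N \<le> 1 \<longrightarrow>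
    \<bar>expectation (\<lambda>w. f (teuler T N (Suc j) w)) - expectation (\<lambda>w. f (teuler T N j w))
      - (T / real N) * expectation (cnd T N j (gen2 f))\<bar>
    \<le> \<epsilon> * (T / real N * (1 + real CARD('k))) + A * ((T / real N)\<^sup>2 * (1 + 3 * (real CARD('k))\<^sup>2))"
proof -
  obtain A where A: "0 \<le> A" "\<And>y \<beta> (S :: real ^ 'k ^ 'n) h \<Delta>.
    norm y \<le> K + 1 \<Longrightarrow> norm \<beta> \<le> K \<Longrightarrow> norm S \<le> K \<Longrightarrow> 0 \<le> h \<Longrightarrow> h \<le> 1 \<Longrightarrow>
    \<bar>(if norm \<Delta> \<le> 1 then f (y + (h *\<^sub>R \<beta> + S *v \<Delta>)) - f y else 0) -
      (h * (gradient f y \<bullet> \<beta>) + gradient f y \<bullet> (S *v \<Delta>) + 1 / 2 * ((S *v \<Delta>) \<bullet> (hessian f y *v (S *v \<Delta>))))\<bar>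
    \<le> \<epsilon> * (h + (norm \<Delta>)\<^sup>2) + A * (h\<^sup>2 + norm \<Delta> ^ 4)"
    by (rule euler_step_taylor[OF f K(1) \<epsilon>, of "K + 1"]) blast
  show ?thesis
  proof (intro exI[of _ A] conjI A(1) allI impI)
    fix T :: real and N j assume T: "0 < T" and h1: "T / real N \<le> 1"
    let ?h = "T / real N" and ?t = "grid T N j" and ?u = "grid T N (Suc j)"
    have T0: "0 \<le> T" using T by simp
    have h0: "0 \<le> ?h" using T by simp
    have tu: "0 \<le> ?t" "?t \<le> ?u" "?u - ?t = ?h"
      using grid_nonneg[OF T0] grid_mono[OF T0, of j "Suc j" N] by (auto simp: grid_Suc)
    let ?D = "\<lambda>w. W ?u w - W ?t w"
    define \<beta> where "\<beta> = cnd T N j (\<lambda>y x. gradient f y \<bullet> b x)"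
    define G where "G = cnd T N j (\<lambda>y x. transpose (\<sigma> x) *v gradient f y)"
    define Q where "Q = cnd T N j (\<lambda>y x. transpose (\<sigma> x) ** hessian f y ** \<sigma> x)"
    note cc = coefficient_continuity[OF f]
    have G: "G \<in> borel_measurable (F ?t)" "integrable P G"
      unfolding G_def by (rule cnd_measurable[OF T0 cc(2)], rule cnd_integrable[OF T0 cc(2)])
    have Q: "Q \<in> borel_measurable (F ?t)" "integrable P Q"
      unfolding Q_def by (rule cnd_measurable[OF T0 cc(3)], rule cnd_integrable[OF T0 cc(3)])
    have \<beta>: "integrable P \<beta>" unfolding \<beta>_def by (rule cnd_integrable[OF T0 cc(1)])
    have trQ: "integrable P (\<lambda>w. trace (Q w))"
      by (rule integrable_bounded_linear[OF bounded_linear_trace Q(2)])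
    note lin = increment_linear[OF tu(1,2) G] and quad = increment_quadratic[OF tu(1,2) Q]
    note sq = increment_square[OF tu(1,2)] and p4 = increment_pow4[OF tu(1,2)]
    have fi: "integrable P (\<lambda>w. f (teuler T N i w))" for i
      by (rule f_teuler_integrable[OF T0 h1 C1_continuous[OF C2_imp_C1[OF f]]])
    \<comment> \<open>If \<open>\<rho>\<close> or the norm test of \<open>cnd\<close> halts the
      scheme, every term of r is 0. The cutoff of the increment, which \<open>cnd\<close> cannot
      know, is part of the Taylor estimate.\<close>
    define r where "r w = f (teuler T N (Suc j) w) - f (teuler T N j w) -
      (?h * \<beta> w + G w \<bullet> ?D w + 1 / 2 * (?D w \<bullet> (Q w *v ?D w)))" for w
    have r_bound: "\<bar>r w\<bar> \<le> \<epsilon> * (?h + (norm (?D w))\<^sup>2) + A * (?h\<^sup>2 + norm (?D w) ^ 4)" if w: "w \<in> space P" for w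
    proof (cases "?t < \<rho> w \<and> norm (teuler T N j w) \<le> K + 1")
      case True
      let ?y = "teuler T N j w" and ?x = "X ?t w"
      have xC: "?x \<in> C" using X_C[OF w tu(1)] True by simp
      have e1: "f (teuler T N (Suc j) w) - f (teuler T N j w) =
        (if norm (?D w) \<le> 1 then f (?y + (?h *\<^sub>R b ?x + \<sigma> ?x *v ?D w)) - f ?y else 0)"
        using True by simp
      have e2: "\<beta> w = gradient f ?y \<bullet> b ?x" using True by (simp add: \<beta>_def cnd_def)
      have e3: "G w \<bullet> ?D w = gradient f ?y \<bullet> (\<sigma> ?x *v ?D w)"
        using True by (simp add: G_def cnd_def dot_lmul_matrix[symmetric] transpose_matrix_vector)
      have e4: "?D w \<bullet> (Q w *v ?D w) = (\<sigma> ?x *v ?D w) \<bullet> (hessian f ?y *v (\<sigma> ?x *v ?D w))"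
        using True by (simp add: Q_def cnd_def quadratic_form_pullback)
      show ?thesis
        unfolding r_def e1 e2 e3 e4
        by (rule A(2)) (use True K xC h0 h1 in auto)
    next
      case False
      then have "r w = 0" unfolding r_def \<beta>_def G_def Q_def cnd_def by auto
      moreover have "0 \<le> \<epsilon> * (?h + (norm (?D w))\<^sup>2) + A * (?h\<^sup>2 + norm (?D w) ^ 4)"
        using \<epsilon> A(1) h0 by simp
      ultimately show ?thesis by simp
    qed
    have ri: "integrable P r"
      unfolding r_def[abs_def] using fi \<beta> lin(1) quad(1) by (simp del: teuler.simps)
    have Er: "expectation r = expectation (\<lambda>w. f (teuler T N (Suc j) w)) - expectation (\<lambda>w. f (teuler T N j w))
      - ?h * expectation (cnd T N j (gen2 f))"
    proof -
      have "cnd T N j (gen2 f) = (\<lambda>w. \<beta> w + 1 / 2 * trace (Q w))"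
        by (rule ext) (simp add: cnd_def gen2_def \<beta>_def Q_def trace_def)
      then have g: "expectation (cnd T N j (gen2 f)) = expectation \<beta> + 1 / 2 * expectation (\<lambda>w. trace (Q w))"
        using \<beta> trQ by simp
      have "expectation r = expectation (\<lambda>w. f (teuler T N (Suc j) w)) - expectation (\<lambda>w. f (teuler T N j w))
        - (?h * expectation \<beta> + expectation (\<lambda>w. G w \<bullet> ?D w) + 1 / 2 * expectation (\<lambda>w. ?D w \<bullet> (Q w *v ?D w)))"
        unfolding r_def[abs_def] using fi \<beta> lin(1) quad(1) by (simp del: teuler.simps)
      then show ?thesis
        unfolding lin(2) quad(2) tu(3) g by (simp only: distrib_left) simp
    qed
    have bi: "integrable P (\<lambda>w. \<epsilon> * (?h + (norm (?D w))\<^sup>2) + A * (?h\<^sup>2 + norm (?D w) ^ 4))"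
      using sq(1) p4(1) by simp
    have "\<bar>expectation r\<bar> \<le> expectation (\<lambda>w. \<bar>r w\<bar>)"
      by (rule integral_abs_bound)
    also have "\<dots> \<le> expectation (\<lambda>w. \<epsilon> * (?h + (norm (?D w))\<^sup>2) + A * (?h\<^sup>2 + norm (?D w) ^ 4))"
      using ri bi r_bound by (intro integral_mono) auto
    also have "\<dots> = \<epsilon> * (?h + expectation (\<lambda>w. (norm (?D w))\<^sup>2)) + A * (?h\<^sup>2 + expectation (\<lambda>w. norm (?D w) ^ 4))"
      using sq(1) p4(1) by (simp add: prob_space)
    also have "\<dots> \<le> \<epsilon> * (?h + ?h * real CARD('k)) + A * (?h\<^sup>2 + 3 * (real CARD('k))\<^sup>2 * ?h\<^sup>2)"
      using sq(2) p4(2) A(1) \<epsilon> unfolding tu(3) by (intro add_mono mult_left_mono) auto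
    also have "\<dots> = \<epsilon> * (?h * (1 + real CARD('k))) + A * (?h\<^sup>2 * (1 + 3 * (real CARD('k))\<^sup>2))"
      by (simp add: algebra_simps)
    finally show "\<bar>expectation (\<lambda>w. f (teuler T N (Suc j) w)) - expectation (\<lambda>w. f (teuler T N j w))
      - ?h * expectation (cnd T N j (gen2 f))\<bar>
      \<le> \<epsilon> * (?h * (1 + real CARD('k))) + A * (?h\<^sup>2 * (1 + 3 * (real CARD('k))\<^sup>2))"
      unfolding Er .
  qed
qed

end

lemma measure_clock_Ioc:
  assumes "0 \<le> a" "a \<le> c" "c \<le> T"
  shows "measure (clock T) {a<..c} = c - a"
  using assms unfolding clock_def by (subst measure_restrict_space) auto

context stopped_ito
begin

text \<open>There are N steps of length \<open>T / real N\<close>: errors of first order in the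
  length add up to a multiple of \<open>\<epsilon> * T\<close>, those of second order to a multiple
  of \<open>T * (T / real N)\<close>.\<close>

lemma dynkin_discrete:
  assumes f: "C2_fun (f :: real ^ 'n \<Rightarrow> real)" and \<epsilon>: "0 < \<epsilon>"
  shows "\<exists>A\<ge>0. \<forall>T N. 0 < T \<longrightarrow> 0 < N \<longrightarrow> T / real N \<le> 1 \<longrightarrow>
    \<bar>expectation (\<lambda>w. f (teuler T N N w)) - f x0 - expectation (\<lambda>w. \<Sum>j<N. (T / real N) * cnd T N j (gen2 f) w)\<bar>
    \<le> \<epsilon> * (T * (1 + real CARD('k))) + A * (T * (T / real N) * (1 + 3 * (real CARD('k))\<^sup>2))"
proof -
  obtain A where A: "0 \<le> A" and step: "\<forall>T N j. 0 < T \<longrightarrow> T / real N \<le> 1 \<longrightarrow>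
    \<bar>expectation (\<lambda>w. f (teuler T N (Suc j) w)) - expectation (\<lambda>w. f (teuler T N j w))
      - (T / real N) * expectation (cnd T N j (gen2 f))\<bar>
    \<le> \<epsilon> * (T / real N * (1 + real CARD('k))) + A * ((T / real N)\<^sup>2 * (1 + 3 * (real CARD('k))\<^sup>2))"
    using dynkin_step[OF f \<epsilon>] by (elim exE conjE)
  show ?thesis
  proof (intro exI[of _ A] conjI A allI impI)
    fix T :: real and N :: nat assume T: "0 < T" and N: "0 < N" and h1: "T / real N \<le> 1"
    let ?h = "T / real N"
    let ?a = "\<lambda>j. expectation (\<lambda>w. f (teuler T N j w))" and ?g = "\<lambda>j. expectation (cnd T N j (gen2 f))"
    let ?b = "\<epsilon> * (?h * (1 + real CARD('k))) + A * (?h\<^sup>2 * (1 + 3 * (real CARD('k))\<^sup>2))"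
    have T0: "0 \<le> T" using T by simp
    have a0: "?a 0 = f x0" by (simp add: prob_space)
    have g: "expectation (\<lambda>w. \<Sum>j<N. ?h * cnd T N j (gen2 f) w) = (\<Sum>j<N. ?h * ?g j)"
    proof -
      have "expectation (\<lambda>w. \<Sum>j<N. ?h * cnd T N j (gen2 f) w) = (\<Sum>j<N. expectation (\<lambda>w. ?h * cnd T N j (gen2 f) w))"
        by (rule Bochner_Integration.integral_sum) (rule integrable_mult_right[OF cnd_integrable[OF T0 coefficient_continuity(4)[OF f]]])
      also have "\<dots> = (\<Sum>j<N. ?h * ?g j)"
        by (rule sum.cong[OF refl]) (rule Bochner_Integration.integral_mult_right_zero)
      finally show ?thesis .
    qed
    have "\<bar>?a N - ?a 0 - (\<Sum>j<N. ?h * ?g j)\<bar> \<le> real N * ?b"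
    proof (rule telescoping_error_bound)
      fix j
      show "\<bar>?a (Suc j) - ?a j - ?h * ?g j\<bar> \<le> ?b"
        using step T h1 by blast
    qed
    moreover have "real N * ?b = \<epsilon> * (T * (1 + real CARD('k))) + A * (T * ?h * (1 + 3 * (real CARD('k))\<^sup>2))"
    proof -
      have Nh: "real N * ?h = T" using N by simp
      have aux: "n * (\<epsilon> * (h * c) + A * (h\<^sup>2 * d)) = \<epsilon> * ((n * h) * c) + A * ((n * h) * h * d)" for n h c d :: real
        by (simp add: power2_eq_square algebra_simps)
      show ?thesis
        using aux[of "real N" ?h "1 + real CARD('k)" "1 + 3 * (real CARD('k))\<^sup>2"] unfolding Nh .
    qed
    ultimately show "\<bar>?a N - f x0 - expectation (\<lambda>w. \<Sum>j<N. ?h * cnd T N j (gen2 f) w)\<bar>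
      \<le> \<epsilon> * (T * (1 + real CARD('k))) + A * (T * ?h * (1 + 3 * (real CARD('k))\<^sup>2))"
      by (simp only: a0 g)
  qed
qed

section \<open>Passage to the limit of fine grids\<close>

lemma riemann_sum_tendsto:
  fixes g :: "real ^ 'n \<Rightarrow> real"
  assumes T: "0 < T" and w: "w \<in> space P" and g: "continuous_on UNIV g"
    and B: "\<And>t. 0 \<le> t \<Longrightarrow> \<bar>act g t w\<bar> \<le> B"
  shows "(\<lambda>N. \<Sum>j<N. (T / real N) * act g (grid T N j) w) \<longlonglongrightarrow> (\<integral>s. act g s w \<partial>clock T)"
proof -
  have T0: "0 \<le> T" using T by simp
  interpret c: finite_measure "clock T" by (rule finite_measure_clock)
  \<comment> \<open>The Riemann sum is the time integral of this step function, so dominated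
    convergence over the clock applies once the two instants 0 and \<open>\<rho>\<close> are
    discarded.\<close>
  define V where "V N s = (\<Sum>j<N. indicator {grid T N j<..grid T N (Suc j)} s * act g (grid T N j) w)" for N s
  have B0: "0 \<le> B" using B[of 0] by linarith
  have val: "\<exists>\<tau>. 0 \<le> \<tau> \<and> s - T / real N \<le> \<tau> \<and> \<tau> \<le> s \<and> V N s = act g \<tau> w"
    if s: "0 < s" "s \<le> T" and N: "0 < N" for N s
  proof -
    obtain j where j: "j < N" "s \<in> {grid T N j<..grid T N (Suc j)}"
      using grid_cell[OF s N] .
    have "V N s = (\<Sum>i<N. if i = j then act g (grid T N i) w else 0)"
      unfolding V_def indicator_grid[OF T0 j(2)] by (rule sum.cong) auto
    also have "\<dots> = act g (grid T N j) w" using j(1) by simp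
    finally show ?thesis
      using j(2) grid_nonneg[OF T0, of N j] by (intro exI[of _ "grid T N j"]) (auto simp: grid_Suc)
  qed
  have sec: "(\<lambda>s. act g s w) \<in> borel_measurable (clock T)"
    using measurable_compose[OF measurable_Pair2'[OF w] act_jointly_measurable[OF g, of T]] by simp
  have Vm: "V N \<in> borel_measurable (clock T)" for N
    unfolding clock_def V_def[abs_def] by (rule measurable_restrict_space1) measurable
  have int: "(\<integral>s. V N s \<partial>clock T) = (\<Sum>j<N. (T / real N) * act g (grid T N j) w)" for N
  proof -
    have m: "measure (clock T) {grid T N j<..grid T N (Suc j)} = T / real N" if "j < N" for j
      using grid_nonneg[OF T0, of N j] grid_mono[OF T0, of j "Suc j" N] grid_le[OF T0, of "Suc j" N] that
      by (subst measure_clock_Ioc) (auto simp: grid_Suc)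
    have st: "{grid T N j<..grid T N (Suc j)} \<subseteq> {0..T}" if "j < N" for j
      using grid_nonneg[OF T0, of N j] grid_le[OF T0, of "Suc j" N] that by auto
    have sm: "{grid T N j<..grid T N (Suc j)} \<in> sets (clock T)" if "j < N" for j
      unfolding clock_def using st[OF that] by (subst sets_restrict_space_iff) auto
    have "(\<integral>s. V N s \<partial>clock T) = (\<Sum>j<N. \<integral>s. indicator {grid T N j<..grid T N (Suc j)} s * act g (grid T N j) w \<partial>clock T)"
      unfolding V_def
    proof (rule Bochner_Integration.integral_sum)
      fix j assume "j \<in> {..<N}"
      then show "integrable (clock T) (\<lambda>s. indicator {grid T N j<..grid T N (Suc j)} s * act g (grid T N j) w)"
        using sm[of j] by (intro integrable_mult_left integrable_real_indicator) (auto simp: less_top[symmetric] c.emeasure_finite)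
    qed
    also have "\<dots> = (\<Sum>j<N. (T / real N) * act g (grid T N j) w)"
    proof (rule sum.cong[OF refl])
      fix j assume "j \<in> {..<N}"
      then show "(\<integral>s. indicator {grid T N j<..grid T N (Suc j)} s * act g (grid T N j) w \<partial>clock T) = (T / real N) * act g (grid T N j) w"
        using m[of j] st[of j] by (simp add: Int_absorb2)
    qed
    finally show ?thesis .
  qed
  have "(\<lambda>N. \<integral>s. V N s \<partial>clock T) \<longlonglongrightarrow> (\<integral>s. act g s w \<partial>clock T)"
  proof (rule integral_dominated_convergence[where w = "\<lambda>_. B"])
    show "(\<lambda>s. act g s w) \<in> borel_measurable (clock T)" by (rule sec)
    show "V N \<in> borel_measurable (clock T)" for N by (rule Vm)
    show "integrable (clock T) (\<lambda>_. B)" by simp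
    have ae: "AE s in clock T. s \<noteq> 0 \<and> s \<noteq> \<rho> w"
    proof -
      have "AE s in lborel. s \<noteq> 0 \<and> s \<noteq> \<rho> w"
        using AE_lborel_singleton[of "0::real"] AE_lborel_singleton[of "\<rho> w"] by eventually_elim simp
      then show ?thesis unfolding clock_def
        by (subst AE_restrict_space_iff) auto
    qed
    have bd: "norm (V N s) \<le> B" if s: "0 < s" "s \<le> T" for N s
    proof (cases "N = 0")
      case True
      then show ?thesis using B0 by (simp add: V_def)
    next
      case False
      then show ?thesis using val[OF s, of N] B by auto
    qed
    show "AE s in clock T. norm (V N s) \<le> B" for N
      using ae AE_space by eventually_elim (rule bd, auto)
    show "AE s in clock T. (\<lambda>N. V N s) \<longlonglongrightarrow> act g s w"
      using ae AE_space
    proof eventually_elim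
      case (elim s)
      then have s: "0 < s" "s \<le> T" "s \<noteq> \<rho> w" by auto
      have "\<forall>N. \<exists>\<tau>. 0 < N \<longrightarrow> 0 \<le> \<tau> \<and> s - T / real N \<le> \<tau> \<and> \<tau> \<le> s \<and> V N s = act g \<tau> w"
        using val[OF s(1,2)] by blast
      then obtain \<tau> where \<tau>: "\<And>N. 0 < N \<Longrightarrow> 0 \<le> \<tau> N \<and> s - T / real N \<le> \<tau> N \<and> \<tau> N \<le> s \<and> V N s = act g (\<tau> N) w"
        by metis
      have ev: "eventually (\<lambda>N::nat. 0 < N) sequentially" by (rule eventually_gt_at_top)
      have lim: "\<tau> \<longlonglongrightarrow> s"
      proof (rule real_tendsto_sandwich[where f = "\<lambda>N. s - T / real N" and h = "\<lambda>_. s"])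
        show "(\<lambda>N. s - T / real N) \<longlonglongrightarrow> s"
          using tendsto_diff[OF tendsto_const[of s] lim_const_over_n[of T]] by simp
        show "eventually (\<lambda>N. s - T / real N \<le> \<tau> N) sequentially" "eventually (\<lambda>N. \<tau> N \<le> s) sequentially"
          using ev by (eventually_elim, use \<tau> in blast)+
      qed simp
      have ev0: "eventually (\<lambda>N. 0 \<le> \<tau> N) sequentially"
        using ev by (eventually_elim, use \<tau> in blast)
      have ev1: "eventually (\<lambda>N. act g (\<tau> N) w = V N s) sequentially"
        using ev
      proof eventually_elim
        case (elim N)
        show ?case using \<tau>[OF elim] by simp
      qed
      have "(\<lambda>N. act g (\<tau> N) w) \<longlonglongrightarrow> act g s w"
        by (rule act_tendsto[OF g w _ lim ev0]) (use s in auto)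
      then show ?case
        using ev1 by (rule Lim_transform_eventually)
    qed
  qed
  then show ?thesis unfolding int .
qed

lemma act_bounded:
  fixes g :: "real ^ 'n \<Rightarrow> real"
  assumes g: "continuous_on UNIV g"
  obtains B where "0 \<le> B" "\<And>w t. w \<in> space P \<Longrightarrow> 0 \<le> t \<Longrightarrow> \<bar>act g t w\<bar> \<le> B"
proof -
  obtain B where B: "0 \<le> B" "\<And>x. x \<in> C \<Longrightarrow> norm (g x) \<le> B"
    by (rule continuous_bounded_on_compact[OF g C(1)]) blast
  show ?thesis
  proof (rule that[OF B(1)])
    fix w and t :: real assume "w \<in> space P" "0 \<le> t"
    then show "\<bar>act g t w\<bar> \<le> B"
      using B(2)[OF X_C, of w t] B(1) by (auto simp: act_def)
  qed
qed

lemma grid_sum_bound: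
  assumes "0 \<le> T" "\<And>j. j < N \<Longrightarrow> \<bar>a j\<bar> \<le> B" "0 \<le> B"
  shows "\<bar>\<Sum>j<N. (T / real N) * a j\<bar> \<le> T * B"
proof -
  have "\<bar>\<Sum>j<N. (T / real N) * a j\<bar> \<le> (\<Sum>j<N. \<bar>(T / real N) * a j\<bar>)"
    by (rule sum_abs)
  also have "\<dots> \<le> (\<Sum>j<N. (T / real N) * B)"
  proof (rule sum_mono)
    fix j assume "j \<in> {..<N}"
    then have "(T / real N) * \<bar>a j\<bar> \<le> (T / real N) * B"
      using assms by (intro mult_left_mono) auto
    then show "\<bar>(T / real N) * a j\<bar> \<le> (T / real N) * B"
      using assms(1) by (simp add: abs_mult)
  qed
  also have "\<dots> \<le> T * B"
    using assms by (cases "N = 0") auto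
  finally show ?thesis .
qed

text \<open>Off \<open>bad\<close> the scheme is within e of the path before \<open>\<rho>\<close>.
  Hence it passes the norm test of \<open>cnd\<close>, and uniform continuity of \<open>gen2\<close>
  on \<open>cball 0 (K + 1) \<times> C\<close> replaces its first argument by the second, where it
  is the generator.\<close>

lemma euler_generator_close:
  assumes T: "0 < T" and f: "C2_fun (f :: real ^ 'n \<Rightarrow> real)" and \<epsilon>: "0 < \<epsilon>"
  obtains e where "0 < e" "\<And>N w. w \<in> space P - bad T e N \<Longrightarrow>
    \<bar>(\<Sum>j<N. (T / real N) * cnd T N j (gen2 f) w) - (\<Sum>j<N. (T / real N) * act (generator b \<sigma> f) (grid T N j) w)\<bar> \<le> \<epsilon>"
proof -
  have T0: "0 \<le> T" using T by simp
  have eT: "0 < \<epsilon> / T" using \<epsilon> T by simp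
  have "uniformly_continuous_on (cball 0 (K + 1) \<times> C) (\<lambda>p. gen2 f (fst p) (snd p))"
    by (intro compact_uniformly_continuous compact_Times compact_cball C(1)
        continuous_on_subset[OF coefficient_continuity(4)[OF f]]) simp
  then obtain d where d: "0 < d" "\<And>p q. p \<in> cball 0 (K + 1) \<times> C \<Longrightarrow> q \<in> cball 0 (K + 1) \<times> C \<Longrightarrow> dist q p < d \<Longrightarrow>
    dist (gen2 f (fst q) (snd q)) (gen2 f (fst p) (snd p)) < \<epsilon> / T"
    unfolding uniformly_continuous_on_def using eT by meson
  define e where "e = min 1 (d / 2)"
  have e: "0 < e" "e \<le> 1" "e < d" using d(1) by (auto simp: e_def)
  show ?thesis
  proof (rule that[OF e(1)])
    fix N w assume w: "w \<in> space P - bad T e N"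
    have pw: "\<bar>cnd T N j (gen2 f) w - act (generator b \<sigma> f) (grid T N j) w\<bar> \<le> \<epsilon> / T" if j: "j < N" for j
    proof (cases "grid T N j < \<rho> w")
      case True
      let ?y = "teuler T N j w" and ?x = "X (grid T N j) w"
      have cl: "norm (?y - ?x) \<le> e"
        using teuler_good(1)[OF T w e(1,2) _ True] j by simp
      have xC: "?x \<in> C" using X_C[OF _ grid_nonneg[OF T0] True] w by simp
      have "norm ?y \<le> norm (?y - ?x) + norm ?x"
        using norm_triangle_ineq[of "?y - ?x" ?x] by simp
      then have ny: "norm ?y \<le> K + 1" using cl e(2) K(2)[OF xC] by linarith
      have "dist (gen2 f (fst (?y, ?x)) (snd (?y, ?x))) (gen2 f (fst (?x, ?x)) (snd (?x, ?x))) < \<epsilon> / T"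
      proof (rule d(2))
        show "(?x, ?x) \<in> cball 0 (K + 1) \<times> C" using xC K(2)[OF xC] by simp
        show "(?y, ?x) \<in> cball 0 (K + 1) \<times> C" using xC ny by simp
        show "dist (?y, ?x) (?x, ?x) < d" using cl e(3) by (simp add: dist_Pair_Pair dist_norm)
      qed
      then show ?thesis
        using True ny by (simp add: cnd_def act_def gen2_same dist_real_def)
    next
      case False
      then show ?thesis using eT by (simp add: cnd_def act_def)
    qed
    have "(\<Sum>j<N. (T / real N) * cnd T N j (gen2 f) w) - (\<Sum>j<N. (T / real N) * act (generator b \<sigma> f) (grid T N j) w)
      = (\<Sum>j<N. (T / real N) * (cnd T N j (gen2 f) w - act (generator b \<sigma> f) (grid T N j) w))"
      by (simp add: sum_subtractf right_diff_distrib)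
    moreover have "\<bar>\<Sum>j<N. (T / real N) * (cnd T N j (gen2 f) w - act (generator b \<sigma> f) (grid T N j) w)\<bar> \<le> T * (\<epsilon> / T)"
      by (rule grid_sum_bound[OF T0 pw]) (use eT in auto)
    ultimately show "\<bar>(\<Sum>j<N. (T / real N) * cnd T N j (gen2 f) w) - (\<Sum>j<N. (T / real N) * act (generator b \<sigma> f) (grid T N j) w)\<bar> \<le> \<epsilon>"
      using T by simp
  qed
qed

lemma time_integral_measurable:
  fixes g :: "real ^ 'n \<Rightarrow> real"
  assumes g: "continuous_on UNIV g"
  shows "(\<lambda>w. \<integral>s. act g s w \<partial>clock T) \<in> borel_measurable P"
proof -
  interpret c: finite_measure "clock T" by (rule finite_measure_clock)
  from measurable_pair_swap[OF act_jointly_measurable[OF g, of T]]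
  have "(\<lambda>(w, s). act g s w) \<in> borel_measurable (P \<Otimes>\<^sub>M clock T)"
    by (simp add: split_def)
  then show ?thesis by (rule c.borel_measurable_lebesgue_integral)
qed

text \<open>Two replacements: the scheme by the path, which is close only in probability, and then
  the sum by the time integral, which converges along every path.\<close>

lemma expectation_generator_tendsto:
  assumes T: "0 < T" and f: "C2_fun (f :: real ^ 'n \<Rightarrow> real)"
  shows "(\<lambda>N. expectation (\<lambda>w. \<Sum>j<N. (T / real N) * cnd T N j (gen2 f) w)) \<longlonglongrightarrow>
    expectation (\<lambda>w. \<integral>s. act (generator b \<sigma> f) s w \<partial>clock T)"
proof -
  have T0: "0 \<le> T" using T by simp
  let ?G = "generator b \<sigma> f"
  have Gc: "continuous_on UNIV ?G" by (rule generator_continuous[OF f b_cont \<sigma>_cont])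
  obtain B1 where B1: "0 \<le> B1" "\<And>w t. w \<in> space P \<Longrightarrow> 0 \<le> t \<Longrightarrow> \<bar>act ?G t w\<bar> \<le> B1"
    by (rule act_bounded[OF Gc]) blast
  obtain B2 where B2: "0 \<le> B2" "\<And>T N j w. 0 \<le> T \<Longrightarrow> w \<in> space P \<Longrightarrow> norm (cnd T N j (gen2 f) w) \<le> B2"
    by (rule cnd_bounded[OF coefficient_continuity(4)[OF f]]) blast
  define Z where "Z N w = (\<Sum>j<N. (T / real N) * cnd T N j (gen2 f) w)" for N w
  define Y where "Y N w = (\<Sum>j<N. (T / real N) * act ?G (grid T N j) w)" for N w
  have Zm: "Z N \<in> borel_measurable P" for N
    unfolding Z_def[abs_def]
    by (intro borel_measurable_sum borel_measurable_times borel_measurable_const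
        measurable_F_P[OF cnd_measurable[OF T0 coefficient_continuity(4)[OF f]]])
  have Ym: "Y N \<in> borel_measurable P" for N
  proof -
    have "act ?G (grid T N j) \<in> borel_measurable P" for j
      by (rule act_measurable_P[OF Gc grid_nonneg[OF T0]])
    then have "(\<lambda>w. (T / real N) * act ?G (grid T N j) w) \<in> borel_measurable P" for j
      by (rule borel_measurable_times[OF borel_measurable_const])
    then show ?thesis
      unfolding Y_def[abs_def] by (rule borel_measurable_sum)
  qed
  have Zb: "\<bar>Z N w\<bar> \<le> T * B2" if "w \<in> space P" for N w
    unfolding Z_def using B2(2)[OF T0 that] by (intro grid_sum_bound[OF T0 _ B2(1)]) simp
  have Yb: "\<bar>Y N w\<bar> \<le> T * B1" if "w \<in> space P" for N w
    unfolding Y_def using B1(2)[OF that grid_nonneg[OF T0]] by (intro grid_sum_bound[OF T0 _ B1(1)]) simp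
  have "(\<lambda>N. expectation (Z N) - expectation (Y N)) \<longlonglongrightarrow> 0"
  proof (rule expectation_diff_tendsto_0)
    show "eventually (\<lambda>N. Z N \<in> borel_measurable P \<and> Y N \<in> borel_measurable P) sequentially"
      using Zm Ym by simp
    have "\<bar>Z N w\<bar> \<le> T * B1 + T * B2 \<and> \<bar>Y N w\<bar> \<le> T * B1 + T * B2" if "w \<in> space P" for N w
      using Zb[OF that, of N] Yb[OF that, of N] by linarith
    then show "eventually (\<lambda>N. \<forall>w\<in>space P. \<bar>Z N w\<bar> \<le> T * B1 + T * B2 \<and> \<bar>Y N w\<bar> \<le> T * B1 + T * B2) sequentially"
      by simp
    fix \<epsilon> :: real assume "0 < \<epsilon>"
    then obtain e where e: "0 < e" "\<And>N w. w \<in> space P - bad T e N \<Longrightarrow> \<bar>Z N w - Y N w\<bar> \<le> \<epsilon>"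
      unfolding Z_def Y_def by (rule euler_generator_close[OF T f]) blast
    show "\<exists>A. (\<forall>N. A N \<in> events) \<and> (\<lambda>N. prob (A N)) \<longlonglongrightarrow> 0 \<and>
      eventually (\<lambda>N. \<forall>w\<in>space P - A N. \<bar>Z N w - Y N w\<bar> \<le> \<epsilon>) sequentially"
      using e bad_measurable[OF T] bad_tendsto[OF T e(1)] by (intro exI[of _ "bad T e"]) auto
  qed
  moreover have "(\<lambda>N. expectation (Y N)) \<longlonglongrightarrow> expectation (\<lambda>w. \<integral>s. act ?G s w \<partial>clock T)"
  proof (rule integral_dominated_convergence[where w = "\<lambda>_. T * B1"])
    show "(\<lambda>w. \<integral>s. act ?G s w \<partial>clock T) \<in> borel_measurable P" by (rule time_integral_measurable[OF Gc])
    show "Y N \<in> borel_measurable P" for N by (rule Ym)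
    show "integrable P (\<lambda>_. T * B1)" by simp
    show "AE w in P. norm (Y N w) \<le> T * B1" for N using Yb by (intro AE_I2) simp
    show "AE w in P. (\<lambda>N. Y N w) \<longlonglongrightarrow> (\<integral>s. act ?G s w \<partial>clock T)"
      unfolding Y_def using B1(2) by (intro AE_I2 riemann_sum_tendsto[OF T _ Gc])
  qed
  ultimately have "(\<lambda>N. (expectation (Z N) - expectation (Y N)) + expectation (Y N)) \<longlonglongrightarrow>
      0 + expectation (\<lambda>w. \<integral>s. act ?G s w \<partial>clock T)"
    by (rule tendsto_add)
  then show ?thesis
    unfolding Z_def[abs_def] by simp
qed

lemma expectation_final_tendsto:
  assumes T: "0 < T" and f: "continuous_on UNIV (f :: real ^ 'n \<Rightarrow> real)"
  shows "(\<lambda>N. expectation (\<lambda>w. f (teuler T N N w))) \<longlonglongrightarrow> expectation (\<lambda>w. f (final_value T w))"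
proof -
  have T0: "0 \<le> T" using T by simp
  obtain B where B: "\<And>x. norm x \<le> 3 * K + 1 \<Longrightarrow> \<bar>f x\<bar> \<le> B"
    by (rule f_teuler_bounded[OF f]) blast
  have lim0: "(\<lambda>N. T / real N) \<longlonglongrightarrow> 0" by (rule lim_const_over_n)
  have nf: "norm (final_value T w) \<le> 3 * K + 1" if "w \<in> space P" for w
    using K(2)[OF final_value_mem_C[OF that less_imp_le[OF T]]] K(1) by linarith
  have tm: "(\<lambda>w. f (teuler T N j w)) \<in> borel_measurable P" for N j
    by (rule borel_measurable_continuous_on[OF f measurable_F_P[OF teuler_measurable[OF T0]]])
  have fm: "(\<lambda>w. f (final_value T w)) \<in> borel_measurable P"
    by (rule borel_measurable_continuous_on[OF f final_value_measurable[OF T]])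
  have h1: "eventually (\<lambda>N. T / real N \<le> 1) sequentially"
    using order_tendstoD(2)[OF lim0, of 1] by (auto elim!: eventually_mono)
  have "(\<lambda>N. expectation (\<lambda>w. f (teuler T N N w)) - expectation (\<lambda>w. f (final_value T w))) \<longlonglongrightarrow> 0"
  proof (rule expectation_diff_tendsto_0)
    show "eventually (\<lambda>N. (\<lambda>w. f (teuler T N N w)) \<in> borel_measurable P \<and> (\<lambda>w. f (final_value T w)) \<in> borel_measurable P) sequentially"
      using tm fm by simp
    show "eventually (\<lambda>N. \<forall>w\<in>space P. \<bar>f (teuler T N N w)\<bar> \<le> B \<and> \<bar>f (final_value T w)\<bar> \<le> B) sequentially"
      using h1
    proof eventually_elim
      case (elim N)
      show ?case using B[OF teuler_bound[OF T0 elim]] B[OF nf] by simp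
    qed
    fix \<epsilon> :: real assume \<epsilon>: "0 < \<epsilon>"
    have "uniformly_continuous_on (cball 0 (3 * K + 1)) f"
      by (intro compact_uniformly_continuous compact_cball continuous_on_subset[OF f]) simp
    then obtain d where d: "0 < d" "\<And>x y. x \<in> cball 0 (3 * K + 1) \<Longrightarrow> y \<in> cball 0 (3 * K + 1) \<Longrightarrow> dist y x < d \<Longrightarrow> dist (f y) (f x) < \<epsilon>"
      unfolding uniformly_continuous_on_def using \<epsilon> by meson
    \<comment> \<open>As K is at least 1, \<open>2 * e + K * e\<close> is at most
      \<open>3 * K * e\<close> and hence at most \<open>d / 2\<close>; the remaining
      \<open>K * (T / real N)\<close> is below \<open>d / 2\<close> for large N.\<close>
    define e where "e = min 1 (d / (6 * K))"
    have e: "0 < e" "e \<le> 1" using d(1) K(1) by (auto simp: e_def)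
    have "e * (6 * K) \<le> d"
      using K(1) d(1) by (simp add: e_def min_def field_simps)
    moreover have "e \<le> e * K" using e K(1) by simp
    ultimately have eK: "2 * e + K * e \<le> d / 2" by (simp add: mult.commute)
    have "0 < d / (2 * K)" using d(1) K(1) by simp
    from order_tendstoD(2)[OF lim0 this] h1
    have ev: "eventually (\<lambda>N. \<forall>w\<in>space P - bad T e N. \<bar>f (teuler T N N w) - f (final_value T w)\<bar> \<le> \<epsilon>) sequentially"
    proof eventually_elim
      case (elim N)
      have Kh: "K * (T / real N) < d / 2"
        using elim(1) K(1) by (simp add: field_simps)
      show ?case
      proof
        fix w assume w: "w \<in> space P - bad T e N"
        have "norm (teuler T N N w - final_value T w) \<le> 2 * e + K * (T / real N) + K * e"
          by (rule teuler_good(2)[OF T w e])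
        then have "dist (teuler T N N w) (final_value T w) < d"
          unfolding dist_norm using eK Kh by linarith
        then have "dist (f (teuler T N N w)) (f (final_value T w)) < \<epsilon>"
          using w teuler_bound[OF T0 elim(2), of w N] nf[of w] by (intro d(2)) auto
        then show "\<bar>f (teuler T N N w) - f (final_value T w)\<bar> \<le> \<epsilon>"
          by (simp add: dist_real_def)
      qed
    qed
    show "\<exists>A. (\<forall>N. A N \<in> events) \<and> (\<lambda>N. prob (A N)) \<longlonglongrightarrow> 0 \<and>
      eventually (\<lambda>N. \<forall>w\<in>space P - A N. \<bar>f (teuler T N N w) - f (final_value T w)\<bar> \<le> \<epsilon>) sequentially"
      using bad_measurable[OF T] bad_tendsto[OF T e(1)] ev by (intro exI[of _ "bad T e"]) auto
  qed
  then show ?thesis by (rule LIM_zero_cancel)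
qed

text \<open>The constant \<open>A\<close> of the discrete formula depends on \<epsilon>, so the
  order of the limits matters: N tends to infinity first and leaves an error proportional to
  \<epsilon>, then \<epsilon> tends to 0.\<close>

theorem dynkin_formula:
  assumes T: "0 < T" and f: "C2_fun (f :: real ^ 'n \<Rightarrow> real)"
  shows "expectation (\<lambda>w. f (final_value T w)) =
    f x0 + expectation (\<lambda>w. \<integral>s. act (generator b \<sigma> f) s w \<partial>clock T)"
proof -
  define L where "L = expectation (\<lambda>w. f (final_value T w)) - f x0 - expectation (\<lambda>w. \<integral>s. act (generator b \<sigma> f) s w \<partial>clock T)"
  define l where "l N = expectation (\<lambda>w. f (teuler T N N w)) - f x0 - expectation (\<lambda>w. \<Sum>j<N. (T / real N) * cnd T N j (gen2 f) w)" for N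
  have lim0: "(\<lambda>N. T / real N) \<longlonglongrightarrow> 0" by (rule lim_const_over_n)
  have lL: "l \<longlonglongrightarrow> L"
    unfolding l_def L_def
    by (intro tendsto_diff tendsto_const expectation_generator_tendsto[OF T f]
        expectation_final_tendsto[OF T C1_continuous[OF C2_imp_C1[OF f]]])
  have "\<bar>L\<bar> \<le> \<epsilon> * (T * (1 + real CARD('k)))" if \<epsilon>: "0 < \<epsilon>" for \<epsilon>
  proof -
    obtain A where A: "0 \<le> A" and dd: "\<forall>T N. 0 < T \<longrightarrow> 0 < N \<longrightarrow> T / real N \<le> 1 \<longrightarrow>
      \<bar>expectation (\<lambda>w. f (teuler T N N w)) - f x0 - expectation (\<lambda>w. \<Sum>j<N. (T / real N) * cnd T N j (gen2 f) w)\<bar>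
      \<le> \<epsilon> * (T * (1 + real CARD('k))) + A * (T * (T / real N) * (1 + 3 * (real CARD('k))\<^sup>2))"
      using dynkin_discrete[OF f \<epsilon>] by (elim exE conjE)
    have h1: "eventually (\<lambda>N. T / real N \<le> 1) sequentially"
      using order_tendstoD(2)[OF lim0, of 1] by (auto elim!: eventually_mono)
    have ev: "eventually (\<lambda>N. \<bar>l N\<bar> \<le> \<epsilon> * (T * (1 + real CARD('k))) + A * (T * (T / real N) * (1 + 3 * (real CARD('k))\<^sup>2))) sequentially"
      using h1 eventually_gt_at_top[of "0::nat"]
    proof eventually_elim
      case (elim N)
      show ?case unfolding l_def by (rule dd[rule_format, OF T elim(2,1)])
    qed
    have "(\<lambda>N. \<epsilon> * (T * (1 + real CARD('k))) + A * (T * (T / real N) * (1 + 3 * (real CARD('k))\<^sup>2)))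
      \<longlonglongrightarrow> \<epsilon> * (T * (1 + real CARD('k))) + A * (T * 0 * (1 + 3 * (real CARD('k))\<^sup>2))"
      by (intro tendsto_intros lim0)
    from tendsto_le[OF sequentially_bot this tendsto_rabs[OF lL] ev] show ?thesis by simp
  qed
  note bnd = this
  have "\<bar>L\<bar> \<le> 0 + e" if e: "0 < e" for e
  proof -
    have c: "0 < T * (1 + real CARD('k))" using T by (intro mult_pos_pos) auto
    have "\<bar>L\<bar> \<le> e / (T * (1 + real CARD('k))) * (T * (1 + real CARD('k)))"
      using e c by (intro bnd) simp
    also have "\<dots> = e" using c T by simp
    finally show ?thesis by simp
  qed
  then have "\<bar>L\<bar> \<le> 0" by (rule field_le_epsilon)
  then show ?thesis by (simp add: L_def)
qed

end

section \<open>A lower Gronwall estimate\<close>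

text \<open>The integral q of h satisfies the differential inequality whose equality case is y.
  Multiplied by \<open>exp (- \<alpha> * t)\<close>, the difference of q and y is nondecreasing for
  either sign of \<alpha>; iterating the integral inequality would require \<alpha> to be
  nonnegative.\<close>

lemma gronwall_lower_comparison:
  fixes h y :: "real \<Rightarrow> real"
  assumes T: "0 < T" and h: "continuous_on {0..T} h"
    and low: "\<And>t. 0 < t \<Longrightarrow> t \<le> T \<Longrightarrow> a + \<alpha> * integral {0..t} h + \<beta> * t \<le> h t"
    and y: "\<And>t. (y has_real_derivative a + \<alpha> * y t + \<beta> * t) (at t)" "y 0 = 0"
  shows "y T \<le> integral {0..T} h"
proof -
  define q where "q t = integral {0..t} h" for t
  define d where "d t = exp (- \<alpha> * t) * (q t - y t)" for t
  have qd: "(q has_real_derivative h t) (at t within {0..T})" if "t \<in> {0..T}" for t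
    unfolding q_def by (rule integral_has_real_derivative[OF h that])
  have "continuous_on {0..T} q"
    by (rule DERIV_continuous_on[OF qd])
  moreover have "continuous_on {0..T} y"
    by (rule DERIV_continuous_on[of _ _ "\<lambda>t. a + \<alpha> * y t + \<beta> * t"]) (rule DERIV_subset[OF y(1)], simp)
  ultimately have dc: "continuous_on {0..T} d"
    unfolding d_def by (intro continuous_intros)
  have "d 0 \<le> d T"
  proof (rule DERIV_nonneg_imp_increasing_open[OF _ _ dc])
    show "0 \<le> T" using T by simp
    fix t assume t: "0 < t" "t < T"
    have q': "(q has_real_derivative h t) (at t)"
      using qd[of t] t at_within_Icc_at[of 0 t T] by simp
    have "(d has_real_derivative exp (- \<alpha> * t) * (h t - (a + \<alpha> * q t + \<beta> * t))) (at t)"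
      unfolding d_def by (rule derivative_eq_intros q' y(1) refl | simp add: algebra_simps)+
    moreover have "0 \<le> exp (- \<alpha> * t) * (h t - (a + \<alpha> * q t + \<beta> * t))"
      using low[OF t(1)] t by (simp add: q_def)
    ultimately show "\<exists>z. (d has_real_derivative z) (at t) \<and> 0 \<le> z"
      by blast
  qed
  then have "0 \<le> exp (- \<alpha> * T) * (q T - y T)"
    using y(2) by (simp add: d_def q_def)
  then show ?thesis
    by (simp add: q_def zero_le_mult_iff)
qed

text \<open>The left-hand side is the explicit solution at time T of y' = a + \<alpha> y + \<beta> t
  with y(0) = 0, in its two forms.\<close>

lemma gronwall_lower:
  fixes h :: "real \<Rightarrow> real"
  assumes T: "0 < T" and h: "continuous_on {0..T} h"
    and low: "\<And>t. 0 < t \<Longrightarrow> t \<le> T \<Longrightarrow> a + \<alpha> * integral {0..t} h + \<beta> * t \<le> h t"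
  shows "(if \<alpha> \<noteq> 0 then (1 / \<alpha> * a + \<beta> / \<alpha>\<^sup>2) * (exp (\<alpha> * T) - 1) - \<beta> / \<alpha> * T
     else a * T + 1 / 2 * \<beta> * T\<^sup>2) \<le> integral {0..T} h"
proof (cases "\<alpha> = 0")
  case False
  have "((\<lambda>t. (1 / \<alpha> * a + \<beta> / \<alpha>\<^sup>2) * (exp (\<alpha> * t) - 1) - \<beta> / \<alpha> * t) has_real_derivative
      a + \<alpha> * ((1 / \<alpha> * a + \<beta> / \<alpha>\<^sup>2) * (exp (\<alpha> * t) - 1) - \<beta> / \<alpha> * t) + \<beta> * t) (at t)" for t
    by (rule derivative_eq_intros refl | simp)+
       (use False in \<open>simp add: field_simps power2_eq_square\<close>)
  from gronwall_lower_comparison[OF T h low this] False show ?thesis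
    by simp
next
  case True
  have "((\<lambda>t. a * t + 1 / 2 * \<beta> * t\<^sup>2) has_real_derivative a + \<alpha> * (a * t + 1 / 2 * \<beta> * t\<^sup>2) + \<beta> * t) (at t)" for t
    unfolding True by (rule derivative_eq_intros refl | simp)+
  from gronwall_lower_comparison[OF T h low this] True show ?thesis
    by simp
qed

section \<open>Time averages along the stopped process\<close>

context wiener_space
begin

text \<open>Boundedness and joint measurability make the process integrable over the product of the
  clock and P, so Fubini applies.\<close>

lemma time_integral_facts:
  fixes p :: "real \<Rightarrow> 'w \<Rightarrow> real"
  assumes m: "(\<lambda>x. p (fst x) (snd x)) \<in> borel_measurable (clock T \<Otimes>\<^sub>M P)"
    and B: "\<And>s w. 0 \<le> s \<Longrightarrow> s \<le> T \<Longrightarrow> w \<in> space P \<Longrightarrow> \<bar>p s w\<bar> \<le> B"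
  shows "w \<in> space P \<Longrightarrow> integrable (clock T) (\<lambda>s. p s w)"
    and "integrable P (\<lambda>w. \<integral>s. p s w \<partial>clock T)"
    and "expectation (\<lambda>w. \<integral>s. p s w \<partial>clock T) = (\<integral>s. expectation (p s) \<partial>clock T)"
proof -
  interpret c: finite_measure "clock T" by (rule finite_measure_clock)
  interpret pp: pair_sigma_finite "clock T" P ..
  interpret fp: finite_measure "clock T \<Otimes>\<^sub>M P"
    by (rule finite_measure_pair_measure) (unfold_locales)
  have sec: "(\<lambda>s. p s w) \<in> borel_measurable (clock T)" if w: "w \<in> space P" for w
    using measurable_compose[OF measurable_Pair2'[OF w] m] by simp
  show "integrable (clock T) (\<lambda>s. p s w)" if w: "w \<in> space P"
    using B w by (intro c.integrable_const_bound[where B = B] sec) auto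
  have "integrable (clock T \<Otimes>\<^sub>M P) (\<lambda>x. p (fst x) (snd x))"
    using B by (intro fp.integrable_const_bound[where B = B] m) (auto simp: space_pair_measure)
  then have int: "integrable (clock T \<Otimes>\<^sub>M P) (case_prod p)"
    by (simp add: split_def)
  show "integrable P (\<lambda>w. \<integral>s. p s w \<partial>clock T)"
    by (rule pp.integrable_snd[OF int])
  show "expectation (\<lambda>w. \<integral>s. p s w \<partial>clock T) = (\<integral>s. expectation (p s) \<partial>clock T)"
    by (rule pp.Fubini_integral[OF int])
qed

end

lemma measure_clock_space: "0 \<le> T \<Longrightarrow> measure (clock T) {0..T} = T"
  unfolding clock_def by (subst measure_restrict_space) auto

lemma integral_clock_eq:
  fixes h :: "real \<Rightarrow> real"
  assumes "continuous_on {0..T} h"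
  shows "(\<integral>s. h s \<partial>clock T) = integral {0..T} h"
proof -
  have "(\<integral>s. h s \<partial>clock T) = (LINT s:{0..T}|lborel. h s)"
    unfolding clock_def set_lebesgue_integral_def by (subst integral_restrict_space) auto
  also have "\<dots> = integral {0..T} h"
    by (rule set_borel_integral_eq_integral(2)[OF borel_integrable_atLeastAtMost'[OF assms]])
  finally show ?thesis .
qed

context stopped_ito
begin

lemma final_value_continuous:
  assumes w: "w \<in> space P"
  shows "continuous_on {0..} (\<lambda>t. final_value t w)"
proof (cases "0 < \<rho> w")
  case True
  have "continuous_on {0..} (\<lambda>t. X (min t (\<rho> w)) w)"
    by (rule continuous_on_compose2[OF X_cont[OF w]]) (use True in \<open>auto intro!: continuous_intros\<close>)
  then show ?thesis using True by (simp add: final_value_def)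
next
  case False
  then show ?thesis by (simp add: final_value_def)
qed

lemma final_value_measurable_P:
  assumes t: "0 \<le> t"
  shows "final_value t \<in> borel_measurable P"
proof (cases "0 < t")
  case True
  then show ?thesis by (rule final_value_measurable)
next
  case False
  then have t0: "t = 0" using t by simp
  have 1: "act (\<lambda>x. x) 0 \<in> borel_measurable P"
    by (rule act_measurable_P[OF continuous_on_id]) simp
  have "{w \<in> space P. 0 < \<rho> w} \<in> sets P"
    using \<rho>_stop[of 0] sets_F_subset by auto
  with 1 have "(\<lambda>w. if 0 < \<rho> w then act (\<lambda>x. x) 0 w else x0) \<in> borel_measurable P"
    by (intro measurable_If) auto
  moreover have "final_value t = (\<lambda>w. if 0 < \<rho> w then act (\<lambda>x. x) 0 w else x0)"
    by (auto simp: final_value_def act_def t0 min_def)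
  ultimately show ?thesis by simp
qed

lemma final_value_jointly_measurable:
  fixes f :: "real ^ 'n \<Rightarrow> real"
  assumes f: "continuous_on UNIV f"
  shows "(\<lambda>x. f (final_value (fst x) (snd x))) \<in> borel_measurable (clock T \<Otimes>\<^sub>M P)"
proof (rule right_continuous_jointly_measurable)
  show "(\<lambda>w. f (final_value t w)) \<in> borel_measurable P" if "0 \<le> t" for t
    by (rule borel_measurable_continuous_on[OF f final_value_measurable_P[OF that]])
  fix w t assume w: "w \<in> space P" and t: "0 \<le> (t::real)"
  have "((\<lambda>s. final_value s w) \<longlongrightarrow> final_value t w) (at_right t)"
  proof (rule continuous_on_tendsto_compose[OF final_value_continuous[OF w] tendsto_ident_at])
    have "eventually (\<lambda>s. t < s) (at_right t)" by (simp add: eventually_at_filter)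
    then show "eventually (\<lambda>s. s \<in> {0..}) (at_right t)"
      using t by (auto elim!: eventually_mono)
  qed (use t in simp)
  then show "((\<lambda>s. f (final_value s w)) \<longlongrightarrow> f (final_value t w)) (at_right t)"
    by (rule continuous_on_tendsto_compose[OF f]) auto
qed

definition mean :: "(real ^ 'n \<Rightarrow> real) \<Rightarrow> real \<Rightarrow> real" where
  "mean f t = expectation (\<lambda>w. f (final_value t w))"

lemma final_value_bounded:
  fixes f :: "real ^ 'n \<Rightarrow> real"
  assumes f: "continuous_on UNIV f"
  obtains B where "0 \<le> B" "\<And>w t. w \<in> space P \<Longrightarrow> 0 \<le> t \<Longrightarrow> \<bar>f (final_value t w)\<bar> \<le> B"
proof -
  obtain B where B: "0 \<le> B" "\<And>x. x \<in> C \<Longrightarrow> norm (f x) \<le> B"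
    by (rule continuous_bounded_on_compact[OF f C(1)]) blast
  show ?thesis
    using B(2)[OF final_value_mem_C] by (intro that[OF B(1)]) auto
qed

lemma final_value_integrable:
  fixes f :: "real ^ 'n \<Rightarrow> real"
  assumes f: "continuous_on UNIV f" and t: "0 \<le> t"
  shows "integrable P (\<lambda>w. f (final_value t w))"
proof -
  obtain B where B: "\<And>w t. w \<in> space P \<Longrightarrow> 0 \<le> t \<Longrightarrow> \<bar>f (final_value t w)\<bar> \<le> B"
    by (rule final_value_bounded[OF f]) blast
  show ?thesis
    using B t borel_measurable_continuous_on[OF f final_value_measurable_P[OF t]]
    by (intro integrable_const_bound[where B = B]) auto
qed

text \<open>Stopped paths are continuous and stay in a compact set, so dominated convergence
  applies. Continuity is needed because the comparison argument differentiates the time integral of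
  the mean.\<close>

lemma mean_continuous:
  assumes f: "continuous_on UNIV f"
  shows "continuous_on {0..T} (mean f)"
  unfolding continuous_on_sequentially
proof (intro ballI allI impI)
  fix t u assume t: "t \<in> {0..T}" and u: "(\<forall>n. u n \<in> {0..T}) \<and> u \<longlonglongrightarrow> t"
  then have un: "u n \<in> {0..T}" and ul: "u \<longlonglongrightarrow> t" for n by auto
  obtain B where B: "\<And>w t. w \<in> space P \<Longrightarrow> 0 \<le> t \<Longrightarrow> \<bar>f (final_value t w)\<bar> \<le> B"
    by (rule final_value_bounded[OF f]) blast
  have "(\<lambda>n. expectation (\<lambda>w. f (final_value (u n) w))) \<longlonglongrightarrow> expectation (\<lambda>w. f (final_value t w))"
  proof (rule integral_dominated_convergence[where w = "\<lambda>_. B"])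
    show "(\<lambda>w. f (final_value t w)) \<in> borel_measurable P"
      using t by (intro borel_measurable_continuous_on[OF f] final_value_measurable_P) simp
    show "(\<lambda>w. f (final_value (u n) w)) \<in> borel_measurable P" for n
      using un[of n] by (intro borel_measurable_continuous_on[OF f] final_value_measurable_P) simp
    show "AE w in P. norm (f (final_value (u n) w)) \<le> B" for n
      using un[of n] B by (intro AE_I2) simp
    show "AE w in P. (\<lambda>n. f (final_value (u n) w)) \<longlonglongrightarrow> f (final_value t w)"
    proof (rule AE_I2)
      fix w assume w: "w \<in> space P"
      have "(\<lambda>n. final_value (u n) w) \<longlonglongrightarrow> final_value t w"
        by (rule continuous_on_tendsto_compose[OF final_value_continuous[OF w] ul]) (use t un in auto)
      then show "(\<lambda>n. f (final_value (u n) w)) \<longlonglongrightarrow> f (final_value t w)"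
        by (rule continuous_on_tendsto_compose[OF f]) auto
    qed
  qed simp
  then show "(mean f \<circ> u) \<longlonglongrightarrow> mean f t"
    by (simp add: mean_def[abs_def] o_def)
qed

lemma time_mean:
  assumes f: "continuous_on UNIV f"
  shows "expectation (\<lambda>w. \<integral>s. f (final_value s w) \<partial>clock T) = integral {0..T} (mean f)"
proof -
  obtain B where B: "\<And>w t. w \<in> space P \<Longrightarrow> 0 \<le> t \<Longrightarrow> \<bar>f (final_value t w)\<bar> \<le> B"
    by (rule final_value_bounded[OF f]) blast
  have "expectation (\<lambda>w. \<integral>s. f (final_value s w) \<partial>clock T) = (\<integral>s. mean f s \<partial>clock T)"
    unfolding mean_def
    by (rule time_integral_facts(3)[OF final_value_jointly_measurable[OF f], where B = B]) (use B in auto)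
  also have "\<dots> = integral {0..T} (mean f)"
    by (rule integral_clock_eq[OF mean_continuous[OF f]])
  finally show ?thesis .
qed

section \<open>Bounds for the mean of the stopped process\<close>

lemma final_value_before:
  assumes "0 \<le> t" "t < \<rho> w"
  shows "final_value t w = X t w"
  using assms by (simp add: final_value_def)

text \<open>After \<open>\<rho>\<close> the integrand in Dynkin's formula is 0, which dominates
  \<open>\<alpha> * f + \<beta>\<close> wherever the path rests at a boundary point. On the event
  \<open>A\<close> the stop need not be an exit, and only the bound c is available there. The loss
  is stated with \<open>T\<close> instead of t, so that the constant in the resulting integral
  inequality does not depend on t.\<close>

lemma mean_lower_bound:
  assumes f: "C2_fun f" and t: "0 < t" "t \<le> T" and A: "A \<in> events" and c0: "0 \<le> c"
    and c: "\<And>x. x \<in> C \<Longrightarrow> \<alpha> * f x + \<beta> \<le> c"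
    and gen: "\<And>w s. w \<in> space P \<Longrightarrow> 0 \<le> s \<Longrightarrow> s < \<rho> w \<Longrightarrow> \<alpha> * f (X s w) + \<beta> \<le> generator b \<sigma> f (X s w)"
    and stopped: "AE w in P. w \<notin> A \<longrightarrow> (\<forall>s. 0 \<le> s \<and> s \<le> T \<and> \<rho> w \<le> s \<longrightarrow> \<alpha> * f (final_value s w) + \<beta> \<le> 0)"
  shows "f x0 - c * T * prob A + \<alpha> * integral {0..t} (mean f) + \<beta> * t \<le> mean f t"
proof -
  let ?G = "generator b \<sigma> f"
  have t0: "0 \<le> t" using t by simp
  have fc: "continuous_on UNIV f" by (rule C1_continuous[OF C2_imp_C1[OF f]])
  have Gc: "continuous_on UNIV ?G" by (rule generator_continuous[OF f b_cont \<sigma>_cont])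
  interpret c: finite_measure "clock t" by (rule finite_measure_clock)
  obtain B1 where B1: "\<And>w t. w \<in> space P \<Longrightarrow> 0 \<le> t \<Longrightarrow> \<bar>act ?G t w\<bar> \<le> B1"
    by (rule act_bounded[OF Gc]) blast
  obtain B2 where B2: "\<And>w t. w \<in> space P \<Longrightarrow> 0 \<le> t \<Longrightarrow> \<bar>f (final_value t w)\<bar> \<le> B2"
    by (rule final_value_bounded[OF fc]) blast
  note tG = time_integral_facts[OF act_jointly_measurable[OF Gc, of t], where B = B1, OF B1]
  note tf = time_integral_facts[OF final_value_jointly_measurable[OF fc, of t], where B = B2, OF B2]
  let ?I = "\<lambda>w. \<integral>s. act ?G s w \<partial>clock t" and ?J = "\<lambda>w. \<integral>s. f (final_value s w) \<partial>clock t"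
  have pw: "AE w in P. \<alpha> * ?J w + (\<beta> - c * indicator A w) * t \<le> ?I w"
    using stopped AE_space
  proof eventually_elim
    case (elim w)
    have "\<alpha> * ?J w + (\<beta> - c * indicator A w) * t = (\<integral>s. \<alpha> * f (final_value s w) + (\<beta> - c * indicator A w) \<partial>clock t)"
      using tf(1)[OF _ _ elim(2)] measure_clock_space[OF t0] by simp
    also have "\<dots> \<le> ?I w"
    proof (rule integral_mono)
      show "integrable (clock t) (\<lambda>s. \<alpha> * f (final_value s w) + (\<beta> - c * indicator A w))"
        using tf(1)[OF _ _ elim(2)] by simp
      show "integrable (clock t) (\<lambda>s. act ?G s w)" using tG(1)[OF _ _ elim(2)] by simp
      fix s assume "s \<in> space (clock t)"
      then have s: "0 \<le> s" "s \<le> T" using t by auto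
      have ic: "0 \<le> c * indicator A w" using c0 by simp
      show "\<alpha> * f (final_value s w) + (\<beta> - c * indicator A w) \<le> act ?G s w"
      proof (cases "s < \<rho> w")
        case True
        then have "act ?G s w = ?G (X s w)" by (simp add: act_def)
        then show ?thesis using gen[OF elim(2) s(1) True] final_value_before[OF s(1) True] ic by simp
      next
        case False
        then have a0: "act ?G s w = 0" by (simp add: act_def)
        show ?thesis
        proof (cases "w \<in> A")
          case True
          then show ?thesis using a0 c[OF final_value_mem_C[OF elim(2) s(1)]] by simp
        next
          case nA: False
          then have "\<alpha> * f (final_value s w) + \<beta> \<le> 0" using elim(1) s False by auto
          then show ?thesis using a0 nA by simp
        qed
      qed
    qed
    finally show ?case .
  qed
  have iA: "integrable P (indicator A :: 'w \<Rightarrow> real)"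
    by (rule integrable_real_indicator[OF A]) (simp add: emeasure_eq_measure)
  have iL: "integrable P (\<lambda>w. \<alpha> * ?J w + (\<beta> - c * indicator A w) * t)"
    using tf(2) iA by (intro Bochner_Integration.integrable_add integrable_mult_right integrable_mult_left Bochner_Integration.integrable_diff) auto
  have "expectation (\<lambda>w. \<alpha> * ?J w + (\<beta> - c * indicator A w) * t) \<le> expectation ?I"
    using tG(2) by (intro integral_mono_AE iL pw) simp
  also have "expectation ?I = mean f t - f x0"
    unfolding mean_def dynkin_formula[OF t(1) f] by simp
  also have "expectation (\<lambda>w. \<alpha> * ?J w + (\<beta> - c * indicator A w) * t) = \<alpha> * integral {0..t} (mean f) + (\<beta> - c * prob A) * t"
  proof -
    have "expectation (\<lambda>w. \<alpha> * ?J w + (\<beta> - c * indicator A w) * t) = \<alpha> * expectation ?J + (\<beta> - c * expectation (indicator A)) * t"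
      using tf(2) iA by (simp add: prob_space)
    then show ?thesis
      using time_mean[OF fc, of t] A sets.sets_into_space[OF A] by (simp add: Int_absorb2)
  qed
  finally have "\<alpha> * integral {0..t} (mean f) + (\<beta> - c * prob A) * t \<le> mean f t - f x0" .
  moreover have "c * prob A * t \<le> c * prob A * T"
    using t c0 by (intro mult_left_mono) auto
  ultimately show ?thesis by (simp add: algebra_simps)
qed

lemma occupation_upper_bound:
  assumes u: "C2_fun u" and v: "continuous_on UNIV v" and T: "0 < T"
    and M: "\<And>x. x \<in> C \<Longrightarrow> \<bar>u x\<bar> \<le> M"
    and gen: "\<And>w s. w \<in> space P \<Longrightarrow> 0 \<le> s \<Longrightarrow> s < \<rho> w \<Longrightarrow> v (X s w) \<le> generator b \<sigma> u (X s w)"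
  shows "expectation (\<lambda>w. \<integral>s. act v s w \<partial>clock T) \<le> 2 * M"
proof -
  let ?G = "generator b \<sigma> u"
  have T0: "0 \<le> T" using T by simp
  have uc: "continuous_on UNIV u" by (rule C1_continuous[OF C2_imp_C1[OF u]])
  have Gc: "continuous_on UNIV ?G" by (rule generator_continuous[OF u b_cont \<sigma>_cont])
  obtain B1 where B1: "\<And>w t. w \<in> space P \<Longrightarrow> 0 \<le> t \<Longrightarrow> \<bar>act ?G t w\<bar> \<le> B1"
    by (rule act_bounded[OF Gc]) blast
  obtain B2 where B2: "\<And>w t. w \<in> space P \<Longrightarrow> 0 \<le> t \<Longrightarrow> \<bar>act v t w\<bar> \<le> B2"
    by (rule act_bounded[OF v]) blast
  note tG = time_integral_facts[OF act_jointly_measurable[OF Gc, of T], where B = B1, OF B1]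
  note tv = time_integral_facts[OF act_jointly_measurable[OF v, of T], where B = B2, OF B2]
  have "expectation (\<lambda>w. \<integral>s. act v s w \<partial>clock T) \<le> expectation (\<lambda>w. \<integral>s. act ?G s w \<partial>clock T)"
  proof (rule integral_mono)
    show "integrable P (\<lambda>w. \<integral>s. act v s w \<partial>clock T)" using tv(2) by simp
    show "integrable P (\<lambda>w. \<integral>s. act ?G s w \<partial>clock T)" using tG(2) by simp
    fix w assume w: "w \<in> space P"
    show "(\<integral>s. act v s w \<partial>clock T) \<le> (\<integral>s. act ?G s w \<partial>clock T)"
    proof (rule integral_mono)
      show "integrable (clock T) (\<lambda>s. act v s w)" using tv(1)[OF _ _ w] by simp
      show "integrable (clock T) (\<lambda>s. act ?G s w)" using tG(1)[OF _ _ w] by simp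
      show "act v s w \<le> act ?G s w" if "s \<in> space (clock T)" for s
        using gen[OF w, of s] that by (auto simp: act_def)
    qed
  qed
  also have "\<dots> = mean u T - u x0"
    unfolding mean_def dynkin_formula[OF T u] by simp
  also have "mean u T \<le> expectation (\<lambda>w. M)"
    unfolding mean_def
  proof (rule integral_mono)
    show "integrable P (\<lambda>w. u (final_value T w))" by (rule final_value_integrable[OF uc T0])
    fix w assume w: "w \<in> space P"
    then have "\<bar>u (final_value T w)\<bar> \<le> M" by (intro M final_value_mem_C T0)
    then show "u (final_value T w) \<le> M" by simp
  qed simp
  finally show ?thesis using M[OF C(2)] by (simp add: prob_space)
qed

text \<open>The time after \<open>\<rho>\<close> is at most \<open>T\<close>. The value of v during
  it is charged to the event \<open>R\<close>, or to the bound c on the exceptional event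
  \<open>A\<close>.\<close>

lemma mean_upper_bound:
  assumes v: "continuous_on UNIV v" and T: "0 < T" and A: "A \<in> events" and R: "R \<in> events" and c0: "0 \<le> c"
    and c: "\<And>x. x \<in> C \<Longrightarrow> v x \<le> c"
    and stopped: "AE w in P. w \<notin> A \<longrightarrow> (\<forall>s. 0 \<le> s \<and> s \<le> T \<and> \<rho> w \<le> s \<longrightarrow> v (final_value s w) \<le> indicator R w)"
  shows "integral {0..T} (mean v) \<le> expectation (\<lambda>w. \<integral>s. act v s w \<partial>clock T) + T * prob R + c * T * prob A"
proof -
  have T0: "0 \<le> T" using T by simp
  interpret c: finite_measure "clock T" by (rule finite_measure_clock)
  obtain B1 where B1: "\<And>w t. w \<in> space P \<Longrightarrow> 0 \<le> t \<Longrightarrow> \<bar>act v t w\<bar> \<le> B1"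
    by (rule act_bounded[OF v]) blast
  obtain B2 where B2: "\<And>w t. w \<in> space P \<Longrightarrow> 0 \<le> t \<Longrightarrow> \<bar>v (final_value t w)\<bar> \<le> B2"
    by (rule final_value_bounded[OF v]) blast
  note tv = time_integral_facts[OF act_jointly_measurable[OF v, of T], where B = B1, OF B1]
  note tf = time_integral_facts[OF final_value_jointly_measurable[OF v, of T], where B = B2, OF B2]
  let ?I = "\<lambda>w. \<integral>s. act v s w \<partial>clock T" and ?J = "\<lambda>w. \<integral>s. v (final_value s w) \<partial>clock T"
  have pw: "AE w in P. ?J w \<le> ?I w + (indicator R w + c * indicator A w) * T"
    using stopped AE_space
  proof eventually_elim
    case (elim w)
    have "?J w \<le> (\<integral>s. act v s w + (indicator R w + c * indicator A w) \<partial>clock T)"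
    proof (rule integral_mono)
      show "integrable (clock T) (\<lambda>s. v (final_value s w))" using tf(1)[OF _ _ elim(2)] by simp
      show "integrable (clock T) (\<lambda>s. act v s w + (indicator R w + c * indicator A w))"
        using tv(1)[OF _ _ elim(2)] by simp
      fix s assume "s \<in> space (clock T)"
      then have s: "0 \<le> s" "s \<le> T" by auto
      have ic: "0 \<le> indicator R w + c * indicator A w" using c0 by simp
      show "v (final_value s w) \<le> act v s w + (indicator R w + c * indicator A w)"
      proof (cases "s < \<rho> w")
        case True
        then show ?thesis using final_value_before[OF s(1) True] ic by (simp add: act_def)
      next
        case False
        then have a0: "act v s w = 0" by (simp add: act_def)
        show ?thesis
        proof (cases "w \<in> A")
          case True
          have "v (final_value s w) \<le> c" by (rule c[OF final_value_mem_C[OF elim(2) s(1)]])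
          moreover have "0 \<le> (indicator R w :: real)" by simp
          ultimately show ?thesis unfolding a0 indicator_simps(1)[OF True] by linarith
        next
          case nA: False
          then have "v (final_value s w) \<le> indicator R w" using elim(1) s False by auto
          then show ?thesis using a0 nA by simp
        qed
      qed
    qed
    also have "\<dots> = ?I w + (indicator R w + c * indicator A w) * T"
      using tv(1)[OF _ _ elim(2)] measure_clock_space[OF T0] by simp
    finally show ?case .
  qed
  have iA: "integrable P (indicator A :: 'w \<Rightarrow> real)" "integrable P (indicator R :: 'w \<Rightarrow> real)"
    by (rule integrable_real_indicator[OF A], simp add: emeasure_eq_measure)
       (rule integrable_real_indicator[OF R], simp add: emeasure_eq_measure)
  have iR: "integrable P (\<lambda>w. ?I w + (indicator R w + c * indicator A w) * T)"
    using tv(2) iA by (intro Bochner_Integration.integrable_add integrable_mult_right integrable_mult_left) auto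
  have "integral {0..T} (mean v) = expectation ?J" by (rule time_mean[OF v, symmetric])
  also have "\<dots> \<le> expectation (\<lambda>w. ?I w + (indicator R w + c * indicator A w) * T)"
    using tf(2) by (intro integral_mono_AE iR pw) simp
  also have "\<dots> = expectation ?I + (expectation (indicator R) + c * expectation (indicator A)) * T"
    using tv(2) iA by simp
  also have "\<dots> = expectation ?I + (prob R + c * prob A) * T"
    using A R sets.sets_into_space[OF A] sets.sets_into_space[OF R] by (simp add: Int_absorb2)
  finally show ?thesis by (simp add: algebra_simps)
qed

end

section \<open>Exit times of a local solution\<close>

text \<open>Exits concern only the continuity and adaptedness of the paths and their lifetime; the
  equation enters when the exit is combined with an announcing time. The domain \<open>D\<close>
  will be \<open>S - S\<^sub>s\<close>.\<close>

locale exit_problem = wiener_space P W for P :: "'w measure" and W :: "real \<Rightarrow> 'w \<Rightarrow> real ^ 'k" +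
  fixes X :: "real \<Rightarrow> 'w \<Rightarrow> real ^ 'n" and \<zeta> :: "'w \<Rightarrow> ereal" and D :: "(real ^ 'n) set"
  assumes lifetime_pos: "\<And>w. w \<in> space P \<Longrightarrow> 0 < \<zeta> w"
    and lifetime_stop: "\<And>t. Measurable.pred (F t) (\<lambda>w. \<zeta> w \<le> ereal t)"
    and path_cont: "\<And>w. w \<in> space P \<Longrightarrow> continuous_on {t. 0 \<le> t \<and> ereal t < \<zeta> w} (\<lambda>t. X t w)"
    and path_adapted: "\<And>t. 0 \<le> t \<Longrightarrow> X t \<in> borel_measurable (restrict_space (F t) {w. ereal t < \<zeta> w})"
    and D: "open D" "bounded D"
begin

lemma alive_antimono: "ereal t < \<zeta> w \<Longrightarrow> s \<le> t \<Longrightarrow> ereal s < \<zeta> w"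
  by (rule le_less_trans[of "ereal s" "ereal t"]) simp_all

lemma alive_sets: "{w \<in> space P. ereal t < \<zeta> w} \<in> sets (F t)"
proof -
  have "{w \<in> space (F t). \<not> \<zeta> w \<le> ereal t} \<in> sets (F t)"
    using lifetime_stop[of t] by measurable
  then show ?thesis by (simp add: not_le)
qed

text \<open>\<open>X\<close> is arbitrary after its lifetime; the value 0 there gives a random
  variable on the whole space that is known at time t.\<close>

definition killed :: "real \<Rightarrow> 'w \<Rightarrow> real ^ 'n" where
  "killed t w = (if ereal t < \<zeta> w then X t w else 0)"

lemma killed_measurable:
  assumes t: "0 \<le> t"
  shows "killed t \<in> borel_measurable (F t)"
proof -
  have e: "{w. ereal t < \<zeta> w} \<inter> space P = {w \<in> space P. ereal t < \<zeta> w}" by auto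
  have m: "{w. ereal t < \<zeta> w} \<inter> space (F t) \<in> sets (F t)" using alive_sets[of t] by (simp add: e)
  have "(\<lambda>w. indicator {w. ereal t < \<zeta> w} w *\<^sub>R X t w) \<in> borel_measurable (F t)"
    using path_adapted[OF t] unfolding borel_measurable_restrict_space_iff[OF m] .
  moreover have "killed t = (\<lambda>w. indicator {w. ereal t < \<zeta> w} w *\<^sub>R X t w)"
    by (auto simp: killed_def indicator_def)
  ultimately show ?thesis by simp
qed

lemma path_cont_Icc:
  assumes "w \<in> space P" "ereal t < \<zeta> w"
  shows "continuous_on {0..t} (\<lambda>s. X s w)"
proof (rule continuous_on_subset[OF path_cont[OF assms(1)]])
  show "{0..t} \<subseteq> {s. 0 \<le> s \<and> ereal s < \<zeta> w}"
    using alive_antimono[of t w, OF assms(2)] by auto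
qed

definition inside :: "real \<Rightarrow> 'w \<Rightarrow> bool" where
  "inside t w \<longleftrightarrow> ereal t < \<zeta> w \<and> (\<forall>s\<in>{0..t}. X s w \<in> D)"

lemma inside_antimono: "inside t w \<Longrightarrow> s \<le> t \<Longrightarrow> inside s w"
  unfolding inside_def using alive_antimono[of t w s] by auto

text \<open>\<open>D\<close> is open and the lifetime exceeds t strictly, so the path remains inside
  a little longer. As a consequence the supremum of the inside times is not itself one of them,
  unless it is capped.\<close>

lemma inside_open:
  assumes w: "w \<in> space P" and t: "0 \<le> t" and i: "inside t w"
  obtains e where "0 < e" "\<And>s. t \<le> s \<Longrightarrow> s < t + e \<Longrightarrow> inside s w"
proof -
  have "ereal t < \<zeta> w" using i by (simp add: inside_def)
  then obtain r where r: "ereal t < ereal r" "ereal r < \<zeta> w"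
    using ereal_dense2 by blast
  have c: "continuous_on {0..r} (\<lambda>s. X s w)" by (rule path_cont_Icc[OF w r(2)])
  have "X t w \<in> D" using i t by (simp add: inside_def)
  then obtain d where d: "0 < d" "ball (X t w) d \<subseteq> D"
    using D(1) by (meson openE)
  have "t \<in> {0..r}" using t r by simp
  then obtain e where e: "0 < e" "\<And>s. s \<in> {0..r} \<Longrightarrow> dist s t < e \<Longrightarrow> dist (X s w) (X t w) < d"
    using c d(1) unfolding continuous_on_iff by meson
  show ?thesis
  proof (rule that[of "min e (r - t)"])
    show "0 < min e (r - t)" using e(1) r by simp
    fix s assume s: "t \<le> s" "s < t + min e (r - t)"
    have "ereal s < \<zeta> w" using s by (intro alive_antimono[OF r(2)]) simp
    moreover have "X q w \<in> D" if q: "q \<in> {0..s}" for q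
    proof (cases "q \<le> t")
      case True
      then show ?thesis using i q by (simp add: inside_def)
    next
      case False
      then have "dist (X q w) (X t w) < d"
        using q s by (intro e(2)) (auto simp: dist_real_def)
      then show ?thesis using d(2) by (auto simp: dist_commute)
    qed
    ultimately show "inside s w" by (simp add: inside_def)
  qed
qed

text \<open>By compactness of \<open>{0..t}\<close>, a continuous path stays in the open set
  \<open>D\<close> exactly if its distance to the complement is at least some
  \<open>1 / real (Suc k)\<close> throughout. By continuity this may be tested at the points of all
  uniform grids, which leaves countably many conditions known at time t.\<close>

lemma inside_sets:
  assumes t: "0 \<le> t"
  shows "{w \<in> space P. inside t w} \<in> sets (F t)"
\<comment> \<open>The distance to an empty complement is 0 by convention, so the criterion cannot be
  used in this case.\<close>
proof (cases "D = UNIV")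
  case True
  have "{w \<in> space P. inside t w} = {w \<in> space P. ereal t < \<zeta> w}"
    unfolding inside_def by (simp only: True UNIV_I ball_triv simp_thms)
  then show ?thesis using alive_sets[of t] by simp
next
  case False
  let ?E = "- D"
  have E: "closed ?E" "?E \<noteq> {}" using D(1) False by auto
  have zero: "infdist x ?E = 0 \<longleftrightarrow> x \<in> ?E" for x
    by (rule in_closed_iff_infdist_zero[OF E, symmetric])
  have m: "{w \<in> space (F t). infdist (killed (grid t n i) w) ?E \<ge> 1 / real (Suc k)} \<in> sets (F t)" if "i \<le> n" for i n k
  proof -
    have "killed (grid t n i) \<in> borel_measurable (F t)"
      using grid_le[OF t that] by (rule measurable_F_mono[OF killed_measurable[OF grid_nonneg[OF t]]])
    then have "(\<lambda>w. infdist (killed (grid t n i) w) ?E) \<in> borel_measurable (F t)"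
      by (rule measurable_compose) (intro borel_measurable_continuous_onI continuous_on_infdist continuous_on_id)
    then show ?thesis by measurable
  qed
  have "{w \<in> space (F t). \<exists>k. \<forall>n. \<forall>i\<in>{..n}. infdist (killed (grid t n i) w) ?E \<ge> 1 / real (Suc k)} \<in> sets (F t)"
    by (intro sets.sets_Collect_countable_Ex sets.sets_Collect_countable_All sets.sets_Collect_finite_All m) auto
  from sets.Int[OF alive_sets[of t] this]
  have "{w \<in> space P. ereal t < \<zeta> w} \<inter> {w \<in> space P. \<exists>k. \<forall>n. \<forall>i\<in>{..n}. infdist (killed (grid t n i) w) ?E \<ge> 1 / real (Suc k)} \<in> sets (F t)"
    by simp
  also have "{w \<in> space P. ereal t < \<zeta> w} \<inter> {w \<in> space P. \<exists>k. \<forall>n. \<forall>i\<in>{..n}. infdist (killed (grid t n i) w) ?E \<ge> 1 / real (Suc k)}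
    = {w \<in> space P. inside t w}"
  proof -
    have "(\<exists>k. \<forall>n. \<forall>i\<in>{..n}. infdist (killed (grid t n i) w) ?E \<ge> 1 / real (Suc k)) \<longleftrightarrow> (\<forall>s\<in>{0..t}. X s w \<in> D)"
      if w: "w \<in> space P" and al: "ereal t < \<zeta> w" for w
    proof -
      have kX: "killed s w = X s w" if "s \<le> t" for s
        using alive_antimono[OF al that] by (simp add: killed_def)
      have c: "continuous_on {0..t} (\<lambda>s. X s w)" by (rule path_cont_Icc[OF w al])
      show ?thesis
      proof
        assume "\<exists>k. \<forall>n. \<forall>i\<in>{..n}. infdist (killed (grid t n i) w) ?E \<ge> 1 / real (Suc k)"
        then obtain k where k: "\<And>n i. i \<le> n \<Longrightarrow> infdist (killed (grid t n i) w) ?E \<ge> 1 / real (Suc k)" by auto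
        show "\<forall>s\<in>{0..t}. X s w \<in> D"
        proof
          fix s assume s: "s \<in> {0..t}"
          show "X s w \<in> D"
          proof (cases "t = 0")
            case True
            then have "infdist (X 0 w) ?E \<ge> 1 / real (Suc k)" using k[of 0 0] kX[of 0] by simp
            then have "infdist (X 0 w) ?E \<noteq> 0" by (auto simp del: of_nat_Suc)
            then have "X 0 w \<notin> ?E" by (simp only: zero not_False_eq_True)
            then show ?thesis using s True by simp
          next
            case False
            then have tp: "0 < t" using t by simp
            \<comment> \<open>The index of the last grid point not after s; these points tend to
              s.\<close>
            define i where "i n = nat \<lfloor>s * real n / t\<rfloor>" for n
            have x0: "0 \<le> s * real n / t" for n using s tp by simp
            have ir: "real (i n) \<le> s * real n / t" "s * real n / t < real (i n) + 1" for n
              using x0[of n] by (auto simp: i_def)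
            have "s * real n / t \<le> real n" for n
              using s tp mult_right_mono[of s t "real n"] by (simp add: pos_divide_le_eq mult.commute)
            then have iN: "i n \<le> n" for n
              using ir(1)[of n] by (meson of_nat_le_iff order_trans)
            have lo: "grid t n (i n) \<le> s" "s - t / real n \<le> grid t n (i n)" if "0 < n" for n
            proof -
              have "t * real (i n) \<le> s * real n" using ir(1)[of n] tp by (simp add: field_simps)
              then show "grid t n (i n) \<le> s" using that by (simp add: grid_def field_simps)
              have "s * real n \<le> t * real (i n) + t" using ir(2)[of n] tp by (simp add: field_simps)
              then have "s * real n / real n \<le> (t * real (i n) + t) / real n"
                by (rule divide_right_mono) simp
              then show "s - t / real n \<le> grid t n (i n)"
                using that by (simp add: grid_def add_divide_distrib mult.commute)
            qed
            have ev: "eventually (\<lambda>n::nat. 0 < n) sequentially" by (rule eventually_gt_at_top)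
            have "(\<lambda>n. grid t n (i n)) \<longlonglongrightarrow> s"
            proof (rule real_tendsto_sandwich[where f = "\<lambda>n. s - t / real n" and h = "\<lambda>_. s"])
              show "(\<lambda>n. s - t / real n) \<longlonglongrightarrow> s"
                using tendsto_diff[OF tendsto_const[of s] lim_const_over_n[of t]] by simp
              show "eventually (\<lambda>n. s - t / real n \<le> grid t n (i n)) sequentially"
                "eventually (\<lambda>n. grid t n (i n) \<le> s) sequentially"
                using ev by (eventually_elim, use lo in blast)+
            qed simp
            then have "(\<lambda>n. X (grid t n (i n)) w) \<longlonglongrightarrow> X s w"
            proof (rule continuous_on_tendsto_compose[OF c])
              show "eventually (\<lambda>n. grid t n (i n) \<in> {0..t}) sequentially"
                using grid_nonneg[OF t] grid_le[OF t iN] by simp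
            qed (use s in simp)
            then have "(\<lambda>n. infdist (X (grid t n (i n)) w) ?E) \<longlonglongrightarrow> infdist (X s w) ?E"
              by (rule tendsto_infdist)
            moreover have "1 / real (Suc k) \<le> infdist (X (grid t n (i n)) w) ?E" for n
              using k[OF iN] kX[OF grid_le[OF t iN]] by simp
            ultimately have "1 / real (Suc k) \<le> infdist (X s w) ?E"
              by (intro LIMSEQ_le_const) auto
            then have "infdist (X s w) ?E \<noteq> 0" by (auto simp del: of_nat_Suc)
            then show ?thesis unfolding zero by simp
          qed
        qed
      next
        assume in_D: "\<forall>s\<in>{0..t}. X s w \<in> D"
        have "continuous_on {0..t} (\<lambda>s. infdist (X s w) ?E)"
          by (intro continuous_on_infdist c)
        then obtain s0 where s0: "s0 \<in> {0..t}" "\<And>s. s \<in> {0..t} \<Longrightarrow> infdist (X s0 w) ?E \<le> infdist (X s w) ?E"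
          using continuous_attains_inf[of "{0..t}" "\<lambda>s. infdist (X s w) ?E"] t by auto
        have "X s0 w \<notin> ?E" using in_D s0(1) by simp
        then have "infdist (X s0 w) ?E \<noteq> 0" by (simp only: zero not_False_eq_True)
        then have "0 < infdist (X s0 w) ?E" using infdist_nonneg[of "X s0 w" ?E] by simp
        then obtain k where "1 / real (Suc k) < infdist (X s0 w) ?E"
          using nat_approx_posE by blast
        then have k: "1 / real (Suc k) \<le> infdist (X s0 w) ?E" by (rule less_imp_le)
        show "\<exists>k. \<forall>n. \<forall>i\<in>{..n}. infdist (killed (grid t n i) w) ?E \<ge> 1 / real (Suc k)"
        proof (intro exI[of _ k] allI ballI)
          fix n i :: nat assume "i \<in> {..n}"
          then have le: "grid t n i \<le> t" using grid_le[OF t] by simp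
          have "infdist (X s0 w) ?E \<le> infdist (X (grid t n i) w) ?E"
            using le grid_nonneg[OF t] by (intro s0(2)) simp
          then show "1 / real (Suc k) \<le> infdist (killed (grid t n i) w) ?E"
            unfolding kX[OF le] using k by (rule order_trans[rotated])
        qed
      qed
    qed
    then show ?thesis by (auto simp: inside_def)
  qed
  finally show ?thesis .
qed

text \<open>The element \<open>0\<close> keeps the supremum from being taken over the empty set.\<close>

definition exit_before :: "real \<Rightarrow> 'w \<Rightarrow> real" where
  "exit_before a w = Sup ({0} \<union> {t. 0 \<le> t \<and> t < a \<and> inside t w})"

lemma exit_before_bounds:
  assumes "0 \<le> a"
  shows "0 \<le> exit_before a w" "exit_before a w \<le> a"
proof -
  have b: "bdd_above ({0} \<union> {t. 0 \<le> t \<and> t < a \<and> inside t w})"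
    using assms by (auto intro!: bdd_aboveI[of _ a])
  show "0 \<le> exit_before a w" unfolding exit_before_def by (rule cSup_upper[OF _ b]) simp
  show "exit_before a w \<le> a" unfolding exit_before_def using assms by (intro cSup_least) auto
qed

text \<open>From left to right this is monotonicity of \<open>inside\<close>, from right to left its
  openness. With the strict inequality, whether the exit is still to come is decided by the path up
  to t and by \<open>t < a\<close>.\<close>

lemma less_exit_before_iff:
  assumes w: "w \<in> space P" and t: "0 \<le> t" and a: "0 \<le> a"
  shows "t < exit_before a w \<longleftrightarrow> t < a \<and> inside t w"
proof
  assume "t < exit_before a w"
  then obtain s where "s \<in> {0} \<union> {t. 0 \<le> t \<and> t < a \<and> inside t w}" "t < s"
    unfolding exit_before_def using a by (subst (asm) less_cSup_iff) (auto intro!: bdd_aboveI[of _ a])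
  then show "t < a \<and> inside t w" using t inside_antimono[of s w t] by auto
next
  assume i: "t < a \<and> inside t w"
  then obtain e where e: "0 < e" "\<And>s. t \<le> s \<Longrightarrow> s < t + e \<Longrightarrow> inside s w"
    using inside_open[OF w t] by blast
  define s where "s = t + min (e / 2) ((a - t) / 2)"
  have s: "t < s" "s < a" "s < t + e" using i e(1) by (auto simp: s_def min_def field_simps)
  then have "inside s w" by (intro e(2)) auto
  then have "s \<le> exit_before a w"
    unfolding exit_before_def using s t a by (intro cSup_upper) (auto intro!: bdd_aboveI[of _ a])
  then show "t < exit_before a w" using s(1) by simp
qed

text \<open>Were the position still in \<open>D\<close>, the path would be inside at the exit time
  itself, and the exit would have to be later.\<close>

lemma exit_before_not_inside:
  assumes w: "w \<in> space P" and a: "0 \<le> a" "exit_before a w < a" and al: "ereal (exit_before a w) < \<zeta> w"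
  shows "X (exit_before a w) w \<notin> D"
proof
  let ?e = "exit_before a w"
  assume "X ?e w \<in> D"
  moreover have "X s w \<in> D" if "0 \<le> s" "s < ?e" for s
    using less_exit_before_iff[OF w that(1) a(1)] that by (auto simp: inside_def)
  ultimately have "inside ?e w"
    using al by (auto simp: inside_def order_le_less)
  then show False
    using less_exit_before_iff[OF w exit_before_bounds(1)[OF a(1)] a(1)] a(2) by blast
qed

lemma exit_before_measurable:
  assumes a: "0 \<le> a"
  shows "exit_before a \<in> borel_measurable P"
proof (rule borel_measurableI_greater)
  fix c :: real
  show "{w \<in> space P. c < exit_before a w} \<in> sets P"
  proof (cases "c < 0")
    case True
    then have "{w \<in> space P. c < exit_before a w} = space P"
      using exit_before_bounds(1)[OF a] by (auto intro: less_le_trans)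
    then show ?thesis by simp
  next
    case False
    then have c: "0 \<le> c" by simp
    have "{w \<in> space P. c < exit_before a w} = (if c < a then {w \<in> space P. inside c w} else {})"
      using less_exit_before_iff[OF _ c a] by auto
    then show ?thesis using inside_sets[OF c] sets_F_subset[of c] by auto
  qed
qed

text \<open>The lifetime is given through events at deterministic times, so the two random times are
  compared by a rational number between them.\<close>

lemma exit_alive_sets:
  assumes a: "0 \<le> a"
  shows "{w \<in> space P. ereal (exit_before a w) < \<zeta> w} \<in> sets P"
proof -
  have [measurable]: "exit_before a \<in> borel_measurable P" by (rule exit_before_measurable[OF a])
  have "{w \<in> space P. exit_before a w < of_rat q} \<inter> {w \<in> space P. ereal (of_rat q) < \<zeta> w} \<in> sets P" for q :: rat
    by (intro sets.Int subsetD[OF sets_F_subset alive_sets]) measurable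
  then have "(\<Union>q::rat. {w \<in> space P. exit_before a w < of_rat q} \<inter> {w \<in> space P. ereal (of_rat q) < \<zeta> w}) \<in> sets P"
    by (intro sets.countable_UN') auto
  also have "(\<Union>q::rat. {w \<in> space P. exit_before a w < of_rat q} \<inter> {w \<in> space P. ereal (of_rat q) < \<zeta> w})
    = {w \<in> space P. ereal (exit_before a w) < \<zeta> w}"
  proof (intro set_eqI iffI)
    fix w assume "w \<in> (\<Union>q::rat. {w \<in> space P. exit_before a w < of_rat q} \<inter> {w \<in> space P. ereal (of_rat q) < \<zeta> w})"
    then obtain q :: rat where q: "w \<in> space P" "exit_before a w < of_rat q" "ereal (of_rat q) < \<zeta> w" by auto
    have "ereal (exit_before a w) < \<zeta> w" by (rule alive_antimono[OF q(3) less_imp_le[OF q(2)]])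
    then show "w \<in> {w \<in> space P. ereal (exit_before a w) < \<zeta> w}"
      using q(1) by simp
  next
    fix w assume w: "w \<in> {w \<in> space P. ereal (exit_before a w) < \<zeta> w}"
    then obtain r where r: "ereal (exit_before a w) < ereal r" "ereal r < \<zeta> w"
      using ereal_dense2[of "ereal (exit_before a w)" "\<zeta> w"] by auto
    then obtain q where q: "exit_before a w < of_rat q" "of_rat q < r"
      using of_rat_dense[of "exit_before a w" r] by auto
    have "ereal (of_rat q) < ereal r" using q(2) by simp
    then have "ereal (of_rat q) < \<zeta> w" using r(2) by (rule less_trans)
    then show "w \<in> (\<Union>q::rat. {w \<in> space P. exit_before a w < of_rat q} \<inter> {w \<in> space P. ereal (of_rat q) < \<zeta> w})"
      using q w by auto
  qed
  finally show ?thesis .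
qed

text \<open>The path is sampled at grid times not after the exit. Approaching from below keeps these
  times within the lifetime, and continuity up to the exit gives the limit.\<close>

lemma exit_position_measurable:
  assumes a: "0 \<le> a"
  shows "(\<lambda>w. killed (exit_before a w) w) \<in> borel_measurable P"
proof (rule borel_measurable_LIMSEQ_metric)
  let ?\<theta> = "exit_before a"
  have [measurable]: "?\<theta> \<in> borel_measurable P" by (rule exit_before_measurable[OF a])
  have k: "killed t \<in> borel_measurable P" if "0 \<le> t" for t
    by (rule measurable_F_P[OF killed_measurable[OF that]])
  have al: "{w \<in> space P. ereal (?\<theta> w) < \<zeta> w} \<in> sets P" by (rule exit_alive_sets[OF a])
  show "(\<lambda>w. if ereal (?\<theta> w) < \<zeta> w then killed (real (nat \<lfloor>?\<theta> w * real (Suc n)\<rfloor>) / real (Suc n)) w else 0) \<in> borel_measurable P" for n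
  proof (rule measurable_If[OF _ measurable_const al])
    show "(\<lambda>w. killed (real (nat \<lfloor>?\<theta> w * real (Suc n)\<rfloor>) / real (Suc n)) w) \<in> borel_measurable P"
    proof (rule measurable_compose_countable[where g = "\<lambda>w. nat \<lfloor>?\<theta> w * real (Suc n)\<rfloor>"
          and f = "\<lambda>i w. killed (real i / real (Suc n)) w"])
      show "(\<lambda>w. killed (real i / real (Suc n)) w) \<in> borel_measurable P" for i
        by (rule k) simp
      show "(\<lambda>w. nat \<lfloor>?\<theta> w * real (Suc n)\<rfloor>) \<in> measurable P (count_space UNIV)"
        by measurable
    qed
  qed simp
  fix w assume w: "w \<in> space P"
  show "(\<lambda>n. if ereal (?\<theta> w) < \<zeta> w then killed (real (nat \<lfloor>?\<theta> w * real (Suc n)\<rfloor>) / real (Suc n)) w else 0)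
    \<longlonglongrightarrow> killed (?\<theta> w) w"
  proof (cases "ereal (?\<theta> w) < \<zeta> w")
    case False
    then show ?thesis by (simp add: killed_def)
  next
    case True
    define s where "s n = real (nat \<lfloor>?\<theta> w * real (Suc n)\<rfloor>) / real (Suc n)" for n
    have \<theta>0: "0 \<le> ?\<theta> w" by (rule exit_before_bounds(1)[OF a])
    have s: "0 \<le> s n" "s n \<le> ?\<theta> w" "?\<theta> w - 1 / real (Suc n) \<le> s n" for n
    proof -
      define r where "r = real (nat \<lfloor>?\<theta> w * real (Suc n)\<rfloor>)"
      have "r = real_of_int \<lfloor>?\<theta> w * real (Suc n)\<rfloor>"
        using \<theta>0 by (simp add: r_def)
      then have r: "r \<le> ?\<theta> w * real (Suc n)" "?\<theta> w * real (Suc n) - 1 \<le> r"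
        by linarith+
      have sr: "s n = r / real (Suc n)" by (simp add: s_def r_def)
      show "s n \<le> ?\<theta> w" unfolding sr using r(1) by (simp only: pos_divide_le_eq of_nat_0_less_iff zero_less_Suc)
      have "(?\<theta> w * real (Suc n) - 1) / real (Suc n) \<le> s n"
        unfolding sr using r(2) by (intro divide_right_mono) simp_all
      then show "?\<theta> w - 1 / real (Suc n) \<le> s n"
        by (simp add: diff_divide_distrib del: of_nat_Suc)
      show "0 \<le> s n" by (simp add: s_def)
    qed
    have "s \<longlonglongrightarrow> ?\<theta> w"
    proof (rule real_tendsto_sandwich[where f = "\<lambda>n. ?\<theta> w - 1 / real (Suc n)" and h = "\<lambda>_. ?\<theta> w"])
      have "(\<lambda>n. ?\<theta> w - 1 / real (Suc n)) \<longlonglongrightarrow> ?\<theta> w - 0"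
        by (intro tendsto_intros LIMSEQ_inverse_real_of_nat[unfolded inverse_eq_divide])
      then show "(\<lambda>n. ?\<theta> w - 1 / real (Suc n)) \<longlonglongrightarrow> ?\<theta> w" by simp
    qed (use s in simp_all)
    then have "(\<lambda>n. X (s n) w) \<longlonglongrightarrow> X (?\<theta> w) w"
      by (rule continuous_on_tendsto_compose[OF path_cont_Icc[OF w True]]) (use s \<theta>0 in simp_all)
    moreover have "killed (s n) w = X (s n) w" for n
      using alive_antimono[OF True s(2)] by (simp add: killed_def)
    ultimately show ?thesis
      using True unfolding s_def by (simp add: killed_def[of "?\<theta> w"])
  qed
qed

text \<open>The cap \<open>T + 1\<close> instead of \<open>T\<close> ensures that a value of at most
  \<open>T\<close> is a genuine exit and not the cap. From left to right, the closed set
  \<open>G\<close> has a first hitting time; before it the path is in \<open>S\<close> but not in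
  \<open>G\<close>, so this time is the exit from \<open>D\<close>.\<close>

lemma reach_event_eq:
  assumes DS: "D = S - G" and G: "closed G" "G \<subseteq> S" and T: "0 < T" and w: "w \<in> space P"
  shows "(\<exists>t\<in>{0..T}. ereal t < \<zeta> w \<and> X t w \<in> G \<and> (\<forall>s\<in>{0..<t}. X s w \<in> S)) \<longleftrightarrow>
    exit_before (T + 1) w \<le> T \<and> ereal (exit_before (T + 1) w) < \<zeta> w \<and> killed (exit_before (T + 1) w) w \<in> G"
proof
  let ?\<theta> = "exit_before (T + 1) w"
  have a: "0 \<le> T + 1" using T by simp
  assume "\<exists>t\<in>{0..T}. ereal t < \<zeta> w \<and> X t w \<in> G \<and> (\<forall>s\<in>{0..<t}. X s w \<in> S)"
  then obtain t where t: "0 \<le> t" "t \<le> T" "ereal t < \<zeta> w" "X t w \<in> G" "\<And>s. 0 \<le> s \<Longrightarrow> s < t \<Longrightarrow> X s w \<in> S"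
    by auto
  define A where "A = {0..t} \<inter> (\<lambda>s. X s w) -` G"
  have "closed A" unfolding A_def
    by (rule continuous_closed_preimage[OF path_cont_Icc[OF w t(3)] _ G(1)]) simp
  moreover have "bounded A" unfolding A_def by (intro bounded_Int disjI1 bounded_closed_interval)
  ultimately have "compact A" by (simp add: compact_eq_bounded_closed)
  moreover have "A \<noteq> {}" using t by (auto simp: A_def)
  ultimately have "\<exists>q\<in>A. \<forall>s\<in>A. q \<le> s" by (rule compact_attains_inf)
  then obtain q where q: "q \<in> A" "\<And>s. s \<in> A \<Longrightarrow> q \<le> s"
    by blast
  have q0: "0 \<le> q" "q \<le> t" "X q w \<in> G" using q(1) by (auto simp: A_def)
  have before: "X s w \<in> D" if "0 \<le> s" "s < q" for s
  proof -
    have "s \<notin> A" using q(2)[of s] that by auto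
    then have "X s w \<notin> G" using that q0 by (auto simp: A_def)
    then show ?thesis using t(5)[of s] that q0 DS by auto
  qed
  have alive: "ereal s < \<zeta> w" if "s \<le> t" for s using t(3) that by (rule alive_antimono)
  have "X q w \<notin> D" using q0(3) unfolding DS by simp
  then have nq: "\<not> inside q w" unfolding inside_def using q0(1) by auto
  have "?\<theta> \<le> q"
    using less_exit_before_iff[OF w q0(1) a] nq by (meson not_le)
  moreover have "q \<le> ?\<theta>"
  proof (rule ccontr)
    assume "\<not> q \<le> ?\<theta>"
    then have lt: "?\<theta> < q" by simp
    then have "inside ?\<theta> w"
      using before alive[of ?\<theta>] q0(2) by (auto simp: inside_def)
    then have "?\<theta> < ?\<theta>"
      using less_exit_before_iff[OF w exit_before_bounds(1)[OF a] a] lt q0(2) t(2) by force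
    then show False by simp
  qed
  ultimately have "?\<theta> = q" by simp
  then show "?\<theta> \<le> T \<and> ereal ?\<theta> < \<zeta> w \<and> killed ?\<theta> w \<in> G"
    using q0 t(2) alive[of q] by (auto simp: killed_def)
next
  let ?\<theta> = "exit_before (T + 1) w"
  have a: "0 \<le> T + 1" using T by simp
  assume h: "?\<theta> \<le> T \<and> ereal ?\<theta> < \<zeta> w \<and> killed ?\<theta> w \<in> G"
  have "X s w \<in> S" if "0 \<le> s" "s < ?\<theta>" for s
  proof -
    have "X s w \<in> D"
      using less_exit_before_iff[OF w that(1) a] that by (auto simp: inside_def)
    then show ?thesis using DS by simp
  qed
  then show "\<exists>t\<in>{0..T}. ereal t < \<zeta> w \<and> X t w \<in> G \<and> (\<forall>s\<in>{0..<t}. X s w \<in> S)"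
    using h exit_before_bounds(1)[OF a, of w] by (intro bexI[of _ ?\<theta>]) (auto simp: killed_def)
qed

lemma reach_event_measurable:
  assumes DS: "D = S - G" and G: "closed G" "G \<subseteq> S" and T: "0 < T"
  shows "{w \<in> space P. \<exists>t\<in>{0..T}. ereal t < \<zeta> w \<and> X t w \<in> G \<and> (\<forall>s\<in>{0..<t}. X s w \<in> S)} \<in> sets P"
proof -
  have a: "0 \<le> T + 1" using T by simp
  have [measurable]: "exit_before (T + 1) \<in> borel_measurable P" by (rule exit_before_measurable[OF a])
  have [measurable]: "(\<lambda>w. killed (exit_before (T + 1) w) w) \<in> borel_measurable P" by (rule exit_position_measurable[OF a])
  have [measurable]: "G \<in> sets borel" using G(1) by simp
  have "{w \<in> space P. exit_before (T + 1) w \<le> T} \<inter> {w \<in> space P. ereal (exit_before (T + 1) w) < \<zeta> w} \<inter>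
    {w \<in> space P. killed (exit_before (T + 1) w) w \<in> G} \<in> sets P"
    by (intro sets.Int exit_alive_sets[OF a]) measurable
  also have "{w \<in> space P. exit_before (T + 1) w \<le> T} \<inter> {w \<in> space P. ereal (exit_before (T + 1) w) < \<zeta> w} \<inter>
    {w \<in> space P. killed (exit_before (T + 1) w) w \<in> G} =
    {w \<in> space P. \<exists>t\<in>{0..T}. ereal t < \<zeta> w \<and> X t w \<in> G \<and> (\<forall>s\<in>{0..<t}. X s w \<in> S)}"
    using reach_event_eq[OF DS G T] by auto
  finally show ?thesis .
qed

text \<open>If the lifetime exceeds \<open>T\<close>, so do the announcing times eventually.
  Otherwise the path explodes at a time not later than \<open>T\<close>; being unbounded before that
  time, it leaves the bounded set \<open>D\<close> strictly earlier, and the announcing times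
  eventually pass that moment.\<close>

lemma announcing_times_pass_exit:
  assumes w: "w \<in> space P" and T: "0 < T"
    and lim: "(\<lambda>m. ereal (\<tau> m)) \<longlonglongrightarrow> \<zeta> w"
    and explosion: "\<zeta> w < \<infinity> \<longrightarrow> Limsup (at_left (real_of_ereal (\<zeta> w))) (\<lambda>t. ereal (norm (X t w))) = \<infinity>"
  shows "eventually (\<lambda>m. \<not> (\<tau> m \<le> T \<and> \<tau> m < exit_before (T + 1) w)) sequentially"
proof (cases "ereal T < \<zeta> w")
  case True
  from order_tendstoD(1)[OF lim this] show ?thesis
    by eventually_elim simp
next
  case False
  have a: "0 \<le> T + 1" using T by simp
  have "\<exists>t. 0 \<le> t \<and> ereal t < \<zeta> w \<and> \<not> inside t w"
  proof (rule ccontr)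
    assume "\<not> (\<exists>t. 0 \<le> t \<and> ereal t < \<zeta> w \<and> \<not> inside t w)"
    then have ins: "inside t w" if "0 \<le> t" "ereal t < \<zeta> w" for t using that by blast
    obtain z where z: "\<zeta> w = ereal z"
      using False lifetime_pos[OF w] by (cases "\<zeta> w") auto
    have z0: "0 < z" using lifetime_pos[OF w] z by simp
    obtain B where B: "\<And>x. x \<in> D \<Longrightarrow> norm x \<le> B" using D(2) unfolding bounded_iff by blast
    have "eventually (\<lambda>t. t \<in> {0<..<z}) (at_left z)"
      using z0 by (rule eventually_at_left_real)
    then have "eventually (\<lambda>t. ereal (norm (X t w)) \<le> ereal B) (at_left z)"
    proof eventually_elim
      case (elim t)
      then have "inside t w" by (intro ins) (auto simp: z)
      then have "X t w \<in> D" using elim by (auto simp: inside_def)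
      then show ?case using B by simp
    qed
    then have "Limsup (at_left z) (\<lambda>t. ereal (norm (X t w))) \<le> ereal B"
      by (rule Limsup_bounded)
    then show False using explosion z by simp
  qed
  then obtain t where t: "0 \<le> t" "ereal t < \<zeta> w" "\<not> inside t w" by blast
  have le: "exit_before (T + 1) w \<le> t"
    using less_exit_before_iff[OF w t(1) a] t(3) by (meson not_le)
  show ?thesis
  proof (rule eventually_mono[OF order_tendstoD(1)[OF lim t(2)]])
    fix m assume "ereal t < ereal (\<tau> m)"
    then have "t < \<tau> m" by simp
    then show "\<not> (\<tau> m \<le> T \<and> \<tau> m < exit_before (T + 1) w)" using le by linarith
  qed
qed

end

section \<open>The estimate for a single announcing time\<close>

context exit_problem
begin

lemma bad_event_measurable:
  assumes \<tau>: "stopping_time F \<tau>" and T: "0 < T"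
  shows "{w \<in> space P. \<tau> w \<le> T \<and> \<tau> w < exit_before (T + 1) w} \<in> sets P"
proof -
  have [measurable]: "exit_before (T + 1) \<in> borel_measurable P"
    using T by (intro exit_before_measurable) simp
  have [measurable]: "\<tau> \<in> borel_measurable P"
  proof (rule borel_measurableI_le)
    fix c :: real
    have "{w \<in> space (F c). \<tau> w \<le> c} \<in> sets (F c)"
      using stopping_timeD[OF \<tau>, of c] by (simp only: pred_def)
    then show "{w \<in> space P. \<tau> w \<le> c} \<in> sets P"
      using sets_F_subset[of c] by auto
  qed
  show ?thesis by measurable
qed

text \<open>A path stopped by time \<open>T\<close> outside the bad event has really left
  \<open>D\<close>: if \<tau> itself were the stopping time with the path still in \<open>D\<close>,
  then \<tau> would be at most \<open>T\<close> and before the true exit. The starting point in the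
  open set \<open>D\<close> makes the stopping time positive.\<close>

lemma exit_position:
  assumes w: "w \<in> space P" and \<tau>: "0 \<le> \<tau>" "ereal \<tau> < \<zeta> w" and T: "0 < T" and X0: "X 0 w \<in> D"
    and good: "\<not> (\<tau> \<le> T \<and> \<tau> < exit_before (T + 1) w)"
    and s: "exit_before \<tau> w \<le> s" "s \<le> T"
  shows "0 < exit_before \<tau> w" and "X (exit_before \<tau> w) w \<notin> D"
proof -
  let ?\<rho> = "exit_before \<tau> w"
  have a: "0 \<le> T + 1" using T by simp
  have i0: "inside 0 w" using X0 lifetime_pos[OF w] by (simp add: inside_def zero_ereal_def)
  have "0 < exit_before (T + 1) w"
    using less_exit_before_iff[OF w order_refl a] i0 T by simp
  then have "0 < \<tau>" using good T \<tau>(1) by (cases "\<tau> = 0") auto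
  then show pos: "0 < ?\<rho>" using less_exit_before_iff[OF w order_refl \<tau>(1)] i0 by simp
  have \<rho>\<tau>: "?\<rho> \<le> \<tau>" by (rule exit_before_bounds(2)[OF \<tau>(1)])
  have al: "ereal ?\<rho> < \<zeta> w" by (rule alive_antimono[OF \<tau>(2) \<rho>\<tau>])
  show "X ?\<rho> w \<notin> D"
  proof (cases "?\<rho> < \<tau>")
    case True
    show ?thesis by (rule exit_before_not_inside[OF w \<tau>(1) True al])
  next
    case False
    then have eq: "?\<rho> = \<tau>" using \<rho>\<tau> by simp
    show ?thesis
    proof
      assume h: "X ?\<rho> w \<in> D"
      have "X q w \<in> D" if "0 \<le> q" "q \<le> ?\<rho>" for q
      proof (cases "q = ?\<rho>")
        case False
        then have "q < ?\<rho>" using that by simp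
        then have "inside q w" using less_exit_before_iff[OF w that(1) \<tau>(1)] by simp
        then show ?thesis using that(1) by (simp add: inside_def)
      qed (use h in simp)
      then have "inside ?\<rho> w" using al by (simp add: inside_def)
      then have "?\<rho> < exit_before (T + 1) w"
        using less_exit_before_iff[OF w less_imp_le[OF pos] a] s by simp
      then show False using good eq s by simp
    qed
  qed
qed

text \<open>The integrand is cut at \<tau> and not at the exit, so the integrals supplied by the
  solution are used unchanged. Before the exit \<open>min t (\<tau> w)\<close> is t and the
  integrand is \<open>\<sigma> (X t w)\<close>, which is what the stopped process needs.\<close>

lemma stopped_ito_exit:
  assumes b: "continuous_on UNIV b" and \<sigma>: "continuous_on UNIV \<sigma>" and x0: "x0 \<in> D"
    and \<tau>: "stopping_time F \<tau>" "\<And>w. w \<in> space P \<Longrightarrow> 0 \<le> \<tau> w" "\<And>w. w \<in> space P \<Longrightarrow> ereal (\<tau> w) < \<zeta> w"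
    and X0: "AE w in P. X 0 w = x0"
    and ito: "\<And>t. 0 \<le> t \<Longrightarrow> \<exists>J. has_ito_integral P F W (\<lambda>s w. if s < \<tau> w then \<sigma> (X s w) else 0) t J \<and>
      (AE w in P. X (min t (\<tau> w)) w = x0 + integral {0..min t (\<tau> w)} (\<lambda>s. b (X s w)) + J w)"
  shows "stopped_ito P W b \<sigma> X (\<lambda>w. exit_before (\<tau> w) w) (\<lambda>s w. if s < \<tau> w then \<sigma> (X s w) else 0) (closure D) x0"
proof -
  have less: "t < exit_before (\<tau> w) w \<longleftrightarrow> t < \<tau> w \<and> inside t w" if "w \<in> space P" "0 \<le> t" for t w
    by (rule less_exit_before_iff[OF that \<tau>(2)[OF that(1)]])
  have \<rho>_stop: "{w \<in> space P. t < exit_before (\<tau> w) w} \<in> sets (F t)" if t: "0 \<le> t" for t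
  proof -
    have "{w \<in> space (F t). t < \<tau> w} \<in> sets (F t)"
      using stopping_timeD2[OF \<tau>(1), of t] by (simp only: pred_def)
    then have "{w \<in> space P. t < \<tau> w} \<inter> {w \<in> space P. inside t w} \<in> sets (F t)"
      using inside_sets[OF t] by (intro sets.Int) simp_all
    also have "{w \<in> space P. t < \<tau> w} \<inter> {w \<in> space P. inside t w} = {w \<in> space P. t < exit_before (\<tau> w) w}"
      using less[OF _ t] by auto
    finally show ?thesis .
  qed
  have mem: "X t w \<in> D" if "w \<in> space P" "0 \<le> t" "t < exit_before (\<tau> w) w" for w t
    using less[OF that(1,2)] that(2,3) by (simp add: inside_def)
  show ?thesis
  proof
    show "continuous_on UNIV b" "continuous_on UNIV \<sigma>" by fact+
    show "compact (closure D)" using D(2) by (simp add: compact_closure)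
    show "x0 \<in> closure D" using x0 closure_subset by blast
    show "0 \<le> exit_before (\<tau> w) w" if "w \<in> space P" for w
      by (rule exit_before_bounds(1)[OF \<tau>(2)[OF that]])
    show "{w \<in> space P. t < exit_before (\<tau> w) w} \<in> sets (F t)" if "0 \<le> t" for t
      by (rule \<rho>_stop[OF that])
    show "(\<lambda>w. if t < exit_before (\<tau> w) w then X t w else 0) \<in> borel_measurable (F t)" if t: "0 \<le> t" for t
    proof -
      have "(\<lambda>w. if t < exit_before (\<tau> w) w then killed t w else 0) \<in> borel_measurable (F t)"
        by (rule measurable_If[OF killed_measurable[OF t] measurable_const]) (use \<rho>_stop[OF t] in simp_all)
      also have "(\<lambda>w. if t < exit_before (\<tau> w) w then killed t w else 0) \<in> borel_measurable (F t)
        \<longleftrightarrow> ?thesis"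
        using less[OF _ t] by (intro measurable_cong) (auto simp: killed_def inside_def)
      finally show ?thesis .
    qed
    show "continuous_on {0..exit_before (\<tau> w) w} (\<lambda>t. X t w)" if w: "w \<in> space P" for w
      by (rule path_cont_Icc[OF w alive_antimono[OF \<tau>(3)[OF w] exit_before_bounds(2)[OF \<tau>(2)[OF w]]]])
    show "X t w \<in> closure D" if "w \<in> space P" "0 \<le> t" "t < exit_before (\<tau> w) w" for w t
      using mem[OF that] closure_subset by blast
    show "AE w in P. X 0 w = x0" by (rule X0)
    show "(if t < \<tau> w then \<sigma> (X t w) else 0) = \<sigma> (X t w)" if "w \<in> space P" "0 \<le> t" "t < exit_before (\<tau> w) w" for w t
      using less[OF that(1,2)] that(3) by simp
    fix t :: real assume t: "0 \<le> t"
    obtain J where J: "has_ito_integral P F W (\<lambda>s w. if s < \<tau> w then \<sigma> (X s w) else 0) t J"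
      "AE w in P. X (min t (\<tau> w)) w = x0 + integral {0..min t (\<tau> w)} (\<lambda>s. b (X s w)) + J w"
      using ito[OF t] by (elim exE conjE)
    from J(2) AE_space
    have "AE w in P. t < exit_before (\<tau> w) w \<longrightarrow> X t w = x0 + integral {0..t} (\<lambda>s. b (X s w)) + J w"
    proof eventually_elim
      case (elim w)
      show ?case
      proof
        assume "t < exit_before (\<tau> w) w"
        then have "min t (\<tau> w) = t" using less[OF elim(2) t] by simp
        then show "X t w = x0 + integral {0..t} (\<lambda>s. b (X s w)) + J w" using elim(1) by simp
      qed
    qed
    with J(1) show "\<exists>J. has_ito_integral P F W (\<lambda>s w. if s < \<tau> w then \<sigma> (X s w) else 0) t J \<and>
      (AE w in P. t < exit_before (\<tau> w) w \<longrightarrow> X t w = x0 + integral {0..t} (\<lambda>s. b (X s w)) + J w)"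
      by (intro exI conjI)
  qed
qed

text \<open>The lower and the upper bound for the time integral of the mean of v are chained, the
  exceptional event being that \<tau> interrupts the path. Its probability p lowers the start value
  to \<open>a\<close> in the lower bound and appears as an additional error in the upper
  one.\<close>

lemma reach_estimate:
  fixes u v :: "real ^ 'n \<Rightarrow> real"
  assumes b: "continuous_on UNIV b" and \<sigma>: "continuous_on UNIV \<sigma>" and x0: "x0 \<in> D"
    and \<tau>: "stopping_time F \<tau>" "\<And>w. w \<in> space P \<Longrightarrow> 0 \<le> \<tau> w" "\<And>w. w \<in> space P \<Longrightarrow> ereal (\<tau> w) < \<zeta> w"
    and X0: "AE w in P. X 0 w = x0"
    and ito: "\<And>t. 0 \<le> t \<Longrightarrow> \<exists>J. has_ito_integral P F W (\<lambda>s w. if s < \<tau> w then \<sigma> (X s w) else 0) t J \<and>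
      (AE w in P. X (min t (\<tau> w)) w = x0 + integral {0..min t (\<tau> w)} (\<lambda>s. b (X s w)) + J w)"
    and T: "0 < T" and DS: "D = S - G" and S: "open S" and G: "closed G" "G \<subseteq> S"
    and v: "C2_fun v" and u: "C2_fun u"
    and u_bound: "\<And>x. x \<in> closure D \<Longrightarrow> \<bar>u x\<bar> \<le> M"
    and gen_v: "\<And>x. x \<in> D \<Longrightarrow> \<alpha> * v x + \<beta> \<le> generator b \<sigma> v x"
    and gen_u: "\<And>x. x \<in> D \<Longrightarrow> v x \<le> generator b \<sigma> u x"
    and boundary: "\<And>x. x \<in> frontier S \<union> frontier G \<Longrightarrow> \<alpha> * v x + \<beta> \<le> 0"
    and v_target: "\<And>x. x \<in> frontier G \<Longrightarrow> v x \<le> 1"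
    and v_outer: "\<And>x. x \<in> frontier S \<Longrightarrow> v x \<le> 0"
    and c1: "0 \<le> c1" "\<And>x. x \<in> closure D \<Longrightarrow> \<alpha> * v x + \<beta> \<le> c1"
    and c2: "0 \<le> c2" "\<And>x. x \<in> closure D \<Longrightarrow> v x \<le> c2"
  defines "p \<equiv> prob {w \<in> space P. \<tau> w \<le> T \<and> \<tau> w < exit_before (T + 1) w}"
  defines "a \<equiv> v x0 - c1 * T * p"
  shows "(if \<alpha> \<noteq> 0 then (1 / \<alpha> * a + \<beta> / \<alpha>\<^sup>2) * (exp (\<alpha> * T) - 1) - \<beta> / \<alpha> * T
      else a * T + 1 / 2 * \<beta> * T\<^sup>2) \<le> 2 * M + T * reach_avoid_prob P X \<zeta> S G T + c2 * T * p"
proof -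
  let ?\<rho> = "\<lambda>w. exit_before (\<tau> w) w"
  interpret s: stopped_ito P W b \<sigma> X ?\<rho> "\<lambda>s w. if s < \<tau> w then \<sigma> (X s w) else 0" "closure D" x0
    by (rule stopped_ito_exit[OF b \<sigma> x0 \<tau> X0 ito])
  define B where "B = {w \<in> space P. \<tau> w \<le> T \<and> \<tau> w < exit_before (T + 1) w}"
  define R where "R = {w \<in> space P. \<exists>t\<in>{0..T}. ereal t < \<zeta> w \<and> X t w \<in> G \<and> (\<forall>s\<in>{0..<t}. X s w \<in> S)}"
  have B_sets: "B \<in> events" unfolding B_def by (rule bad_event_measurable[OF \<tau>(1) T])
  have R_sets: "R \<in> events" unfolding R_def by (rule reach_event_measurable[OF DS G T])
  have p: "p = prob B" unfolding p_def B_def ..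
  have vc: "continuous_on UNIV v" by (rule C1_continuous[OF C2_imp_C1[OF v]])
  have mem: "X t w \<in> D" if "w \<in> space P" "0 \<le> t" "t < ?\<rho> w" for w t
    using less_exit_before_iff[OF that(1,2) \<tau>(2)[OF that(1)]] that(2,3) by (simp add: inside_def)
  have stop: "AE w in P. w \<notin> B \<longrightarrow> (\<forall>s. 0 \<le> s \<and> s \<le> T \<and> ?\<rho> w \<le> s \<longrightarrow>
      \<alpha> * v (s.final_value s w) + \<beta> \<le> 0 \<and> v (s.final_value s w) \<le> indicator R w)"
    using X0 AE_space
  proof eventually_elim
    case (elim w)
    note w = elim(2)
    show ?case
    proof (intro impI allI, elim conjE)
      fix s assume "w \<notin> B" and s: "0 \<le> s" "s \<le> T" "?\<rho> w \<le> s"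
      then have good: "\<not> (\<tau> w \<le> T \<and> \<tau> w < exit_before (T + 1) w)" using w by (simp add: B_def)
      have "X 0 w \<in> D" using elim(1) x0 by simp
      note ex = exit_position[OF w \<tau>(2,3)[OF w] T this good s(3,2)]
      have fin: "s.final_value s w = X (?\<rho> w) w"
        using ex(1) s(3) by (simp add: s.final_value_def min_def)
      have cl: "X (?\<rho> w) w \<in> closure D"
        using s.X_mem_C[OF w less_imp_le[OF ex(1)] order_refl ex(1)] .
      show "\<alpha> * v (s.final_value s w) + \<beta> \<le> 0 \<and> v (s.final_value s w) \<le> indicator R w"
      \<comment> \<open>The stopping position is in the closure of \<open>D\<close> but not in
        \<open>D\<close>. If it is in \<open>G\<close>, it is a limit of points outside
        \<open>G\<close> and lies on the frontier of \<open>G\<close>; otherwise it is outside the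
        open set \<open>S\<close> and lies on the frontier of \<open>S\<close>.\<close>
      proof (cases "X (?\<rho> w) w \<in> G")
        case True
        have "closure D \<subseteq> closure (- G)" using DS by (intro closure_mono) auto
        then have "X (?\<rho> w) w \<in> frontier G"
          using cl True G(1) by (auto simp: frontier_closures)
        moreover have "w \<in> R"
        proof -
          have "ereal (?\<rho> w) < \<zeta> w"
            by (rule alive_antimono[OF \<tau>(3)[OF w] exit_before_bounds(2)[OF \<tau>(2)[OF w]]])
          moreover have "X q w \<in> S" if "q \<in> {0..<?\<rho> w}" for q
            using mem[OF w, of q] that DS by simp
          ultimately show ?thesis
            unfolding R_def using w True ex(1) s by (intro CollectI conjI bexI[of _ "?\<rho> w"]) auto
        qed
        ultimately show ?thesis using boundary v_target by (simp add: fin)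
      next
        case False
        then have "X (?\<rho> w) w \<notin> S" using ex(2) DS by simp
        moreover have "closure D \<subseteq> closure S" using DS by (intro closure_mono) auto
        ultimately have fr: "X (?\<rho> w) w \<in> frontier S"
          using cl S by (auto simp: frontier_def interior_open)
        have "v (X (?\<rho> w) w) \<le> indicator R w"
          by (rule order_trans[OF v_outer[OF fr]]) simp
        then show ?thesis using boundary[of "X (?\<rho> w) w"] fr by (simp add: fin)
      qed
    qed
  qed
  have "(if \<alpha> \<noteq> 0 then (1 / \<alpha> * a + \<beta> / \<alpha>\<^sup>2) * (exp (\<alpha> * T) - 1) - \<beta> / \<alpha> * T
      else a * T + 1 / 2 * \<beta> * T\<^sup>2) \<le> integral {0..T} (s.mean v)"
  proof (rule gronwall_lower[OF T s.mean_continuous[OF vc]])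
    fix t assume t: "0 < t" "t \<le> T"
    show "a + \<alpha> * integral {0..t} (s.mean v) + \<beta> * t \<le> s.mean v t"
      unfolding a_def p
    proof (rule s.mean_lower_bound[OF v t B_sets c1])
      show "\<alpha> * v (X s w) + \<beta> \<le> generator b \<sigma> v (X s w)" if "w \<in> space P" "0 \<le> s" "s < ?\<rho> w" for w s
        by (rule gen_v[OF mem[OF that]])
      show "AE w in P. w \<notin> B \<longrightarrow> (\<forall>s. 0 \<le> s \<and> s \<le> T \<and> ?\<rho> w \<le> s \<longrightarrow> \<alpha> * v (s.final_value s w) + \<beta> \<le> 0)"
        using stop by eventually_elim blast
    qed
  qed
  also have "\<dots> \<le> expectation (\<lambda>w. \<integral>s. s.act v s w \<partial>clock T) + T * prob R + c2 * T * prob B"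
  proof (rule s.mean_upper_bound[OF vc T B_sets R_sets c2])
    show "AE w in P. w \<notin> B \<longrightarrow> (\<forall>s. 0 \<le> s \<and> s \<le> T \<and> ?\<rho> w \<le> s \<longrightarrow> v (s.final_value s w) \<le> indicator R w)"
      using stop by eventually_elim blast
  qed
  also have "expectation (\<lambda>w. \<integral>s. s.act v s w \<partial>clock T) \<le> 2 * M"
    by (rule s.occupation_upper_bound[OF u vc T]) (rule u_bound, assumption, rule gen_u[OF mem])
  finally show ?thesis by (simp add: p reach_avoid_prob_def R_def)
qed

end

text \<open>The estimate for one announcing time is continuous in the probability of interruption,
  which tends to 0 along the announcing sequence, while the reach-avoid probability does not depend
  on the sequence. Dividing the limit by \<open>T\<close> gives the bound.\<close>

theorem corollary3:
  fixes P :: "'w measure"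
    and W :: "real \<Rightarrow> 'w \<Rightarrow> real ^ 'k"
    and b :: "real ^ 'n \<Rightarrow> real ^ 'n"
    and \<sigma> :: "real ^ 'n \<Rightarrow> real ^ 'k ^ 'n"
    and X :: "real \<Rightarrow> 'w \<Rightarrow> real ^ 'n"
    and \<zeta> :: "'w \<Rightarrow> ereal"
    and S S\<^sub>s :: "(real ^ 'n) set"
    and x\<^sub>0 :: "real ^ 'n"
    and u v :: "real ^ 'n \<Rightarrow> real"
    and \<alpha> \<beta> M T :: real
  assumes "prob_space P"
    and "wiener_process P W"
    and "local_lipschitz (UNIV :: real set) UNIV (\<lambda>_. b)"
    and "local_lipschitz (UNIV :: real set) UNIV (\<lambda>_. \<sigma>)"
    and "open S" and "bounded S"
    and "closed S\<^sub>s" and "S\<^sub>s \<subseteq> S"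
    and "0 < T"
    and "C2_fun v" and "C2_fun u"
    and "(SUP x\<in>closure S. \<bar>u x\<bar>) \<le> M"
    and "\<forall>x\<in>S - S\<^sub>s. generator b \<sigma> v x \<ge> \<alpha> * v x + \<beta>"
    and "\<forall>x\<in>frontier S \<union> frontier S\<^sub>s. 0 \<ge> \<alpha> * v x + \<beta>"
    and "\<forall>x\<in>frontier S\<^sub>s. v x \<le> 1"
    and "\<forall>x\<in>S - S\<^sub>s. v x \<le> generator b \<sigma> u x"
    and "\<forall>x\<in>frontier S. v x \<le> 0"
    and "x\<^sub>0 \<in> S - S\<^sub>s"
    and "maximal_local_strong_solution P W b \<sigma> x\<^sub>0 X \<zeta>"
  shows "reach_avoid_prob P X \<zeta> S S\<^sub>s T \<ge>
    (if \<alpha> \<noteq> 0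
     then ((1 / \<alpha> * v x\<^sub>0 + \<beta> / \<alpha>\<^sup>2) * (exp (\<alpha> * T) - 1) - \<beta> / \<alpha> * T) / T - 2 * M / T
     else v x\<^sub>0 + 1 / 2 * \<beta> * T - 2 * M / T)"
proof -
  interpret prob_space P by fact
  interpret wiener_space P W by standard fact
  let ?D = "S - S\<^sub>s"
  have b: "continuous_on UNIV b" and \<sigma>: "continuous_on UNIV \<sigma>"
    using assms(3,4) by (auto dest: local_lipschitz_continuous_on)
  have sol: "local_strong_solution P W b \<sigma> x\<^sub>0 X \<zeta>"
    and explosion: "AE w in P. \<zeta> w < \<infinity> \<longrightarrow>
        Limsup (at_left (real_of_ereal (\<zeta> w))) (\<lambda>t. ereal (norm (X t w))) = \<infinity>"
    using assms(19) unfolding maximal_local_strong_solution_def by simp_all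
  note sol = sol[unfolded local_strong_solution_def Let_def]
  interpret exit_problem P W X \<zeta> ?D
  proof
    show "0 < \<zeta> w" if "w \<in> space P" for w using sol that by simp
    show "Measurable.pred (F t) (\<lambda>w. \<zeta> w \<le> ereal t)" for t using sol by simp
    show "continuous_on {t. 0 \<le> t \<and> ereal t < \<zeta> w} (\<lambda>t. X t w)" if "w \<in> space P" for w
      using sol that by simp
    show "X t \<in> borel_measurable (restrict_space (F t) {w. ereal t < \<zeta> w})" if "0 \<le> t" for t
      using sol that by simp
    show "open ?D" using assms(5,7) by (rule open_Diff)
    show "bounded ?D" by (rule bounded_diff[OF assms(6)])
  qed
  have X0: "AE w in P. X 0 w = x\<^sub>0" using sol by simp
  obtain \<tau> :: "nat \<Rightarrow> 'w \<Rightarrow> real" where \<tau>: "\<forall>m. stopping_time F (\<tau> m)"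
      "\<forall>m. \<forall>w\<in>space P. 0 \<le> \<tau> m w \<and> ereal (\<tau> m w) < \<zeta> w"
      "AE w in P. mono (\<lambda>m. \<tau> m w) \<and> (\<lambda>m. ereal (\<tau> m w)) \<longlonglongrightarrow> \<zeta> w"
      "\<forall>m. \<forall>t\<ge>0. \<exists>J. has_ito_integral P F W (\<lambda>s w. if s < \<tau> m w then \<sigma> (X s w) else 0) t J \<and>
             (AE w in P. X (min t (\<tau> m w)) w =
                x\<^sub>0 + integral {0..min t (\<tau> m w)} (\<lambda>s. b (X s w)) + J w)"
    using sol by (elim conjE exE) (rule that; assumption)
  have vc: "continuous_on UNIV v" by (rule C1_continuous[OF C2_imp_C1[OF assms(10)]])
  have uc: "continuous_on UNIV u" by (rule C1_continuous[OF C2_imp_C1[OF assms(11)]])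
  have cpt: "compact (closure ?D)" using D(2) by (simp add: compact_closure)
  have sub: "closure ?D \<subseteq> closure S" by (rule closure_mono) auto
  have u_bound: "\<bar>u x\<bar> \<le> M" if x: "x \<in> closure ?D" for x
  proof -
    \<comment> \<open>A supremum of reals bounds the values only if the image is bounded above,
      which compactness of \<open>closure S\<close> provides.\<close>
    have "compact ((\<lambda>x. \<bar>u x\<bar>) ` closure S)"
      using assms(6) uc by (intro compact_continuous_image continuous_intros)
        (auto simp: compact_closure intro: continuous_on_subset)
    then have "bdd_above ((\<lambda>x. \<bar>u x\<bar>) ` closure S)"
      by (intro bounded_imp_bdd_above compact_imp_bounded)
    from cSUP_upper[OF subsetD[OF sub x] this] show ?thesis using assms(12) by linarith
  qed
  \<comment> \<open>These bounds multiply the interruption probabilities, so they have to be the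
    same for all announcing times.\<close>
  have above: "\<exists>c\<ge>0. \<forall>x\<in>closure ?D. g x \<le> c" if g: "continuous_on UNIV g" for g :: "real ^ 'n \<Rightarrow> real"
  proof -
    have "bounded (g ` closure ?D)"
      by (intro compact_imp_bounded compact_continuous_image continuous_on_subset[OF g] cpt) simp
    then obtain c where "\<forall>x\<in>closure ?D. \<bar>g x\<bar> \<le> c" unfolding bounded_iff by auto
    then show ?thesis by (intro exI[of _ "max c 0"]) force
  qed
  have "continuous_on UNIV (\<lambda>x. \<alpha> * v x + \<beta>)" by (intro continuous_intros vc)
  from above[OF this] obtain c1 where c1: "0 \<le> c1" "\<And>x. x \<in> closure ?D \<Longrightarrow> \<alpha> * v x + \<beta> \<le> c1"
    by auto
  from above[OF vc] obtain c2 where c2: "0 \<le> c2" "\<And>x. x \<in> closure ?D \<Longrightarrow> v x \<le> c2"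
    by auto
  define p where "p m = prob {w \<in> space P. \<tau> m w \<le> T \<and> \<tau> m w < exit_before (T + 1) w}" for m
  have p0: "p \<longlonglongrightarrow> 0"
    unfolding p_def
  proof (rule prob_tendsto_0)
    show "{w \<in> space P. \<tau> m w \<le> T \<and> \<tau> m w < exit_before (T + 1) w} \<in> events" for m
      by (rule bad_event_measurable[OF spec[OF \<tau>(1)] assms(9)])
    show "AE w in P. eventually (\<lambda>m. w \<notin> {w \<in> space P. \<tau> m w \<le> T \<and> \<tau> m w < exit_before (T + 1) w}) sequentially"
      using \<tau>(3) explosion AE_space
    proof eventually_elim
      case (elim w)
      have "eventually (\<lambda>m. \<not> (\<tau> m w \<le> T \<and> \<tau> m w < exit_before (T + 1) w)) sequentially"
        using elim(1) by (intro announcing_times_pass_exit[OF elim(3) assms(9) _ elim(2)]) (rule conjunct2)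
      then show ?case by (rule eventually_mono) simp
    qed
  qed
  \<comment> \<open>The Gronwall bound as a function of the start value, so that the limit along the
    announcing times is a matter of continuity.\<close>
  define f where "f a = (if \<alpha> \<noteq> 0 then (1 / \<alpha> * a + \<beta> / \<alpha>\<^sup>2) * (exp (\<alpha> * T) - 1) - \<beta> / \<alpha> * T
      else a * T + 1 / 2 * \<beta> * T\<^sup>2)" for a
  let ?r = "reach_avoid_prob P X \<zeta> S S\<^sub>s T"
  have est: "f (v x\<^sub>0 - c1 * T * p m) \<le> 2 * M + T * ?r + c2 * T * p m" for m
    unfolding f_def p_def
  proof (rule reach_estimate[OF b \<sigma> assms(18) spec[OF \<tau>(1)] _ _ X0 _ assms(9) refl assms(5,7,8,10,11) u_bound _ _ _ _ _ c1 c2])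
    show "0 \<le> \<tau> m w" "ereal (\<tau> m w) < \<zeta> w" if "w \<in> space P" for w using \<tau>(2) that by auto
    show "\<exists>J. has_ito_integral P F W (\<lambda>s w. if s < \<tau> m w then \<sigma> (X s w) else 0) t J \<and>
             (AE w in P. X (min t (\<tau> m w)) w =
                x\<^sub>0 + integral {0..min t (\<tau> m w)} (\<lambda>s. b (X s w)) + J w)" if "0 \<le> t" for t
      using \<tau>(4) that by (drule_tac spec[of _ m]) (drule spec[of _ t], erule mp)
  qed (use assms(13-17) in auto)
  have "(\<lambda>m. f (v x\<^sub>0 - c1 * T * p m)) \<longlonglongrightarrow> f (v x\<^sub>0 - c1 * T * 0)"
    unfolding f_def by (cases "\<alpha> = 0"; simp only: simp_thms if_True if_False; intro tendsto_intros p0)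
  moreover have "(\<lambda>m. 2 * M + T * ?r + c2 * T * p m) \<longlonglongrightarrow> 2 * M + T * ?r + c2 * T * 0"
    by (intro tendsto_intros p0)
  ultimately have "f (v x\<^sub>0 - c1 * T * 0) \<le> 2 * M + T * ?r + c2 * T * 0"
    by (rule LIMSEQ_le) (use est in auto)
  then have "(f (v x\<^sub>0) - 2 * M) / T \<le> ?r"
    using assms(9) by (simp add: pos_divide_le_eq mult.commute)
  then show ?thesis
    using assms(9) by (cases "\<alpha> = 0") (simp_all add: f_def diff_divide_distrib add_divide_distrib power2_eq_square)
qed

end
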